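(* Let $\mathcal Z_n$ be discrete zero-sets and $\delta_n>0$ with $\delta_n\to0$ and $\delta_n\,\mathrm{square}(\mathcal Z_n)\xrightarrow{E}\widetilde{\mathcal Z}$ for a Euclidean zero-set $\widetilde{\mathcal Z}$. Then for every $(\alpha,\beta)\in[0,1]^2$, $$\delta_n^2 I(\alpha,\beta,\mathcal Z_n)\to\widetilde I(\alpha,\beta,\widetilde{\mathcal Z}),\quad \delta_n^2\gamma(\mathcal Z_n)\to\widetilde\gamma(\widetilde{\mathcal Z}),\quad \delta_n^2\gamma_{\rm thin}(\mathcal Z_n)\to\widetilde\gamma_{\rm thin}(\widetilde{\mathcal Z}).$$ If $\mathrm{area}(\widetilde{\mathcal Z})=\infty$ then $\widetilde I(\cdot,\cdot,\widetilde{\mathcal Z})\equiv\infty$ on $[0,1)^2$ and $\widetilde\gamma_{\rm thin}(\widetilde{\mathcal Z})=\infty$. If $\mathrm{area}(\widetilde{\mathcal Z})<\infty$ then: $\widetilde I(\cdot,\cdot,\widetilde{\mathcal Z})$ is finite, concave and continuous on $[0,1]^2$; $\widetilde\gamma_{\rm thin}(\widetilde{\mathcal Z})<\infty$; the convergence $\delta_n^2I(\alpha,\beta,\mathcal Z_n)\to\widetilde I(\alpha,\beta,\widetilde{\mathcal Z})$ is uniform over $[0,1]^2$; and whenever Euclidean zero-sets $\widetilde{\mathcal Z}_n\xrightarrow{E}\widetilde{\mathcal Z}$, $\widetilde I(\cdot,\cdot,\widetilde{\mathcal Z}_n)\to\widetilde I(\cdot,\cdot,\widetilde{\mathcal Z})$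 uniformly on $[0,1]^2$.
   Context: Discrete setting: $\mathbb Z_+=\{0,1,\dots\}$, $R_{a,b}=([0,a-1]\times[0,b-1])\cap\mathbb Z_+^2$; a zero-set is a union of such rectangles; $\mathrm{row}(x,A),\mathrm{col}(x,A)$ count points of $A$ on the horizontal/vertical line through $x$; $\mathcal T(A)=A\cup\{x\notin A:(\mathrm{row}(x,A),\mathrm{col}(x,A))\notin\mathcal Z\}$; $A$ spans if $\bigcup_t\mathcal T^t(A)=\mathbb Z_+^2$; $\gamma(\mathcal Z)$ is the minimal size of a finite spanning set; a set is thin if each of its points has no other point of the set on its horizontal line or none on its vertical line; $\gamma_{\rm thin}(\mathcal Z)$ is the minimal size of a thin spanning set. Large deviation rate: for $\alpha,\beta\ge0$, as $p\to0$ let $N,M\to\infty$ with $\log N\sim-\alpha\log p$, $\log M\sim-\beta\log p$, occupy each point of $R_{N,M}$ independently with probability $p$, and $I(\alpha,\beta,\mathcal Z)=\lim_{p\to0}\log P_p(\text{the initial set spans})/\log p$ (it exists for finite $\mathcal Z$; for infinite $\mathcal Z$ it is taken as $\lim_{R\to\infty}I(\alpha,\beta,\mathcal Z\cap R_{R,R})$). $\mathrm{square}(A)=\bigcup_{x\in A}(x+[0,1]^2)$. Euclidean setting: $\widetilde R_{a,b}=[0,a]\times[0,b]$. A Euclidean zero-set is a closed $\widetilde{\mathcal Z}\subseteq[0,\infty)^2$ such that $(a,b)\in\widetilde{\mathcal Z}$ implies $\widetilde R_{a,b}\subseteq\widetilde{\mathcal Z}$, and $\widetilde{\mathcal Z}$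 is the closure of $\widetilde{\mathcal Z}\cap(0,\infty)^2$. $\widetilde{\mathcal Z}_n\xrightarrow{E}\widetilde{\mathcal Z}$ means: for every $R>0$, $\widetilde{\mathcal Z}_n\cap[0,R]^2\to\widetilde{\mathcal Z}\cap[0,R]^2$ in Hausdorff metric, and $\mathrm{area}(\widetilde{\mathcal Z}_n)\to\mathrm{area}(\widetilde{\mathcal Z})$. For Borel $A\subseteq[0,\infty)^2$, $\widetilde{\mathrm{row}}(x,A)$ (resp. $\widetilde{\mathrm{col}}(x,A)$) is the 1-dimensional Lebesgue measure of $A$ intersected with the horizontal (resp. vertical) line through $x$. For left-continuous nonincreasing $f,g:[0,\infty)\to[0,\infty)$ of compact support, $\widetilde{\mathcal T}(A)=A\cup\{(u,v):(\widetilde{\mathrm{row}}((u,v),A)+f(v),\widetilde{\mathrm{col}}((u,v),A)+g(u))\notin\widetilde{\mathcal Z}\}$; $A$ E-spans for $(\widetilde{\mathcal Z},f,g)$ if $\bigcup_n\widetilde{\mathcal T}^n(A)=[0,\infty)^2$. For bounded $\widetilde{\mathcal Z}$ and $(\alpha,\beta)\in[0,1]^2$: $\widetilde I(\alpha,\beta,\widetilde{\mathcal Z})=\inf\{\mathrm{area}(A)+(1-\alpha)\int_0^\infty f+(1-\beta)\int_0^\infty g\}$ over all $(A,f,g)$ with $A$ compact E-spanning for $(\widetilde{\mathcal Z},f,g)$; $\widetilde\gamma_{\rm thin}(\widetilde{\mathcal Z})=\inf\{\int f+\int g:\emptyset\text{ E-spans for }(\widetilde{\mathcal Z},f,g)\}$.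 For general $\widetilde{\mathcal Z}$ both are defined as $\lim_{R\to\infty}$ of the values for $\widetilde{\mathcal Z}\cap[0,R]^2$. Finally $\widetilde\gamma(\widetilde{\mathcal Z})=\widetilde I(0,0,\widetilde{\mathcal Z})$. *)

theory Defs
  imports "HOL-Analysis.Analysis"
begin

definition Rect :: "nat \<Rightarrow> nat \<Rightarrow> (nat \<times> nat) set" where
  "Rect a b = {(i, j). i < a \<and> j < b}"

definition disc_zero_set :: "(nat \<times> nat) set \<Rightarrow> bool" where
  "disc_zero_set Z \<longleftrightarrow> (\<exists>S. Z = (\<Union>(a, b)\<in>S. Rect a b))"

definition ecard :: "'a set \<Rightarrow> enat" where
  "ecard S = (if finite S then enat (card S) else \<infinity>)"

definition row :: "nat \<times> nat \<Rightarrow> (nat \<times> nat) set \<Rightarrow> enat" where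
  "row x A = ecard {y \<in> A. snd y = snd x}"

definition col :: "nat \<times> nat \<Rightarrow> (nat \<times> nat) set \<Rightarrow> enat" where
  "col x A = ecard {y \<in> A. fst y = fst x}"

definition Tstep :: "(nat \<times> nat) set \<Rightarrow> (nat \<times> nat) set \<Rightarrow> (nat \<times> nat) set" where
  "Tstep Z A = A \<union> {x. x \<notin> A \<and> \<not> (\<exists>(i, j)\<in>Z. row x A = enat i \<and> col x A = enat j)}"

definition spans :: "(nat \<times> nat) set \<Rightarrow> (nat \<times> nat) set \<Rightarrow> bool" where
  "spans Z A \<longleftrightarrow> (\<Union>t. (Tstep Z ^^ t) A) = UNIV"

definition thin :: "(nat \<times> nat) set \<Rightarrow> bool" where
  "thin A \<longleftrightarrow> (\<forall>x\<in>A. (\<forall>y\<in>A. y \<noteq> x \<longrightarrow> snd y \<noteq> snd x) \<or> (\<forall>y\<in>A. y \<noteq> x \<longrightarrow> fst y \<noteq> fst x))"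

definition gamma :: "(nat \<times> nat) set \<Rightarrow> ereal" where
  "gamma Z = Inf {ereal (real (card A)) | A. finite A \<and> spans Z A}"

definition gamma_thin :: "(nat \<times> nat) set \<Rightarrow> ereal" where
  "gamma_thin Z = Inf {ereal (real (card A)) | A. finite A \<and> thin A \<and> spans Z A}"

definition span_prob :: "(nat \<times> nat) set \<Rightarrow> nat \<Rightarrow> nat \<Rightarrow> real \<Rightarrow> real" where
  "span_prob Z N M p =
     (\<Sum>A\<in>{A. A \<subseteq> Rect N M \<and> spans Z A}. p ^ card A * (1 - p) ^ (N * M - card A))"

text \<open>log P_p(spans) / log p, with log 0 = -infinity giving the value +infinity\<close>
definition rate :: "(nat \<times> nat) set \<Rightarrow> nat \<Rightarrow> nat \<Rightarrow> real \<Rightarrow> ereal" where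
  "rate Z N M p = (if span_prob Z N M p = 0 then \<infinity> else ereal (ln (span_prob Z N M p) / ln p))"

definition admissible :: "real \<Rightarrow> real \<Rightarrow> (real \<Rightarrow> nat) \<Rightarrow> (real \<Rightarrow> nat) \<Rightarrow> bool" where
  "admissible \<alpha> \<beta> N M \<longleftrightarrow>
     filterlim N at_top (at_right 0) \<and> filterlim M at_top (at_right 0) \<and>
     ((\<lambda>p. ln (real (N p)) / ln (1 / p)) \<longlongrightarrow> \<alpha>) (at_right 0) \<and>
     ((\<lambda>p. ln (real (M p)) / ln (1 / p)) \<longlongrightarrow> \<beta>) (at_right 0)"

definition I_fin :: "real \<Rightarrow> real \<Rightarrow> (nat \<times> nat) set \<Rightarrow> ereal" where
  "I_fin \<alpha> \<beta> Z = (THE L. \<forall>N M. admissible \<alpha> \<beta> N M \<longrightarrow>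
                       ((\<lambda>p. rate Z (N p) (M p) p) \<longlongrightarrow> L) (at_right 0))"

definition I_disc :: "real \<Rightarrow> real \<Rightarrow> (nat \<times> nat) set \<Rightarrow> ereal" where
  "I_disc \<alpha> \<beta> Z = (if finite Z then I_fin \<alpha> \<beta> Z
                     else lim (\<lambda>R. I_fin \<alpha> \<beta> (Z \<inter> Rect R R)))"

definition square :: "(nat \<times> nat) set \<Rightarrow> (real \<times> real) set" where
  "square A = (\<Union>(i, j)\<in>A. {(real i + s, real j + t) | s t. s \<in> {0..1} \<and> t \<in> {0..1}})"

definition scale_set :: "real \<Rightarrow> (real \<times> real) set \<Rightarrow> (real \<times> real) set" where
  "scale_set d S = (\<lambda>x. d *\<^sub>R x) ` S"

definition quadrant :: "(real \<times> real) set" where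
  "quadrant = {(a, b). 0 \<le> a \<and> 0 \<le> b}"

definition eucl_zero_set :: "(real \<times> real) set \<Rightarrow> bool" where
  "eucl_zero_set Z \<longleftrightarrow> closed Z \<and> Z \<subseteq> quadrant \<and>
     (\<forall>(a, b)\<in>Z. {0..a} \<times> {0..b} \<subseteq> Z) \<and>
     Z = closure (Z \<inter> {(a, b). 0 < a \<and> 0 < b})"

definition area :: "(real \<times> real) set \<Rightarrow> ennreal" where
  "area S = emeasure lborel S"

text \<open>Hausdorff-metric convergence (distance between empty and nonempty set is infinite)\<close>
definition haus_conv :: "(nat \<Rightarrow> (real \<times> real) set) \<Rightarrow> (real \<times> real) set \<Rightarrow> bool" where
  "haus_conv Sn S \<longleftrightarrow> (\<forall>e>0. eventually (\<lambda>n.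
      (\<forall>x\<in>Sn n. \<exists>y\<in>S. dist x y < e) \<and> (\<forall>y\<in>S. \<exists>x\<in>Sn n. dist x y < e)) sequentially)"

definition E_conv :: "(nat \<Rightarrow> (real \<times> real) set) \<Rightarrow> (real \<times> real) set \<Rightarrow> bool" where
  "E_conv Sn S \<longleftrightarrow>
     (\<forall>R>0. haus_conv (\<lambda>n. Sn n \<inter> ({0..R} \<times> {0..R})) (S \<inter> ({0..R} \<times> {0..R}))) \<and>
     (\<lambda>n. area (Sn n)) \<longlonglongrightarrow> area S"

definition erow :: "real \<times> real \<Rightarrow> (real \<times> real) set \<Rightarrow> ennreal" where
  "erow x A = emeasure lebesgue {s. (s, snd x) \<in> A}"

definition ecol :: "real \<times> real \<Rightarrow> (real \<times> real) set \<Rightarrow> ennreal" where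
  "ecol x A = emeasure lebesgue {t. (fst x, t) \<in> A}"

definition notin_Z :: "(real \<times> real) set \<Rightarrow> ennreal \<Rightarrow> ennreal \<Rightarrow> bool" where
  "notin_Z Z r c \<longleftrightarrow> \<not> (\<exists>(a, b)\<in>Z. r = ennreal a \<and> c = ennreal b)"

definition ETstep :: "(real \<times> real) set \<Rightarrow> (real \<Rightarrow> real) \<Rightarrow> (real \<Rightarrow> real)
                      \<Rightarrow> (real \<times> real) set \<Rightarrow> (real \<times> real) set" where
  "ETstep Z f g A = A \<union> {(u, v). 0 \<le> u \<and> 0 \<le> v \<and>
        notin_Z Z (erow (u, v) A + ennreal (f v)) (ecol (u, v) A + ennreal (g u))}"

definition Espans :: "(real \<times> real) set \<Rightarrow> (real \<Rightarrow> real) \<Rightarrow> (real \<Rightarrow> real) \<Rightarrow> (real \<times> real) set \<Rightarrow> bool" where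
  "Espans Z f g A \<longleftrightarrow> quadrant \<subseteq> (\<Union>n. (ETstep Z f g ^^ n) A)"

definition admissible_fun :: "(real \<Rightarrow> real) \<Rightarrow> bool" where
  "admissible_fun f \<longleftrightarrow> (\<forall>x\<ge>0. 0 \<le> f x) \<and> (\<forall>x y. 0 \<le> x \<longrightarrow> x \<le> y \<longrightarrow> f y \<le> f x) \<and>
     (\<forall>x>0. (f \<longlongrightarrow> f x) (at_left x)) \<and> (\<exists>K. \<forall>x\<ge>K. f x = 0)"

definition It_bdd :: "real \<Rightarrow> real \<Rightarrow> (real \<times> real) set \<Rightarrow> ereal" where
  "It_bdd \<alpha> \<beta> Z = Inf {ereal (measure lborel A + (1 - \<alpha>) * integral {0..} f + (1 - \<beta>) * integral {0..} g)
       | A f g. compact A \<and> A \<subseteq> quadrant \<and> admissible_fun f \<and> admissible_fun g \<and> Espans Z f g A}"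

definition It :: "real \<Rightarrow> real \<Rightarrow> (real \<times> real) set \<Rightarrow> ereal" where
  "It \<alpha> \<beta> Z = (if bounded Z then It_bdd \<alpha> \<beta> Z
                 else Lim at_top (\<lambda>R::real. It_bdd \<alpha> \<beta> (Z \<inter> ({0..R} \<times> {0..R}))))"

definition gt_thin_bdd :: "(real \<times> real) set \<Rightarrow> ereal" where
  "gt_thin_bdd Z = Inf {ereal (integral {0..} f + integral {0..} g)
       | f g. admissible_fun f \<and> admissible_fun g \<and> Espans Z f g {}}"

definition gt_thin :: "(real \<times> real) set \<Rightarrow> ereal" where
  "gt_thin Z = (if bounded Z then gt_thin_bdd Z
                else Lim at_top (\<lambda>R::real. gt_thin_bdd (Z \<inter> ({0..R} \<times> {0..R}))))"

definition gt :: "(real \<times> real) set \<Rightarrow> ereal" where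
  "gt Z = It 0 0 Z"

end

theory Submission
  imports Defs
begin

text \<open>
  Both models are compared with one discrete variational problem: minimize
  \<open>|A| + (1 - \<alpha>) \<Sum>f + (1 - \<beta>) \<Sum>g\<close> over initial sets \<open>A\<close> and row and column boosts \<open>f\<close>, \<open>g\<close>
  that together span.

  On the probabilistic side, a union bound over spanning subsets of bounded size and a second moment
  computation show that the rate of a finite zero-set is the infimum, over finite spanning sets \<open>A\<close>,
  of \<open>max (|A \<inter> X \<times> Y| - \<alpha> |X| - \<beta> |Y|)\<close> over sets \<open>X\<close>, \<open>Y\<close> of columns and rows. This agrees with the
  variational problem up to lower order terms: points lying on lightly occupied lines can be traded for
  a boost on few lines, and conversely a boost can be realized by points on otherwise empty lines.

  On the Euclidean side, a configuration for \<open>W\<close> and one for \<open>{(i, j). (d * i, d * j) \<in> W}\<close> can be converted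
  into each other exactly, up to rounding, so the Euclidean infimum is the limit of \<open>d\<^sup>2\<close> times the discrete
  one as \<open>d \<rightarrow> 0\<close>. Scaling, concavity, the area bounds and the truncation estimate therefore only have to be
  proved for the discrete problem. Finally, the closure condition on Euclidean zero-sets turns Hausdorff
  convergence on squares into inclusions up to a scaling factor arbitrarily close to \<open>1\<close>.
\<close>

section \<open>Discrete growth with row and column boosts\<close>

text \<open>What makes the errors negligible is a difference of orders. For a zero-set in
  \<open>Rect m m\<close> the costs are of order \<open>m^2\<close>, whereas replacing light points
  by boosts costs \<open>k * m\<close> on fresh lines plus one unit per heavy line, and there are
  only O(m) heavy lines. A threshold \<open>k\<close> equal to a small multiple of \<open>m\<close>
  makes both small relative to \<open>m^2\<close>, provided \<alpha>, \<beta> < 1. On the sides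
  \<alpha> = 1 or \<beta> = 1 all quantities vanish, because boosts of one direction alone fill
  everything.

  The union bound must run over patterns whose size does not grow with the box. A minimal spanning
  subset has no obvious bounded size, so bounded spanning subsets are extracted by following the
  growth up to the first long line.

  Hausdorff convergence on squares says nothing about thin arms reaching far out. Their influence is
  bounded by their area in both directions: they cost at most a constant times the area missing in a
  truncation, and any cost dominates a constant times the area if \<alpha>, \<beta> < 1. Hence areas
  must converge too, and infinite area forces infinite cost.\<close>

definition down_closed :: "(nat \<times> nat) set \<Rightarrow> bool" where
  "down_closed Z \<longleftrightarrow> (\<forall>i j i' j'. (i, j) \<in> Z \<longrightarrow> i' \<le> i \<longrightarrow> j' \<le> j \<longrightarrow> (i', j') \<in> Z)"

lemma down_closedD: "down_closed Z \<Longrightarrow> (i, j) \<in> Z \<Longrightarrow> i' \<le> i \<Longrightarrow> j' \<le> j \<Longrightarrow> (i', j') \<in> Z"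
  unfolding down_closed_def by blast

lemma disc_zero_set_down_closed: "disc_zero_set Z \<Longrightarrow> down_closed Z"
  unfolding disc_zero_set_def down_closed_def Rect_def by fastforce

lemma down_closed_Rect: "down_closed (Rect a b)"
  unfolding down_closed_def Rect_def by auto

lemma down_closed_Int: "down_closed Z \<Longrightarrow> down_closed Z' \<Longrightarrow> down_closed (Z \<inter> Z')"
  unfolding down_closed_def by blast

lemma finite_Rect [simp]: "finite (Rect a b)"
proof -
  have "Rect a b = {..<a} \<times> {..<b}" by (auto simp: Rect_def)
  then show ?thesis by simp
qed

lemma Rect_mono: "a \<le> a' \<Longrightarrow> b \<le> b' \<Longrightarrow> Rect a b \<subseteq> Rect a' b'"
  by (auto simp: Rect_def)

lemma finite_subset_Rect:
  assumes "finite S" shows "\<exists>m. S \<subseteq> Rect m m"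
proof -
  obtain m where "fst ` S \<union> snd ` S \<subseteq> {..<m}"
    using assms finite_nat_iff_bounded by (metis finite_UnI finite_imageI)
  then have "S \<subseteq> Rect m m" by (fastforce simp: Rect_def)
  then show ?thesis ..
qed

text \<open>Counts are extended naturals, so an infinitely occupied line is outside every zero-set
  without a separate case.\<close>

definition outside :: "(nat \<times> nat) set \<Rightarrow> enat \<Rightarrow> enat \<Rightarrow> bool" where
  "outside Z r c \<longleftrightarrow> \<not> (\<exists>(i, j)\<in>Z. r = enat i \<and> c = enat j)"

lemma outside_mono:
  assumes "down_closed Z" "outside Z r c" "r \<le> r'" "c \<le> c'" shows "outside Z r' c'"
  unfolding outside_def
proof clarify
  fix i j assume "(i, j) \<in> Z" and e: "r' = enat i" "c' = enat j"
  from e assms(3,4) obtain i' j' where "r = enat i'" "i' \<le> i" "c = enat j'" "j' \<le> j"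
    by (metis enat_ile enat_ord_simps(1))
  moreover from this \<open>(i, j) \<in> Z\<close> have "(i', j') \<in> Z" using assms(1) down_closedD by blast
  ultimately show False using assms(2) unfolding outside_def by auto
qed

lemma outside_subset: "Z' \<subseteq> Z \<Longrightarrow> outside Z r c \<Longrightarrow> outside Z' r c"
  unfolding outside_def by blast

lemma outside_ge1: "Z \<subseteq> Rect a b \<Longrightarrow> enat a \<le> r \<Longrightarrow> outside Z r c"
  unfolding outside_def Rect_def by auto

lemma outside_ge2: "Z \<subseteq> Rect a b \<Longrightarrow> enat b \<le> c \<Longrightarrow> outside Z r c"
  unfolding outside_def Rect_def by auto

lemma outside_enat: "outside Z (enat i) (enat j) \<longleftrightarrow> (i, j) \<notin> Z"
  unfolding outside_def by auto

lemma ecard_mono: "S \<subseteq> T \<Longrightarrow> ecard S \<le> ecard T"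
  unfolding ecard_def by (auto simp: card_mono finite_subset)

lemma ecard_image: "inj_on h S \<Longrightarrow> ecard (h ` S) = ecard S"
  unfolding ecard_def by (auto simp: card_image finite_image_iff)

lemma ecard_finite: "finite S \<Longrightarrow> ecard S = enat (card S)"
  by (simp add: ecard_def)

lemma enat_le_ecard: "finite T \<Longrightarrow> T \<subseteq> S \<Longrightarrow> n \<le> card T \<Longrightarrow> enat n \<le> ecard S"
  by (metis ecard_finite ecard_mono enat_ord_simps(1) order_trans)

lemma ecard_Un_le: "ecard (S \<union> T) \<le> ecard S + ecard T"
  unfolding ecard_def by (auto simp: card_Un_le)

lemma row_eq: "row (x, y) A = ecard {u. (u, y) \<in> A}"
proof -
  have "{p \<in> A. snd p = y} = (\<lambda>u. (u, y)) ` {u. (u, y) \<in> A}" by force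
  then show ?thesis unfolding row_def by (simp add: ecard_image inj_on_def)
qed

lemma col_eq: "col (x, y) A = ecard {v. (x, v) \<in> A}"
proof -
  have "{p \<in> A. fst p = x} = (\<lambda>u. (x, u)) ` {u. (x, u) \<in> A}" by force
  then show ?thesis unfolding col_def by (simp add: ecard_image inj_on_def)
qed

lemma row_mono: "A \<subseteq> B \<Longrightarrow> row p A \<le> row p B"
  unfolding row_def by (rule ecard_mono) auto

lemma col_mono: "A \<subseteq> B \<Longrightarrow> col p A \<le> col p B"
  unfolding col_def by (rule ecard_mono) auto

definition stable :: "(nat \<times> nat) set \<Rightarrow> (nat \<Rightarrow> nat) \<Rightarrow> (nat \<Rightarrow> nat) \<Rightarrow> (nat \<times> nat) set \<Rightarrow> bool" where
  "stable Z f g S \<longleftrightarrow>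
     (\<forall>x y. outside Z (row (x, y) S + enat (f y)) (col (x, y) S + enat (g x)) \<longrightarrow> (x, y) \<in> S)"

text \<open>For a down-closed zero-set the growth is monotone, so its final configuration is the
  least stable superset of \<open>A\<close>; spanning is phrased as the absence of a proper one.
  Comparisons then only exhibit one stable set and need not follow the iteration in time.\<close>

definition fspans :: "(nat \<times> nat) set \<Rightarrow> (nat \<Rightarrow> nat) \<Rightarrow> (nat \<Rightarrow> nat) \<Rightarrow> (nat \<times> nat) set \<Rightarrow> bool" where
  "fspans Z f g A \<longleftrightarrow> (\<forall>S. A \<subseteq> S \<longrightarrow> stable Z f g S \<longrightarrow> S = UNIV)"

lemma stableD: "stable Z f g S \<Longrightarrow> outside Z (row (x, y) S + enat (f y)) (col (x, y) S + enat (g x)) \<Longrightarrow> (x, y) \<in> S"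
  unfolding stable_def by blast

lemma stable_mono:
  assumes "stable Z f g S" "down_closed Z'" "Z \<subseteq> Z'" "\<And>y. f' y \<le> f y" "\<And>x. g' x \<le> g x"
  shows "stable Z' f' g' S"
  unfolding stable_def
proof clarify
  fix x y assume "outside Z' (row (x, y) S + enat (f' y)) (col (x, y) S + enat (g' x))"
  then have "outside Z' (row (x, y) S + enat (f y)) (col (x, y) S + enat (g x))"
    by (rule outside_mono[OF assms(2)]) (auto intro!: add_left_mono assms)
  then have "outside Z (row (x, y) S + enat (f y)) (col (x, y) S + enat (g x))"
    using outside_subset assms(3) by blast
  then show "(x, y) \<in> S" using stableD assms(1) by blast
qed

lemma fspans_mono:
  assumes "fspans Z' f g A" "down_closed Z'" "Z \<subseteq> Z'" "A \<subseteq> A'"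
    "\<And>y. f y \<le> f' y" "\<And>x. g x \<le> g' x"
  shows "fspans Z f' g' A'"
  unfolding fspans_def
proof (intro allI impI)
  fix S assume "A' \<subseteq> S" "stable Z f' g' S"
  then have "stable Z' f g S" using stable_mono assms by blast
  then show "S = UNIV" using assms(1,4) \<open>A' \<subseteq> S\<close> unfolding fspans_def by blast
qed

text \<open>The block columns put \<open>m\<close> points on each row of \<open>R\<close>, which
  takes it beyond \<open>Rect m m\<close> and fills it; the filled rows then do the same for every
  column.\<close>

lemma stable_block_UNIV:
  assumes "Z \<subseteq> Rect m m" "stable Z f g S" "finite C" "m \<le> card C" "finite R" "m \<le> card R" "C \<times> R \<subseteq> S"
  shows "S = UNIV"
proof -
  have row_full: "(x, y) \<in> S" if "y \<in> R" for x y
  proof (rule stableD[OF assms(2)], rule outside_ge1[OF assms(1)])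
    have "enat m \<le> row (x, y) S" unfolding row_eq
      by (rule enat_le_ecard[of C]) (use assms that in auto)
    then show "enat m \<le> row (x, y) S + enat (f y)" by (simp add: add_increasing2)
  qed
  have "(x, y) \<in> S" for x y
  proof (rule stableD[OF assms(2)], rule outside_ge2[OF assms(1)])
    have "enat m \<le> col (x, y) S" unfolding col_eq
      by (rule enat_le_ecard[of R]) (use assms row_full in auto)
    then show "enat m \<le> col (x, y) S + enat (g x)" by (simp add: add_increasing2)
  qed
  then show ?thesis by auto
qed

text \<open>If \<open>P\<close> or \<open>Q\<close> is infinite, \<open>m\<close> of its points
  already exceed \<open>Rect m m\<close>. This is the compactness that lets growth be witnessed at
  one finite time.\<close>

lemma outside_finite_witness:
  assumes "Z \<subseteq> Rect m m" "outside Z (ecard P) (ecard Q)"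
  shows "\<exists>P' Q'. P' \<subseteq> P \<and> Q' \<subseteq> Q \<and> finite P' \<and> finite Q' \<and> outside Z (ecard P') (ecard Q')"
proof (cases "finite P \<and> finite Q")
  case False
  have *: "\<exists>P'\<subseteq>P. finite P' \<and> enat m \<le> ecard P'" if "infinite P" for P :: "'c set"
    using infinite_arbitrarily_large[OF that, of m] by (metis enat_le_ecard order_refl)
  from False show ?thesis
  proof (cases "infinite P")
    case True
    then obtain P' where "P' \<subseteq> P" "finite P'" "enat m \<le> ecard P'" using * by blast
    then show ?thesis using outside_ge1[OF assms(1)] by blast
  next
    case F: False
    with False obtain Q' where "Q' \<subseteq> Q" "finite Q'" "enat m \<le> ecard Q'" using *[of Q] by blast
    then show ?thesis using outside_ge2[OF assms(1)] by blast
  qed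
qed (use assms in blast)

section \<open>Iterated growth and stable sets\<close>

lemma Tstep_iff: "(x, y) \<in> Tstep Z A \<longleftrightarrow> (x, y) \<in> A \<or> outside Z (row (x, y) A) (col (x, y) A)"
  unfolding Tstep_def outside_def by auto

lemma Tstep_incr: "A \<subseteq> Tstep Z A" by (auto simp: Tstep_def)

lemma Tstep_pow_mono: "s \<le> t \<Longrightarrow> (Tstep Z ^^ s) A \<subseteq> (Tstep Z ^^ t) A"
proof (induction rule: dec_induct)
  case (step n)
  then show ?case using Tstep_incr[of "(Tstep Z ^^ n) A" Z] by simp
qed simp

lemma finite_subset_Tstep_pow:
  assumes "finite F" "F \<subseteq> (\<Union>t. (Tstep Z ^^ t) A)"
  shows "\<exists>t. F \<subseteq> (Tstep Z ^^ t) A"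
  using assms
proof (induction F rule: finite_induct)
  case (insert p F)
  then obtain s t where "p \<in> (Tstep Z ^^ s) A" "F \<subseteq> (Tstep Z ^^ t) A" by auto
  then have "insert p F \<subseteq> (Tstep Z ^^ (max s t)) A"
    using Tstep_pow_mono[of s "max s t"] Tstep_pow_mono[of t "max s t"] by fastforce
  then show ?case ..
qed auto

lemma Tstep_pow_subset_stable:
  assumes "down_closed Z" "A \<subseteq> S" "stable Z (\<lambda>_. 0) (\<lambda>_. 0) S"
  shows "(Tstep Z ^^ t) A \<subseteq> S"
proof (induction t)
  case (Suc t)
  show ?case
  proof (clarsimp simp: Tstep_iff)
    fix x y assume h: "(x, y) \<in> (Tstep Z ^^ t) A \<or>
        outside Z (row (x, y) ((Tstep Z ^^ t) A)) (col (x, y) ((Tstep Z ^^ t) A))"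
    then show "(x, y) \<in> S"
    proof
      assume "outside Z (row (x, y) ((Tstep Z ^^ t) A)) (col (x, y) ((Tstep Z ^^ t) A))"
      then have "outside Z (row (x, y) S) (col (x, y) S)"
        by (rule outside_mono[OF assms(1)]) (intro row_mono col_mono Suc)+
      then show ?thesis using stableD[OF assms(3), of x y] by (simp add: zero_enat_def[symmetric])
    qed (use Suc in auto)
  qed
qed (use assms in auto)

text \<open>A site that would grow from the union does so because of finitely many points, and these
  are all present at one common time.\<close>

lemma stable_Union_Tstep:
  assumes "down_closed Z" "finite Z"
  shows "stable Z (\<lambda>_. 0) (\<lambda>_. 0) (\<Union>t. (Tstep Z ^^ t) A)"
  unfolding stable_def
proof clarify
  let ?U = "\<Union>t. (Tstep Z ^^ t) A"
  fix x y assume "outside Z (row (x, y) ?U + enat 0) (col (x, y) ?U + enat 0)"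
  then have o: "outside Z (ecard {u. (u, y) \<in> ?U}) (ecard {v. (x, v) \<in> ?U})"
    by (simp add: row_eq col_eq zero_enat_def[symmetric])
  obtain m where m: "Z \<subseteq> Rect m m" using assms(2) finite_subset_Rect by blast
  obtain P Q where PQ: "P \<subseteq> {u. (u, y) \<in> ?U}" "Q \<subseteq> {v. (x, v) \<in> ?U}" "finite P" "finite Q"
      "outside Z (ecard P) (ecard Q)"
    using outside_finite_witness[OF m o] by blast
  have "finite (P \<times> {y} \<union> {x} \<times> Q)" "P \<times> {y} \<union> {x} \<times> Q \<subseteq> ?U" using PQ by auto
  then obtain t where t: "P \<times> {y} \<union> {x} \<times> Q \<subseteq> (Tstep Z ^^ t) A"
    using finite_subset_Tstep_pow by blast
  have "outside Z (row (x, y) ((Tstep Z ^^ t) A)) (col (x, y) ((Tstep Z ^^ t) A))"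
    by (rule outside_mono[OF assms(1) PQ(5)]; unfold row_eq col_eq; rule ecard_mono) (use t in auto)
  then have "(x, y) \<in> (Tstep Z ^^ Suc t) A" by (simp add: Tstep_iff)
  then show "(x, y) \<in> ?U" by blast
qed

lemma spans_iff_fspans:
  assumes "down_closed Z" "finite Z"
  shows "spans Z A \<longleftrightarrow> fspans Z (\<lambda>_. 0) (\<lambda>_. 0) A"
proof
  assume "spans Z A"
  then show "fspans Z (\<lambda>_. 0) (\<lambda>_. 0) A"
    unfolding fspans_def spans_def using Tstep_pow_subset_stable[OF assms(1), of A]
    by (metis UN_least UNIV_I subset_UNIV subset_antisym)
next
  assume "fspans Z (\<lambda>_. 0) (\<lambda>_. 0) A"
  moreover have "(Tstep Z ^^ 0) A \<subseteq> (\<Union>t. (Tstep Z ^^ t) A)" by (rule UN_upper) simp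
  then have "A \<subseteq> (\<Union>t. (Tstep Z ^^ t) A)" by simp
  ultimately show "spans Z A"
    unfolding fspans_def spans_def using stable_Union_Tstep[OF assms, of A] by meson
qed

lemma spans_Un:
  assumes "spans Z A" "down_closed Z" "A \<subseteq> B" shows "spans Z B"
proof -
  have "(Tstep Z ^^ t) A \<subseteq> (Tstep Z ^^ t) B" for t
  proof (induction t)
    case (Suc t)
    show ?case
    proof (clarsimp simp: Tstep_iff)
      fix x y assume h: "(x, y) \<in> (Tstep Z ^^ t) A \<or>
        outside Z (row (x, y) ((Tstep Z ^^ t) A)) (col (x, y) ((Tstep Z ^^ t) A))"
        and "\<not> outside Z (row (x, y) ((Tstep Z ^^ t) B)) (col (x, y) ((Tstep Z ^^ t) B))"
      then show "(x, y) \<in> (Tstep Z ^^ t) B"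
        using outside_mono[OF assms(2) _ row_mono[OF Suc, of "(x, y)"] col_mono[OF Suc, of "(x, y)"]] Suc by (meson subsetD)
    qed
  qed (use assms in auto)
  then have "(\<Union>t. (Tstep Z ^^ t) A) \<subseteq> (\<Union>t. (Tstep Z ^^ t) B)" by (intro UN_mono) auto
  then show ?thesis using assms(1) unfolding spans_def by (simp add: top.extremum_unique)
qed

lemma spans_antimono:
  assumes "spans Z A" "Z' \<subseteq> Z" "down_closed Z'" shows "spans Z' A"
proof -
  have "(Tstep Z ^^ t) A \<subseteq> (Tstep Z' ^^ t) A" for t
  proof (induction t)
    case (Suc t)
    show ?case
    proof (clarsimp simp: Tstep_iff)
      fix x y assume h: "(x, y) \<in> (Tstep Z ^^ t) A \<or>
        outside Z (row (x, y) ((Tstep Z ^^ t) A)) (col (x, y) ((Tstep Z ^^ t) A))"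
        and "\<not> outside Z' (row (x, y) ((Tstep Z' ^^ t) A)) (col (x, y) ((Tstep Z' ^^ t) A))"
      then show "(x, y) \<in> (Tstep Z' ^^ t) A"
        using outside_mono[OF assms(3) outside_subset[OF assms(2)] row_mono[OF Suc, of "(x, y)"] col_mono[OF Suc, of "(x, y)"]] Suc by (meson subsetD)
    qed
  qed auto
  then have "(\<Union>t. (Tstep Z ^^ t) A) \<subseteq> (\<Union>t. (Tstep Z' ^^ t) A)" by (intro UN_mono) auto
  then show ?thesis using assms(1) unfolding spans_def by (simp add: top.extremum_unique)
qed

section \<open>Exchanging rows and columns\<close>

lemma row_converse: "row (x, y) (A\<inverse>) = col (y, x) A"
  by (simp add: row_eq col_eq)

lemma col_converse: "col (x, y) (A\<inverse>) = row (y, x) A"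
  by (simp add: row_eq col_eq)

lemma outside_converse: "outside (Z\<inverse>) r c \<longleftrightarrow> outside Z c r"
  unfolding outside_def by auto

lemma stable_converse: "stable (Z\<inverse>) g f (S\<inverse>) \<longleftrightarrow> stable Z f g S"
  unfolding stable_def by (auto simp: row_converse col_converse outside_converse)

lemma down_closed_converse: "down_closed (Z\<inverse>) \<longleftrightarrow> down_closed Z"
  unfolding down_closed_def converse_iff by blast

lemma initial_segment:
  fixes S :: "nat set"
  assumes "finite S" "\<And>x x'. x \<in> S \<Longrightarrow> x' \<le> x \<Longrightarrow> x' \<in> S"
  shows "S = {..<card S}"
proof (cases "S = {}")
  case False
  then have "S = {..Max S}" using assms Max_in Max_ge by blast
  then show ?thesis by (metis card_atMost lessThan_Suc_atMost)
qed simp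

text \<open>The row lengths of \<open>Z\<close> seen as a Young diagram; the column lengths are
  \<open>width (Z\<inverse>)\<close>.\<close>

definition width :: "(nat \<times> nat) set \<Rightarrow> nat \<Rightarrow> nat" where
  "width Z y = card {x. (x, y) \<in> Z}"

lemma finite_section1: "finite A \<Longrightarrow> finite {x. (x, y) \<in> A}"
  by (rule finite_subset[of _ "fst ` A"]) force+

lemma finite_section2: "finite A \<Longrightarrow> finite {y. (x, y) \<in> A}"
  by (rule finite_subset[of _ "snd ` A"]) force+

lemma width_iff:
  assumes "down_closed Z" "finite Z"
  shows "(x, y) \<in> Z \<longleftrightarrow> x < width Z y"
proof -
  have "{x. (x, y) \<in> Z} = {..<width Z y}" unfolding width_def
  proof (rule initial_segment)
    show "finite {x. (x, y) \<in> Z}" by (rule finite_section1[OF assms(2)])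
  qed (auto intro: down_closedD[OF assms(1)])
  then show ?thesis by auto
qed

lemma width_antimono:
  assumes "down_closed Z" "finite Z" "y \<le> y'"
  shows "width Z y' \<le> width Z y"
  unfolding width_def
  by (intro card_mono finite_section1 assms) (auto intro: down_closedD[OF assms(1) _ order_refl assms(3)])

lemma sum_card_sections:
  assumes "finite A" "finite J"
  shows "(\<Sum>y\<in>J. card {x. (x, y) \<in> A}) = card {(x, y) \<in> A. y \<in> J}"
proof -
  have "{(x, y) \<in> A. y \<in> J} = prod.swap ` (SIGMA y:J. {x. (x, y) \<in> A})" by force
  then show ?thesis using assms by (simp add: card_image finite_section1)
qed

text \<open>Rows fill from the bottom up: once the rows below \<open>y\<close> are full, every
  column count is at least \<open>y\<close>, and \<open>(width Z y, y)\<close> is the first site of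
  row \<open>y\<close> outside \<open>Z\<close>.\<close>

lemma fill_rows:
  assumes Z: "down_closed Z" "finite Z" and S: "stable Z f g S"
    and f: "\<And>y. y < h \<Longrightarrow> width Z y \<le> f y" and "y < h"
  shows "(x, y) \<in> S"
  using \<open>y < h\<close>
proof (induction y arbitrary: x rule: less_induct)
  case (less y)
  have "enat y \<le> col (x, y) S" unfolding col_eq
    by (rule enat_le_ecard[of "{..<y}"]) (use less in auto)
  moreover have "outside Z (enat (width Z y)) (enat y)"
    using width_iff[OF Z] by (simp add: outside_enat)
  moreover have "enat (width Z y) \<le> row (x, y) S + enat (f y)"
    using f[OF less.prems] by (simp add: add_increasing)
  ultimately have "outside Z (row (x, y) S + enat (f y)) (col (x, y) S + enat (g x))"
    using outside_mono[OF Z(1)] by (simp add: add_increasing2)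
  then show ?case using stableD[OF S] by blast
qed

lemma fill_cols:
  assumes Z: "down_closed Z" "finite Z" and S: "stable Z f g S"
    and g: "\<And>x. x < h \<Longrightarrow> width (Z\<inverse>) x \<le> g x" and "x < h"
  shows "(x, y) \<in> S"
  using fill_rows[of "Z\<inverse>" g f "S\<inverse>" h x y] assms
  by (auto simp: down_closed_converse stable_converse)

definition total :: "(nat \<Rightarrow> nat) \<Rightarrow> nat" where
  "total f = (\<Sum>y | f y \<noteq> 0. f y)"

lemma total_eq: "finite J \<Longrightarrow> (\<And>y. f y \<noteq> 0 \<Longrightarrow> y \<in> J) \<Longrightarrow> total f = sum f J"
  unfolding total_def by (rule sum.mono_neutral_left) auto

definition profile :: "(nat \<Rightarrow> nat) \<Rightarrow> bool" where
  "profile f \<longleftrightarrow> antimono f \<and> finite {y. f y \<noteq> 0}"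

text \<open>Filling by row boosts alone; together with \<open>total_width\<close> this bounds the
  cost by \<open>card Z\<close> times the price of a row boost.\<close>

lemma fspans_width:
  assumes Z: "down_closed Z" "finite Z"
  shows "fspans Z (width Z) (\<lambda>_. 0) {}"
  unfolding fspans_def
proof (intro allI impI)
  fix S assume S: "stable Z (width Z) (\<lambda>_. 0) S"
  have "(x, y) \<in> S" for x y using fill_rows[OF Z S, of "Suc y"] by auto
  then show "S = UNIV" by auto
qed

lemma support_width: "{y. width Z y \<noteq> 0} \<subseteq> snd ` Z"
  by (force simp: width_def dest: card_gt_0_iff[THEN iffD1])

lemma total_width: "finite Z \<Longrightarrow> total (width Z) = card Z"
  using total_eq[of "snd ` Z" "width Z"] support_width[of Z] sum_card_sections[of Z "snd ` Z"]
  by (force simp: width_def intro!: arg_cong[where f = card])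

lemma profile_width: "down_closed Z \<Longrightarrow> finite Z \<Longrightarrow> profile (width Z)"
  unfolding profile_def using support_width[of Z] width_antimono
  by (auto simp: monotone_def intro: finite_subset)

subsection \<open>Truncating the zero-set\<close>

text \<open>The added boosts fill all rows below the height of \<open>Z\<close> at abscissa \<open>2 * q\<close>, after which
  only the part of \<open>Z\<close> left of \<open>2 * q\<close> matters; symmetrically for columns. The rectangle
  below that height has at least half its points outside \<open>Rect q q\<close>.\<close>

lemma fspans_tail:
  assumes Z: "down_closed Z" "finite Z" and sp: "fspans (Z \<inter> Rect (2 * q) (2 * q)) f g A"
    and fg: "profile f" "profile g"
  obtains f' g' where "profile f'" "profile g'" "fspans Z f' g' A"
    "total f' \<le> total f + 3 * card (Z - Rect q q)" "total g' \<le> total g + 3 * card (Z - Rect q q)"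
proof -
  define h where "h = width (Z\<inverse>) (2 * q)"
  define w where "w = width Z (2 * q)"
  have Z': "down_closed (Z\<inverse>)" "finite (Z\<inverse>)" using Z by (simp_all add: down_closed_converse)
  have ext: "\<exists>f'. profile f' \<and> (\<forall>y. f y \<le> f' y) \<and> (\<forall>y<h. width Z y \<le> f' y) \<and>
      total f' \<le> total f + 3 * card (Z - Rect q q)"
    if Z: "down_closed Z" "finite Z" and fg: "profile f"
      and h: "h = width (Z\<inverse>) (2 * q)" for Z f h
  proof -
    have Z': "down_closed (Z\<inverse>)" "finite (Z\<inverse>)" using Z by (simp_all add: down_closed_converse)
    let ?f2 = "\<lambda>y. if y < h then width Z y else 0"
    let ?T = "Z - Rect q q"
    have fin: "finite ?T" using Z by simp
    have hZ: "(2 * q, y) \<in> Z \<longleftrightarrow> y < h" for y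
      using width_iff[OF Z', of y "2 * q"] h by simp
    have "card ({q..<2 * q} \<times> {..<h}) \<le> card ?T"
      by (rule card_mono[OF fin]) (auto simp: Rect_def intro: down_closedD[OF Z(1), of "2 * q"] simp: hZ)
    then have qh: "q * h \<le> card ?T" by simp
    \<comment> \<open>Points of the low rows have abscissa below \<open>2 * q\<close>, at most
      \<open>2 * q * h\<close> of them, or lie outside \<open>Rect q q\<close>; the bound on
      \<open>q * h\<close> turns this into the factor 3.\<close>
    have "card {(x, y) \<in> Z. y \<in> {..<h}} \<le> card (({..<2 * q} \<times> {..<h}) \<union> ?T)"
      by (rule card_mono) (use Z in \<open>auto simp: Rect_def\<close>)
    also have "\<dots> \<le> 2 * q * h + card ?T" by (rule order_trans[OF card_Un_le]) simp
    also have "\<dots> \<le> 3 * card ?T" using qh by simp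
    finally have s: "sum (width Z) {..<h} \<le> 3 * card ?T"
      using sum_card_sections[OF Z(2), of "{..<h}"] by (simp add: width_def)
    let ?J = "{y. f y \<noteq> 0} \<union> {..<h}"
    have fJ: "finite ?J" using fg by (simp add: profile_def)
    have "total (\<lambda>y. f y + ?f2 y) = (\<Sum>y\<in>?J. f y + ?f2 y)"
      by (rule total_eq[OF fJ]) (auto split: if_splits)
    also have "\<dots> = sum f ?J + sum ?f2 ?J" by (rule sum.distrib)
    also have "sum ?f2 ?J = sum (width Z) {..<h}"
      by (rule sum.mono_neutral_cong_right[OF fJ]) auto
    also have "sum f ?J = total f" by (rule total_eq[symmetric, OF fJ]) auto
    finally have t: "total (\<lambda>y. f y + ?f2 y) \<le> total f + 3 * card ?T" using s by simp
    have "antimono (\<lambda>y. f y + ?f2 y)"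
    proof (rule antimonoI)
      fix y y' :: nat assume "y \<le> y'"
      then have "f y' \<le> f y" "width Z y' \<le> width Z y"
        using fg width_antimono[OF Z] by (auto simp: profile_def monotone_def)
      then show "f y' + ?f2 y' \<le> f y + ?f2 y" using \<open>y \<le> y'\<close> by auto
    qed
    moreover have "finite {y. f y + ?f2 y \<noteq> 0}" by (rule finite_subset[OF _ fJ]) (auto split: if_splits)
    ultimately show ?thesis using t by (intro exI[of _ "\<lambda>y. f y + ?f2 y"]) (auto simp: profile_def)
  qed
  obtain f' where f': "profile f'" "\<And>y. f y \<le> f' y" "\<And>y. y < h \<Longrightarrow> width Z y \<le> f' y"
      "total f' \<le> total f + 3 * card (Z - Rect q q)"
    using ext[OF Z fg(1) h_def] by blast
  have "w = width ((Z\<inverse>)\<inverse>) (2 * q)" by (simp add: w_def)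
  from ext[OF Z' fg(2) this]
  obtain g' where g': "profile g'" "\<And>y. g y \<le> g' y" "\<And>y. y < w \<Longrightarrow> width (Z\<inverse>) y \<le> g' y"
      "total g' \<le> total g + 3 * card (Z\<inverse> - Rect q q)" by blast
  have "Z\<inverse> - Rect q q = (Z - Rect q q)\<inverse>" by (auto simp: Rect_def)
  then have "card (Z\<inverse> - Rect q q) = card (Z - Rect q q)" by simp
  moreover have "fspans Z f' g' A"
    unfolding fspans_def
  proof (intro allI impI)
    fix S assume S: "A \<subseteq> S" "stable Z f' g' S"
    have rf: "(x, y) \<in> S" if "y < h" for x y using fill_rows[OF Z S(2)] f'(3) that by blast
    have cf: "(x, y) \<in> S" if "x < w" for x y using fill_cols[OF Z S(2)] g'(3) that by blast
    have "stable (Z \<inter> Rect (2 * q) (2 * q)) f g S"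
      unfolding stable_def
    proof clarify
      fix x y
      let ?r = "row (x, y) S + enat (f y)" and ?c = "col (x, y) S + enat (g x)"
      assume o: "outside (Z \<inter> Rect (2 * q) (2 * q)) ?r ?c"
      have "enat w \<le> row (x, y) S" unfolding row_eq
        by (rule enat_le_ecard[of "{..<w}"]) (use cf in auto)
      then have rw: "enat w \<le> ?r" by (simp add: add_increasing2)
      have "enat h \<le> col (x, y) S" unfolding col_eq
        by (rule enat_le_ecard[of "{..<h}"]) (use rf in auto)
      then have ch: "enat h \<le> ?c" by (simp add: add_increasing2)
      have "outside Z ?r ?c"
        unfolding outside_def
      proof clarify
        fix i j assume ij: "(i, j) \<in> Z" "?r = enat i" "?c = enat j"
        \<comment> \<open>A point of \<open>Z\<close> beyond the truncation has
          \<open>2 * q \<le> i\<close> and \<open>h \<le> j\<close>, or \<open>2 * q \<le> j\<close>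
          and \<open>w \<le> i\<close>; but \<open>(2 * q, h)\<close> and \<open>(w, 2 * q)\<close>
          are just outside \<open>Z\<close>.\<close>
        then have "(i, j) \<notin> Rect (2 * q) (2 * q)" using o unfolding outside_def by auto
        then have "2 * q \<le> i \<or> 2 * q \<le> j" by (auto simp: Rect_def)
        moreover have "w \<le> i" "h \<le> j" using rw ch ij by auto
        ultimately have "(2 * q, h) \<in> Z \<or> (w, 2 * q) \<in> Z" using down_closedD[OF Z(1) ij(1)] by blast
        then show False using width_iff[OF Z] width_iff[OF Z', of h "2 * q"] by (auto simp: h_def w_def)
      qed
      then have "outside Z (row (x, y) S + enat (f' y)) (col (x, y) S + enat (g' x))"
        by (rule outside_mono[OF Z(1)]) (auto intro!: add_left_mono f' g')
      then show "(x, y) \<in> S" using stableD[OF S(2)] by blast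
    qed
    then show "S = UNIV" using sp S(1) unfolding fspans_def by blast
  qed
  ultimately show ?thesis using that f' g' by metis
qed

subsection \<open>The area bound\<close>

lemma sum_card_swap:
  assumes "finite X" "finite J"
  shows "(\<Sum>x\<in>X. card {j \<in> J. P x j}) = (\<Sum>j\<in>J. card {x \<in> X. P x j})"
proof -
  have "(\<Sum>x\<in>X. card {j \<in> J. P x j}) = (\<Sum>x\<in>X. \<Sum>j\<in>J. if P x j then 1 else 0)"
    using assms by (simp add: sum.If_cases Collect_conj_eq)
  also have "\<dots> = (\<Sum>j\<in>J. \<Sum>x\<in>X. if P x j then 1 else 0)" by (rule sum.swap)
  also have "\<dots> = (\<Sum>j\<in>J. card {x \<in> X. P x j})"
    using assms by (simp add: sum.If_cases Collect_conj_eq)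
  finally show ?thesis .
qed

text \<open>Layer-cake summation: counting the pairs with \<open>x < 2 * F j\<close> by
  \<open>j\<close> gives at most twice the sum of \<open>F\<close>, and the height contributes the
  other factor 2.\<close>

lemma card_below_layers:
  fixes F :: "nat \<Rightarrow> nat"
  assumes "finite J" "\<And>j. F j \<noteq> 0 \<Longrightarrow> j \<in> J"
  shows "card {(x, y). x < M \<and> y < 2 * card {j. x < 2 * F j}} \<le> 4 * sum F J"
proof -
  have e: "{j. x < 2 * F j} = {j \<in> J. x < 2 * F j}" for x using assms(2) by fastforce
  have "{(x, y). x < M \<and> y < 2 * card {j. x < 2 * F j}} = (SIGMA x:{..<M}. {..<2 * card {j. x < 2 * F j}})"
    by auto
  then have "card {(x, y). x < M \<and> y < 2 * card {j. x < 2 * F j}} = (\<Sum>x<M. 2 * card {j. x < 2 * F j})"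
    by simp
  also have "\<dots> = 2 * (\<Sum>x<M. card {j \<in> J. x < 2 * F j})" by (simp add: sum_distrib_left e)
  also have "\<dots> = 2 * (\<Sum>j\<in>J. card {x \<in> {..<M}. x < 2 * F j})"
    by (subst sum_card_swap) (use assms in auto)
  also have "\<dots> \<le> 2 * (\<Sum>j\<in>J. card {..<2 * F j})"
    by (intro mult_left_mono sum_mono card_mono) auto
  finally show ?thesis by (simp add: sum_distrib_left)
qed

text \<open>\<open>F j\<close> and \<open>G i\<close> are the total help that row \<open>j\<close>
  and column \<open>i\<close> receive from \<open>A\<close> and the boosts. If both alternatives of
  \<open>key\<close> failed at a point \<open>(x, y)\<close> of \<open>Z\<close>, then
  \<open>A\<close> with the rows \<open>V\<close> and columns \<open>U\<close> would be a proper
  stable set: off it, row counts are at most \<open>F j + card U\<close>, that is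
  \<open>x / 2 + x / 2\<close>, and likewise for columns. So \<open>Z\<close> lies below two layer
  regions.\<close>

lemma card_le_fspans:
  assumes Z: "down_closed Z" "finite Z" and sp: "fspans Z f g A" and A: "finite A"
    and fg: "finite {y. f y \<noteq> 0}" "finite {y. g y \<noteq> 0}"
  shows "card Z \<le> 8 * card A + 4 * total f + 4 * total g"
proof -
  define F where "F j = card {i. (i, j) \<in> A} + f j" for j
  define G where "G i = card {j. (i, j) \<in> A} + g i" for i
  define JF where "JF = snd ` A \<union> {y. f y \<noteq> 0}"
  define JG where "JG = fst ` A \<union> {y. g y \<noteq> 0}"
  have fJ: "finite JF" "finite JG" using A fg by (auto simp: JF_def JG_def)
  have FJ: "j \<in> JF" if "F j \<noteq> 0" for j
    using that card_gt_0_iff[of "{i. (i, j) \<in> A}"] by (force simp: F_def JF_def)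
  have GJ: "j \<in> JG" if "G j \<noteq> 0" for j
    using that card_gt_0_iff[of "{i. (j, i) \<in> A}"] by (force simp: G_def JG_def)
  have sF: "sum F JF = card A + total f"
  proof -
    have "sum F JF = (\<Sum>j\<in>JF. card {i. (i, j) \<in> A}) + sum f JF" unfolding F_def by (rule sum.distrib)
    also have "(\<Sum>j\<in>JF. card {i. (i, j) \<in> A}) = card {(x, y) \<in> A. y \<in> JF}"
      by (rule sum_card_sections[OF A fJ(1)])
    also have "{(x, y) \<in> A. y \<in> JF} = A" by (force simp: JF_def)
    also have "sum f JF = total f" by (rule total_eq[symmetric, OF fJ(1)]) (simp add: JF_def)
    finally show ?thesis .
  qed
  have sG: "sum G JG = card A + total g"
  proof -
    have "sum G JG = (\<Sum>j\<in>JG. card {i. (i, j) \<in> A\<inverse>}) + sum g JG" unfolding G_def by (simp add: sum.distrib)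
    also have "(\<Sum>j\<in>JG. card {i. (i, j) \<in> A\<inverse>}) = card {(x, y) \<in> A\<inverse>. y \<in> JG}"
      by (rule sum_card_sections) (use A fJ in auto)
    also have "{(x, y) \<in> A\<inverse>. y \<in> JG} = A\<inverse>" by (force simp: JG_def)
    also have "sum g JG = total g" by (rule total_eq[symmetric, OF fJ(2)]) (simp add: JG_def)
    finally show ?thesis by simp
  qed
  have key: "y < 2 * card {j. x < 2 * F j} \<or> x < 2 * card {i. y < 2 * G i}" if xy: "(x, y) \<in> Z" for x y
  proof (rule ccontr)
    assume neg: "\<not> ?thesis"
    define V where "V = {j. x < 2 * F j}"
    define U where "U = {i. y < 2 * G i}"
    have fV: "finite V" by (rule finite_subset[OF _ fJ(1)]) (use FJ in \<open>force simp: V_def\<close>)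
    have fU: "finite U" by (rule finite_subset[OF _ fJ(2)]) (use GJ in \<open>force simp: U_def\<close>)
    have VU: "2 * card V \<le> y" "2 * card U \<le> x" using neg by (auto simp: V_def U_def)
    define S where "S = A \<union> {(i, j). i \<in> U \<or> j \<in> V}"
    have "stable Z f g S"
      unfolding stable_def
    proof (clarify, rule ccontr)
      fix i j assume o: "outside Z (row (i, j) S + enat (f j)) (col (i, j) S + enat (g i))"
        and n: "(i, j) \<notin> S"
      then have ij: "2 * F j \<le> x" "2 * G i \<le> y" by (auto simp: S_def U_def V_def)
      have e: "{u. (u, j) \<in> S} = {u. (u, j) \<in> A} \<union> U" "{v. (i, v) \<in> S} = {v. (i, v) \<in> A} \<union> V"
        using n by (auto simp: S_def)
      have "row (i, j) S \<le> ecard {u. (u, j) \<in> A} + ecard U"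
        unfolding row_eq e by (rule ecard_Un_le)
      then have "row (i, j) S + enat (f j) \<le> ecard {u. (u, j) \<in> A} + ecard U + enat (f j)"
        by (rule add_right_mono)
      also have "\<dots> = enat (F j + card U)"
        using fU A by (simp add: ecard_finite finite_section1 F_def)
      also have "\<dots> \<le> enat x" using ij VU by simp
      finally have r: "row (i, j) S + enat (f j) \<le> enat x" .
      have "col (i, j) S \<le> ecard {u. (i, u) \<in> A} + ecard V"
        unfolding col_eq e by (rule ecard_Un_le)
      then have "col (i, j) S + enat (g i) \<le> ecard {u. (i, u) \<in> A} + ecard V + enat (g i)"
        by (rule add_right_mono)
      also have "\<dots> = enat (G i + card V)"
        using fV A by (simp add: ecard_finite finite_section2 G_def)
      also have "\<dots> \<le> enat y" using ij VU by simp
      finally have "outside Z (enat x) (enat y)" using outside_mono[OF Z(1) o r] by blast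
      then show False using xy by (simp add: outside_enat)
    qed
    moreover have "A \<subseteq> S" by (auto simp: S_def)
    ultimately have "S = UNIV" using sp unfolding fspans_def by blast
    \<comment> \<open>The crossing of a column that avoids \<open>A\<close> and \<open>U\<close>
      with a row outside \<open>V\<close> is missing from \<open>S\<close>.\<close>
    moreover obtain i where "i \<notin> fst ` A \<union> U" using ex_new_if_finite[of "fst ` A \<union> U"] A fU by auto
    moreover obtain j where "j \<notin> V" using ex_new_if_finite[OF _ fV] by auto
    ultimately show False by (force simp: S_def)
  qed
  obtain M where M: "Z \<subseteq> Rect M M" using finite_subset_Rect Z by blast
  let ?P = "{(x, y). x < M \<and> y < 2 * card {j. x < 2 * F j}}"
  let ?Q = "{(y, x). y < M \<and> x < 2 * card {i. y < 2 * G i}}"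
  have "?P = (SIGMA x:{..<M}. {..<2 * card {j. x < 2 * F j}})"
    "?Q = (SIGMA x:{..<M}. {..<2 * card {j. x < 2 * G j}})" by auto
  then have fin: "finite ?P" "finite ?Q" by simp_all
  have "Z \<subseteq> ?P \<union> ?Q\<inverse>" using key M by (fastforce simp: Rect_def)
  then have "card Z \<le> card (?P \<union> ?Q\<inverse>)" by (rule card_mono[rotated]) (use fin in auto)
  also have "\<dots> \<le> card ?P + card (?Q\<inverse>)" by (rule card_Un_le)
  also have "\<dots> \<le> 4 * sum F JF + 4 * sum G JG"
    using card_below_layers[OF fJ(1), of F M] card_below_layers[OF fJ(2), of G M] FJ GJ
    by (simp del: card_gt_0_iff)
  finally show ?thesis using sF sG by simp
qed

subsection \<open>Blowing up a finite window\<close>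

text \<open>\<open>W x\<close> and \<open>V y\<close> are the representatives, inside a finite window, of the column \<open>x\<close>
  and the row \<open>y\<close>: core lines represent themselves, all other lines are represented by
  the same block of interchangeable lines.\<close>

definition blow :: "(nat \<Rightarrow> nat set) \<Rightarrow> (nat \<Rightarrow> nat set) \<Rightarrow> (nat \<times> nat) set \<Rightarrow> (nat \<times> nat) set" where
  "blow W V S = {(x, y). W x \<times> V y \<subseteq> S}"

lemma blow_converse: "(blow W V S)\<inverse> = blow V W (S\<inverse>)"
  unfolding blow_def by auto

text \<open>A single non-core column in the blown-up row forces the whole block \<open>C2\<close>
  onto row \<open>y'\<close> of \<open>S\<close>, which is then long; otherwise only core columns
  occur, and these represent themselves.\<close>

lemma blow_row:
  assumes "\<And>x. x \<in> C \<Longrightarrow> W x = {x}" "\<And>x. x \<notin> C \<Longrightarrow> W x = C2" "finite C2" "m \<le> card C2" "y' \<in> V y"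
  shows "enat m \<le> row (x', y') S \<or> {u. (u, y) \<in> blow W V S} \<subseteq> C \<inter> {u. (u, y') \<in> S}"
proof (cases "\<exists>u. u \<notin> C \<and> (u, y) \<in> blow W V S")
  case True
  then have "C2 \<times> V y \<subseteq> S" using assms(2) by (auto simp: blow_def)
  then have "enat m \<le> row (x', y') S" unfolding row_eq
    by (intro enat_le_ecard[of C2]) (use assms in auto)
  then show ?thesis ..
next
  case False
  have "u \<in> C \<and> (u, y') \<in> S" if u: "(u, y) \<in> blow W V S" for u
  proof -
    have "u \<in> C" using False u by blast
    then show ?thesis using u assms(1)[of u] assms(5) by (auto simp: blow_def)
  qed
  then show ?thesis by blast
qed

lemma inj_on_block_code:
  assumes "\<And>j. f j < (K::nat)"
  shows "inj_on (\<lambda>(j, i). c + j * K + i) (SIGMA j:J. {..<f j})"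
proof (rule inj_onI, clarsimp)
  fix j i j' i' assume "i < f j" "i' < f j'" and e: "j * K + i = j' * K + i'"
  then have i: "i < K" "i' < K" using assms less_trans by blast+
  have "j = (j * K + i) div K" using i by simp
  also have "\<dots> = j'" unfolding e using i by simp
  finally show "j = j' \<and> i = i'" using e by simp
qed

text \<open>Each unit of a row boost becomes a point of that row in a private column, each unit of a
  column boost a point in a private row. Every private column inside \<open>X\<close> pays back
  \<alpha>, hence the price \<open>1 - \<alpha>\<close> per unit. If \<open>A\<close> is empty, the
  private lines make \<open>B\<close> thin.\<close>

lemma fspans_imp_spanning_set:
  assumes Z: "down_closed Z" "finite Z" and A: "finite A" and fg: "profile f" "profile g"
    and sp: "fspans Z f g A"
  obtains B where "finite B" "spans Z B"
    "\<And>X Y (\<alpha>::real) (\<beta>::real). finite X \<Longrightarrow> finite Y \<Longrightarrow> \<alpha> \<in> {0..1} \<Longrightarrow> \<beta> \<in> {0..1} \<Longrightarrow>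
       real (card (B \<inter> X \<times> Y)) - \<alpha> * card X - \<beta> * card Y
         \<le> card A + (1 - \<alpha>) * total f + (1 - \<beta>) * total g"
    "A = {} \<Longrightarrow> thin B" "A = {} \<Longrightarrow> card B \<le> total f + total g"
proof -
  have fin: "finite (Z \<union> A \<union> {y. f y \<noteq> 0} \<times> {y. g y \<noteq> 0} \<union> {y. f y \<noteq> 0} \<times> {0} \<union> {0} \<times> {y. g y \<noteq> 0} \<union> {(0,0)})"
    using Z A fg by (auto simp: profile_def)
  obtain m where m: "Z \<union> A \<union> {y. f y \<noteq> 0} \<times> {y. g y \<noteq> 0} \<union> {y. f y \<noteq> 0} \<times> {0} \<union> {0} \<times> {y. g y \<noteq> 0} \<union> {(0,0)} \<subseteq> Rect m m"
    using finite_subset_Rect[OF fin] by blast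
  then have ZA: "Z \<subseteq> Rect m m" "A \<subseteq> Rect m m"
    and fm: "\<And>y. f y \<noteq> 0 \<Longrightarrow> y < m" and gm: "\<And>y. g y \<noteq> 0 \<Longrightarrow> y < m"
    by (auto simp: Rect_def)
  define K where "K = Suc (f 0 + g 0)"
  have fK: "f y < K" and gK: "g y < K" for y
    using fg[unfolded profile_def monotone_def] by (auto simp: K_def less_Suc_eq_le intro: trans_le_add1 trans_le_add2)
  \<comment> \<open>Private lines start at \<open>2 * m\<close>, beyond the core lines below
    \<open>m\<close> and the block from \<open>m\<close> to \<open>2 * m\<close>. The base
    \<open>K\<close> exceeds all boosts, so different units of one boost get different
    lines.\<close>
  define cf where "cf = (\<lambda>(j, i). 2 * m + j * K + i)"
  define DF where "DF = (SIGMA j:{..<m}. {..<f j})"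
  define DG where "DG = (SIGMA j:{..<m}. {..<g j})"
  define P where "P = (\<lambda>p. (cf p, fst p)) ` DF"
  define Q where "Q = (\<lambda>p. (fst p, cf p)) ` DG"
  have injF: "inj_on cf DF" unfolding cf_def DF_def by (rule inj_on_block_code[OF fK])
  have injG: "inj_on cf DG" unfolding cf_def DG_def by (rule inj_on_block_code[OF gK])
  have finD: "finite DF" "finite DG" by (auto simp: DF_def DG_def)
  have injP: "inj_on fst P" unfolding P_def by (rule inj_onI) (use injF in \<open>auto dest: inj_onD\<close>)
  have injQ: "inj_on snd Q" unfolding Q_def by (rule inj_onI) (use injG in \<open>auto dest: inj_onD\<close>)
  have finP: "finite P" "finite Q" using finD by (auto simp: P_def Q_def)
  have tf: "total f = card DF" using total_eq[of "{..<m}" f] fm by (auto simp: DF_def)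
  have tg: "total g = card DG" using total_eq[of "{..<m}" g] gm by (auto simp: DG_def)
  have cP: "card P \<le> total f" unfolding P_def tf by (rule card_image_le[OF finD(1)])
  have cQ: "card Q \<le> total g" unfolding Q_def tg by (rule card_image_le[OF finD(2)])
  have P1: "2 * m \<le> fst p \<and> snd p < m" if "p \<in> P" for p using that by (auto simp: P_def cf_def DF_def)
  have Q1: "2 * m \<le> snd p \<and> fst p < m" if "p \<in> Q" for p using that by (auto simp: Q_def cf_def DG_def)
  define B where "B = A \<union> P \<union> Q"
  have B1: "finite B" using A finP by (simp add: B_def)
  have B2: "spans Z B"
    unfolding spans_iff_fspans[OF Z] fspans_def
  proof (intro allI impI)
    fix S assume S: "B \<subseteq> S" "stable Z (\<lambda>_. 0) (\<lambda>_. 0) S"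
    define W where "W x = (if x < m then {x} else {m..<2 * m})" for x
    \<comment> \<open>Private columns are disjoint from the core, so the boost points add to what
      the core columns contribute. Stated for general \<open>P\<close> and \<open>f\<close>, to be
      reused for the columns with the transpose of \<open>Q\<close>.\<close>
    have row_claim: "enat m \<le> row (x', y') S \<or> row (x, y) (blow W W S) + enat (f y) \<le> row (x', y') S"
      if S: "P \<subseteq> S" and P: "P = (\<lambda>p. (cf p, fst p)) ` (SIGMA j:{..<m}. {..<f j})"
        and inj: "inj_on cf (SIGMA j:{..<m}. {..<f j})"
        and fm: "\<And>y. f y \<noteq> 0 \<Longrightarrow> y < m"
        and y': "y' \<in> W y" for x x' y y' S P f
    proof (cases "enat m \<le> row (x', y') S")
      case False
      then have sub: "{u. (u, y) \<in> blow W W S} \<subseteq> {..<m} \<inter> {u. (u, y') \<in> S}"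
        using blow_row[of "{..<m}" W "{m..<2 * m}" m y' W y x' S] y' by (auto simp: W_def)
      let ?E = "(\<lambda>i. cf (y, i)) ` {..<f y}"
      have E: "?E \<subseteq> {u. (u, y') \<in> S} \<and> ?E \<inter> {..<m} = {}"
      proof (cases "f y = 0")
        case False
        then have "y < m" by (rule fm)
        then have "y' = y" using y' by (simp add: W_def)
        have "(cf (y, i), y) \<in> P" if "i < f y" for i
          unfolding P by (rule image_eqI[of _ _ "(y, i)"]) (use that \<open>y < m\<close> in auto)
        then show ?thesis using S \<open>y' = y\<close> by (auto simp: cf_def)
      qed simp
      have "card ?E = f y"
      proof (cases "f y = 0")
        case False
        then have "y < m" by (rule fm)
        then have "inj_on (\<lambda>i. cf (y, i)) {..<f y}"
          by (intro inj_onI) (use inj in \<open>auto dest: inj_onD\<close>)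
        then show ?thesis by (simp add: card_image)
      qed simp
      let ?U = "{u. (u, y) \<in> blow W W S}"
      have fU: "finite ?U" using sub finite_subset by blast
      have "row (x, y) (blow W W S) + enat (f y) = enat (card ?U + card ?E)"
        using fU \<open>card ?E = f y\<close> by (simp add: row_eq ecard_finite)
      also have "card ?U + card ?E = card (?U \<union> ?E)"
        by (rule card_Un_disjoint[symmetric]) (use fU sub E in auto)
      also have "enat \<dots> \<le> row (x', y') S" unfolding row_eq
        by (rule enat_le_ecard[of "?U \<union> ?E"]) (use fU sub E in auto)
      finally show ?thesis ..
    qed simp
    have "stable Z f g (blow W W S)"
      unfolding stable_def
    proof clarify
      fix x y assume o: "outside Z (row (x, y) (blow W W S) + enat (f y)) (col (x, y) (blow W W S) + enat (g x))"
      have "(x', y') \<in> S" if "x' \<in> W x" "y' \<in> W y" for x' y'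
      proof -
        have r: "enat m \<le> row (x', y') S \<or> row (x, y) (blow W W S) + enat (f y) \<le> row (x', y') S"
          by (rule row_claim[OF _ P_def[unfolded DF_def] injF[unfolded DF_def] fm that(2)]) (use S in \<open>auto simp: B_def\<close>)
        have "Q\<inverse> = (\<lambda>p. (cf p, fst p)) ` (SIGMA j:{..<m}. {..<g j})" by (auto simp: Q_def DG_def)
        then have "enat m \<le> row (y', x') (S\<inverse>) \<or> row (y, x) (blow W W (S\<inverse>)) + enat (g x) \<le> row (y', x') (S\<inverse>)"
          by (rule row_claim[rotated, OF _ injG[unfolded DG_def] gm that(1)]) (use S in \<open>auto simp: B_def\<close>)
        then have c: "enat m \<le> col (x', y') S \<or> col (x, y) (blow W W S) + enat (g x) \<le> col (x', y') S"
          by (simp add: row_converse blow_converse[symmetric])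
        have "outside Z (row (x', y') S) (col (x', y') S)"
          using r c outside_ge1[OF ZA(1)] outside_ge2[OF ZA(1)] outside_mono[OF Z(1) o] by blast
        then show ?thesis using stableD[OF S(2), of x' y'] by (simp add: zero_enat_def[symmetric])
      qed
      then show "(x, y) \<in> blow W W S" by (auto simp: blow_def)
    qed
    moreover have "A \<subseteq> blow W W S" using ZA(2) S(1) by (auto simp: blow_def W_def B_def Rect_def)
    ultimately have "blow W W S = UNIV" using sp unfolding fspans_def by blast
    \<comment> \<open>The site \<open>(m, m)\<close> is represented by the block of the lines from
      \<open>m\<close> to \<open>2 * m\<close>, so its presence puts an \<open>m\<close> by
      \<open>m\<close> block into \<open>S\<close>.\<close>
    then have "(m, m) \<in> blow W W S" by simp
    then have "{m..<2 * m} \<times> {m..<2 * m} \<subseteq> S" by (auto simp: blow_def W_def)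
    then show "S = UNIV"
      by (rule stable_block_UNIV[OF ZA(1) S(2), rotated -1]) auto
  qed
  have B3: "real (card (B \<inter> X \<times> Y)) - \<alpha> * card X - \<beta> * card Y
         \<le> card A + (1 - \<alpha>) * total f + (1 - \<beta>) * total g"
    if "finite X" "finite Y" "\<alpha> \<in> {0..1}" "\<beta> \<in> {0..1}" for X Y and \<alpha> \<beta> :: real
  proof -
    define p where "p = card (P \<inter> X \<times> Y)"
    define q where "q = card (Q \<inter> X \<times> Y)"
    have "card (B \<inter> X \<times> Y) \<le> card (A \<union> (P \<inter> X \<times> Y) \<union> (Q \<inter> X \<times> Y))"
      by (rule card_mono) (use A finP in \<open>auto simp: B_def\<close>)
    also have "\<dots> \<le> card A + p + q" unfolding p_def q_def
      by (meson card_Un_le add_mono order_trans order_refl)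
    finally have 1: "real (card (B \<inter> X \<times> Y)) \<le> card A + p + q" by linarith
    have "p = card (fst ` (P \<inter> X \<times> Y))" unfolding p_def
      by (rule card_image[symmetric]) (use injP in \<open>auto intro: inj_on_subset\<close>)
    also have "\<dots> \<le> card X" by (rule card_mono) (use that in auto)
    finally have aX: "\<alpha> * p \<le> \<alpha> * card X" using that by (intro mult_left_mono) auto
    have "q = card (snd ` (Q \<inter> X \<times> Y))" unfolding q_def
      by (rule card_image[symmetric]) (use injQ in \<open>auto intro: inj_on_subset\<close>)
    moreover have "card (snd ` (Q \<inter> X \<times> Y)) \<le> card Y" by (rule card_mono) (use that in auto)
    ultimately have qY: "q \<le> card Y" by simp
    have "\<beta> * q \<le> \<beta> * card Y" using that qY by (intro mult_left_mono) auto
    moreover have "p \<le> total f" unfolding p_def by (rule order_trans[OF card_mono cP]) (use finP in auto)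
    then have "(1 - \<alpha>) * p \<le> (1 - \<alpha>) * total f" using that by (intro mult_left_mono) auto
    moreover have "q \<le> total g" unfolding q_def by (rule order_trans[OF card_mono cQ]) (use finP in auto)
    then have "(1 - \<beta>) * q \<le> (1 - \<beta>) * total g" using that by (intro mult_left_mono) auto
    ultimately show ?thesis using 1 aX by (simp add: algebra_simps)
  qed
  have B4: "thin B" if "A = {}"
    unfolding thin_def
  proof
    fix p assume "p \<in> B"
    then consider "p \<in> P" | "p \<in> Q" using \<open>A = {}\<close> by (auto simp: B_def)
    then show "(\<forall>y\<in>B. y \<noteq> p \<longrightarrow> snd y \<noteq> snd p) \<or> (\<forall>y\<in>B. y \<noteq> p \<longrightarrow> fst y \<noteq> fst p)"
    proof cases
      case 1
      have "fst y \<noteq> fst p" if y: "y \<in> B" "y \<noteq> p" for y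
      proof (cases "y \<in> P")
        case True then show ?thesis using injP 1 y by (auto dest: inj_onD)
      next
        case False then have "y \<in> Q" using y \<open>A = {}\<close> by (simp add: B_def)
        then show ?thesis using P1[OF 1] Q1[of y] by auto
      qed
      then show ?thesis by blast
    next
      case 2
      have "snd y \<noteq> snd p" if y: "y \<in> B" "y \<noteq> p" for y
      proof (cases "y \<in> Q")
        case True then show ?thesis using injQ 2 y by (auto dest: inj_onD)
      next
        case False then have "y \<in> P" using y \<open>A = {}\<close> by (simp add: B_def)
        then show ?thesis using Q1[OF 2] P1[of y] by auto
      qed
      then show ?thesis by blast
    qed
  qed
  have B5: "card B \<le> total f + total g" if "A = {}"
    using card_Un_le[of P Q] cP cQ that by (simp add: B_def)
  show ?thesis by (rule that[OF B1 B2 B3 B4 B5])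
qed

subsection \<open>The containment exponent of a pattern\<close>

text \<open>In a box whose sides are about \<open>p powr (- \<alpha>)\<close> and
  \<open>p powr (- \<beta>)\<close>, the expected number of copies of
  \<open>A \<inter> X \<times> Y\<close> on \<open>card X\<close> columns and \<open>card Y\<close>
  rows is about \<open>p\<close> raised to the expression inside. The rarest subpattern decides,
  hence the maximum.\<close>

definition rho :: "real \<Rightarrow> real \<Rightarrow> (nat \<times> nat) set \<Rightarrow> real" where
  "rho \<alpha> \<beta> A = Max ((\<lambda>(X, Y). real (card (A \<inter> X \<times> Y)) - \<alpha> * card X - \<beta> * card Y) `
     (Pow (fst ` A) \<times> Pow (snd ` A)))"

lemma rho_ge:
  fixes \<alpha> \<beta> :: real
  assumes "finite A" "X \<subseteq> fst ` A" "Y \<subseteq> snd ` A"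
  shows "real (card (A \<inter> X \<times> Y)) - \<alpha> * card X - \<beta> * card Y \<le> rho \<alpha> \<beta> A"
  unfolding rho_def by (rule Max_ge) (use assms in auto)

lemma rho_attained:
  fixes \<alpha> \<beta> :: real
  assumes "finite A"
  obtains X Y where "X \<subseteq> fst ` A" "Y \<subseteq> snd ` A"
    "rho \<alpha> \<beta> A = real (card (A \<inter> X \<times> Y)) - \<alpha> * card X - \<beta> * card Y"
proof -
  have "rho \<alpha> \<beta> A \<in> ((\<lambda>(X, Y). real (card (A \<inter> X \<times> Y)) - \<alpha> * card X - \<beta> * card Y) `
     (Pow (fst ` A) \<times> Pow (snd ` A)))"
    unfolding rho_def by (rule Max_in) (use assms in auto)
  then show ?thesis using that by auto
qed

lemma rho_nonneg: "finite A \<Longrightarrow> 0 \<le> rho \<alpha> \<beta> A"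
  using rho_ge[of A "{}" "{}"] by simp

lemma rho_0: "finite A \<Longrightarrow> rho 0 0 A = card A"
proof (rule antisym)
  assume A: "finite A"
  obtain X Y where "X \<subseteq> fst ` A" "Y \<subseteq> snd ` A"
      "rho 0 0 A = real (card (A \<inter> X \<times> Y)) - (0::real) * card X - (0::real) * card Y"
    by (rule rho_attained[OF A])
  then show "rho 0 0 A \<le> card A" using card_mono[OF A, of "A \<inter> X \<times> Y"] by simp
  have "A \<inter> fst ` A \<times> snd ` A = A" by force
  then show "card A \<le> rho 0 0 A" using rho_ge[OF A order_refl order_refl, of 0 0] by simp
qed

lemma rho_antimono:
  fixes \<alpha> \<beta> :: real
  assumes "finite A" "\<alpha> \<le> \<alpha>'" "\<beta> \<le> \<beta>'" shows "rho \<alpha>' \<beta>' A \<le> rho \<alpha> \<beta> A"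
proof -
  obtain X Y where XY: "X \<subseteq> fst ` A" "Y \<subseteq> snd ` A"
    "rho \<alpha>' \<beta>' A = real (card (A \<inter> X \<times> Y)) - \<alpha>' * card X - \<beta>' * card Y"
    by (rule rho_attained[OF assms(1)])
  have "\<alpha> * card X \<le> \<alpha>' * card X" "\<beta> * card Y \<le> \<beta>' * card Y"
    using assms by (auto intro: mult_right_mono)
  then show ?thesis using rho_ge[OF assms(1) XY(1,2), of \<alpha> \<beta>] XY(3) by linarith
qed

subsection \<open>Replacing light points by boosts\<close>

text \<open>Concerns rows; the heavy columns are \<open>heavy k (A\<inverse>)\<close>.\<close>

definition heavy :: "nat \<Rightarrow> (nat \<times> nat) set \<Rightarrow> nat set" where
  "heavy k A = {y. k \<le> card {u. (u, y) \<in> A}}"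

lemma heavy_subset: "1 \<le> k \<Longrightarrow> heavy k A \<subseteq> snd ` A"
proof
  fix y assume "1 \<le> k" "y \<in> heavy k A"
  then have "card {u. (u, y) \<in> A} \<noteq> 0" by (simp add: heavy_def)
  then have "{u. (u, y) \<in> A} \<noteq> {}" by (metis card.empty)
  then show "y \<in> snd ` A" by force
qed

lemma finite_heavy: "finite A \<Longrightarrow> 1 \<le> k \<Longrightarrow> finite (heavy k A)"
  using heavy_subset finite_subset by (metis finite_imageI)

lemma snd_converse_image: "snd ` (A\<inverse>) = fst ` A" by force

lemma rho_converse:
  fixes \<alpha> \<beta> :: real
  assumes "finite A" shows "rho \<beta> \<alpha> (A\<inverse>) = rho \<alpha> \<beta> A"
proof -
  have *: "rho \<beta> \<alpha> (A\<inverse>) \<le> rho \<alpha> \<beta> A" if A: "finite A" for \<alpha> \<beta> :: real and A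
  proof -
    have "finite (A\<inverse>)" using A by simp
    obtain X Y where XY: "X \<subseteq> fst ` (A\<inverse>)" "Y \<subseteq> snd ` (A\<inverse>)"
      "rho \<beta> \<alpha> (A\<inverse>) = real (card (A\<inverse> \<inter> X \<times> Y)) - \<beta> * card X - \<alpha> * card Y"
      by (rule rho_attained[OF \<open>finite (A\<inverse>)\<close>])
    have "A\<inverse> \<inter> X \<times> Y = (A \<inter> Y \<times> X)\<inverse>" by auto
    then have "card (A\<inverse> \<inter> X \<times> Y) = card (A \<inter> Y \<times> X)" by simp
    moreover have "Y \<subseteq> fst ` A" "X \<subseteq> snd ` A" using XY by force+
    ultimately show ?thesis using rho_ge[OF A, of Y X \<alpha> \<beta>] XY(3) by linarith
  qed
  show ?thesis using *[OF assms, of \<beta> \<alpha>] *[of "A\<inverse>" \<alpha> \<beta>] assms by force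
qed

text \<open>Test \<open>rho\<close> with the heavy rows and the columns of their points. A heavy row
  carries at least \<open>k\<close> points, each needing at most one column, so it contributes at
  least \<open>(1 - \<alpha>) * k - 1\<close> to the exponent.\<close>

lemma card_heavy_le:
  fixes \<alpha> \<beta> :: real
  assumes A: "finite A" and k: "1 \<le> k" and ab: "\<alpha> \<in> {0..1}" "\<beta> \<le> 1" and pos: "(1 - \<alpha>) * k > 1"
  shows "card (heavy k A) \<le> rho \<alpha> \<beta> A / ((1 - \<alpha>) * k - 1)"
proof -
  let ?R = "heavy k A"
  let ?E = "{(x, y) \<in> A. y \<in> ?R}"
  have fR: "finite ?R" by (rule finite_heavy[OF A k])
  have fE: "finite ?E" using A by (rule rev_finite_subset) auto
  have "k * card ?R = (\<Sum>y\<in>?R. k)" by simp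
  also have "\<dots> \<le> (\<Sum>y\<in>?R. card {x. (x, y) \<in> A})" by (rule sum_mono) (simp add: heavy_def)
  also have "\<dots> = card ?E" by (rule sum_card_sections[OF A fR])
  finally have kR: "k * card ?R \<le> card ?E" .
  have "card (fst ` ?E) \<le> card ?E" by (rule card_image_le[OF fE])
  then have a: "\<alpha> * card (fst ` ?E) \<le> \<alpha> * card ?E" using ab by (intro mult_left_mono) auto
  have "A \<inter> fst ` ?E \<times> ?R = ?E" "fst ` ?E \<subseteq> fst ` A" by force+
  then have "real (card ?E) - \<alpha> * card (fst ` ?E) - \<beta> * card ?R \<le> rho \<alpha> \<beta> A"
    using rho_ge[OF A, of "fst ` ?E" ?R \<alpha> \<beta>] heavy_subset[OF k, of A] by simp
  moreover have "\<beta> * card ?R \<le> card ?R" using mult_right_mono[OF ab(2), of "card ?R"] by simp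
  moreover have "(1 - \<alpha>) * (k * card ?R) \<le> (1 - \<alpha>) * card ?E"
    using kR ab by (intro mult_left_mono) (auto simp flip: of_nat_mult)
  ultimately have "((1 - \<alpha>) * k - 1) * card ?R \<le> rho \<alpha> \<beta> A" using a by (simp add: algebra_simps)
  then show ?thesis using pos by (simp add: pos_le_divide_eq mult.commute)
qed

text \<open>Points at the crossing of two heavy lines are kept, and points on exactly one heavy line
  become a boost of that line. What remains lies on light lines only; any light row has fewer than
  \<open>k\<close> points, so \<open>m\<close> fresh rows with boost \<open>k\<close> can stand for
  all of them, and similarly for columns. This costs \<open>k * m\<close> on each side.\<close>

lemma fspans_light_boosts:
  assumes Z: "down_closed Z" "Z \<subseteq> Rect m m" and A: "finite A" and sp: "spans Z A" and k: "1 \<le> k"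
  obtains f g where "finite {y. f y \<noteq> 0}" "finite {x. g x \<noteq> 0}"
    "fspans Z f g (A \<inter> heavy k (A\<inverse>) \<times> heavy k A)"
    "total f = card {(x, y) \<in> A. x \<notin> heavy k (A\<inverse>) \<and> y \<in> heavy k A} + k * m"
    "total g = card {(x, y) \<in> A. x \<in> heavy k (A\<inverse>) \<and> y \<notin> heavy k A} + k * m"
proof -
  define R where "R = heavy k A"
  define C where "C = heavy k (A\<inverse>)"
  have fRC: "finite R" "finite C" using finite_heavy A k by (auto simp: R_def C_def)
  have new: "\<exists>J. finite J \<and> card J = m \<and> J \<inter> I = {}" if "finite I" for I :: "nat set"
    using infinite_arbitrarily_large[of "- I" m] that by (metis Compl_disjoint2 Int_commute finite_compl infinite_UNIV_nat disjoint_eq_subset_Compl)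
  obtain R2 where R2: "finite R2" "card R2 = m" "R2 \<inter> R = {}" using new[OF fRC(1)] by blast
  obtain C2 where C2: "finite C2" "card C2 = m" "C2 \<inter> C = {}" using new[OF fRC(2)] by blast
  \<comment> \<open>On \<open>R\<close> the boost replaces the points in light columns; on
    \<open>R2\<close> the value \<open>k\<close> dominates the content of every light row.\<close>
  define f where "f y = (if y \<in> R then card {u. (u, y) \<in> A \<and> u \<notin> C} else if y \<in> R2 then k else 0)" for y
  define g where "g x = (if x \<in> C then card {v. (x, v) \<in> A \<and> v \<notin> R} else if x \<in> C2 then k else 0)" for x
  define W where "W x = (if x \<in> C then {x} else C2)" for x
  define V where "V y = (if y \<in> R then {y} else R2)" for y
  have supp: "f y \<noteq> 0 \<Longrightarrow> y \<in> R \<union> R2" "g x \<noteq> 0 \<Longrightarrow> x \<in> C \<union> C2" for x y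
    by (auto simp: f_def g_def split: if_splits)
  have fin: "finite {y. f y \<noteq> 0}" "finite {x. g x \<noteq> 0}"
    using supp fRC R2 C2 by (auto intro: finite_subset[of _ "R \<union> R2"] finite_subset[of _ "C \<union> C2"])
  have tot: "total f = card {(x, y) \<in> A. x \<notin> C \<and> y \<in> R} + k * m"
    if A: "finite A" and f: "\<And>y. f y = (if y \<in> R then card {u. (u, y) \<in> A \<and> u \<notin> C} else if y \<in> R2 then k else 0)"
      and R: "finite R" "finite R2" "card R2 = m" "R2 \<inter> R = {}" for f A and C R R2 :: "nat set"
  proof -
    have "total f = sum f (R \<union> R2)"
      by (rule total_eq) (use R in \<open>auto simp: f split: if_splits\<close>)
    also have "\<dots> = sum f R + sum f R2" by (rule sum.union_disjoint) (use R in auto)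
    also have "sum f R2 = (\<Sum>y\<in>R2. k)" by (rule sum.cong) (use R in \<open>auto simp: f\<close>)
    also have "\<dots> = k * m" using R by simp
    also have "sum f R = (\<Sum>y\<in>R. card {u. (u, y) \<in> {(x, y) \<in> A. x \<notin> C}})"
      by (rule sum.cong) (auto simp: f)
    also have "\<dots> = card {(x, y) \<in> {(x, y) \<in> A. x \<notin> C}. y \<in> R}"
      by (rule sum_card_sections) (use A R in \<open>auto intro: finite_subset[of _ A]\<close>)
    also have "{(x, y) \<in> {(x, y) \<in> A. x \<notin> C}. y \<in> R} = {(x, y) \<in> A. x \<notin> C \<and> y \<in> R}" by auto
    finally show ?thesis .
  qed
  have tf: "total f = card {(x, y) \<in> A. x \<notin> C \<and> y \<in> R} + k * m"
    by (rule tot[OF A _ fRC(1) R2]) (simp add: f_def)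
  have "total g = card {(x, y) \<in> A\<inverse>. x \<notin> R \<and> y \<in> C} + k * m"
    by (rule tot[OF _ _ fRC(2) C2]) (use A in \<open>auto simp: g_def\<close>)
  also have "{(x, y) \<in> A\<inverse>. x \<notin> R \<and> y \<in> C} = {(x, y) \<in> A. x \<in> C \<and> y \<notin> R}\<inverse>" by auto
  finally have tg: "total g = card {(x, y) \<in> A. x \<in> C \<and> y \<notin> R} + k * m" by simp
  have row_claim: "enat m \<le> row (x', y') S \<or> row (x, y) (blow W V S \<union> A) \<le> row (x', y') S + enat (f y')"
    if A: "finite A" and S: "A \<inter> C \<times> R \<subseteq> S" and y': "y' \<in> V y" and R: "R = heavy k A"
      and W: "\<And>x. W x = (if x \<in> C then {x} else C2)" and V: "\<And>y. V y = (if y \<in> R then {y} else R2)"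
      and C2: "finite C2" "card C2 = m" and R2: "R2 \<inter> R = {}"
      and f: "\<And>y. f y = (if y \<in> R then card {u. (u, y) \<in> A \<and> u \<notin> C} else if y \<in> R2 then k else 0)"
    for x x' y y' S A C R C2 R2 W V f
  proof (cases "enat m \<le> row (x', y') S")
    case False
    then have sub: "{u. (u, y) \<in> blow W V S} \<subseteq> C \<inter> {u. (u, y') \<in> S}"
      using blow_row[of C W C2 m y' V y x' S] W C2 y' by auto
    define D where "D = (if y \<in> R then {u. (u, y) \<in> A \<and> u \<notin> C} else {u. (u, y) \<in> A})"
    have fD: "finite D" using A by (auto simp: D_def finite_section1 intro: finite_subset[OF _ finite_section1[OF A]])
    have "card D \<le> f y' \<and> {u. (u, y) \<in> A} \<subseteq> {u. (u, y') \<in> S} \<union> D"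
    proof (cases "y \<in> R")
      case True
      then have "y' = y" using y' V by simp
      then show ?thesis using True S by (auto simp: D_def f)
    next
      case False
      then have "card {u. (u, y) \<in> A} \<le> k" using R by (simp add: heavy_def)
      moreover have "f y' = k" using y' False V f R2 by auto
      ultimately show ?thesis using False by (auto simp: D_def)
    qed
    then have D: "card D \<le> f y'" "{u. (u, y) \<in> blow W V S \<union> A} \<subseteq> {u. (u, y') \<in> S} \<union> D"
      using sub by auto
    have "row (x, y) (blow W V S \<union> A) \<le> ecard ({u. (u, y') \<in> S} \<union> D)"
      unfolding row_eq by (rule ecard_mono[OF D(2)])
    also have "\<dots> \<le> row (x', y') S + ecard D" unfolding row_eq by (rule ecard_Un_le)
    also have "\<dots> \<le> row (x', y') S + enat (f y')" using fD D(1) by (intro add_left_mono) (simp add: ecard_finite)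
    finally show ?thesis ..
  qed simp
  have "fspans Z f g (A \<inter> C \<times> R)"
    unfolding fspans_def
  proof (intro allI impI)
    fix S assume S: "A \<inter> C \<times> R \<subseteq> S" "stable Z f g S"
    let ?B = "blow W V S"
    \<comment> \<open>The spanning property of \<open>A\<close> is applied to the pulled-back set
      together with \<open>A\<close> itself, because points of \<open>A\<close> on light lines need
      not belong to the pulled-back set.\<close>
    have "stable Z (\<lambda>_. 0) (\<lambda>_. 0) (?B \<union> A)"
      unfolding stable_def
    proof clarify
      fix x y assume "outside Z (row (x, y) (?B \<union> A) + enat 0) (col (x, y) (?B \<union> A) + enat 0)" and nA: "(x, y) \<notin> A"
      then have o: "outside Z (row (x, y) (?B \<union> A)) (col (x, y) (?B \<union> A))" by (simp add: zero_enat_def[symmetric])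
      have "(x', y') \<in> S" if "x' \<in> W x" "y' \<in> V y" for x' y'
      proof -
        have r: "enat m \<le> row (x', y') S \<or> row (x, y) (?B \<union> A) \<le> row (x', y') S + enat (f y')"
          by (rule row_claim[OF A S(1) that(2) R_def W_def V_def C2(1,2) R2(3) f_def])
        have "(A\<inverse>) \<inter> R \<times> C \<subseteq> S\<inverse>" using S(1) by auto
        then have "enat m \<le> row (y', x') (S\<inverse>) \<or> row (y, x) (blow V W (S\<inverse>) \<union> A\<inverse>) \<le> row (y', x') (S\<inverse>) + enat (g x')"
          by (rule row_claim[OF _ _ that(1) C_def V_def W_def R2(1,2) C2(3), rotated]) (use A in \<open>auto simp: g_def\<close>)
        then have c: "enat m \<le> col (x', y') S \<or> col (x, y) (?B \<union> A) \<le> col (x', y') S + enat (g x')"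
          by (simp add: row_converse blow_converse[symmetric] converse_Un[symmetric] del: converse_Un)
        have "outside Z (row (x', y') S + enat (f y')) (col (x', y') S + enat (g x'))"
          using r c outside_ge1[OF Z(2)] outside_ge2[OF Z(2)] outside_mono[OF Z(1) o]
          by (metis add_increasing2 zero_le)
        then show ?thesis using stableD[OF S(2)] by blast
      qed
      then show "(x, y) \<in> ?B" by (auto simp: blow_def)
    qed
    moreover have "finite Z" using Z(2) finite_Rect finite_subset by blast
    ultimately have full: "?B \<union> A = UNIV"
      using sp spans_iff_fspans[OF Z(1)] unfolding fspans_def by blast
    have "C2 \<times> R2 \<subseteq> S"
    proof -
      \<comment> \<open>In a light column without points of \<open>A\<close>, the site
        \<open>(x, y)\<close> must come from \<open>?B\<close>, and both of its coordinates are
        represented by fresh blocks.\<close>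
      obtain x where x: "x \<notin> C \<union> fst ` A" using ex_new_if_finite[of "C \<union> fst ` A"] A fRC by auto
      obtain y where y: "y \<notin> R" using ex_new_if_finite[of R] fRC by auto
      have "(x, y) \<notin> A" using x by force
      then have "(x, y) \<in> ?B" using full by blast
      then show ?thesis using x y by (auto simp: blow_def W_def V_def)
    qed
    then show "S = UNIV"
      by (intro stable_block_UNIV[OF Z(2) S(2), of C2 R2]) (use C2 R2 in auto)
  qed
  with that[OF fin] tf tg show ?thesis unfolding C_def R_def by simp
qed

text \<open>Test \<open>rho\<close> with the heavy lines enlarged by the columns of
  \<open>?P\<close> and the rows of \<open>?Q\<close>: each of these points adds 1 and costs at most
  \<alpha> or \<beta>. The heavy lines themselves are the only loss.\<close>

lemma light_boosts_cost:
  fixes \<alpha> \<beta> :: real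
  assumes A: "finite A" and k: "1 \<le> k" and ab: "\<alpha> \<in> {0..1}" "\<beta> \<in> {0..1}"
  defines "C \<equiv> heavy k (A\<inverse>)" and "R \<equiv> heavy k A"
  shows "real (card (A \<inter> C \<times> R)) + (1 - \<alpha>) * card {(x, y) \<in> A. x \<notin> C \<and> y \<in> R}
     + (1 - \<beta>) * card {(x, y) \<in> A. x \<in> C \<and> y \<notin> R} \<le> rho \<alpha> \<beta> A + \<alpha> * card C + \<beta> * card R"
proof -
  let ?P = "{(x, y) \<in> A. x \<notin> C \<and> y \<in> R}" and ?Q = "{(x, y) \<in> A. x \<in> C \<and> y \<notin> R}"
  have fPQ: "finite ?P" "finite ?Q" by (rule finite_subset[OF _ A]; auto)+
  have fRC: "finite R" "finite C" using finite_heavy A k by (auto simp: R_def C_def)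
  have sub: "C \<subseteq> fst ` A" "R \<subseteq> snd ` A"
    using heavy_subset[OF k, of A] heavy_subset[OF k, of "A\<inverse>"] by (auto simp: C_def R_def snd_converse_image)
  let ?X = "C \<union> fst ` ?P" and ?Y = "R \<union> snd ` ?Q"
  have cX: "card ?X \<le> card C + card ?P"
    by (rule order_trans[OF card_Un_le add_left_mono[OF card_image_le[OF fPQ(1)]]])
  have cY: "card ?Y \<le> card R + card ?Q"
    by (rule order_trans[OF card_Un_le add_left_mono[OF card_image_le[OF fPQ(2)]]])
  have "card (A \<inter> C \<times> R) + card ?P + card ?Q = card ((A \<inter> C \<times> R) \<union> ?P) + card ?Q"
    by (subst card_Un_disjoint) (use A fPQ in auto)
  also have "\<dots> = card ((A \<inter> C \<times> R) \<union> ?P \<union> ?Q)"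
    by (subst card_Un_disjoint) (use A fPQ in auto)
  also have "\<dots> \<le> card (A \<inter> ?X \<times> ?Y)"
  proof (rule card_mono)
    have "x \<in> fst ` ?P" if "(x, y) \<in> ?P" for x y using that by (intro image_eqI[of _ fst "(x, y)"]) simp_all
    moreover have "y \<in> snd ` ?Q" if "(x, y) \<in> ?Q" for x y using that by (intro image_eqI[of _ snd "(x, y)"]) simp_all
    ultimately show "A \<inter> C \<times> R \<union> ?P \<union> ?Q \<subseteq> A \<inter> ?X \<times> ?Y"
      by (intro subsetI) (clarsimp split del: if_split, blast)
  qed (use A in auto)
  finally have 1: "real (card (A \<inter> C \<times> R)) + card ?P + card ?Q \<le> card (A \<inter> ?X \<times> ?Y)" by linarith
  have "real (card (A \<inter> ?X \<times> ?Y)) - \<alpha> * card ?X - \<beta> * card ?Y \<le> rho \<alpha> \<beta> A"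
    by (rule rho_ge[OF A]) (use sub in auto)
  moreover have "\<alpha> * card ?X \<le> \<alpha> * (real (card C) + card ?P)"
    using cX ab by (intro mult_left_mono) (auto simp flip: of_nat_add)
  moreover have "\<beta> * card ?Y \<le> \<beta> * (real (card R) + card ?Q)"
    using cY ab by (intro mult_left_mono) (auto simp flip: of_nat_add)
  ultimately show ?thesis using 1 by (simp add: algebra_simps)
qed

text \<open>With threshold 2 the set kept by \<open>fspans_light_boosts\<close> is therefore empty,
  as the thin variational problem demands.\<close>

lemma heavy_2_thin:
  assumes "finite A" "thin A" shows "A \<inter> heavy 2 (A\<inverse>) \<times> heavy 2 A = {}"
proof (rule ccontr)
  assume "\<not> ?thesis"
  then obtain x y where xy: "(x, y) \<in> A" "2 \<le> card {v. (x, v) \<in> A}" "2 \<le> card {u. (u, y) \<in> A}"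
    by (auto simp: heavy_def)
  have "(\<forall>q\<in>A. q \<noteq> (x, y) \<longrightarrow> snd q \<noteq> y) \<or> (\<forall>q\<in>A. q \<noteq> (x, y) \<longrightarrow> fst q \<noteq> x)"
    using assms(2) xy(1) by (simp add: thin_def Ball_def)
  then have "{v. (x, v) \<in> A} \<subseteq> {y} \<or> {u. (u, y) \<in> A} \<subseteq> {x}" by auto
  then have "card {v. (x, v) \<in> A} \<le> 1 \<or> card {u. (u, y) \<in> A} \<le> 1"
    using card_mono[of "{y}" "{v. (x, v) \<in> A}"] card_mono[of "{x}" "{u. (u, y) \<in> A}"] by auto
  then show False using xy by linarith
qed

subsection \<open>Sorting the boosts\<close>

text \<open>Boosts arise on arbitrary lines, while \<open>profile\<close> asks for nonincreasing
  ones, in line with the monotone functions of the Euclidean problem. Growth does not depend on the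
  order of the lines, so sorting is free.\<close>

lemma sort_boost:
  fixes f :: "nat \<Rightarrow> nat"
  assumes "finite {y. f y \<noteq> 0}"
  obtains \<pi> :: "nat \<Rightarrow> nat" where "bij \<pi>" "antimono (f \<circ> \<pi>)"
proof -
  obtain n where n: "\<And>y. f y \<noteq> 0 \<Longrightarrow> y < n"
    using finite_nat_iff_bounded[THEN iffD1, OF assms] by blast
  let ?xs = "map f [0..<n]"
  have "mset (rev (sort ?xs)) = mset ?xs" by simp
  then obtain p where p: "p permutes {..<length ?xs}" "permute_list p ?xs = rev (sort ?xs)"
    by (metis mset_eq_permutation)
  have pn: "p permutes {..<n}" using p(1) by simp
  have e: "f (p i) = rev (sort ?xs) ! i" if "i < n" for i
    using permute_list_nth[OF p(1), of i] p(2) that permutes_in_image[OF pn, of i] by simp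
  have "sorted (rev (rev (sort ?xs)))" by simp
  then have d: "rev (sort ?xs) ! j \<le> rev (sort ?xs) ! i" if "i \<le> j" "j < n" for i j
    using that by (metis length_map length_rev length_sort length_upt diff_zero sorted_rev_nth_mono)
  have "antimono (f \<circ> p)"
  proof (rule antimonoI)
    fix i j :: nat assume "i \<le> j"
    show "(f \<circ> p) j \<le> (f \<circ> p) i"
    proof (cases "j < n")
      case True then show ?thesis using d e \<open>i \<le> j\<close> by simp
    next
      case False
      then have "p j = j" using pn by (simp add: permutes_def)
      then show ?thesis using n[of j] False by fastforce
    qed
  qed
  then show ?thesis using that permutes_bij[OF pn] by blast
qed

lemma fspans_permute:
  assumes sp: "fspans Z f g A" and b: "bij \<sigma>" "bij \<pi>"
  shows "fspans Z (f \<circ> \<pi>) (g \<circ> \<sigma>) {(x, y). (\<sigma> x, \<pi> y) \<in> A}"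
  unfolding fspans_def
proof (intro allI impI)
  fix S assume S: "{(x, y). (\<sigma> x, \<pi> y) \<in> A} \<subseteq> S" "stable Z (f \<circ> \<pi>) (g \<circ> \<sigma>) S"
  let ?S = "{(x, y). (inv \<sigma> x, inv \<pi> y) \<in> S}"
  have s: "surj \<sigma>" "surj \<pi>" "inj \<sigma>" "inj \<pi>" using b by (auto simp: bij_def)
  have "stable Z f g ?S"
    unfolding stable_def
  proof (clarify, rule stableD[OF S(2)])
    fix x y assume o: "outside Z (row (x, y) ?S + enat (f y)) (col (x, y) ?S + enat (g x))"
    have "row (inv \<sigma> x, inv \<pi> y) S = ecard (\<sigma> ` {u. (u, inv \<pi> y) \<in> S})"
      unfolding row_eq using s by (simp add: ecard_image inj_on_subset)
    also have "\<sigma> ` {u. (u, inv \<pi> y) \<in> S} = {u. (inv \<sigma> u, inv \<pi> y) \<in> S}"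
      using s by (force simp: surj_f_inv_f image_iff)
    finally have 1: "row (inv \<sigma> x, inv \<pi> y) S = row (x, y) ?S" by (simp add: row_eq)
    have "col (inv \<sigma> x, inv \<pi> y) S = ecard (\<pi> ` {u. (inv \<sigma> x, u) \<in> S})"
      unfolding col_eq using s by (simp add: ecard_image inj_on_subset)
    also have "\<pi> ` {u. (inv \<sigma> x, u) \<in> S} = {u. (inv \<sigma> x, inv \<pi> u) \<in> S}"
      using s by (force simp: surj_f_inv_f image_iff)
    finally have 2: "col (inv \<sigma> x, inv \<pi> y) S = col (x, y) ?S" by (simp add: col_eq)
    show "outside Z (row (inv \<sigma> x, inv \<pi> y) S + enat ((f \<circ> \<pi>) (inv \<pi> y))) (col (inv \<sigma> x, inv \<pi> y) S + enat ((g \<circ> \<sigma>) (inv \<sigma> x)))"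
      using o 1 2 s by (simp add: surj_f_inv_f)
  qed
  moreover have "A \<subseteq> ?S" using S(1) s by (auto simp: surj_f_inv_f subset_iff)
  ultimately have "?S = UNIV" using sp unfolding fspans_def by blast
  then have "(inv \<sigma> (\<sigma> x), inv \<pi> (\<pi> y)) \<in> S" for x y by blast
  then show "S = UNIV" using s by auto
qed

lemma total_permute:
  assumes "bij \<pi>" shows "total (f \<circ> \<pi>) = total f" "finite {y. f y \<noteq> 0} \<Longrightarrow> finite {y. (f \<circ> \<pi>) y \<noteq> 0}"
proof -
  have e: "\<pi> ` {y. (f \<circ> \<pi>) y \<noteq> 0} = {y. f y \<noteq> 0}"
    using assms by (force simp: bij_def image_iff)
  have i: "inj_on \<pi> {y. (f \<circ> \<pi>) y \<noteq> 0}" using assms inj_on_subset by (auto simp: bij_def)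
  show "total (f \<circ> \<pi>) = total f" unfolding total_def e[symmetric]
    using i by (subst sum.reindex) auto
  show "finite {y. f y \<noteq> 0} \<Longrightarrow> finite {y. (f \<circ> \<pi>) y \<noteq> 0}"
    using e i finite_image_iff by metis
qed

lemma fspans_sorted:
  assumes sp: "fspans Z f g A" and A: "finite A" and f: "finite {y. f y \<noteq> 0}" "finite {y. g y \<noteq> 0}"
  obtains f' g' A' where "fspans Z f' g' A'" "finite A'" "card A' = card A" "profile f'" "profile g'"
    "total f' = total f" "total g' = total g"
proof -
  obtain \<pi> :: "nat \<Rightarrow> nat" where p: "bij \<pi>" "antimono (f \<circ> \<pi>)" by (rule sort_boost[OF f(1)])
  obtain \<sigma> :: "nat \<Rightarrow> nat" where s: "bij \<sigma>" "antimono (g \<circ> \<sigma>)" by (rule sort_boost[OF f(2)])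
  have b: "bij (map_prod \<sigma> \<pi>)" using p s by (simp add: bij_def map_prod_inj_on prod.inj_map map_prod_surj)
  let ?A = "{(x, y). (\<sigma> x, \<pi> y) \<in> A}"
  have e: "?A = map_prod \<sigma> \<pi> -` A" by auto
  have "card ?A = card A" "finite ?A" unfolding e using b A
    by (simp_all add: card_vimage_inj bij_def finite_vimageI)
  then show ?thesis
    using that[OF fspans_permute[OF sp s(1) p(1)]] total_permute p s f by (auto simp: profile_def)
qed

subsection \<open>Spanning sets contain spanning subsets of bounded size\<close>

text \<open>The final configuration as a closure operator: \<open>growth_hull_trans\<close> allows
  hulls of separate pieces to be composed.\<close>

definition growth_hull :: "(nat \<times> nat) set \<Rightarrow> (nat \<times> nat) set \<Rightarrow> (nat \<times> nat) set" where
  "growth_hull Z B = \<Inter>{S. B \<subseteq> S \<and> stable Z (\<lambda>_. 0) (\<lambda>_. 0) S}"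

definition lines :: "nat set \<Rightarrow> nat set \<Rightarrow> (nat \<times> nat) set" where
  "lines X Y = {(x, y). x \<in> X \<or> y \<in> Y}"

lemma lines_converse: "(lines X Y)\<inverse> = lines Y X"
  by (auto simp: lines_def)

lemma growth_hull_superset: "B \<subseteq> growth_hull Z B"
  unfolding growth_hull_def by blast

lemma growth_hull_least: "B \<subseteq> S \<Longrightarrow> stable Z (\<lambda>_. 0) (\<lambda>_. 0) S \<Longrightarrow> growth_hull Z B \<subseteq> S"
  unfolding growth_hull_def by blast

lemma stable0_iff: "stable Z (\<lambda>_. 0) (\<lambda>_. 0) S \<longleftrightarrow> (\<forall>x y. outside Z (row (x, y) S) (col (x, y) S) \<longrightarrow> (x, y) \<in> S)"
  unfolding stable_def by (simp add: zero_enat_def[symmetric])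

lemma growth_hull_stable:
  assumes "down_closed Z"
  shows "stable Z (\<lambda>_. 0) (\<lambda>_. 0) (growth_hull Z B)"
  unfolding stable0_iff
proof (intro allI impI)
  fix x y assume o: "outside Z (row (x, y) (growth_hull Z B)) (col (x, y) (growth_hull Z B))"
  have "(x, y) \<in> S" if S: "B \<subseteq> S" "stable Z (\<lambda>_. 0) (\<lambda>_. 0) S" for S
  proof -
    have "outside Z (row (x, y) S) (col (x, y) S)"
      by (rule outside_mono[OF assms o]; intro row_mono col_mono growth_hull_least S)
    then show ?thesis using S(2) unfolding stable0_iff by blast
  qed
  then show "(x, y) \<in> growth_hull Z B" unfolding growth_hull_def by blast
qed

lemma growth_hullI:
  assumes "down_closed Z" "outside Z r c" "r \<le> row (x, y) (growth_hull Z B)" "c \<le> col (x, y) (growth_hull Z B)"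
  shows "(x, y) \<in> growth_hull Z B"
  using growth_hull_stable[OF assms(1), of B] outside_mono[OF assms] unfolding stable0_iff by blast

lemma growth_hull_trans:
  assumes "down_closed Z" "B \<subseteq> growth_hull Z B'" shows "growth_hull Z B \<subseteq> growth_hull Z B'"
  by (rule growth_hull_least[OF assms(2) growth_hull_stable[OF assms(1)]])

lemma growth_hull_mono: "down_closed Z \<Longrightarrow> B \<subseteq> B' \<Longrightarrow> growth_hull Z B \<subseteq> growth_hull Z B'"
  using growth_hull_trans growth_hull_superset by (metis order_trans)

lemma spans_iff_growth_hull:
  assumes "down_closed Z" "finite Z"
  shows "spans Z B \<longleftrightarrow> growth_hull Z B = UNIV"
  unfolding spans_iff_fspans[OF assms] fspans_def
  using growth_hull_stable[OF assms(1), of B] growth_hull_superset[of B Z] growth_hull_least[of B _ Z]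
  by (metis top.extremum_uniqueI)

lemma growth_hull_converse: "growth_hull (Z\<inverse>) (B\<inverse>) = (growth_hull Z B)\<inverse>"
proof -
  have "(growth_hull Z B)\<inverse> = \<Inter>(converse ` {S. B \<subseteq> S \<and> stable Z (\<lambda>_. 0) (\<lambda>_. 0) S})"
    unfolding growth_hull_def by auto
  also have "converse ` {S. B \<subseteq> S \<and> stable Z (\<lambda>_. 0) (\<lambda>_. 0) S} = {S. B\<inverse> \<subseteq> S \<and> stable (Z\<inverse>) (\<lambda>_. 0) (\<lambda>_. 0) S}"
  proof (intro set_eqI iffI)
    fix S assume "S \<in> {S. B\<inverse> \<subseteq> S \<and> stable (Z\<inverse>) (\<lambda>_. 0) (\<lambda>_. 0) S}"
    then have "B \<subseteq> S\<inverse>" "stable Z (\<lambda>_. 0) (\<lambda>_. 0) (S\<inverse>)"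
      using stable_converse[of Z "\<lambda>_. 0" "\<lambda>_. 0" "S\<inverse>"] by auto
    then have "(S\<inverse>)\<inverse> \<in> converse ` {S. B \<subseteq> S \<and> stable Z (\<lambda>_. 0) (\<lambda>_. 0) S}" by blast
    then show "S \<in> converse ` {S. B \<subseteq> S \<and> stable Z (\<lambda>_. 0) (\<lambda>_. 0) S}" by simp
  qed (auto simp: stable_converse)
  finally show ?thesis by (simp add: growth_hull_def)
qed

lemma Tstep_converse: "(Tstep (Z\<inverse>) ^^ t) (A\<inverse>) = ((Tstep Z ^^ t) A)\<inverse>"
proof (induction t)
  case (Suc t)
  then show ?case by (auto simp: Tstep_iff row_converse col_converse outside_converse)
qed simp

lemma not_enat_le_ecard: "\<not> enat m \<le> ecard S \<Longrightarrow> finite S \<and> card S < m"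
  by (auto simp: ecard_def split: if_splits)

lemma Tstep_first_time:
  assumes "p \<in> (Tstep Z ^^ t) A" "p \<notin> A"
  shows "\<exists>s<t. p \<notin> (Tstep Z ^^ s) A \<and> p \<in> (Tstep Z ^^ Suc s) A"
  using assms(1)
proof (induction t)
  case (Suc t)
  then show ?case by (cases "p \<in> (Tstep Z ^^ t) A") (use less_Suc_eq in blast)+
qed (use assms in simp)

text \<open>As long as no new line is long, growth is confined to few lines: a row with the most points
  grows in every column in which some row has grown, so there are at most \<open>m\<close> such columns.\<close>

lemma active_columns:
  assumes Z: "down_closed Z" and Y: "finite Y"
    and short: "\<And>y. y \<notin> Y \<Longrightarrow> \<not> enat m \<le> row (0, y) ((Tstep Z ^^ t) (A \<union> lines X Y))"
  defines "Xa \<equiv> {x. \<exists>y. (x, y) \<in> (Tstep Z ^^ t) (A \<union> lines X Y) - (A \<union> lines X Y)}"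
  shows "finite Xa \<and> card Xa \<le> m"
proof (cases t)
  case 0
  then show ?thesis by (simp add: Xa_def)
next
  case (Suc t')
  define G where "G s = (Tstep Z ^^ s) (A \<union> lines X Y)" for s
  have G: "G s \<subseteq> G s'" if "s \<le> s'" for s s' unfolding G_def by (rule Tstep_pow_mono[OF that])
  have A: "A \<union> lines X Y \<subseteq> G s" for s using G[of 0 s] by (simp add: G_def)
  have fin: "finite {u. (u, y) \<in> G s}" "card {u. (u, y) \<in> G s} < m" if "y \<notin> Y" "s \<le> t" for y s
  proof -
    have "\<not> enat m \<le> ecard {u. (u, y) \<in> G t}" using short[OF that(1)] by (simp add: row_eq G_def)
    then have f: "finite {u. (u, y) \<in> G t}" "card {u. (u, y) \<in> G t} < m" using not_enat_le_ecard by auto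
    have sub: "{u. (u, y) \<in> G s} \<subseteq> {u. (u, y) \<in> G t}" using G[OF that(2)] by auto
    then show "finite {u. (u, y) \<in> G s}" using f finite_subset by blast
    show "card {u. (u, y) \<in> G s} < m" using card_mono[OF f(1) sub] f(2) by simp
  qed
  have t': "t' \<le> t" using Suc by simp
  obtain y0 where "y0 \<notin> Y" using ex_new_if_finite[OF _ Y] by auto
  \<comment> \<open>The row counts at time \<open>t'\<close> are bounded by \<open>m\<close>, so a
    row with the most points exists among those outside \<open>Y\<close>.\<close>
  then obtain z where z: "z \<notin> Y" "\<And>y. y \<notin> Y \<Longrightarrow> card {u. (u, y) \<in> G t'} \<le> card {u. (u, z) \<in> G t'}"
    using ex_has_greatest_nat[of "\<lambda>y. y \<notin> Y" y0 "\<lambda>y. card {u. (u, y) \<in> G t'}" m] fin[OF _ t'] less_imp_le by blast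
  have "Xa \<subseteq> {u. (u, z) \<in> G t}"
  proof
    fix x assume "x \<in> Xa"
    then obtain y where y: "(x, y) \<in> G t" "(x, y) \<notin> A \<union> lines X Y" by (auto simp: Xa_def G_def)
    then obtain s where s: "s < t" "(x, y) \<notin> G s" "(x, y) \<in> G (Suc s)"
      unfolding G_def using Tstep_first_time by blast
    then have o: "outside Z (row (x, y) (G s)) (col (x, y) (G s))" by (simp add: G_def Tstep_iff)
    have "y \<notin> Y" using y by (simp add: lines_def)
    have st: "s \<le> t'" using s Suc by simp
    have "row (x, y) (G s) \<le> row (x, y) (G t')" by (rule row_mono[OF G[OF st]])
    also have "\<dots> \<le> row (x, z) (G t')"
      unfolding row_eq using z(2)[OF \<open>y \<notin> Y\<close>] fin(1)[OF _ t'] \<open>y \<notin> Y\<close> z(1) by (simp add: ecard_finite)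
    finally have "outside Z (row (x, z) (G t')) (col (x, z) (G t'))"
      by (rule outside_mono[OF Z o]) (use col_mono[OF G[OF st], of "(x, y)"] in \<open>simp add: col_eq\<close>)
    then show "x \<in> {u. (u, z) \<in> G t}" unfolding Suc by (simp add: G_def Tstep_iff)
  qed
  then show ?thesis using fin[OF z(1) order_refl] card_mono finite_subset by (metis less_imp_le order_trans)
qed

lemma card_points_on_rows:
  assumes "finite A" "finite Y" "card Y \<le> m" "\<And>y. y \<in> Y \<Longrightarrow> card {u. (u, y) \<in> A} \<le> m"
  shows "card {(x, y) \<in> A. y \<in> Y} \<le> m * m"
proof -
  have "card {(x, y) \<in> A. y \<in> Y} = (\<Sum>y\<in>Y. card {u. (u, y) \<in> A})"
    by (rule sum_card_sections[symmetric, OF assms(1,2)])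
  also have "\<dots> \<le> card Y * m" using sum_bounded_above[of Y "\<lambda>y. card {u. (u, y) \<in> A}" m] assms by simp
  also have "\<dots> \<le> m * m" using assms by simp
  finally show ?thesis .
qed

lemma card_points_on_columns:
  assumes "finite A" "finite X" "card X \<le> m" "\<And>x. x \<in> X \<Longrightarrow> card {v. (x, v) \<in> A} \<le> m"
  shows "card {(x, y) \<in> A. x \<in> X} \<le> m * m"
proof -
  have "{(x, y) \<in> A\<inverse>. y \<in> X} = {(x, y) \<in> A. x \<in> X}\<inverse>" by auto
  then show ?thesis using card_points_on_rows[of "A\<inverse>" X m] assms by simp
qed

lemma row_block_growth_hull:
  assumes Z: "down_closed Z" "Z \<subseteq> Rect m m" and P: "finite P" "m \<le> card P" "P \<times> {y} \<subseteq> growth_hull Z B"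
  shows "(x, y) \<in> growth_hull Z B"
proof (rule growth_hullI[OF Z(1) _ order_refl order_refl], rule outside_ge1[OF Z(2)])
  show "enat m \<le> row (x, y) (growth_hull Z B)"
    unfolding row_eq by (rule enat_le_ecard[of P]) (use P in auto)
qed

text \<open>Before time \<open>s\<close> no new line is long, so growth is confined to at most
  \<open>m\<close> columns and \<open>m\<close> rows, each with at most \<open>m\<close> points of
  \<open>A\<close>, and only these points can have influenced it. Adding the points on row
  \<open>y1\<close> and on the columns \<open>P\<close> used in the last step gives
  \<open>3 * (m * m) + m\<close>. The abscissa 0 in \<open>row (0, y1)\<close> is a dummy.\<close>

lemma first_long_row:
  assumes Z: "down_closed Z" "Z \<subseteq> Rect m m" and A: "finite A" and XY: "finite X" "finite Y"
    and y1: "y1 \<notin> Y" "enat m \<le> row (0, y1) ((Tstep Z ^^ s) (A \<union> lines X Y))"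
    and short: "\<And>t y. t < s \<Longrightarrow> y \<notin> Y \<Longrightarrow> \<not> enat m \<le> row (0, y) ((Tstep Z ^^ t) (A \<union> lines X Y))"
      "\<And>t x. t < s \<Longrightarrow> x \<notin> X \<Longrightarrow> \<not> enat m \<le> col (x, 0) ((Tstep Z ^^ t) (A \<union> lines X Y))"
  shows "\<exists>B\<subseteq>A. card B \<le> 3 * (m * m) + m \<and> (\<forall>x. (x, y1) \<in> growth_hull Z (B \<union> lines X Y))"
proof -
  define F where "F = lines X Y"
  define G where "G s = (Tstep Z ^^ s) (A \<union> F)" for s
  have G: "G s \<subseteq> G s'" if "s \<le> s'" for s s' unfolding G_def by (rule Tstep_pow_mono[OF that])
  have AF: "A \<union> F \<subseteq> G s" for s using G[of 0 s] by (simp add: G_def)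
  obtain P where P: "finite P" "card P = m" "P \<subseteq> {u. (u, y1) \<in> G s}"
  proof -
    have "\<exists>P\<subseteq>{u. (u, y1) \<in> G s}. finite P \<and> card P = m"
    proof (cases "finite {u. (u, y1) \<in> G s}")
      case True
      then show ?thesis using y1(2) obtain_subset_with_card_n[of m "{u. (u, y1) \<in> G s}"]
        by (auto simp: row_eq ecard_def G_def F_def)
    next
      case False
      then show ?thesis using infinite_arbitrarily_large by (metis (no_types, lifting))
    qed
    then show ?thesis using that by blast
  qed
  show ?thesis
  \<comment> \<open>At time 0 the \<open>m\<close> points of row \<open>y1\<close> already lie in
    \<open>A\<close> or on the given lines. Otherwise shortness is used at the preceding time
    \<open>t\<close>, and the last step is treated separately.\<close>
  proof (cases s)
    case 0
    let ?B = "A \<inter> P \<times> {y1}"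
    have "card ?B \<le> card (P \<times> {y1})" by (rule card_mono) (use P in auto)
    also have "\<dots> = m" using P by simp
    finally have "card ?B \<le> 3 * (m * m) + m" by simp
    moreover have "P \<times> {y1} \<subseteq> ?B \<union> F" using P(3) by (auto simp: 0 G_def)
    then have "P \<times> {y1} \<subseteq> growth_hull Z (?B \<union> F)" using growth_hull_superset by (rule order_trans)
    then have "(x, y1) \<in> growth_hull Z (?B \<union> F)" for x
      using row_block_growth_hull[OF Z P(1)] P(2) by simp
    ultimately show ?thesis unfolding F_def by (intro exI[of _ ?B]) auto
  next
    case (Suc t)
    have sr: "finite {u. (u, y) \<in> G t}" "card {u. (u, y) \<in> G t} < m" if "y \<notin> Y" for y
      using short(1)[of t y] that not_enat_le_ecard[of m "{u. (u, y) \<in> G t}"] Suc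
      by (auto simp: row_eq G_def F_def)
    have sc: "finite {u. (x, u) \<in> G t}" "card {u. (x, u) \<in> G t} < m" if "x \<notin> X" for x
      using short(2)[of t x] that not_enat_le_ecard[of m "{u. (x, u) \<in> G t}"] Suc
      by (auto simp: col_eq G_def F_def)
    have Ar: "card {u. (u, y) \<in> A} \<le> m" if "y \<notin> Y" for y
      using card_mono[OF sr(1)[OF that], of "{u. (u, y) \<in> A}"] sr(2)[OF that] AF by fastforce
    have Ac: "card {u. (x, u) \<in> A} \<le> m" if "x \<notin> X" for x
      using card_mono[OF sc(1)[OF that], of "{u. (x, u) \<in> A}"] sc(2)[OF that] AF by fastforce
    define Xa where "Xa = {x. \<exists>y. (x, y) \<in> G t - (A \<union> F)}"
    define Ya where "Ya = {y. \<exists>x. (x, y) \<in> G t - (A \<union> F)}"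
    have Xa: "finite Xa" "card Xa \<le> m" "Xa \<inter> X = {}"
      using active_columns[OF Z(1) XY(2), of m t A X] short(1)[of t] Suc
      by (auto simp: Xa_def G_def F_def lines_def)
    have Ya: "finite Ya" "card Ya \<le> m" "Ya \<inter> Y = {}"
    proof -
      have c: "(Tstep (Z\<inverse>) ^^ t) (A\<inverse> \<union> lines Y X) = (G t)\<inverse>"
        using Tstep_converse[of t Z "A \<union> F"] by (simp add: G_def F_def lines_converse converse_Un)
      have "\<not> enat m \<le> row (0, x) ((Tstep (Z\<inverse>) ^^ t) (A\<inverse> \<union> lines Y X))" if "x \<notin> X" for x
        unfolding c row_converse using short(2)[of t x] that Suc by (simp add: G_def F_def)
      from active_columns[OF _ XY(1) this] have
        "finite {x. \<exists>y. (x, y) \<in> (G t)\<inverse> - (A\<inverse> \<union> lines Y X)} \<and> card {x. \<exists>y. (x, y) \<in> (G t)\<inverse> - (A\<inverse> \<union> lines Y X)} \<le> m"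
        using Z(1) by (simp add: c down_closed_converse)
      moreover have "{x. \<exists>y. (x, y) \<in> (G t)\<inverse> - (A\<inverse> \<union> lines Y X)} = Ya"
        by (auto simp: Ya_def F_def lines_def)
      ultimately show "finite Ya" "card Ya \<le> m" by auto
      show "Ya \<inter> Y = {}" by (auto simp: Ya_def F_def lines_def)
    qed
    define B where "B = {(x, y) \<in> A. x \<in> Xa} \<union> {(x, y) \<in> A. y \<in> Ya} \<union> {(x, y) \<in> A. y \<in> {y1}} \<union> {(x, y) \<in> A. x \<in> P - X}"
    have "card {(x, y) \<in> A. x \<in> Xa} \<le> m * m"
      by (rule card_points_on_columns[OF A Xa(1,2) Ac]) (use Xa in auto)
    moreover have "card {(x, y) \<in> A. y \<in> Ya} \<le> m * m"
      by (rule card_points_on_rows[OF A Ya(1,2) Ar]) (use Ya in auto)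
    moreover have "card {(x, y) \<in> A. y \<in> {y1}} \<le> m"
      using sum_card_sections[OF A, of "{y1}"] Ar[OF y1(1)] by simp
    moreover have "card {(x, y) \<in> A. x \<in> P - X} \<le> m * m"
      by (rule card_points_on_columns[OF A _ _ Ac]) (use P card_Diff_subset_Int card_mono[OF P(1), of "P - X"] in auto)
    ultimately have cB: "card B \<le> 3 * (m * m) + m"
      unfolding B_def
      using card_Un_le[of "{(x, y) \<in> A. x \<in> Xa}" "{(x, y) \<in> A. y \<in> Ya}"]
        card_Un_le[of "{(x, y) \<in> A. x \<in> Xa} \<union> {(x, y) \<in> A. y \<in> Ya}" "{(x, y) \<in> A. y \<in> {y1}}"]
        card_Un_le[of "{(x, y) \<in> A. x \<in> Xa} \<union> {(x, y) \<in> A. y \<in> Ya} \<union> {(x, y) \<in> A. y \<in> {y1}}" "{(x, y) \<in> A. x \<in> P - X}"]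
      by linarith
    have BA: "B \<subseteq> A" by (auto simp: B_def)
    let ?H = "growth_hull Z (B \<union> F)"
    have H: "B \<subseteq> ?H" "F \<subseteq> ?H" using growth_hull_superset[of "B \<union> F" Z] by auto
    \<comment> \<open>Induction on time: a site that has grown by time \<open>t\<close> lies on an
      active column and an active row, and \<open>B\<close> contains all points of \<open>A\<close>
      on these.\<close>
    have new: "(x, y) \<in> ?H" if "r \<le> t" "(x, y) \<in> G r" "(x, y) \<notin> A \<union> F" for r x y
      using that
    proof (induction r arbitrary: x y)
      case 0
      then show ?case by (simp add: G_def)
    next
      case (Suc r)
      show ?case
      proof (cases "(x, y) \<in> G r")
        case True
        then show ?thesis using Suc by simp
      next
        case False
        then have o: "outside Z (row (x, y) (G r)) (col (x, y) (G r))"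
          using Suc.prems(2) by (simp add: G_def Tstep_iff)
        have "(x, y) \<in> G t" using Suc.prems G by blast
        then have xy: "x \<in> Xa" "y \<in> Ya" using Suc.prems(3) by (auto simp: Xa_def Ya_def)
        have "{u. (u, y) \<in> G r} \<subseteq> {u. (u, y) \<in> ?H}"
        proof clarify
          fix u assume "(u, y) \<in> G r"
          then show "(u, y) \<in> ?H" using Suc.IH[of u y] Suc.prems(1) xy H by (auto simp: B_def)
        qed
        moreover have "{u. (x, u) \<in> G r} \<subseteq> {u. (x, u) \<in> ?H}"
        proof clarify
          fix u assume "(x, u) \<in> G r"
          then show "(x, u) \<in> ?H" using Suc.IH[of x u] Suc.prems(1) xy H by (auto simp: B_def)
        qed
        ultimately show ?thesis
          by (intro growth_hullI[OF Z(1) o]) (auto simp: row_eq col_eq intro!: ecard_mono)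
      qed
    qed
    have y1H: "(u, y1) \<in> ?H" if "(u, y1) \<in> G t" for u
    proof -
      have "(u, y1) \<in> A \<Longrightarrow> (u, y1) \<in> B" by (simp add: B_def)
      then show ?thesis using new[OF order_refl that] H by blast
    qed
    have "(u, y1) \<in> ?H" if u: "u \<in> P" for u
    proof (cases "(u, y1) \<in> G t \<or> u \<in> X")
      case True
      then show ?thesis using y1H H by (auto simp: F_def lines_def)
    next
      case False
      then have o: "outside Z (row (u, y1) (G t)) (col (u, y1) (G t))"
        using P(3) u Suc by (auto simp: G_def Tstep_iff)
      have "{v. (v, y1) \<in> G t} \<subseteq> {v. (v, y1) \<in> ?H}" using y1H by auto
      moreover have "{v. (u, v) \<in> G t} \<subseteq> {v. (u, v) \<in> ?H}"
      proof clarify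
        fix v assume "(u, v) \<in> G t"
        moreover have "(u, v) \<in> A \<Longrightarrow> (u, v) \<in> B" using u False by (simp add: B_def)
        ultimately show "(u, v) \<in> ?H" using new[OF order_refl, of u v] H by blast
      qed
      ultimately show ?thesis
        by (intro growth_hullI[OF Z(1) o]) (auto simp: row_eq col_eq intro!: ecard_mono)
    qed
    then have "(x, y1) \<in> ?H" for x using row_block_growth_hull[OF Z P(1)] P(2) by blast
    then show ?thesis using cB BA unfolding F_def by blast
  qed
qed

text \<open>Look at the first time when a line outside \<open>X\<close> and \<open>Y\<close> is
  long; it exists because the process spans. A long row is covered by \<open>first_long_row\<close>,
  a long column by the same lemma for the transposed process.\<close>

lemma new_full_line:
  assumes Z: "down_closed Z" "Z \<subseteq> Rect m m" and A: "finite A" and XY: "finite X" "finite Y"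
    and sp: "spans Z A"
  shows "\<exists>B\<subseteq>A. card B \<le> 3 * (m * m) + m \<and>
    ((\<exists>y. y \<notin> Y \<and> lines X (insert y Y) \<subseteq> growth_hull Z (B \<union> lines X Y)) \<or>
     (\<exists>x. x \<notin> X \<and> lines (insert x X) Y \<subseteq> growth_hull Z (B \<union> lines X Y)))"
proof -
  define G where "G s = (Tstep Z ^^ s) (A \<union> lines X Y)" for s
  define long where "long s \<longleftrightarrow> (\<exists>y. y \<notin> Y \<and> enat m \<le> row (0, y) (G s)) \<or> (\<exists>x. x \<notin> X \<and> enat m \<le> col (x, 0) (G s))" for s
  have fZ: "finite Z" using Z(2) finite_subset finite_Rect by blast
  have "(\<Union>s. G s) = UNIV" using spans_Un[OF sp Z(1), of "A \<union> lines X Y"] by (simp add: spans_def G_def)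
  obtain y0 where y0: "y0 \<notin> Y" using ex_new_if_finite[OF _ XY(2)] by auto
  have "{..<m} \<times> {y0} \<subseteq> (\<Union>s. G s)" using \<open>(\<Union>s. G s) = UNIV\<close> by simp
  then obtain s where s: "{..<m} \<times> {y0} \<subseteq> G s"
    using finite_subset_Tstep_pow[of "{..<m} \<times> {y0}" Z "A \<union> lines X Y"] by (auto simp: G_def)
  have "enat m \<le> row (0, y0) (G s)" unfolding row_eq
    by (rule enat_le_ecard[of "{..<m}"]) (use s in auto)
  then have "long s" using y0 by (auto simp: long_def)
  define s0 where "s0 = (LEAST s. long s)"
  have s0: "long s0" "\<And>t. t < s0 \<Longrightarrow> \<not> long t"
    unfolding s0_def using \<open>long s\<close> by (rule LeastI) (rule not_less_Least)
  have l: "lines X Y \<subseteq> growth_hull Z (B \<union> lines X Y)" for B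
    using growth_hull_superset[of "B \<union> lines X Y" Z] by auto
  from s0(1) consider y where "y \<notin> Y" "enat m \<le> row (0, y) (G s0)" | x where "x \<notin> X" "enat m \<le> col (x, 0) (G s0)"
    unfolding long_def by blast
  then show ?thesis
  proof cases
    case 1
    have "\<exists>B\<subseteq>A. card B \<le> 3 * (m * m) + m \<and> (\<forall>x. (x, y) \<in> growth_hull Z (B \<union> lines X Y))"
      by (rule first_long_row[OF Z A XY 1(1), of s0]) (use 1 s0(2) in \<open>auto simp: long_def G_def\<close>)
    then obtain B where B: "B \<subseteq> A" "card B \<le> 3 * (m * m) + m" "\<And>x. (x, y) \<in> growth_hull Z (B \<union> lines X Y)"
      by blast
    have "lines X (insert y Y) \<subseteq> growth_hull Z (B \<union> lines X Y)"
      using B(3) l[of B] by (auto simp: lines_def)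
    then show ?thesis using B 1 by blast
  next
    case 2
    have c: "(Tstep (Z\<inverse>) ^^ t) (A\<inverse> \<union> lines Y X) = (G t)\<inverse>" for t
      using Tstep_converse[of t Z "A \<union> lines X Y"] by (simp add: G_def lines_converse converse_Un)
    have "Z\<inverse> \<subseteq> Rect m m" using Z(2) by (auto simp: Rect_def)
    then have "\<exists>B\<subseteq>A\<inverse>. card B \<le> 3 * (m * m) + m \<and> (\<forall>y. (y, x) \<in> growth_hull (Z\<inverse>) (B \<union> lines Y X))"
      by (intro first_long_row[OF _ _ _ XY(2,1) 2(1), of _ _ _ s0])
        (use 2 s0(2) A Z(1) in \<open>auto simp: long_def c row_converse col_converse down_closed_converse\<close>)
    then obtain B where B: "B \<subseteq> A\<inverse>" "card B \<le> 3 * (m * m) + m" "\<And>y. (y, x) \<in> growth_hull (Z\<inverse>) (B \<union> lines Y X)"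
      by blast
    have "growth_hull (Z\<inverse>) (B \<union> lines Y X) = (growth_hull Z (B\<inverse> \<union> lines X Y))\<inverse>"
      using growth_hull_converse[of Z "B\<inverse> \<union> lines X Y"] by (simp add: converse_Un lines_converse)
    then have "lines (insert x X) Y \<subseteq> growth_hull Z (B\<inverse> \<union> lines X Y)"
      using B(3) l[of "B\<inverse>"] by (auto simp: lines_def)
    moreover have "B\<inverse> \<subseteq> A" "card (B\<inverse>) \<le> 3 * (m * m) + m" using B by auto
    ultimately show ?thesis using 2(1) by blast
  qed
qed

text \<open>Full lines are collected one at a time, each at a bounded price; among
  \<open>2 * m\<close> of them \<open>m\<close> are parallel, and these span. That \<open>K\<close>
  does not depend on \<open>A\<close> is what makes the later union bound polynomial in the side
  lengths of the box.\<close>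

lemma bounded_spanning_subset:
  assumes Z: "down_closed Z" "finite Z"
  obtains K where "\<And>A. finite A \<Longrightarrow> spans Z A \<Longrightarrow> \<exists>B\<subseteq>A. spans Z B \<and> card B \<le> K"
proof -
  obtain m where m: "Z \<subseteq> Rect m m" using finite_subset_Rect[OF Z(2)] by blast
  let ?k = "3 * (m * m) + m"
  have "\<exists>B\<subseteq>A. spans Z B \<and> card B \<le> 2 * m * ?k" if A: "finite A" "spans Z A" for A
  proof -
    have iter: "\<exists>B X Y. B \<subseteq> A \<and> card B \<le> n * ?k \<and> finite X \<and> finite Y \<and> lines X Y \<subseteq> growth_hull Z B \<and>
        n \<le> card X + card Y" for n
    proof (induction n)
      case 0
      have "lines {} {} \<subseteq> growth_hull Z {}" by (simp add: lines_def)
      then show ?case by (intro exI[of _ "{}"]) auto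
    next
      case (Suc n)
      then obtain B X Y where IH: "B \<subseteq> A" "card B \<le> n * ?k" "finite X" "finite Y" "lines X Y \<subseteq> growth_hull Z B"
        "n \<le> card X + card Y" by blast
      obtain B' where B': "B' \<subseteq> A" "card B' \<le> ?k"
        "(\<exists>y. y \<notin> Y \<and> lines X (insert y Y) \<subseteq> growth_hull Z (B' \<union> lines X Y)) \<or>
         (\<exists>x. x \<notin> X \<and> lines (insert x X) Y \<subseteq> growth_hull Z (B' \<union> lines X Y))"
        using new_full_line[OF Z(1) m A(1) IH(3,4) A(2)] by blast
      have c: "card (B \<union> B') \<le> Suc n * ?k" using card_Un_le[of B B'] IH(2) B'(2) by simp
      have "growth_hull Z (B' \<union> lines X Y) \<subseteq> growth_hull Z (B \<union> B')"
      proof (rule growth_hull_trans[OF Z(1)])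
        have "growth_hull Z B \<subseteq> growth_hull Z (B \<union> B')" by (rule growth_hull_mono[OF Z(1)]) simp
        then show "B' \<union> lines X Y \<subseteq> growth_hull Z (B \<union> B')"
          using IH(5) growth_hull_superset[of "B \<union> B'" Z] by auto
      qed
      with B'(3) have "\<exists>X' Y'. finite X' \<and> finite Y' \<and> Suc n \<le> card X' + card Y' \<and> lines X' Y' \<subseteq> growth_hull Z (B \<union> B')"
      proof (elim disjE exE conjE)
        fix y assume "y \<notin> Y" "lines X (insert y Y) \<subseteq> growth_hull Z (B' \<union> lines X Y)"
          "growth_hull Z (B' \<union> lines X Y) \<subseteq> growth_hull Z (B \<union> B')"
        then show ?thesis using IH by (intro exI[of _ X] exI[of _ "insert y Y"]) auto
      next
        fix x assume "x \<notin> X" "lines (insert x X) Y \<subseteq> growth_hull Z (B' \<union> lines X Y)"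
          "growth_hull Z (B' \<union> lines X Y) \<subseteq> growth_hull Z (B \<union> B')"
        then show ?thesis using IH by (intro exI[of _ "insert x X"] exI[of _ Y]) auto
      qed
      then show ?case using c IH(1) B'(1) by (meson Un_least)
    qed
    obtain B X Y where B: "B \<subseteq> A" "card B \<le> 2 * m * ?k" "finite X" "finite Y" "lines X Y \<subseteq> growth_hull Z B"
        "2 * m \<le> card X + card Y" using iter[of "2 * m"] by blast
    have st: "stable Z (\<lambda>_. 0) (\<lambda>_. 0) (growth_hull Z B)" by (rule growth_hull_stable[OF Z(1)])
    have "m \<le> card X \<or> m \<le> card Y" using B(6) by linarith
    then have "growth_hull Z B = UNIV"
    proof
      assume "m \<le> card X"
      then show ?thesis by (intro stable_block_UNIV[OF m st B(3), of "{..<m}"]) (use B(5) in \<open>auto simp: lines_def\<close>)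
    next
      assume "m \<le> card Y"
      then show ?thesis by (intro stable_block_UNIV[OF m st, of "{..<m}" Y]) (use B(4,5) in \<open>auto simp: lines_def\<close>)
    qed
    then show ?thesis using B spans_iff_growth_hull[OF Z] by blast
  qed
  then show ?thesis using that by blast
qed

section \<open>Large deviation rate of the random initial set\<close>

definition wt :: "real \<Rightarrow> 'a set \<Rightarrow> 'a set \<Rightarrow> real" where
  "wt p U \<omega> = p ^ card \<omega> * (1 - p) ^ (card U - card \<omega>)"

lemma sum_wt:
  assumes U: "finite U" and T: "T \<subseteq> U"
  shows "(\<Sum>\<omega> | T \<subseteq> \<omega> \<and> \<omega> \<subseteq> U. wt p U \<omega>) = p ^ card T"
proof -
  have fT: "finite T" using assms finite_subset by blast
  have e: "{\<omega>. T \<subseteq> \<omega> \<and> \<omega> \<subseteq> U} = (\<lambda>X. T \<union> X) ` Pow (U - T)"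
  proof (intro set_eqI iffI)
    fix \<omega> assume "\<omega> \<in> {\<omega>. T \<subseteq> \<omega> \<and> \<omega> \<subseteq> U}"
    then have "\<omega> = T \<union> (\<omega> - T)" "\<omega> - T \<in> Pow (U - T)" by auto
    then show "\<omega> \<in> (\<lambda>X. T \<union> X) ` Pow (U - T)" by blast
  qed (use T in auto)
  have inj: "inj_on (\<lambda>X. T \<union> X) (Pow (U - T))" by (rule inj_onI) auto
  have w: "wt p U (T \<union> X) = p ^ card T * ((\<Prod>x\<in>X. p) * (\<Prod>x\<in>(U - T) - X. 1 - p))" if "X \<in> Pow (U - T)" for X
  proof -
    have fX: "finite X" using that U finite_subset by blast
    have "card (T \<union> X) = card T + card X" by (rule card_Un_disjoint) (use fT fX that in auto)
    moreover have "card ((U - T) - X) = card U - (card T + card X)"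
      using that T fT fX U by (simp add: card_Diff_subset)
    ultimately show ?thesis by (simp add: wt_def power_add)
  qed
  have "(\<Sum>\<omega> | T \<subseteq> \<omega> \<and> \<omega> \<subseteq> U. wt p U \<omega>) = (\<Sum>X\<in>Pow (U - T). wt p U (T \<union> X))"
    unfolding e by (simp add: sum.reindex[OF inj])
  also have "\<dots> = p ^ card T * (\<Sum>X\<in>Pow (U - T). (\<Prod>x\<in>X. p) * (\<Prod>x\<in>(U - T) - X. 1 - p))"
    by (simp add: w sum_distrib_left)
  also have "(\<Sum>X\<in>Pow (U - T). (\<Prod>x\<in>X. p) * (\<Prod>x\<in>(U - T) - X. 1 - p)) = (\<Prod>x\<in>U - T. p + (1 - p))"
    by (rule prod_add[symmetric]) (use U in simp)
  finally show ?thesis by simp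
qed

lemma sum_wt_if:
  assumes "finite U" "T \<subseteq> U"
  shows "(\<Sum>\<omega>\<in>Pow U. wt p U \<omega> * (if T \<subseteq> \<omega> then 1 else 0)) = p ^ card T"
proof -
  have "(\<Sum>\<omega>\<in>Pow U. wt p U \<omega> * (if T \<subseteq> \<omega> then 1 else 0)) = (\<Sum>\<omega> | T \<subseteq> \<omega> \<and> \<omega> \<subseteq> U. wt p U \<omega>)"
    by (rule sum.mono_neutral_cong_right) (use assms in auto)
  then show ?thesis using sum_wt[OF assms] by simp
qed

lemma wt_nonneg: "0 \<le> p \<Longrightarrow> p \<le> 1 \<Longrightarrow> 0 \<le> wt p U \<omega>"
  by (simp add: wt_def)

lemma union_bound:
  assumes U: "finite U" and Q: "finite Q" "\<And>q. q \<in> Q \<Longrightarrow> C q \<subseteq> U" and p: "0 \<le> p" "p \<le> 1"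
    and E: "\<And>\<omega>. \<omega> \<in> E \<Longrightarrow> \<omega> \<subseteq> U \<and> (\<exists>q\<in>Q. C q \<subseteq> \<omega>)"
  shows "(\<Sum>\<omega>\<in>E. wt p U \<omega>) \<le> (\<Sum>q\<in>Q. p ^ card (C q))"
proof -
  have "(\<Sum>\<omega>\<in>E. wt p U \<omega>) \<le> (\<Sum>\<omega>\<in>E. \<Sum>q\<in>Q. wt p U \<omega> * (if C q \<subseteq> \<omega> then 1 else 0))"
  proof (rule sum_mono)
    fix \<omega> assume "\<omega> \<in> E"
    then obtain q where q: "q \<in> Q" "C q \<subseteq> \<omega>" using E by blast
    have "wt p U \<omega> * (if C q \<subseteq> \<omega> then 1 else 0) \<le> (\<Sum>q\<in>Q. wt p U \<omega> * (if C q \<subseteq> \<omega> then 1 else 0))"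
      by (rule member_le_sum[OF q(1) _ Q(1)]) (use wt_nonneg[OF p] in auto)
    then show "wt p U \<omega> \<le> (\<Sum>q\<in>Q. wt p U \<omega> * (if C q \<subseteq> \<omega> then 1 else 0))" using q(2) by simp
  qed
  also have "\<dots> \<le> (\<Sum>\<omega>\<in>Pow U. \<Sum>q\<in>Q. wt p U \<omega> * (if C q \<subseteq> \<omega> then 1 else 0))"
    by (rule sum_mono2) (use U E wt_nonneg[OF p] in \<open>auto intro!: sum_nonneg\<close>)
  also have "\<dots> = (\<Sum>q\<in>Q. \<Sum>\<omega>\<in>Pow U. wt p U \<omega> * (if C q \<subseteq> \<omega> then 1 else 0))" by (rule sum.swap)
  also have "\<dots> = (\<Sum>q\<in>Q. p ^ card (C q))"
    by (rule sum.cong[OF refl]) (rule sum_wt_if[OF U Q(2)])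
  finally show ?thesis .
qed

text \<open>With \<open>X\<close> the number of indices \<open>q\<close> whose set
  \<open>C q\<close> is occupied, this is the Cauchy-Schwarz bound: the squared mean of
  \<open>X\<close> is at most the probability of \<open>E\<close> times the second moment of
  \<open>X\<close>.\<close>

lemma second_moment:
  assumes U: "finite U" and Q: "finite Q" "\<And>q. q \<in> Q \<Longrightarrow> C q \<subseteq> U" and p: "0 \<le> p" "p \<le> 1"
    and E: "\<And>\<omega>. \<omega> \<subseteq> U \<Longrightarrow> (\<exists>q\<in>Q. C q \<subseteq> \<omega>) \<Longrightarrow> \<omega> \<in> E" "E \<subseteq> Pow U"
  shows "(\<Sum>q\<in>Q. p ^ card (C q))\<^sup>2 \<le> (\<Sum>\<omega>\<in>E. wt p U \<omega>) * (\<Sum>q\<in>Q. \<Sum>q'\<in>Q. p ^ card (C q \<union> C q'))"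
proof -
  define i where "i q \<omega> = (if C q \<subseteq> \<omega> then 1 else 0 :: real)" for q \<omega>
  define X where "X \<omega> = (\<Sum>q\<in>Q. i q \<omega>)" for \<omega>
  have w0: "0 \<le> wt p U \<omega>" for \<omega> using wt_nonneg[OF p] .
  have "(\<Sum>q\<in>Q. p ^ card (C q)) = (\<Sum>q\<in>Q. \<Sum>\<omega>\<in>Pow U. wt p U \<omega> * i q \<omega>)"
    unfolding i_def by (rule sum.cong[OF refl]) (rule sum_wt_if[symmetric, OF U Q(2)])
  also have "\<dots> = (\<Sum>\<omega>\<in>Pow U. wt p U \<omega> * X \<omega>)"
    unfolding X_def by (subst sum.swap) (simp add: sum_distrib_left)
  also have "\<dots> = (\<Sum>\<omega>\<in>E. wt p U \<omega> * X \<omega>)"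
  proof (rule sum.mono_neutral_right)
    show "\<forall>\<omega>\<in>Pow U - E. wt p U \<omega> * X \<omega> = 0"
    proof
      fix \<omega> assume "\<omega> \<in> Pow U - E"
      then have "\<not> (\<exists>q\<in>Q. C q \<subseteq> \<omega>)" using E(1) by blast
      then have "X \<omega> = 0" unfolding X_def i_def by (intro sum.neutral) auto
      then show "wt p U \<omega> * X \<omega> = 0" by simp
    qed
  qed (use U E in auto)
  also have "\<dots> = (\<Sum>\<omega>\<in>E. sqrt (wt p U \<omega>) * (sqrt (wt p U \<omega>) * X \<omega>))"
    by (rule sum.cong) (use w0 in \<open>simp_all flip: mult.assoc\<close>)
  finally have "(\<Sum>q\<in>Q. p ^ card (C q))\<^sup>2 \<le>
      (\<Sum>\<omega>\<in>E. (sqrt (wt p U \<omega>))\<^sup>2) * (\<Sum>\<omega>\<in>E. (sqrt (wt p U \<omega>) * X \<omega>)\<^sup>2)"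
    using Cauchy_Schwarz_ineq_sum[of "\<lambda>\<omega>. sqrt (wt p U \<omega>)" "\<lambda>\<omega>. sqrt (wt p U \<omega>) * X \<omega>" E] by simp
  also have "\<dots> = (\<Sum>\<omega>\<in>E. wt p U \<omega>) * (\<Sum>\<omega>\<in>E. wt p U \<omega> * (X \<omega>)\<^sup>2)"
    by (simp add: w0 power_mult_distrib)
  also have "\<dots> \<le> (\<Sum>\<omega>\<in>E. wt p U \<omega>) * (\<Sum>\<omega>\<in>Pow U. wt p U \<omega> * (X \<omega>)\<^sup>2)"
    by (intro mult_left_mono sum_mono2 sum_nonneg) (use U E(2) w0 in auto)
  also have "(\<Sum>\<omega>\<in>Pow U. wt p U \<omega> * (X \<omega>)\<^sup>2) = (\<Sum>\<omega>\<in>Pow U. \<Sum>q\<in>Q. \<Sum>q'\<in>Q. wt p U \<omega> * (if C q \<union> C q' \<subseteq> \<omega> then 1 else 0))"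
    unfolding X_def power2_eq_square sum_product
    unfolding sum_distrib_left by (intro sum.cong refl) (auto simp: i_def)
  also have "\<dots> = (\<Sum>q\<in>Q. \<Sum>q'\<in>Q. \<Sum>\<omega>\<in>Pow U. wt p U \<omega> * (if C q \<union> C q' \<subseteq> \<omega> then 1 else 0))"
    by (subst sum.swap) (intro sum.cong refl sum.swap)
  also have "\<dots> = (\<Sum>q\<in>Q. \<Sum>q'\<in>Q. p ^ card (C q \<union> C q'))"
    by (intro sum.cong refl sum_wt_if[OF U]) (use Q in auto)
  finally show ?thesis .
qed

section \<open>Bounds for the spanning probability\<close>

lemma card_Rect: "card (Rect N M) = N * M"
proof -
  have "Rect N M = {..<N} \<times> {..<M}" by (auto simp: Rect_def)
  then show ?thesis by simp
qed

lemma span_prob_wt: "span_prob Z N M p = (\<Sum>\<omega> | \<omega> \<subseteq> Rect N M \<and> spans Z \<omega>. wt p (Rect N M) \<omega>)"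
  by (simp add: span_prob_def wt_def card_Rect)

lemma sum_pow_card_le:
  fixes a :: real
  assumes "0 \<le> a"
  shows "(\<Sum>X | X \<subseteq> {..<N} \<and> card X \<le> K. a ^ card X) \<le> real (Suc K) * (max 1 (real N * a)) ^ K"
proof -
  let ?S = "{X. X \<subseteq> {..<N} \<and> card X \<le> K}"
  have fS: "finite ?S" by simp
  have "(\<Sum>X\<in>?S. a ^ card X) = (\<Sum>k\<in>card ` ?S. \<Sum>X | X \<in> ?S \<and> card X = k. a ^ card X)"
    by (rule sum.image_gen[OF fS])
  also have "\<dots> \<le> (\<Sum>k\<in>card ` ?S. (max 1 (real N * a)) ^ K)"
  proof (rule sum_mono)
    fix k assume "k \<in> card ` ?S"
    then have k: "k \<le> K" by auto
    have "card {X. X \<in> ?S \<and> card X = k} \<le> card {X. X \<subseteq> {..<N} \<and> card X = k}"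
      by (rule card_mono) auto
    also have "\<dots> = N choose k" using n_subsets[of "{..<N}" k] by simp
    also have "\<dots> \<le> N ^ k" using binomial_fact_pow[of N k] fact_ge_1[of k, where 'a = nat]
      by (metis le_trans mult.right_neutral mult_le_mono2)
    finally have c: "card {X. X \<in> ?S \<and> card X = k} \<le> N ^ k" .
    have "(\<Sum>X | X \<in> ?S \<and> card X = k. a ^ card X) = real (card {X. X \<in> ?S \<and> card X = k}) * a ^ k" by simp
    also have "\<dots> \<le> real (N ^ k) * a ^ k" using c assms by (intro mult_right_mono) auto
    also have "\<dots> = (real N * a) ^ k" by (simp add: power_mult_distrib)
    also have "\<dots> \<le> (max 1 (real N * a)) ^ k" using assms by (intro power_mono) auto
    also have "\<dots> \<le> (max 1 (real N * a)) ^ K" using k by (intro power_increasing) auto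
    finally show "(\<Sum>X | X \<in> ?S \<and> card X = k. a ^ card X) \<le> (max 1 (real N * a)) ^ K" .
  qed
  also have "\<dots> = real (card (card ` ?S)) * (max 1 (real N * a)) ^ K" by simp
  also have "\<dots> \<le> real (Suc K) * (max 1 (real N * a)) ^ K"
  proof (rule mult_right_mono)
    have "card (card ` ?S) \<le> card {..K}" by (rule card_mono) auto
    then show "real (card (card ` ?S)) \<le> real (Suc K)" by simp
  qed simp
  finally show ?thesis .
qed

text \<open>A spanning configuration contains a spanning pattern of bounded size, and a pair
  \<open>X\<close>, \<open>Y\<close> attaining its \<open>rho\<close> isolates a subpattern with at
  least \<open>I + \<alpha> * card X + \<beta> * card Y\<close> points. In the union bound over
  these subpatterns the \<alpha> and \<beta> terms offset the number of choices of \<open>X\<close>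
  and \<open>Y\<close>.\<close>

lemma span_prob_upper:
  fixes \<alpha> \<beta> I :: real
  assumes Z: "down_closed Z" "finite Z" and p: "0 < p" "p < 1" and ab: "0 \<le> \<alpha>" "0 \<le> \<beta>"
    and K: "\<And>A. finite A \<Longrightarrow> spans Z A \<Longrightarrow> \<exists>B\<subseteq>A. spans Z B \<and> card B \<le> K"
    and I: "\<And>A. finite A \<Longrightarrow> spans Z A \<Longrightarrow> I \<le> rho \<alpha> \<beta> A"
  shows "span_prob Z N M p \<le> 2 ^ (K * K) * (real (Suc K))\<^sup>2 * p powr I
      * (max 1 (real N * p powr \<alpha>)) ^ K * (max 1 (real M * p powr \<beta>)) ^ K"
proof -
  define SX where "SX N = {X. X \<subseteq> {..<N} \<and> card X \<le> K}" for N :: nat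
  have fSX: "finite (SX N)" for N by (simp add: SX_def)
  define SB where "SB X Y = {B. B \<subseteq> X \<times> Y \<and> I + \<alpha> * card X + \<beta> * card Y \<le> card B}" for X Y :: "nat set"
  let ?Q = "SIGMA X:SX N. SIGMA Y:SX M. SB X Y"
  have fSXe: "finite X" "card X \<le> K" if "X \<in> SX N" for X N using that finite_subset by (auto simp: SX_def)
  have fSB: "finite (SB X Y)" if "X \<in> SX N" "Y \<in> SX M" for X Y
    unfolding SB_def using fSXe that by simp
  have fQ: "finite ?Q" using fSX fSB by (intro finite_SigmaI) auto
  have "span_prob Z N M p \<le> (\<Sum>q\<in>?Q. p ^ card (snd (snd q)))"
    unfolding span_prob_wt
  proof (rule union_bound[OF finite_Rect fQ])
    fix \<omega> assume "\<omega> \<in> {\<omega>. \<omega> \<subseteq> Rect N M \<and> spans Z \<omega>}"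
    then have w: "\<omega> \<subseteq> Rect N M" "spans Z \<omega>" "finite \<omega>" using finite_subset[OF _ finite_Rect] by auto
    obtain A where A: "A \<subseteq> \<omega>" "spans Z A" "card A \<le> K" using K[OF w(3,2)] by blast
    have fA: "finite A" using A(1) w(3) finite_subset by blast
    obtain X Y where XY: "X \<subseteq> fst ` A" "Y \<subseteq> snd ` A"
      "rho \<alpha> \<beta> A = real (card (A \<inter> X \<times> Y)) - \<alpha> * card X - \<beta> * card Y"
      by (rule rho_attained[OF fA])
    have "card X \<le> card (fst ` A)" "card Y \<le> card (snd ` A)" using XY fA by (auto intro: card_mono)
    then have "card X \<le> K" "card Y \<le> K" using card_image_le[OF fA, of fst] card_image_le[OF fA, of snd] A(3) by linarith+
    moreover have "X \<subseteq> {..<N}" "Y \<subseteq> {..<M}" using XY(1,2) A(1) w(1) by (fastforce simp: Rect_def)+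
    ultimately have "X \<in> SX N" "Y \<in> SX M" by (auto simp: SX_def)
    moreover have "A \<inter> X \<times> Y \<in> SB X Y" using XY(3) I[OF fA A(2)] by (auto simp: SB_def)
    ultimately have "(X, Y, A \<inter> X \<times> Y) \<in> ?Q" by simp
    moreover have "snd (snd (X, Y, A \<inter> X \<times> Y)) \<subseteq> \<omega>" using A(1) by auto
    ultimately show "\<omega> \<subseteq> Rect N M \<and> (\<exists>q\<in>?Q. snd (snd q) \<subseteq> \<omega>)" using w(1) by blast
  next
    fix q assume "q \<in> ?Q"
    then show "snd (snd q) \<subseteq> Rect N M" by (force simp: SX_def SB_def Rect_def)
  qed (use p in auto)
  also have "\<dots> = (\<Sum>X\<in>SX N. \<Sum>Y\<in>SX M. \<Sum>B\<in>SB X Y. p ^ card B)"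
  proof -
    have "(\<Sum>X\<in>SX N. \<Sum>Y\<in>SX M. \<Sum>B\<in>SB X Y. p ^ card B) = (\<Sum>X\<in>SX N. \<Sum>(Y, B)\<in>Sigma (SX M) (SB X). p ^ card B)"
      by (intro sum.cong refl sum.Sigma) (use fSX fSB in auto)
    also have "\<dots> = (\<Sum>(X, (Y, B))\<in>?Q. p ^ card B)"
      by (rule sum.Sigma) (use fSX fSB in auto)
    finally show ?thesis by (simp add: case_prod_unfold)
  qed
  also have "\<dots> \<le> (\<Sum>X\<in>SX N. \<Sum>Y\<in>SX M. 2 ^ (K * K) * p powr I * ((p powr \<alpha>) ^ card X * (p powr \<beta>) ^ card Y))"
  proof (intro sum_mono)
    fix X Y assume XY: "X \<in> SX N" "Y \<in> SX M"
    let ?t = "p powr I * ((p powr \<alpha>) ^ card X * (p powr \<beta>) ^ card Y)"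
    have "p ^ card B \<le> ?t" if "B \<in> SB X Y" for B
    proof -
      have "p ^ card B = p powr card B" using p by (simp add: powr_realpow)
      also have "\<dots> \<le> p powr (I + \<alpha> * card X + \<beta> * card Y)"
        using that p by (intro powr_mono') (auto simp: SB_def)
      also have "\<dots> = ?t" using p by (simp add: powr_add powr_powr[symmetric] powr_realpow)
      finally show ?thesis .
    qed
    then have "(\<Sum>B\<in>SB X Y. p ^ card B) \<le> real (card (SB X Y)) * ?t"
      using sum_bounded_above[of "SB X Y" "\<lambda>B. p ^ card B" ?t] by simp
    also have "\<dots> \<le> 2 ^ (K * K) * ?t"
    proof (rule mult_right_mono)
      have "card (SB X Y) \<le> card (Pow (X \<times> Y))"
        by (rule card_mono) (use fSXe XY in \<open>auto simp: SB_def\<close>)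
      also have "\<dots> = 2 ^ (card X * card Y)" using fSXe XY by (simp add: card_Pow)
      also have "\<dots> \<le> 2 ^ (K * K)" using fSXe XY by (intro power_increasing mult_le_mono) auto
      finally show "real (card (SB X Y)) \<le> 2 ^ (K * K)" by (metis of_nat_le_iff of_nat_numeral of_nat_power)
    qed (use p in simp)
    finally show "(\<Sum>B\<in>SB X Y. p ^ card B) \<le> 2 ^ (K * K) * p powr I * ((p powr \<alpha>) ^ card X * (p powr \<beta>) ^ card Y)"
      by (simp add: mult.assoc)
  qed
  also have "\<dots> = 2 ^ (K * K) * p powr I * ((\<Sum>X\<in>SX N. (p powr \<alpha>) ^ card X) * (\<Sum>Y\<in>SX M. (p powr \<beta>) ^ card Y))"
    unfolding sum_product unfolding sum_distrib_left ..
  also have "\<dots> \<le> 2 ^ (K * K) * p powr I * ((real (Suc K) * (max 1 (real N * p powr \<alpha>)) ^ K) * (real (Suc K) * (max 1 (real M * p powr \<beta>)) ^ K))"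
    unfolding SX_def by (intro mult_left_mono mult_mono sum_pow_card_le sum_nonneg) auto
  finally show ?thesis by (simp add: power2_eq_square mult_ac del: of_nat_Suc)
qed

text \<open>An injection defined on finitely many lines extends to a permutation of all lines, and
  growth is invariant under such permutations.\<close>

lemma spans_inj_image:
  assumes Z: "down_closed Z" "finite Z" and A: "finite A" "spans Z A"
    and inj: "inj_on h (fst ` A)" "inj_on k (snd ` A)"
  shows "spans Z ((\<lambda>(x, y). (h x, k y)) ` A)"
proof -
  have ext: "\<exists>\<sigma>. bij \<sigma> \<and> (\<forall>x\<in>h ` X. \<sigma> x = the_inv_into X h x)" if X: "finite X" "inj_on h X" for X and h :: "nat \<Rightarrow> nat"
  proof -
    have i: "infinite (- h ` X)" "infinite (- X)" using X by (auto simp: finite_compl)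
    have "bij_betw (enumerate (- X)) UNIV (- X)" "bij_betw (enumerate (- h ` X)) UNIV (- h ` X)"
      using i bij_enumerate by blast+
    then obtain e where e: "bij_betw e (- h ` X) (- X)"
      by (metis bij_betw_inv_into bij_betw_trans)
    have "bij_betw (the_inv_into X h) (h ` X) X"
      using X(2) by (simp add: bij_betw_the_inv_into inj_on_imp_bij_betw)
    then have "bij_betw (\<lambda>x. if x \<in> h ` X then the_inv_into X h x else e x) (h ` X \<union> - h ` X) (X \<union> - X)"
      by (rule bij_betw_disjoint_Un) (use e in auto)
    then show ?thesis by (intro exI[of _ "\<lambda>x. if x \<in> h ` X then the_inv_into X h x else e x"]) auto
  qed
  obtain \<sigma> where s: "bij \<sigma>" "\<And>x. x \<in> fst ` A \<Longrightarrow> \<sigma> (h x) = x"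
    using ext[OF _ inj(1)] A(1) the_inv_into_f_f[OF inj(1)] by (metis finite_imageI imageI)
  obtain \<pi> where t: "bij \<pi>" "\<And>x. x \<in> snd ` A \<Longrightarrow> \<pi> (k x) = x"
    using ext[OF _ inj(2)] A(1) the_inv_into_f_f[OF inj(2)] by (metis finite_imageI imageI)
  have sp: "fspans Z (\<lambda>_. 0) (\<lambda>_. 0) {(x, y). (\<sigma> x, \<pi> y) \<in> A}"
    using fspans_permute[OF A(2)[unfolded spans_iff_fspans[OF Z]] s(1) t(1)] by (simp add: comp_def)
  have "{(x, y). (\<sigma> x, \<pi> y) \<in> A} \<subseteq> (\<lambda>(x, y). (h x, k y)) ` A"
  proof clarify
    fix x y assume a: "(\<sigma> x, \<pi> y) \<in> A"
    then have "\<sigma> (h (\<sigma> x)) = \<sigma> x" "\<pi> (k (\<pi> y)) = \<pi> y" using s(2) t(2) by force+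
    then have "h (\<sigma> x) = x" "k (\<pi> y) = y" using s(1) t(1) by (metis bij_def injD)+
    then show "(x, y) \<in> (\<lambda>(x, y). (h x, k y)) ` A" using a by (intro image_eqI[of _ _ "(\<sigma> x, \<pi> y)"]) auto
  qed
  then show ?thesis unfolding spans_iff_fspans[OF Z]
    using fspans_mono[OF sp Z(1)] by blast
qed

text \<open>Copies of the pattern \<open>A\<close> are placed with the \<open>i\<close>-th column of \<open>A\<close> inside the \<open>i\<close>-th block
  of \<open>N'\<close> columns, so that two copies can only share a point that comes from the same point of \<open>A\<close>.\<close>

lemma span_prob_lower:
  assumes Z: "down_closed Z" "finite Z" and p: "0 < p" "p < 1"
    and A: "finite A" "spans Z A"
    and N: "0 < N'" "card (fst ` A) * N' \<le> N" and M: "0 < M'" "card (snd ` A) * M' \<le> M"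
  shows "1 \<le> span_prob Z N M p * (\<Sum>X\<in>Pow (fst ` A). \<Sum>Y\<in>Pow (snd ` A).
      (1 / p) ^ card (A \<inter> X \<times> Y) / (real N' ^ card X * real M' ^ card Y))"
proof -
  let ?X = "fst ` A" and ?Y = "snd ` A"
  let ?a = "card A"
  have fXY: "finite ?X" "finite ?Y" using A by auto
  obtain \<iota> where io: "bij_betw \<iota> ?X {..<card ?X}" using ex_bij_betw_finite_nat[OF fXY(1)] by (auto simp: atLeast0LessThan)
  obtain \<kappa> where ka: "bij_betw \<kappa> ?Y {..<card ?Y}" using ex_bij_betw_finite_nat[OF fXY(2)] by (auto simp: atLeast0LessThan)
  define S where "S = PiE ?X (\<lambda>_. {..<N'})"
  define T where "T = PiE ?Y (\<lambda>_. {..<M'})"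
  define cp where "cp s t = (\<lambda>(x, y). (\<iota> x * N' + s x, \<kappa> y * M' + t y))" for s t :: "nat \<Rightarrow> nat"
  have code: "\<iota> x = \<iota> x' \<and> s = s'" if "\<iota> x * n + s = \<iota> x' * n + s'" "s < n" "s' < n" for \<iota> :: "nat \<Rightarrow> nat" and x x' s s' n
  proof -
    have "\<iota> x = (\<iota> x * n + s) div n" using that(2) by simp
    also have "\<dots> = \<iota> x'" unfolding that(1) using that(3) by simp
    finally show ?thesis using that by simp
  qed
  have cpeq: "(x, y) = (x', y') \<and> s x = s' x \<and> t y = t' y"
    if "cp s t (x, y) = cp s' t' (x', y')" "(x, y) \<in> A" "(x', y') \<in> A" "s \<in> S" "s' \<in> S" "t \<in> T" "t' \<in> T" for s s' t t' x y x' y'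
  proof -
    have m: "x \<in> ?X" "x' \<in> ?X" "y \<in> ?Y" "y' \<in> ?Y" using that(2,3) by force+
    have sb: "s x < N'" "s' x' < N'" "t y < M'" "t' y' < M'"
      using that(4-) m by (auto simp: S_def T_def PiE_iff)
    have "\<iota> x = \<iota> x' \<and> s x = s' x'" by (rule code[of _ _ N']) (use that(1) sb in \<open>auto simp: cp_def\<close>)
    moreover have "\<kappa> y = \<kappa> y' \<and> t y = t' y'" by (rule code[of _ _ M']) (use that(1) sb in \<open>auto simp: cp_def\<close>)
    ultimately show ?thesis using m io ka by (auto simp: bij_betw_def dest: inj_onD)
  qed
  have cpinj: "inj_on (cp s t) A" if "s \<in> S" "t \<in> T" for s t
    by (rule inj_onI) (use cpeq that in \<open>metis prod.collapse\<close>)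
  define Q where "Q = S \<times> T"
  define C where "C = (\<lambda>(s, t). cp s t ` A)"
  have fST: "finite S" "finite T" using fXY by (auto simp: S_def T_def intro!: finite_PiE)
  have cS: "card S = N' ^ card ?X" "card T = M' ^ card ?Y" using fXY by (auto simp: S_def T_def card_PiE)
  have cC: "card (C q) = ?a" if "q \<in> Q" for q
    using that cpinj by (auto simp: C_def Q_def card_image)
  have CR: "C q \<subseteq> Rect N M" if "q \<in> Q" for q
  proof -
    obtain s t where q: "q = (s, t)" "s \<in> S" "t \<in> T" using \<open>q \<in> Q\<close> by (auto simp: Q_def)
    have lt: "i * n + j < B" if "i < c" "j < n" "c * n \<le> B" for i j n c B :: nat
    proof -
      have "i * n + j < Suc i * n" using that by simp
      also have "\<dots> \<le> c * n" using that by (intro mult_le_mono1) simp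
      finally show ?thesis using that by simp
    qed
    have b: "\<iota> x < card ?X" "s x < N'" "\<kappa> y < card ?Y" "t y < M'" if "(x, y) \<in> A" for x y
    proof -
      have "x \<in> ?X" "y \<in> ?Y" using that by force+
      then show "\<iota> x < card ?X" "s x < N'" "\<kappa> y < card ?Y" "t y < M'"
        using bij_betwE[OF io] bij_betwE[OF ka] q by (auto simp: S_def T_def PiE_iff)
    qed
    have "\<iota> x * N' + s x < N" "\<kappa> y * M' + t y < M" if "(x, y) \<in> A" for x y
      using lt[OF b(1,2)[OF that] N(2)] lt[OF b(3,4)[OF that] M(2)] by auto
    then show ?thesis by (auto simp: q C_def cp_def Rect_def)
  qed
  have Csp: "spans Z (C q)" if "q \<in> Q" for q
  proof -
    obtain s t where q: "q = (s, t)" "s \<in> S" "t \<in> T" using \<open>q \<in> Q\<close> by (auto simp: Q_def)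
    have "inj_on (\<lambda>x. \<iota> x * N' + s x) ?X"
    proof (rule inj_onI)
      fix x x' assume x: "x \<in> ?X" "x' \<in> ?X" "\<iota> x * N' + s x = \<iota> x' * N' + s x'"
      then have "\<iota> x = \<iota> x'" using code[of \<iota> x N' "s x" x' "s x'"] q by (auto simp: S_def PiE_iff)
      then show "x = x'" using io x by (auto simp: bij_betw_def dest: inj_onD)
    qed
    moreover have "inj_on (\<lambda>x. \<kappa> x * M' + t x) ?Y"
    proof (rule inj_onI)
      fix x x' assume x: "x \<in> ?Y" "x' \<in> ?Y" "\<kappa> x * M' + t x = \<kappa> x' * M' + t x'"
      then have "\<kappa> x = \<kappa> x'" using code[of \<kappa> x M' "t x" x' "t x'"] q by (auto simp: T_def PiE_iff)
      then show "x = x'" using ka x by (auto simp: bij_betw_def dest: inj_onD)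
    qed
    ultimately show ?thesis using spans_inj_image[OF Z A] by (simp add: q C_def cp_def)
  qed
  let ?P = "span_prob Z N M p"
  have "(\<Sum>q\<in>Q. p ^ card (C q))\<^sup>2 \<le> ?P * (\<Sum>q\<in>Q. \<Sum>q'\<in>Q. p ^ card (C q \<union> C q'))"
    unfolding span_prob_wt
  proof (rule second_moment[OF finite_Rect])
    show "finite Q" using fST by (simp add: Q_def)
    show "\<omega> \<in> {\<omega>. \<omega> \<subseteq> Rect N M \<and> spans Z \<omega>}" if "\<omega> \<subseteq> Rect N M" "\<exists>q\<in>Q. C q \<subseteq> \<omega>" for \<omega>
      using that Csp spans_Un[OF _ Z(1)] by blast
  qed (use p CR in auto)
  moreover have "(\<Sum>q\<in>Q. p ^ card (C q)) = real (N' ^ card ?X) * real (M' ^ card ?Y) * p ^ ?a"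
    using cC cS by (simp add: Q_def card_cartesian_product)
  ultimately have 1: "(real (N' ^ card ?X) * real (M' ^ card ?Y) * p ^ ?a)\<^sup>2 \<le> ?P * (\<Sum>q\<in>Q. \<Sum>q'\<in>Q. p ^ card (C q \<union> C q'))"
    by simp
  define R where "R = (\<Sum>X\<in>Pow ?X. \<Sum>Y\<in>Pow ?Y. (1 / p) ^ card (A \<inter> X \<times> Y) / (real N' ^ card X * real M' ^ card Y))"
  \<comment> \<open>Two copies share at most the points of \<open>A\<close> on columns where
    \<open>s\<close>, \<open>s'\<close> agree and rows where \<open>t\<close>, \<open>t'\<close>
    agree. Summing over all \<open>X\<close>, \<open>Y\<close> on which they agree, instead of the
    exact agreement sets, only enlarges the sum and lets it factorize.\<close>
  have 2: "(\<Sum>q'\<in>Q. p ^ card (C q \<union> C q')) \<le> p ^ (2 * ?a) * (real (N' ^ card ?X) * real (M' ^ card ?Y)) * R" if qQ: "q \<in> Q" for q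
  proof -
    obtain s t where q: "q = (s, t)" "s \<in> S" "t \<in> T" using qQ by (auto simp: Q_def)
    define h where "h X Y = p ^ (2 * ?a) * (1 / p) ^ card (A \<inter> X \<times> Y)" for X Y
    have h0: "0 \<le> h X Y" for X Y using p by (simp add: h_def)
    define J where "J s' X = (if \<forall>x\<in>X. s' x = s x then 1 else 0 :: real)" for s' X
    define J' where "J' t' X = (if \<forall>x\<in>X. t' x = t x then 1 else 0 :: real)" for t' X
    have termwise: "p ^ card (C q \<union> C (s', t')) \<le> (\<Sum>X\<in>Pow ?X. \<Sum>Y\<in>Pow ?Y. J s' X * J' t' Y * h X Y)"
      if st: "s' \<in> S" "t' \<in> T" for s' t'
    proof -
      let ?Xs = "{x \<in> ?X. s' x = s x}" and ?Ys = "{y \<in> ?Y. t' y = t y}"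
      have "C q \<inter> C (s', t') \<subseteq> cp s t ` (A \<inter> ?Xs \<times> ?Ys)"
      proof
        fix z assume "z \<in> C q \<inter> C (s', t')"
        then obtain x y x' y' where z: "(x, y) \<in> A" "z = cp s t (x, y)" "(x', y') \<in> A" "z = cp s' t' (x', y')"
          by (auto simp: C_def q)
        then have "s x = s' x \<and> t y = t' y" using cpeq[of s t x y s' t' x' y'] q st by auto
        then have "(x, y) \<in> A \<inter> ?Xs \<times> ?Ys" using z(1) by force
        then show "z \<in> cp s t ` (A \<inter> ?Xs \<times> ?Ys)" using z(2) by blast
      qed
      then have "card (C q \<inter> C (s', t')) \<le> card (A \<inter> ?Xs \<times> ?Ys)"
        using A(1) by (meson card_image_le card_mono finite_Int finite_imageI order_trans)
      moreover have "card (C q) + card (C (s', t')) = card (C q \<union> C (s', t')) + card (C q \<inter> C (s', t'))"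
        by (rule card_Un_Int) (use A in \<open>auto simp: C_def q\<close>)
      moreover have "card (C q) = ?a" "card (C (s', t')) = ?a" using cC qQ st by (auto simp: Q_def)
      ultimately have k: "2 * ?a \<le> card (C q \<union> C (s', t')) + card (A \<inter> ?Xs \<times> ?Ys)" by linarith
      have "p ^ card (C q \<union> C (s', t')) * p ^ card (A \<inter> ?Xs \<times> ?Ys) \<le> p ^ (2 * ?a)"
        unfolding power_add[symmetric] by (rule power_decreasing[OF k]) (use p in auto)
      then have "p ^ card (C q \<union> C (s', t')) \<le> h ?Xs ?Ys"
        using p by (simp add: h_def power_one_over field_simps)
      also have "\<dots> = J s' ?Xs * J' t' ?Ys * h ?Xs ?Ys" by (simp add: J_def J'_def)
      also have "\<dots> \<le> (\<Sum>Y\<in>Pow ?Y. J s' ?Xs * J' t' Y * h ?Xs Y)"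
        by (rule member_le_sum[of ?Ys "Pow ?Y" "\<lambda>Y. J s' ?Xs * J' t' Y * h ?Xs Y"]) (use fXY h0 in \<open>auto simp: J_def J'_def\<close>)
      also have "\<dots> \<le> (\<Sum>X\<in>Pow ?X. \<Sum>Y\<in>Pow ?Y. J s' X * J' t' Y * h X Y)"
        by (rule member_le_sum[of ?Xs "Pow ?X" "\<lambda>X. \<Sum>Y\<in>Pow ?Y. J s' X * J' t' Y * h X Y"]) (use fXY h0 in \<open>auto simp: J_def J'_def intro!: sum_nonneg\<close>)
      finally show ?thesis .
    qed
    \<comment> \<open>Prescribing the values on \<open>X\<close> leaves the fraction
      \<open>1 / n ^ card X\<close> of all functions.\<close>
    have cnt: "(\<Sum>s'\<in>PiE W (\<lambda>_. {..<n}). if \<forall>x\<in>X. s' x = s x then 1 else 0) = real n ^ card W / real n ^ card X"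
      if "finite W" "X \<subseteq> W" "s \<in> PiE W (\<lambda>_. {..<n})" "0 < n" for W X and s :: "nat \<Rightarrow> nat" and n :: nat
    proof -
      have fX: "finite X" using that finite_subset by blast
      have "(\<Sum>s'\<in>PiE W (\<lambda>_. {..<n}). if \<forall>x\<in>X. s' x = s x then 1 else 0) = real (card {s' \<in> PiE W (\<lambda>_. {..<n}). \<forall>x\<in>X. s' x = s x})"
        using that by (subst sum.If_cases) (auto intro!: finite_PiE arg_cong[where f = card])
      also have "{s' \<in> PiE W (\<lambda>_. {..<n}). \<forall>x\<in>X. s' x = s x} = PiE W (\<lambda>x. if x \<in> X then {s x} else {..<n})"
      proof (intro set_eqI iffI)
        fix s' assume s': "s' \<in> PiE W (\<lambda>x. if x \<in> X then {s x} else {..<n})"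
        have "s' x < n" if "x \<in> W" for x
          using PiE_mem[OF s' that] PiE_mem[OF \<open>s \<in> PiE W (\<lambda>_. {..<n})\<close> that] by (auto split: if_splits)
        moreover have "s' x = s x" if "x \<in> X" for x
          using PiE_mem[OF s', of x] that \<open>X \<subseteq> W\<close> by auto
        ultimately show "s' \<in> {s' \<in> PiE W (\<lambda>_. {..<n}). \<forall>x\<in>X. s' x = s x}" using s' by (auto simp: PiE_iff)
      qed (auto simp: PiE_iff)
      also have "card \<dots> = (\<Prod>x\<in>W. card (if x \<in> X then {s x} else {..<n}))" by (rule card_PiE[OF that(1)])
      also have "\<dots> = (\<Prod>x\<in>W - X. n)"
        by (rule prod.mono_neutral_cong_right[symmetric, THEN sym]) (use that in auto)
      also have "\<dots> = n ^ (card W - card X)" using that fX by (simp add: card_Diff_subset)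
      also have "real \<dots> = real n ^ card W / real n ^ card X"
        using that card_mono[of W X] power_diff[of "real n" "card X" "card W"] by simp
      finally show ?thesis .
    qed
    have JS: "(\<Sum>s'\<in>S. J s' X) = real N' ^ card ?X / real N' ^ card X" if "X \<in> Pow ?X" for X
      unfolding J_def S_def by (rule cnt) (use fXY that q N in \<open>auto simp: S_def\<close>)
    have JT: "(\<Sum>t'\<in>T. J' t' X) = real M' ^ card ?Y / real M' ^ card X" if "X \<in> Pow ?Y" for X
      unfolding J'_def T_def by (rule cnt) (use fXY that q M in \<open>auto simp: T_def\<close>)
    have "(\<Sum>q'\<in>Q. p ^ card (C q \<union> C q')) = (\<Sum>s'\<in>S. \<Sum>t'\<in>T. p ^ card (C q \<union> C (s', t')))"
      unfolding Q_def by (simp add: sum.cartesian_product)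
    also have "\<dots> \<le> (\<Sum>s'\<in>S. \<Sum>t'\<in>T. \<Sum>X\<in>Pow ?X. \<Sum>Y\<in>Pow ?Y. J s' X * J' t' Y * h X Y)"
      by (intro sum_mono termwise)
    also have "\<dots> = (\<Sum>X\<in>Pow ?X. \<Sum>Y\<in>Pow ?Y. \<Sum>s'\<in>S. \<Sum>t'\<in>T. J s' X * J' t' Y * h X Y)"
    proof -
      have "(\<Sum>s'\<in>S. \<Sum>t'\<in>T. \<Sum>X\<in>Pow ?X. \<Sum>Y\<in>Pow ?Y. J s' X * J' t' Y * h X Y) = (\<Sum>s'\<in>S. \<Sum>X\<in>Pow ?X. \<Sum>t'\<in>T. \<Sum>Y\<in>Pow ?Y. J s' X * J' t' Y * h X Y)"
        by (intro sum.cong refl sum.swap)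
      also have "\<dots> = (\<Sum>X\<in>Pow ?X. \<Sum>s'\<in>S. \<Sum>t'\<in>T. \<Sum>Y\<in>Pow ?Y. J s' X * J' t' Y * h X Y)" by (rule sum.swap)
      also have "\<dots> = (\<Sum>X\<in>Pow ?X. \<Sum>s'\<in>S. \<Sum>Y\<in>Pow ?Y. \<Sum>t'\<in>T. J s' X * J' t' Y * h X Y)" by (intro sum.cong refl sum.swap)
      also have "\<dots> = (\<Sum>X\<in>Pow ?X. \<Sum>Y\<in>Pow ?Y. \<Sum>s'\<in>S. \<Sum>t'\<in>T. J s' X * J' t' Y * h X Y)" by (intro sum.cong refl sum.swap)
      finally show ?thesis .
    qed
    also have "\<dots> = (\<Sum>X\<in>Pow ?X. \<Sum>Y\<in>Pow ?Y. (\<Sum>s'\<in>S. J s' X) * (\<Sum>t'\<in>T. J' t' Y) * h X Y)"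
      unfolding sum_product unfolding sum_distrib_right ..
    also have "\<dots> = (\<Sum>X\<in>Pow ?X. \<Sum>Y\<in>Pow ?Y. p ^ (2 * ?a) * (real (N' ^ card ?X) * real (M' ^ card ?Y)) *
        ((1 / p) ^ card (A \<inter> X \<times> Y) / (real N' ^ card X * real M' ^ card Y)))"
      by (intro sum.cong refl) (simp add: JS JT h_def)
    also have "\<dots> = p ^ (2 * ?a) * (real (N' ^ card ?X) * real (M' ^ card ?Y)) * R"
      unfolding R_def by (simp add: sum_distrib_left)
    finally show ?thesis .
  qed
  define D where "D = real (N' ^ card ?X) * real (M' ^ card ?Y)"
  have D: "D > 0" using N M by (simp add: D_def)
  have P0: "0 \<le> ?P" unfolding span_prob_wt by (intro sum_nonneg wt_nonneg) (use p in auto)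
  have "(D * p ^ ?a)\<^sup>2 \<le> ?P * (\<Sum>q\<in>Q. p ^ (2 * ?a) * D * R)"
    unfolding D_def by (rule order_trans[OF 1 mult_left_mono[OF sum_mono[OF 2] P0]])
  also have "(\<Sum>q\<in>Q. p ^ (2 * ?a) * D * R) = D * (p ^ (2 * ?a) * D * R)"
    using cS by (simp add: Q_def D_def card_cartesian_product)
  finally have "(D * p ^ ?a)\<^sup>2 * 1 \<le> (D * p ^ ?a)\<^sup>2 * (?P * R)"
    by (simp add: power2_eq_square power_mult mult_ac power_mult_distrib)
  then have "1 \<le> ?P * R" using D p by (simp add: mult_le_cancel_left_pos)
  then show ?thesis unfolding R_def .
qed

section \<open>The exponent of a finite zero-set\<close>

definition Irate :: "real \<Rightarrow> real \<Rightarrow> (nat \<times> nat) set \<Rightarrow> real" where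
  "Irate \<alpha> \<beta> Z = Inf (rho \<alpha> \<beta> ` {A. finite A \<and> spans Z A})"

lemma ex_finite_spanning:
  assumes "down_closed Z" "finite Z" shows "\<exists>A. finite A \<and> spans Z A"
proof -
  obtain m where m: "Z \<subseteq> Rect m m" using finite_subset_Rect assms by blast
  have "spans Z (Rect m m)"
    unfolding spans_iff_fspans[OF assms] fspans_def
  proof (intro allI impI)
    fix S assume S: "Rect m m \<subseteq> S" "stable Z (\<lambda>_. 0) (\<lambda>_. 0) S"
    show "S = UNIV"
      by (rule stable_block_UNIV[OF m S(2), of "{..<m}" "{..<m}"]) (use S(1) in \<open>auto simp: Rect_def\<close>)
  qed
  then show ?thesis using finite_Rect by blast
qed

lemma Irate_le: "finite A \<Longrightarrow> spans Z A \<Longrightarrow> Irate \<alpha> \<beta> Z \<le> rho \<alpha> \<beta> A"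
  unfolding Irate_def by (rule cInf_lower) (auto intro!: bdd_belowI[of _ 0] rho_nonneg)

lemma Irate_greatest:
  assumes "down_closed Z" "finite Z" "\<And>A. finite A \<Longrightarrow> spans Z A \<Longrightarrow> c \<le> rho \<alpha> \<beta> A"
  shows "c \<le> Irate \<alpha> \<beta> Z"
  unfolding Irate_def by (rule cInf_greatest) (use ex_finite_spanning[OF assms(1,2)] assms(3) in auto)

lemma Irate_nonneg: "down_closed Z \<Longrightarrow> finite Z \<Longrightarrow> 0 \<le> Irate \<alpha> \<beta> Z"
  by (rule Irate_greatest) (auto intro: rho_nonneg)

lemma Irate_mono:
  assumes "down_closed Z" "down_closed Z'" "finite Z'" "Z \<subseteq> Z'" shows "Irate \<alpha> \<beta> Z \<le> Irate \<alpha> \<beta> Z'"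
  by (rule Irate_greatest[OF assms(2,3)]) (use assms in \<open>blast intro: Irate_le spans_antimono\<close>)

lemma Irate_antimono:
  assumes "down_closed Z" "finite Z" "\<alpha> \<le> \<alpha>'" "\<beta> \<le> \<beta>'" shows "Irate \<alpha>' \<beta>' Z \<le> Irate \<alpha> \<beta> Z"
  by (rule Irate_greatest[OF assms(1,2)]) (use assms in \<open>blast intro: Irate_le rho_antimono order_trans\<close>)

subsection \<open>The limit of the rate\<close>

lemma filterlim_ln_inverse_at_right_0: "filterlim (\<lambda>p::real. ln (1 / p)) at_top (at_right 0)"
proof -
  have "filterlim (\<lambda>p::real. ln (inverse p)) at_top (at_right 0)"
    by (rule filterlim_compose[OF ln_at_top filterlim_inverse_at_top_right])
  then show ?thesis by (simp add: inverse_eq_divide)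
qed

lemma eventually_at_right_0_unit: "eventually (\<lambda>p::real. 0 < p \<and> p < 1) (at_right 0)"
  using eventually_at_right_real[of 0 1] by (auto elim: eventually_mono)

lemma ln_max_one_div:
  fixes L y :: real
  assumes "0 < y" "0 < L" shows "ln (max 1 y) / L = max 0 (ln y / L)"
proof (cases "y \<le> 1")
  case True
  then have "ln y / L \<le> 0" using assms by (simp add: divide_nonpos_pos)
  then show ?thesis using True by (simp add: max_def)
next
  case False
  then have "ln y / L > 0" using assms by simp
  then show ?thesis using False by (simp add: max_def)
qed

text \<open>Admissibility fixes the side lengths only up to factors that are subpolynomial in
  \<open>1 / p\<close>. Both the excess over \<open>p powr (- \<alpha>)\<close> and the deficit from
  it vanish on the logarithmic scale; the first enters the lower bound on the rate, the second the
  upper bound.\<close>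

lemma tendsto_ln_count_excess:
  fixes N :: "real \<Rightarrow> nat"
  assumes N: "filterlim N at_top (at_right 0)"
    and l: "((\<lambda>p. ln (real (N p)) / ln (1 / p)) \<longlongrightarrow> \<alpha>) (at_right 0)"
  shows "((\<lambda>p. ln (max 1 (real (N p) * p powr \<alpha>)) / ln (1 / p)) \<longlongrightarrow> 0) (at_right 0)"
    and "((\<lambda>p. ln (max 1 ((1 / p) powr \<alpha> / real (N p))) / ln (1 / p)) \<longlongrightarrow> 0) (at_right 0)"
proof -
  have N1: "eventually (\<lambda>p. 1 \<le> N p) (at_right 0)" using N by (simp add: filterlim_at_top)
  have "((\<lambda>p. max 0 (ln (real (N p)) / ln (1 / p) - \<alpha>)) \<longlongrightarrow> max 0 (\<alpha> - \<alpha>)) (at_right 0)"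
    by (intro tendsto_intros l)
  then have "((\<lambda>p. max 0 (ln (real (N p)) / ln (1 / p) - \<alpha>)) \<longlongrightarrow> 0) (at_right 0)" by simp
  then show "((\<lambda>p. ln (max 1 (real (N p) * p powr \<alpha>)) / ln (1 / p)) \<longlongrightarrow> 0) (at_right 0)"
  proof (rule Lim_transform_eventually)
    show "\<forall>\<^sub>F p in at_right 0. max 0 (ln (real (N p)) / ln (1 / p) - \<alpha>) = ln (max 1 (real (N p) * p powr \<alpha>)) / ln (1 / p)"
      using N1 eventually_at_right_0_unit
    proof eventually_elim
      case (elim p)
      then have "ln (max 1 (real (N p) * p powr \<alpha>)) / ln (1 / p) = max 0 (ln (real (N p) * p powr \<alpha>) / ln (1 / p))"
        by (intro ln_max_one_div) auto
      also have "ln (real (N p) * p powr \<alpha>) / ln (1 / p) = ln (real (N p)) / ln (1 / p) - \<alpha>"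
        using elim by (simp add: ln_mult ln_powr ln_div field_simps)
      finally show ?case by simp
    qed
  qed
  have "((\<lambda>p. max 0 (\<alpha> - ln (real (N p)) / ln (1 / p))) \<longlongrightarrow> max 0 (\<alpha> - \<alpha>)) (at_right 0)"
    by (intro tendsto_intros l)
  then have "((\<lambda>p. max 0 (\<alpha> - ln (real (N p)) / ln (1 / p))) \<longlongrightarrow> 0) (at_right 0)" by simp
  then show "((\<lambda>p. ln (max 1 ((1 / p) powr \<alpha> / real (N p))) / ln (1 / p)) \<longlongrightarrow> 0) (at_right 0)"
  proof (rule Lim_transform_eventually)
    show "\<forall>\<^sub>F p in at_right 0. max 0 (\<alpha> - ln (real (N p)) / ln (1 / p)) = ln (max 1 ((1 / p) powr \<alpha> / real (N p))) / ln (1 / p)"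
      using N1 eventually_at_right_0_unit
    proof eventually_elim
      case (elim p)
      then have "ln (max 1 ((1 / p) powr \<alpha> / real (N p))) / ln (1 / p) = max 0 (ln ((1 / p) powr \<alpha> / real (N p)) / ln (1 / p))"
        by (intro ln_max_one_div) auto
      also have "ln ((1 / p) powr \<alpha> / real (N p)) / ln (1 / p) = \<alpha> - ln (real (N p)) / ln (1 / p)"
        using elim by (simp add: ln_powr ln_div field_simps)
      finally show ?case by simp
    qed
  qed
qed

lemma tendsto_error_term:
  assumes "((\<lambda>p. u p / ln (1 / p)) \<longlongrightarrow> 0) (at_right 0)" "((\<lambda>p. v p / ln (1 / p)) \<longlongrightarrow> 0) (at_right 0)"
  shows "((\<lambda>p. (c + a * u p + b * v p) / ln (1 / p)) \<longlongrightarrow> (0::real)) (at_right (0::real))"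
proof -
  have "((\<lambda>p. c / ln (1 / p) + a * (u p / ln (1 / p)) + b * (v p / ln (1 / p))) \<longlongrightarrow> 0 + a * 0 + b * 0) (at_right 0)"
    by (intro tendsto_intros assms tendsto_divide_0[OF tendsto_const]
      filterlim_at_top_imp_at_infinity filterlim_ln_inverse_at_right_0)
  then show ?thesis by (simp add: add_divide_distrib)
qed

lemma rate_eventually_ge:
  assumes Z: "down_closed Z" "finite Z" and ab: "0 \<le> \<alpha>" "0 \<le> \<beta>" and adm: "admissible \<alpha> \<beta> N M"
    and I: "\<And>A. finite A \<Longrightarrow> spans Z A \<Longrightarrow> I \<le> rho \<alpha> \<beta> A" and e: "0 < e"
  shows "eventually (\<lambda>p. ereal (I - e) \<le> rate Z (N p) (M p) p) (at_right 0)"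
proof -
  obtain K where K: "\<And>A. finite A \<Longrightarrow> spans Z A \<Longrightarrow> \<exists>B\<subseteq>A. spans Z B \<and> card B \<le> K"
    using bounded_spanning_subset[OF Z] by blast
  define c where "c = (2::real) ^ (K * K) * (real (Suc K))\<^sup>2"
  have c: "c > 0" by (simp add: c_def)
  define u where "u p = max 1 (real (N p) * p powr \<alpha>)" for p
  define v where "v p = max 1 (real (M p) * p powr \<beta>)" for p
  have "((\<lambda>p. (ln c + real K * ln (u p) + real K * ln (v p)) / ln (1 / p)) \<longlongrightarrow> 0) (at_right 0)"
    using adm unfolding u_def v_def admissible_def
    by (intro tendsto_error_term tendsto_ln_count_excess) auto
  then have "eventually (\<lambda>p. (ln c + real K * ln (u p) + real K * ln (v p)) / ln (1 / p) < e) (at_right 0)"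
    using e order_tendstoD(2) by blast
  then show ?thesis using eventually_at_right_0_unit
  proof eventually_elim
    case (elim p)
    show ?case
    proof (cases "span_prob Z (N p) (M p) p = 0")
      case False
      let ?P = "span_prob Z (N p) (M p) p"
      have "0 \<le> ?P" unfolding span_prob_wt by (intro sum_nonneg wt_nonneg) (use elim in auto)
      then have P: "0 < ?P" using False by simp
      have uv: "u p \<ge> 1" "v p \<ge> 1" by (auto simp: u_def v_def)
      have "?P \<le> c * p powr I * u p ^ K * v p ^ K"
        unfolding c_def u_def v_def using elim by (intro span_prob_upper Z ab K I) auto
      then have "ln ?P \<le> ln (c * p powr I * u p ^ K * v p ^ K)"
        by (intro ln_mono) (use P in auto)
      also have "\<dots> = ln c + I * ln p + K * ln (u p) + K * ln (v p)"
        using c elim uv by (simp add: ln_mult ln_powr ln_realpow)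
      finally have "ln ?P \<le> I * ln p + (ln c + K * ln (u p) + K * ln (v p))" by simp
      also have "\<dots> \<le> I * ln p + e * ln (1 / p)"
        using elim by (simp add: pos_divide_less_eq)
      also have "\<dots> = (I - e) * ln p" using elim by (simp add: ln_div algebra_simps)
      finally have "I - e \<le> ln ?P / ln p" using elim by (simp add: neg_le_divide_eq)
      then show ?thesis using False by (simp add: rate_def)
    qed (simp add: rate_def)
  qed
qed

text \<open>By definition of \<open>rho\<close>, every term of the sum in
  \<open>span_prob_lower\<close> is at most \<open>(1 / p) powr rho \<alpha> \<beta> A\<close> up to
  factors that are negligible on the logarithmic scale.\<close>

lemma rate_eventually_le:
  assumes Z: "down_closed Z" "finite Z" and ab: "0 \<le> \<alpha>" "0 \<le> \<beta>" and adm: "admissible \<alpha> \<beta> N M"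
    and A: "finite A" "spans Z A" and e: "0 < e"
  shows "eventually (\<lambda>p. rate Z (N p) (M p) p \<le> ereal (rho \<alpha> \<beta> A + e)) (at_right 0)"
proof -
  define n where "n = card (fst ` A)"
  define m where "m = card (snd ` A)"
  \<comment> \<open>Cutting a side into a fixed number of blocks does not change its exponent;
    \<open>Suc\<close> avoids division by 0 when \<open>A\<close> is empty.\<close>
  have blocks: "filterlim (\<lambda>p. N p div Suc n) at_top (at_right 0) \<and>
      ((\<lambda>p. ln (real (N p div Suc n)) / ln (1 / p)) \<longlongrightarrow> \<alpha>) (at_right 0)"
    if N: "filterlim N at_top (at_right 0)" and l: "((\<lambda>p. ln (real (N p)) / ln (1 / p)) \<longlongrightarrow> \<alpha>) (at_right 0)"
    for N :: "real \<Rightarrow> nat" and n \<alpha>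
  proof
    show "filterlim (\<lambda>p. N p div Suc n) at_top (at_right 0)"
      unfolding filterlim_at_top
    proof
      fix k
      have "eventually (\<lambda>p. k * Suc n \<le> N p) (at_right 0)" using N unfolding filterlim_at_top by blast
      then show "eventually (\<lambda>p. k \<le> N p div Suc n) (at_right 0)"
        by eventually_elim (metis div_le_mono nonzero_mult_div_cancel_right Suc_not_Zero)
    qed
    have c0: "((\<lambda>p. ln (2 * real (Suc n)) / ln (1 / p)) \<longlongrightarrow> 0) (at_right (0::real))"
      by (intro tendsto_divide_0[OF tendsto_const] filterlim_at_top_imp_at_infinity filterlim_ln_inverse_at_right_0)
    have lo: "((\<lambda>p. ln (real (N p)) / ln (1 / p) - ln (2 * real (Suc n)) / ln (1 / p)) \<longlongrightarrow> \<alpha>) (at_right 0)"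
      using tendsto_diff[OF l c0] by simp
    have big: "eventually (\<lambda>p. Suc n \<le> N p) (at_right 0)" using N unfolding filterlim_at_top by blast
    show "((\<lambda>p. ln (real (N p div Suc n)) / ln (1 / p)) \<longlongrightarrow> \<alpha>) (at_right 0)"
    proof (rule tendsto_sandwich[OF _ _ lo l])
      show "\<forall>\<^sub>F p in at_right 0. ln (real (N p)) / ln (1 / p) - ln (2 * real (Suc n)) / ln (1 / p) \<le> ln (real (N p div Suc n)) / ln (1 / p)"
        using big eventually_at_right_0_unit
      proof eventually_elim
        case (elim p)
        define k where "k = N p div Suc n"
        have k: "1 \<le> k" using elim div_le_mono[of "Suc n" "N p" "Suc n"] by (simp add: k_def)
        have "N p = k * Suc n + N p mod Suc n" unfolding k_def by (rule div_mult_mod_eq[symmetric])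
        also have "\<dots> \<le> k * Suc n + k * Suc n" using k mod_less_divisor[of "Suc n" "N p"]
          by (intro add_left_mono) (metis le_trans less_imp_le mult.commute mult_le_mono2 nat_mult_1_right zero_less_Suc)
        finally have "N p \<le> 2 * Suc n * k" by (simp add: algebra_simps)
        then have "real (N p) \<le> real (2 * Suc n * k)" by (simp only: of_nat_le_iff)
        then have "real (N p) / (2 * real (Suc n)) \<le> real k" by (simp add: field_simps)
        then have "ln (real (N p) / (2 * real (Suc n))) \<le> ln (real k)"
          using elim k by (intro ln_mono) auto
        moreover have "ln (real (N p) / (2 * real (Suc n))) = ln (real (N p)) - ln (2 * real (Suc n))"
          using elim by (simp add: ln_div del: of_nat_Suc)
        ultimately have "(ln (real (N p)) - ln (2 * real (Suc n))) / ln (1 / p) \<le> ln (real k) / ln (1 / p)"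
          using elim by (intro divide_right_mono) (auto simp: ln_div)
        then show ?case by (simp add: diff_divide_distrib k_def)
      qed
      show "\<forall>\<^sub>F p in at_right 0. ln (real (N p div Suc n)) / ln (1 / p) \<le> ln (real (N p)) / ln (1 / p)"
        using big eventually_at_right_0_unit
      proof eventually_elim
        case (elim p)
        have "1 \<le> N p div Suc n" using elim div_le_mono[of "Suc n" "N p" "Suc n"] by simp
        then have "ln (real (N p div Suc n)) \<le> ln (real (N p))"
          by (intro ln_mono) (auto simp: div_le_dividend intro: order_trans[of 1 "N p div Suc n"])
        then show ?case using elim by (intro divide_right_mono) (auto simp: ln_div)
      qed
    qed
  qed
  define N' where "N' p = N p div Suc n" for p
  define M' where "M' p = M p div Suc m" for p
  have N': "filterlim N' at_top (at_right 0)" "((\<lambda>p. ln (real (N' p)) / ln (1 / p)) \<longlongrightarrow> \<alpha>) (at_right 0)"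
    and M': "filterlim M' at_top (at_right 0)" "((\<lambda>p. ln (real (M' p)) / ln (1 / p)) \<longlongrightarrow> \<beta>) (at_right 0)"
    using blocks[of N \<alpha> n] blocks[of M \<beta> m] adm unfolding N'_def[abs_def] M'_def[abs_def] admissible_def by auto
  have ev: "eventually (\<lambda>p. 1 \<le> N' p) (at_right 0)" "eventually (\<lambda>p. 1 \<le> M' p) (at_right 0)"
    using N'(1) M'(1) unfolding filterlim_at_top by blast+
  define c where "c = (2::real) ^ n * 2 ^ m"
  have c: "c > 0" by (simp add: c_def)
  define u where "u p = max 1 ((1 / p) powr \<alpha> / real (N' p))" for p
  define v where "v p = max 1 ((1 / p) powr \<beta> / real (M' p))" for p
  have "((\<lambda>p. (ln c + real n * ln (u p) + real m * ln (v p)) / ln (1 / p)) \<longlongrightarrow> 0) (at_right 0)"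
    unfolding u_def v_def
    by (intro tendsto_error_term tendsto_ln_count_excess N' M')
  then have "eventually (\<lambda>p. (ln c + real n * ln (u p) + real m * ln (v p)) / ln (1 / p) < e) (at_right 0)"
    using e order_tendstoD(2) by blast
  then show ?thesis using eventually_at_right_0_unit ev
  proof eventually_elim
    case (elim p)
    let ?P = "span_prob Z (N p) (M p) p"
    have uv: "u p \<ge> 1" "v p \<ge> 1" by (auto simp: u_def v_def)
    let ?T = "\<lambda>X Y. (1 / p) ^ card (A \<inter> X \<times> Y) / (real (N' p) ^ card X * real (M' p) ^ card Y)"
    let ?b = "(1 / p) powr rho \<alpha> \<beta> A * u p ^ n * v p ^ m"
    have "n * N' p \<le> N p" "m * M' p \<le> M p"
      unfolding N'_def M'_def
      by (metis div_times_less_eq_dividend le_trans mult.commute mult_le_mono1 le_SucI order_refl)+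
    then have "1 \<le> ?P * (\<Sum>X\<in>Pow (fst ` A). \<Sum>Y\<in>Pow (snd ` A). ?T X Y)"
      using elim by (intro span_prob_lower Z A) (auto simp: n_def m_def)
    also have "\<dots> \<le> ?P * (\<Sum>X\<in>Pow (fst ` A). \<Sum>Y\<in>Pow (snd ` A). ?b)"
    proof (intro mult_left_mono sum_mono)
      fix X Y assume XY: "X \<in> Pow (fst ` A)" "Y \<in> Pow (snd ` A)"
      have cXY: "card X \<le> n" "card Y \<le> m" unfolding n_def m_def using XY A by (auto intro: card_mono)
      have "real (card (A \<inter> X \<times> Y)) \<le> rho \<alpha> \<beta> A + \<alpha> * card X + \<beta> * card Y"
        using rho_ge[OF A(1), of X Y \<alpha> \<beta>] XY by simp
      then have "(1 / p) powr card (A \<inter> X \<times> Y) \<le> (1 / p) powr (rho \<alpha> \<beta> A + \<alpha> * card X + \<beta> * card Y)"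
        using elim by (intro powr_mono) auto
      also have "\<dots> = (1 / p) powr rho \<alpha> \<beta> A * ((1 / p) powr \<alpha>) ^ card X * ((1 / p) powr \<beta>) ^ card Y"
        using elim by (simp add: powr_add powr_powr[symmetric] powr_realpow del: powr_one_eq_one)
      finally have "(1 / p) ^ card (A \<inter> X \<times> Y) \<le> (1 / p) powr rho \<alpha> \<beta> A * ((1 / p) powr \<alpha>) ^ card X * ((1 / p) powr \<beta>) ^ card Y"
        using elim by (simp add: powr_realpow)
      then have "?T X Y \<le> ((1 / p) powr rho \<alpha> \<beta> A * ((1 / p) powr \<alpha>) ^ card X * ((1 / p) powr \<beta>) ^ card Y) / (real (N' p) ^ card X * real (M' p) ^ card Y)"
        by (rule divide_right_mono) simp
      also have "\<dots> = (1 / p) powr rho \<alpha> \<beta> A * ((1 / p) powr \<alpha> / real (N' p)) ^ card X * ((1 / p) powr \<beta> / real (M' p)) ^ card Y"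
        by (simp add: power_divide)
      also have "\<dots> \<le> (1 / p) powr rho \<alpha> \<beta> A * u p ^ card X * v p ^ card Y"
        by (intro mult_mono power_mono) (auto simp: u_def v_def)
      also have "\<dots> \<le> ?b"
        by (intro mult_mono power_increasing mult_nonneg_nonneg) (use uv cXY in auto)
      finally show "?T X Y \<le> ?b" .
    next
      show "0 \<le> ?P" unfolding span_prob_wt by (intro sum_nonneg wt_nonneg) (use elim in auto)
    qed
    also have "(\<Sum>X\<in>Pow (fst ` A). \<Sum>Y\<in>Pow (snd ` A). ?b) = c * ?b"
      using A(1) by (simp add: card_Pow n_def m_def c_def)
    finally have 1: "1 \<le> ?P * (c * ?b)" .
    have cb: "0 < c * ?b" using c uv elim by (intro mult_pos_pos) auto
    have P: "0 < ?P" using 1 cb by (metis less_le_trans not_one_le_zero zero_less_mult_pos2 zero_less_one)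
    have "0 \<le> ln (?P * (c * ?b))" using 1 by simp
    also have "\<dots> = ln ?P + (ln c + (rho \<alpha> \<beta> A * ln (1 / p) + n * ln (u p) + m * ln (v p)))"
      using P c uv elim by (simp add: ln_mult ln_powr ln_realpow ln_div)
    finally have "- ln ?P \<le> rho \<alpha> \<beta> A * ln (1 / p) + (ln c + n * ln (u p) + m * ln (v p))" by linarith
    also have "\<dots> \<le> rho \<alpha> \<beta> A * ln (1 / p) + e * ln (1 / p)"
      using elim by (simp add: pos_divide_less_eq)
    finally have "ln ?P \<ge> (rho \<alpha> \<beta> A + e) * ln p" using elim by (simp add: ln_div algebra_simps)
    then have "ln ?P / ln p \<le> rho \<alpha> \<beta> A + e" using elim by (simp add: neg_divide_le_eq)
    then show ?case using P by (simp add: rate_def)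
  qed
qed

lemma rate_tendsto_Irate:
  assumes Z: "down_closed Z" "finite Z" and ab: "0 \<le> \<alpha>" "0 \<le> \<beta>" and adm: "admissible \<alpha> \<beta> N M"
  shows "((\<lambda>p. rate Z (N p) (M p) p) \<longlongrightarrow> ereal (Irate \<alpha> \<beta> Z)) (at_right 0)"
proof (rule order_tendstoI)
  fix a assume "a < ereal (Irate \<alpha> \<beta> Z)"
  then obtain r where r: "a < ereal r" "r < Irate \<alpha> \<beta> Z" using ereal_dense2 by (metis ereal_less_eq(3) less_ereal.simps(1))
  have "eventually (\<lambda>p. ereal (Irate \<alpha> \<beta> Z - (Irate \<alpha> \<beta> Z - r)) \<le> rate Z (N p) (M p) p) (at_right 0)"
    by (rule rate_eventually_ge[OF Z ab adm Irate_le]) (use r in auto)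
  then show "eventually (\<lambda>p. a < rate Z (N p) (M p) p) (at_right 0)"
    by eventually_elim (use r(1) in auto)
next
  fix a assume "ereal (Irate \<alpha> \<beta> Z) < a"
  then obtain r where r: "ereal r < a" "Irate \<alpha> \<beta> Z < r" using ereal_dense2 by (metis less_ereal.simps(1))
  obtain A where A: "finite A" "spans Z A" "rho \<alpha> \<beta> A < r"
    using Irate_greatest[OF Z, of r \<alpha> \<beta>] r(2) by (meson not_le)
  have "eventually (\<lambda>p. rate Z (N p) (M p) p \<le> ereal (rho \<alpha> \<beta> A + (r - rho \<alpha> \<beta> A))) (at_right 0)"
    by (rule rate_eventually_le[OF Z ab adm A(1,2)]) (use A(3) in simp)
  then show "eventually (\<lambda>p. rate Z (N p) (M p) p < a) (at_right 0)"
    by eventually_elim (use r(1) in auto)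
qed

text \<open>\<open>I_fin\<close> is a definite description over all admissible side lengths, so
  uniqueness of its value requires that some exist. The logarithmic factor makes the counts tend to
  infinity also when \<alpha> = 0.\<close>

lemma ex_admissible_count:
  fixes \<alpha> :: real
  assumes "0 \<le> \<alpha>"
  shows "\<exists>N. filterlim N at_top (at_right 0) \<and> ((\<lambda>p. ln (real (N p)) / ln (1 / p)) \<longlongrightarrow> \<alpha>) (at_right 0)"
proof -
  define x where "x p = (1 / p) powr \<alpha> * ln (1 / p)" for p :: real
  define N where "N p = nat \<lceil>x p\<rceil>" for p
  have L1: "eventually (\<lambda>p::real. 1 \<le> ln (1 / p)) (at_right 0)"
    using filterlim_ln_inverse_at_right_0 unfolding filterlim_at_top by blast
  have xL: "ln (1 / p) \<le> x p" if "0 < p" "p < 1" for p :: real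
  proof -
    have "1 * ln (1 / p) \<le> (1 / p) powr \<alpha> * ln (1 / p)"
      using that assms by (intro mult_right_mono ge_one_powr_ge_zero) (auto simp: ln_div)
    then show ?thesis by (simp add: x_def)
  qed
  have Nx: "x p \<le> real (N p)" "real (N p) \<le> 2 * x p" if "0 < p" "p < 1" "1 \<le> ln (1 / p)" for p
    using xL[OF that(1,2)] that(3) unfolding N_def by linarith+
  have "filterlim (\<lambda>p. real (N p)) at_top (at_right 0)"
  proof (rule filterlim_at_top_mono[OF filterlim_ln_inverse_at_right_0])
    show "eventually (\<lambda>p. ln (1 / p) \<le> real (N p)) (at_right 0)"
      using L1 eventually_at_right_0_unit by eventually_elim (use xL Nx in force)
  qed
  then have N: "filterlim N at_top (at_right 0)"
    unfolding filterlim_at_top by (metis (mono_tags, lifting) eventually_mono of_nat_le_iff)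
  have "((\<lambda>p::real. ln (ln (1 / p)) / ln (1 / p)) \<longlongrightarrow> 0) (at_right 0)"
    by (rule filterlim_compose[OF ln_x_over_x_tendsto_0 filterlim_ln_inverse_at_right_0])
  then have lo: "((\<lambda>p. \<alpha> + ln (ln (1 / p)) / ln (1 / p)) \<longlongrightarrow> \<alpha>) (at_right 0)"
    using tendsto_add[OF tendsto_const, of _ 0 "at_right 0" \<alpha>] by simp
  have "((\<lambda>p::real. ln 2 / ln (1 / p)) \<longlongrightarrow> 0) (at_right 0)"
    by (intro tendsto_divide_0[OF tendsto_const] filterlim_at_top_imp_at_infinity filterlim_ln_inverse_at_right_0)
  from tendsto_add[OF lo this] have hi: "((\<lambda>p. \<alpha> + ln (ln (1 / p)) / ln (1 / p) + ln 2 / ln (1 / p)) \<longlongrightarrow> \<alpha>) (at_right 0)"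
    by simp
  have lnx: "ln (x p) / ln (1 / p) = \<alpha> + ln (ln (1 / p)) / ln (1 / p)" "0 < x p"
    if "0 < p" "p < 1" "1 \<le> ln (1 / p)" for p
  proof -
    have "ln (x p) = \<alpha> * ln (1 / p) + ln (ln (1 / p))"
      unfolding x_def using that by (subst ln_mult) (auto simp: ln_powr)
    then show "ln (x p) / ln (1 / p) = \<alpha> + ln (ln (1 / p)) / ln (1 / p)"
      using that by (simp add: add_divide_distrib)
    show "0 < x p" using xL[OF that(1,2)] that(3) by linarith
  qed
  have "((\<lambda>p. ln (real (N p)) / ln (1 / p)) \<longlongrightarrow> \<alpha>) (at_right 0)"
  proof (rule tendsto_sandwich[OF _ _ lo hi])
    show "\<forall>\<^sub>F p in at_right 0. \<alpha> + ln (ln (1 / p)) / ln (1 / p) \<le> ln (real (N p)) / ln (1 / p)"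
      using L1 eventually_at_right_0_unit
    proof eventually_elim
      case (elim p)
      then have "ln (x p) \<le> ln (real (N p))" using Nx lnx(2) by (intro ln_mono) (auto intro: less_le_trans)
      then have "ln (x p) / ln (1 / p) \<le> ln (real (N p)) / ln (1 / p)" using elim by (intro divide_right_mono) auto
      then show ?case using lnx(1) elim by simp
    qed
    show "\<forall>\<^sub>F p in at_right 0. ln (real (N p)) / ln (1 / p) \<le> \<alpha> + ln (ln (1 / p)) / ln (1 / p) + ln 2 / ln (1 / p)"
      using L1 eventually_at_right_0_unit
    proof eventually_elim
      case (elim p)
      have x0: "0 < x p" "0 < real (N p)" using lnx(2)[of p] Nx(1)[of p] elim by linarith+
      then have "ln (real (N p)) \<le> ln (2 * x p)" using Nx elim by (intro ln_mono) auto
      also have "\<dots> = ln 2 + ln (x p)" using x0 by (simp add: ln_mult)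
      finally have "ln (real (N p)) / ln (1 / p) \<le> (ln 2 + ln (x p)) / ln (1 / p)" using elim by (intro divide_right_mono) auto
      then show ?case using lnx(1)[of p] elim by (simp add: add_divide_distrib)
    qed
  qed
  then show ?thesis using N by blast
qed

lemma I_fin_eq_Irate:
  assumes Z: "down_closed Z" "finite Z" and ab: "0 \<le> \<alpha>" "0 \<le> \<beta>"
  shows "I_fin \<alpha> \<beta> Z = ereal (Irate \<alpha> \<beta> Z)"
  unfolding I_fin_def
proof (rule the_equality)
  show "\<forall>N M. admissible \<alpha> \<beta> N M \<longrightarrow> ((\<lambda>p. rate Z (N p) (M p) p) \<longlongrightarrow> ereal (Irate \<alpha> \<beta> Z)) (at_right 0)"
    using rate_tendsto_Irate[OF Z ab] by blast
next
  fix L assume L: "\<forall>N M. admissible \<alpha> \<beta> N M \<longrightarrow> ((\<lambda>p. rate Z (N p) (M p) p) \<longlongrightarrow> L) (at_right 0)"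
  obtain N M where adm: "admissible \<alpha> \<beta> N M"
    using ex_admissible_count[OF ab(1)] ex_admissible_count[OF ab(2)] unfolding admissible_def by blast
  show "L = ereal (Irate \<alpha> \<beta> Z)"
    by (rule tendsto_unique[OF _ L[rule_format, OF adm] rate_tendsto_Irate[OF Z ab adm]]) simp
qed

section \<open>The enhanced cost functional\<close>

text \<open>With \<open>\<tau> = True\<close> only the empty initial set is allowed, which is the discrete counterpart of
  \<open>gt_thin_bdd\<close>.\<close>

definition costs :: "bool \<Rightarrow> real \<Rightarrow> real \<Rightarrow> (nat \<times> nat) set \<Rightarrow> real set" where
  "costs \<tau> \<alpha> \<beta> Z = {real (card A) + (1 - \<alpha>) * real (total f) + (1 - \<beta>) * real (total g) | A f g.
     finite A \<and> profile f \<and> profile g \<and> (\<tau> \<longrightarrow> A = {}) \<and> fspans Z f g A}"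

definition Enh :: "bool \<Rightarrow> real \<Rightarrow> real \<Rightarrow> (nat \<times> nat) set \<Rightarrow> real" where
  "Enh \<tau> \<alpha> \<beta> Z = Inf (costs \<tau> \<alpha> \<beta> Z)"

lemma Enh_le:
  assumes "\<alpha> \<le> 1" "\<beta> \<le> 1" "finite A" "profile f" "profile g" "\<tau> \<Longrightarrow> A = {}" "fspans Z f g A"
  shows "Enh \<tau> \<alpha> \<beta> Z \<le> real (card A) + (1 - \<alpha>) * real (total f) + (1 - \<beta>) * real (total g)"
  unfolding Enh_def
proof (rule cInf_lower)
  show "bdd_below (costs \<tau> \<alpha> \<beta> Z)"
    by (rule bdd_belowI[of _ 0]) (use assms(1,2) in \<open>auto simp: costs_def\<close>)
qed (use assms in \<open>auto simp: costs_def\<close>)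

lemma profile_0: "profile (\<lambda>_. 0)" by (simp add: profile_def monotone_def)

lemma total_0 [simp]: "total (\<lambda>_. 0) = 0" by (simp add: total_def)

lemma Enh_greatest:
  assumes "down_closed Z" "finite Z"
    "\<And>A f g. finite A \<Longrightarrow> profile f \<Longrightarrow> profile g \<Longrightarrow> (\<tau> \<Longrightarrow> A = {}) \<Longrightarrow> fspans Z f g A \<Longrightarrow>
       c \<le> real (card A) + (1 - \<alpha>) * real (total f) + (1 - \<beta>) * real (total g)"
  shows "c \<le> Enh \<tau> \<alpha> \<beta> Z"
  unfolding Enh_def
proof (rule cInf_greatest)
  show "costs \<tau> \<alpha> \<beta> Z \<noteq> {}"
    using fspans_width[OF assms(1,2)] profile_width[OF assms(1,2)] profile_0 unfolding costs_def by blast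
qed (use assms(3) in \<open>auto simp: costs_def\<close>)

lemma Enh_mono:
  assumes "down_closed Z'" "finite Z'" "Z \<subseteq> Z'" "\<alpha> \<le> 1" "\<beta> \<le> 1"
  shows "Enh \<tau> \<alpha> \<beta> Z \<le> Enh \<tau> \<alpha> \<beta> Z'"
proof (rule Enh_greatest[OF assms(1,2)])
  fix A f g assume *: "finite A" "profile f" "profile g" "\<tau> \<Longrightarrow> A = {}" "fspans Z' f g A"
  have "fspans Z f g A" by (rule fspans_mono[OF *(5) assms(1,3)]) auto
  then show "Enh \<tau> \<alpha> \<beta> Z \<le> real (card A) + (1 - \<alpha>) * real (total f) + (1 - \<beta>) * real (total g)"
    using * assms by (intro Enh_le) auto
qed

lemma fspans_converse: "fspans (Z\<inverse>) g f (A\<inverse>) \<longleftrightarrow> fspans Z f g A"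
proof -
  have *: "fspans (Z\<inverse>) g f (A\<inverse>)" if "fspans Z f g A" for Z f g A
    unfolding fspans_def
  proof (intro allI impI)
    fix S assume "A\<inverse> \<subseteq> S" "stable (Z\<inverse>) g f S"
    then have "A \<subseteq> S\<inverse>" "stable Z f g (S\<inverse>)" using stable_converse[of Z g f "S\<inverse>"] by auto
    then have "S\<inverse> = UNIV" using that unfolding fspans_def by blast
    then show "S = UNIV" by auto
  qed
  show ?thesis using *[of Z f g A] *[of "Z\<inverse>" g f "A\<inverse>"] by auto
qed

text \<open>Everything can be filled by row boosts only or by column boosts only. In particular the
  cost disappears as soon as \<alpha> = 1 or \<beta> = 1.\<close>

lemma Enh_le_card:
  assumes Z: "down_closed Z" "finite Z" and "\<alpha> \<le> 1" "\<beta> \<le> 1"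
  shows "Enh \<tau> \<alpha> \<beta> Z \<le> (1 - \<alpha>) * card Z" "Enh \<tau> \<alpha> \<beta> Z \<le> (1 - \<beta>) * card Z"
proof -
  show "Enh \<tau> \<alpha> \<beta> Z \<le> (1 - \<alpha>) * card Z"
    using Enh_le[OF assms(3,4) _ profile_width[OF Z] profile_0 _ fspans_width[OF Z], of \<tau>] total_width[OF Z(2)] by simp
  have Z': "down_closed (Z\<inverse>)" "finite (Z\<inverse>)" using Z by (simp_all add: down_closed_converse)
  have "fspans Z (\<lambda>_. 0) (width (Z\<inverse>)) {}"
    using fspans_width[OF Z'] fspans_converse[of Z "width (Z\<inverse>)" "\<lambda>_. 0" "{}"] by simp
  from Enh_le[OF assms(3,4) _ profile_0 profile_width[OF Z'] _ this, of \<tau>]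
  show "Enh \<tau> \<alpha> \<beta> Z \<le> (1 - \<beta>) * card Z"
    using total_width[OF Z'(2)] by simp
qed

lemma Enh_tail:
  assumes Z: "down_closed Z" "finite Z" and ab: "0 \<le> \<alpha>" "\<alpha> \<le> 1" "0 \<le> \<beta>" "\<beta> \<le> 1"
  shows "Enh \<tau> \<alpha> \<beta> Z \<le> Enh \<tau> \<alpha> \<beta> (Z \<inter> Rect (2 * q) (2 * q)) + 6 * card (Z - Rect q q)"
proof -
  let ?T = "card (Z - Rect q q)"
  have "Enh \<tau> \<alpha> \<beta> Z - 6 * ?T \<le> Enh \<tau> \<alpha> \<beta> (Z \<inter> Rect (2 * q) (2 * q))"
  proof (rule Enh_greatest)
    fix A f g assume *: "finite A" "profile f" "profile g" "\<tau> \<Longrightarrow> A = {}" "fspans (Z \<inter> Rect (2 * q) (2 * q)) f g A"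
    obtain f' g' where fg: "profile f'" "profile g'" "fspans Z f' g' A"
      "total f' \<le> total f + 3 * ?T" "total g' \<le> total g + 3 * ?T"
      by (rule fspans_tail[OF Z *(5,2,3)])
    have "Enh \<tau> \<alpha> \<beta> Z \<le> real (card A) + (1 - \<alpha>) * real (total f') + (1 - \<beta>) * real (total g')"
      using * fg ab by (intro Enh_le) auto
    moreover have "(1 - \<alpha>) * real (total f') \<le> (1 - \<alpha>) * (real (total f) + 3 * ?T)"
      using fg(4) ab by (intro mult_left_mono) linarith+
    moreover have "(1 - \<beta>) * real (total g') \<le> (1 - \<beta>) * (real (total g) + 3 * ?T)"
      using fg(5) ab by (intro mult_left_mono) linarith+
    moreover have "0 \<le> \<alpha> * ?T" "0 \<le> \<beta> * ?T" using ab by auto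
    ultimately show "Enh \<tau> \<alpha> \<beta> Z - 6 * ?T \<le> real (card A) + (1 - \<alpha>) * real (total f) + (1 - \<beta>) * real (total g)"
      by (simp add: algebra_simps)
  qed (use Z down_closed_Int down_closed_Rect in auto)
  then show ?thesis by simp
qed

text \<open>Each of the three terms of the cost has a weight of at least \<open>c\<close>, so
  \<open>card_le_fspans\<close> applies. This later forces infinite cost for infinite area.\<close>

lemma Enh_lower:
  fixes c :: real
  assumes Z: "down_closed Z" "finite Z" and c: "0 \<le> c" "c \<le> 1 - \<alpha>" "c \<le> 1 - \<beta>" "c \<le> 1"
  shows "c * card Z \<le> 8 * Enh \<tau> \<alpha> \<beta> Z"
proof -
  have "c * card Z / 8 \<le> Enh \<tau> \<alpha> \<beta> Z"
  proof (rule Enh_greatest[OF Z])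
    fix A f g assume *: "finite A" "profile f" "profile g" "\<tau> \<Longrightarrow> A = {}" "fspans Z f g A"
    have "card Z \<le> 8 * card A + 4 * total f + 4 * total g"
      using * by (intro card_le_fspans[OF Z]) (auto simp: profile_def)
    then have "real (card Z) \<le> 8 * card A + 4 * total f + 4 * total g"
      by (metis of_nat_add of_nat_le_iff of_nat_mult of_nat_numeral)
    then have "c * card Z \<le> c * (8 * card A + 4 * total f + 4 * total g)"
      using c by (intro mult_left_mono) auto
    moreover have "c * real (card A) \<le> 1 * real (card A)" by (rule mult_right_mono[OF c(4)]) simp
    moreover have "c * total f \<le> (1 - \<alpha>) * total f" "c * total g \<le> (1 - \<beta>) * total g"
      using c by (auto intro!: mult_right_mono)
    moreover have "0 \<le> c * total f" "0 \<le> c * total g" using c by auto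
    ultimately show "c * card Z / 8 \<le> real (card A) + (1 - \<alpha>) * real (total f) + (1 - \<beta>) * real (total g)"
      by (simp add: algebra_simps)
  qed
  then show ?thesis by simp
qed

text \<open>Every weight at the new parameters is at least \<open>r\<close> times the old one, the
  weight 1 of \<open>A\<close> included. This comparison supplies the continuity in
  \<open>TS_continuous\<close>.\<close>

lemma Enh_ratio:
  assumes Z: "down_closed Z" "finite Z" and r: "0 \<le> r" "r \<le> 1" "r * (1 - \<alpha>) \<le> 1 - \<alpha>'" "r * (1 - \<beta>) \<le> 1 - \<beta>'"
    and ab: "\<alpha> \<le> 1" "\<beta> \<le> 1"
  shows "r * Enh \<tau> \<alpha> \<beta> Z \<le> Enh \<tau> \<alpha>' \<beta>' Z"
proof (rule Enh_greatest[OF Z])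
  fix A f g assume *: "finite A" "profile f" "profile g" "\<tau> \<Longrightarrow> A = {}" "fspans Z f g A"
  have "r * Enh \<tau> \<alpha> \<beta> Z \<le> r * (real (card A) + (1 - \<alpha>) * real (total f) + (1 - \<beta>) * real (total g))"
    using * ab r(1) by (intro mult_left_mono Enh_le) auto
  also have "\<dots> = r * real (card A) + (r * (1 - \<alpha>)) * real (total f) + (r * (1 - \<beta>)) * real (total g)"
    by (simp add: algebra_simps)
  also have "\<dots> \<le> 1 * real (card A) + (1 - \<alpha>') * real (total f) + (1 - \<beta>') * real (total g)"
    using r by (intro add_mono mult_right_mono) auto
  finally show "r * Enh \<tau> \<alpha> \<beta> Z \<le> real (card A) + (1 - \<alpha>') * real (total f) + (1 - \<beta>') * real (total g)" by simp
qed

lemma Enh_antimono: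
  assumes Z: "down_closed Z" "finite Z" and "\<alpha> \<le> \<alpha>'" "\<beta> \<le> \<beta>'" "\<alpha>' \<le> 1" "\<beta>' \<le> 1"
  shows "Enh \<tau> \<alpha>' \<beta>' Z \<le> Enh \<tau> \<alpha> \<beta> Z"
proof (rule Enh_greatest[OF Z])
  fix A f g assume *: "finite A" "profile f" "profile g" "\<tau> \<Longrightarrow> A = {}" "fspans Z f g A"
  have "Enh \<tau> \<alpha>' \<beta>' Z \<le> real (card A) + (1 - \<alpha>') * real (total f) + (1 - \<beta>') * real (total g)"
    using * assms by (intro Enh_le) auto
  also have "\<dots> \<le> real (card A) + (1 - \<alpha>) * real (total f) + (1 - \<beta>) * real (total g)"
    using assms by (intro add_mono mult_right_mono) auto
  finally show "Enh \<tau> \<alpha>' \<beta>' Z \<le> real (card A) + (1 - \<alpha>) * real (total f) + (1 - \<beta>) * real (total g)" .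
qed

text \<open>The cost of a fixed configuration is affine in \<open>(\<alpha>, \<beta>)\<close>, and
  an infimum of affine functions is concave.\<close>

lemma Enh_concave:
  assumes Z: "down_closed Z" "finite Z" and t: "0 \<le> s" "0 \<le> t" "s + t = 1"
    and ab: "\<alpha> \<le> 1" "\<beta> \<le> 1" "\<alpha>' \<le> 1" "\<beta>' \<le> 1"
  shows "s * Enh \<tau> \<alpha> \<beta> Z + t * Enh \<tau> \<alpha>' \<beta>' Z \<le> Enh \<tau> (s * \<alpha> + t * \<alpha>') (s * \<beta> + t * \<beta>') Z"
proof (rule Enh_greatest[OF Z])
  fix A f g assume *: "finite A" "profile f" "profile g" "\<tau> \<Longrightarrow> A = {}" "fspans Z f g A"
  let ?c = "\<lambda>\<alpha> \<beta>. real (card A) + (1 - \<alpha>) * real (total f) + (1 - \<beta>) * real (total g)"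
  have "s * Enh \<tau> \<alpha> \<beta> Z + t * Enh \<tau> \<alpha>' \<beta>' Z \<le> s * ?c \<alpha> \<beta> + t * ?c \<alpha>' \<beta>'"
    using * ab t by (intro add_mono mult_left_mono Enh_le) auto
  also have "\<dots> = (s + t) * card A + ((s + t) - (s * \<alpha> + t * \<alpha>')) * real (total f) + ((s + t) - (s * \<beta> + t * \<beta>')) * real (total g)"
    by (simp add: algebra_simps)
  finally show "s * Enh \<tau> \<alpha> \<beta> Z + t * Enh \<tau> \<alpha>' \<beta>' Z \<le> ?c (s * \<alpha> + t * \<alpha>') (s * \<beta> + t * \<beta>')"
    using t(3) by simp
qed

subsection \<open>Comparison with the discrete quantities\<close>

lemma Irate_le_Enh:
  assumes Z: "down_closed Z" "finite Z" and ab: "\<alpha> \<in> {0..1}" "\<beta> \<in> {0..1}"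
  shows "Irate \<alpha> \<beta> Z \<le> Enh \<tau> \<alpha> \<beta> Z"
proof (rule Enh_greatest[OF Z])
  fix A f g assume *: "finite A" "profile f" "profile g" "\<tau> \<Longrightarrow> A = {}" "fspans Z f g A"
  obtain B where B: "finite B" "spans Z B"
    and r: "\<And>X Y (\<alpha>::real) (\<beta>::real). finite X \<Longrightarrow> finite Y \<Longrightarrow> \<alpha> \<in> {0..1} \<Longrightarrow> \<beta> \<in> {0..1} \<Longrightarrow>
       real (card (B \<inter> X \<times> Y)) - \<alpha> * card X - \<beta> * card Y
         \<le> card A + (1 - \<alpha>) * total f + (1 - \<beta>) * total g"
    using fspans_imp_spanning_set[OF Z *(1,2,3,5)] by metis
  obtain X Y where XY: "X \<subseteq> fst ` B" "Y \<subseteq> snd ` B"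
    "rho \<alpha> \<beta> B = real (card (B \<inter> X \<times> Y)) - \<alpha> * card X - \<beta> * card Y"
    by (rule rho_attained[OF B(1)])
  have "finite X" "finite Y" using XY B(1) by (meson finite_imageI finite_subset)+
  then have "rho \<alpha> \<beta> B \<le> card A + (1 - \<alpha>) * total f + (1 - \<beta>) * total g"
    unfolding XY(3) by (rule r[OF _ _ ab])
  then show "Irate \<alpha> \<beta> Z \<le> card A + (1 - \<alpha>) * total f + (1 - \<beta>) * total g"
    using Irate_le[OF B] order_trans by blast
qed

lemma card_subset_Rect: "Z \<subseteq> Rect m m \<Longrightarrow> card Z \<le> m * m"
  using card_mono[OF finite_Rect, of Z m m] by (simp add: card_Rect)

lemma Enh_le_rho:
  assumes Z: "down_closed Z" "Z \<subseteq> Rect m m" and A: "finite A" "spans Z A" and k: "1 \<le> k"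
    and ab: "\<alpha> \<in> {0..1}" "\<beta> \<in> {0..1}"
    and \<tau>: "\<tau> \<Longrightarrow> A \<inter> heavy k (A\<inverse>) \<times> heavy k A = {}"
  shows "Enh \<tau> \<alpha> \<beta> Z \<le> rho \<alpha> \<beta> A + \<alpha> * card (heavy k (A\<inverse>)) + \<beta> * card (heavy k A) + 2 * real (k * m)"
proof -
  obtain f g where fg: "finite {y. f y \<noteq> 0}" "finite {x. g x \<noteq> 0}"
    "fspans Z f g (A \<inter> heavy k (A\<inverse>) \<times> heavy k A)"
    "total f = card {(x, y) \<in> A. x \<notin> heavy k (A\<inverse>) \<and> y \<in> heavy k A} + k * m"
    "total g = card {(x, y) \<in> A. x \<in> heavy k (A\<inverse>) \<and> y \<notin> heavy k A} + k * m"
    by (rule fspans_light_boosts[OF Z A k])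
  let ?A = "A \<inter> heavy k (A\<inverse>) \<times> heavy k A"
  obtain f' g' A' where fg': "fspans Z f' g' A'" "finite A'" "card A' = card ?A" "profile f'" "profile g'"
    "total f' = total f" "total g' = total g"
    using fspans_sorted[OF fg(3) _ fg(1,2)] A(1) by (metis finite_Int)
  have "\<tau> \<Longrightarrow> A' = {}" using \<tau> fg'(2,3) by simp
  then have "Enh \<tau> \<alpha> \<beta> Z \<le> real (card ?A) + (1 - \<alpha>) * real (total f) + (1 - \<beta>) * real (total g)"
    using Enh_le[of \<alpha> \<beta> A' f' g' \<tau> Z] fg' ab by auto
  moreover have "(1 - \<alpha>) * real (k * m) \<le> 1 * real (k * m)" "(1 - \<beta>) * real (k * m) \<le> 1 * real (k * m)"
    using ab by (intro mult_right_mono; simp)+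
  ultimately show ?thesis
    using light_boosts_cost[OF A(1) k ab] unfolding fg(4,5) by (simp add: algebra_simps)
qed

text \<open>Use \<open>Enh_le_rho\<close> with \<open>k\<close> about \<open>b * m\<close>. The
  fresh lines then cost about \<open>2 * b * m^2\<close>, half of the allowed error, and the number
  of heavy lines is only of order \<open>m\<close>, since \<open>rho\<close> may be assumed to be at
  most \<open>m^2\<close>. The latter count relies on \<alpha>, \<beta> < 1.\<close>

lemma Enh_le_Irate:
  assumes ab: "\<alpha> \<in> {0..<1}" "\<beta> \<in> {0..<1}" and e: "0 < e"
  shows "\<exists>m0. \<forall>m\<ge>m0. \<forall>Z. down_closed Z \<longrightarrow> Z \<subseteq> Rect m m \<longrightarrow> Enh False \<alpha> \<beta> Z \<le> Irate \<alpha> \<beta> Z + e * real m ^ 2"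
proof -
  define c where "c = min (1 - \<alpha>) (1 - \<beta>)"
  have c: "0 < c" "c \<le> 1 - \<alpha>" "c \<le> 1 - \<beta>" using ab by (auto simp: c_def)
  define b where "b = e / 4"
  have b: "b > 0" using e by (simp add: b_def)
  \<comment> \<open>The first summand gives \<open>2 \<le> c * b * m\<close>, so that
    \<open>(1 - a) * k - 1\<close> is at least \<open>c * b * m / 2\<close>; the second absorbs the
    terms linear in \<open>m\<close> into the other half of the error.\<close>
  define m0 where "m0 = nat \<lceil>2 / (c * b) + (4 + 16 / (c * b)) / e\<rceil> + 1"
  have "Enh False \<alpha> \<beta> Z \<le> Irate \<alpha> \<beta> Z + e * real m ^ 2" if m: "m0 \<le> m" and Z: "down_closed Z" "Z \<subseteq> Rect m m" for m Z
  proof -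
    have "2 / (c * b) + (4 + 16 / (c * b)) / e \<le> real m" using m unfolding m0_def by linarith
    moreover have "0 \<le> 2 / (c * b)" "0 \<le> (4 + 16 / (c * b)) / e" using c b e by auto
    ultimately have m1: "2 / (c * b) \<le> m" "(4 + 16 / (c * b)) / e \<le> m" by linarith+
    have m1': "2 \<le> c * b * m" using m1(1) c b by (simp add: pos_divide_le_eq mult_ac)
    have mp: "1 \<le> real m" using m by (simp add: m0_def)
    have fZ: "finite Z" using Z(2) finite_subset finite_Rect by blast
    define k where "k = nat \<lceil>b * m\<rceil>"
    have k: "b * m \<le> k" "k \<le> b * m + 1" using b by (auto simp: k_def)
    have k1: "1 \<le> k" using k(1) b mp by (metis less_le_trans mult_pos_pos not_less of_nat_0 less_one linorder_not_le of_nat_le_0_iff zero_less_one)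
    have "Enh False \<alpha> \<beta> Z - e * real m ^ 2 \<le> Irate \<alpha> \<beta> Z"
    proof (rule Irate_greatest[OF Z(1) fZ])
      fix A assume A: "finite A" "spans Z A"
      show "Enh False \<alpha> \<beta> Z - e * real m ^ 2 \<le> rho \<alpha> \<beta> A"
      \<comment> \<open>Above \<open>m^2\<close> the claim is trivial, because \<open>Enh\<close> is
        at most \<open>card Z\<close>.\<close>
      proof (cases "rho \<alpha> \<beta> A \<le> real m ^ 2")
        case False
        have "Enh False \<alpha> \<beta> Z \<le> (1 - \<alpha>) * card Z" using ab by (intro Enh_le_card[OF Z(1) fZ]) auto
        also have "\<dots> \<le> 1 * real m ^ 2"
          using ab card_subset_Rect[OF Z(2)] by (intro mult_mono) (auto simp: power2_eq_square simp flip: of_nat_mult)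
        finally have "Enh False \<alpha> \<beta> Z \<le> rho \<alpha> \<beta> A" using False by simp
        moreover have "0 \<le> e * real m ^ 2" using e by simp
        ultimately show ?thesis by linarith
      next
        case True
        have hv: "card (heavy k B) \<le> 2 * m / (c * b)"
          if B: "finite B" "rho a a' B \<le> real m ^ 2" "a \<in> {0..1}" "a' \<le> 1" "c \<le> 1 - a" for B a a'
        proof -
          have "c * (b * m) \<le> (1 - a) * k" using k(1) that c b by (intro mult_mono) auto
          then have d: "c * b * m / 2 \<le> (1 - a) * k - 1" using m1' by (simp add: mult.assoc)
          have d0: "0 < c * b * m / 2" using m1' by linarith
          have "card (heavy k B) \<le> rho a a' B / ((1 - a) * k - 1)"
            using card_heavy_le[OF B(1) k1 B(3,4)] d d0 by simp
          also have "\<dots> \<le> real m ^ 2 / (c * b * m / 2)"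
            using d d0 B rho_nonneg[OF B(1)] by (intro frac_le) auto
          also have "\<dots> = 2 * m / (c * b)" using mp c b by (simp add: field_simps power2_eq_square)
          finally show ?thesis .
        qed
        have h1: "card (heavy k A) \<le> 2 * m / (c * b)" by (rule hv[OF A(1) True]) (use ab c in auto)
        have h2: "card (heavy k (A\<inverse>)) \<le> 2 * m / (c * b)"
          by (rule hv[of "A\<inverse>" \<beta> \<alpha>]) (use ab c A True rho_converse[OF A(1), of \<beta> \<alpha>] in auto)
        have "Enh False \<alpha> \<beta> Z \<le> rho \<alpha> \<beta> A + \<alpha> * card (heavy k (A\<inverse>)) + \<beta> * card (heavy k A) + 2 * real (k * m)"
          by (rule Enh_le_rho[OF Z A k1]) (use ab in auto)
        also have "\<dots> \<le> rho \<alpha> \<beta> A + 1 * (2 * m / (c * b)) + 1 * (2 * m / (c * b)) + 2 * ((b * m + 1) * m)"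
          using ab h1 h2 k(2) mp by (intro add_mono mult_mono order_refl) (auto intro!: mult_right_mono)
        also have "\<dots> = rho \<alpha> \<beta> A + (e / 2) * real m ^ 2 + (2 + 4 / (c * b)) * m"
          by (simp add: b_def algebra_simps power2_eq_square)
        also have "(2 + 4 / (c * b)) * m \<le> (e / 2 * m) * m"
        proof (rule mult_right_mono)
          define y where "y = 16 / (c * b)"
          define x where "x = e * m"
          have yx: "4 + y \<le> x" using m1(2) e by (simp add: x_def y_def pos_divide_le_eq mult.commute)
          have y0: "0 \<le> y" using c b by (simp add: y_def)
          have eq: "4 / (c * b) = y / 4" "e / 2 * m = x / 2" by (simp_all add: x_def y_def)
          show "2 + 4 / (c * b) \<le> e / 2 * m" unfolding eq using yx y0 by linarith
        qed simp
        finally show ?thesis by (simp add: power2_eq_square algebra_simps)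
      qed
    qed
    then show ?thesis by simp
  qed
  then show ?thesis by blast
qed

lemma gamma_eq_Irate:
  assumes Z: "down_closed Z" "finite Z" shows "gamma Z = ereal (Irate 0 0 Z)"
proof (rule antisym)
  show "ereal (Irate 0 0 Z) \<le> gamma Z"
    unfolding gamma_def using Irate_le[of _ Z 0 0] rho_0 by (force intro!: Inf_greatest)
  show "gamma Z \<le> ereal (Irate 0 0 Z)"
  proof (rule ereal_le_epsilon2)
    fix e :: real assume "0 < e"
    then obtain A where A: "finite A" "spans Z A" "rho 0 0 A < Irate 0 0 Z + e"
      using Irate_greatest[OF Z, of "Irate 0 0 Z + e" 0 0] by (meson less_add_same_cancel1 not_le)
    have "gamma Z \<le> ereal (real (card A))" unfolding gamma_def using A by (intro Inf_lower) auto
    also have "\<dots> \<le> ereal (Irate 0 0 Z + e)" using A(3) rho_0[OF A(1)] by simp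
    finally show "gamma Z \<le> ereal (Irate 0 0 Z) + ereal e" by simp
  qed
qed

lemma gamma_thin_le_Enh:
  assumes Z: "down_closed Z" "finite Z" shows "gamma_thin Z \<le> ereal (Enh True 0 0 Z)"
proof (rule ereal_le_epsilon2)
  fix e :: real assume e: "0 < e"
  have "costs True 0 0 Z \<noteq> {}"
    using fspans_width[OF Z] profile_width[OF Z] profile_0 unfolding costs_def by blast
  then obtain x where "x \<in> costs True 0 0 Z" "x < Enh True 0 0 Z + e"
    using cInf_lessD[of "costs True 0 0 Z" "Enh True 0 0 Z + e"] e unfolding Enh_def by auto
  then obtain f g where fg: "profile f" "profile g" "fspans Z f g {}" "real (total f) + real (total g) < Enh True 0 0 Z + e"
    by (auto simp: costs_def)
  obtain B where B: "finite B" "spans Z B" "thin B" "card B \<le> total f + total g"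
    using fspans_imp_spanning_set[OF Z finite.emptyI fg(1,2,3)] by metis
  have "gamma_thin Z \<le> ereal (real (card B))" unfolding gamma_thin_def using B by (intro Inf_lower) auto
  also have "\<dots> \<le> ereal (Enh True 0 0 Z) + ereal e" using B(4) fg(4) by simp
  finally show "gamma_thin Z \<le> ereal (Enh True 0 0 Z) + ereal e" .
qed

text \<open>Threshold 2 leaves no initial set, and at \<alpha> = \<beta> = 0 heavy lines are not
  charged; only the two families of \<open>m\<close> fresh lines with boost 2 remain, which gives
  \<open>4 * m\<close>.\<close>

lemma Enh_le_gamma_thin:
  assumes Z: "down_closed Z" "Z \<subseteq> Rect m m"
  shows "ereal (Enh True 0 0 Z) \<le> gamma_thin Z + ereal (4 * m)"
proof -
  have "ereal (Enh True 0 0 Z - 4 * m) \<le> gamma_thin Z"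
    unfolding gamma_thin_def
  proof (rule Inf_greatest, clarify)
    fix A assume A: "finite A" "thin A" "spans Z A"
    show "ereal (Enh True 0 0 Z - 4 * m) \<le> ereal (real (card A))"
      using Enh_le_rho[OF Z A(1,3), of 2 0 0 True] heavy_2_thin[OF A(1,2)] rho_0[OF A(1)] by simp
  qed
  then have "ereal (Enh True 0 0 Z - 4 * m) + ereal (4 * m) \<le> gamma_thin Z + ereal (4 * m)"
    by (rule add_right_mono)
  then show ?thesis by simp
qed

lemma gamma_thin_mono: "Z \<subseteq> Z' \<Longrightarrow> down_closed Z \<Longrightarrow> gamma_thin Z \<le> gamma_thin Z'"
  unfolding gamma_thin_def by (rule Inf_superset_mono) (auto intro: spans_antimono)

lemma gamma_mono: "Z \<subseteq> Z' \<Longrightarrow> down_closed Z \<Longrightarrow> gamma Z \<le> gamma Z'"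
  unfolding gamma_def by (rule Inf_superset_mono) (auto intro: spans_antimono)

section \<open>Discretization of the Euclidean dynamics\<close>

text \<open>The empty set is included, so the truncation of a Euclidean zero-set to
  \<open>[0, R]^2\<close> qualifies for every real \<open>R\<close>.\<close>

definition low_set :: "(real \<times> real) set \<Rightarrow> bool" where
  "low_set W \<longleftrightarrow> closed W \<and> bounded W \<and> W \<subseteq> quadrant \<and> (\<forall>(a, b)\<in>W. {0..a} \<times> {0..b} \<subseteq> W)"

lemma low_setD:
  assumes "low_set W" "(a, b) \<in> W" "0 \<le> a'" "a' \<le> a" "0 \<le> b'" "b' \<le> b"
  shows "(a', b') \<in> W"
proof -
  have "{0..a} \<times> {0..b} \<subseteq> W" using assms(1,2) unfolding low_set_def by blast
  then show ?thesis using assms by auto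
qed

text \<open>A count \<open>i\<close> corresponds to the length \<open>d * i\<close>, so that for
  cell configurations the discrete and the Euclidean test of being outside agree exactly.\<close>

definition Zd :: "real \<Rightarrow> (real \<times> real) set \<Rightarrow> (nat \<times> nat) set" where
  "Zd d W = {(i, j). (d * real i, d * real j) \<in> W}"

lemma low_set_bound:
  assumes "low_set W"
  obtains K where "0 < K" "W \<subseteq> {0..K} \<times> {0..K}"
proof -
  have "bounded W" using assms by (simp add: low_set_def)
  then obtain K where K: "0 < K" "\<forall>x\<in>W. norm x \<le> K" unfolding bounded_pos by blast
  have "W \<subseteq> {0..K} \<times> {0..K}"
  proof clarify
    fix a b assume ab: "(a, b) \<in> W"
    then have "0 \<le> a" "0 \<le> b" using assms by (auto simp: low_set_def quadrant_def)
    moreover have "norm a \<le> K" "norm b \<le> K" using norm_fst_le[of a b] norm_snd_le[of b a] K(2) ab by force+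
    ultimately show "a \<in> {0..K} \<and> b \<in> {0..K}" by auto
  qed
  then show ?thesis by (rule that[OF K(1)])
qed

lemma down_closed_Zd:
  assumes "low_set W" "0 < d" shows "down_closed (Zd d W)"
  unfolding down_closed_def Zd_def using assms by (auto intro: low_setD[OF assms(1)])

lemma Zd_subset_Rect:
  assumes "W \<subseteq> {0..K} \<times> {0..K}" "0 < d" "K < d * m"
  shows "Zd d W \<subseteq> Rect m m"
proof clarify
  fix i j assume "(i, j) \<in> Zd d W"
  then have "d * i \<le> K" "d * j \<le> K" using assms(1) by (auto simp: Zd_def)
  then have "d * i < d * m" "d * j < d * m" using assms(3) by linarith+
  then show "(i, j) \<in> Rect m m" using assms(2) by (simp add: Rect_def)
qed

lemma finite_Zd:
  assumes "low_set W" "0 < d" shows "finite (Zd d W)"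
proof -
  obtain K where K: "0 < K" "W \<subseteq> {0..K} \<times> {0..K}" by (rule low_set_bound[OF assms(1)])
  obtain m where "K / d < real m" using reals_Archimedean2 by blast
  then have "K < d * m" using assms(2) by (simp add: pos_divide_less_eq mult.commute)
  from finite_subset[OF Zd_subset_Rect[OF K(2) assms(2) this] finite_Rect] show ?thesis .
qed

subsection \<open>Cells\<close>

text \<open>The cells are \<open>[0, d]\<close> and \<open>(d * i, d * (i + 1)]\<close> for \<open>i > 0\<close>, so that functions which are constant
  on cells are left-continuous.\<close>

definition cell :: "real \<Rightarrow> real \<Rightarrow> nat" where
  "cell d u = nat (\<lceil>u / d\<rceil> - 1)"

lemma cell_le: "0 < d \<Longrightarrow> 0 \<le> u \<Longrightarrow> d * cell d u \<le> u"
proof -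
  assume d: "0 < d" "0 \<le> u"
  have "real (nat (\<lceil>u / d\<rceil> - 1)) \<le> u / d" using divide_nonneg_pos[OF d(2,1)] by linarith
  then show ?thesis using d by (simp add: cell_def pos_le_divide_eq mult.commute)
qed

lemma le_cell: "0 < d \<Longrightarrow> u \<le> d * (real (cell d u) + 1)"
proof -
  assume d: "0 < d"
  have "u / d \<le> real (nat (\<lceil>u / d\<rceil> - 1)) + 1" by linarith
  then show ?thesis using d by (simp add: cell_def pos_divide_le_eq mult.commute)
qed

lemma cell_eqI:
  assumes "0 < d" "d * real i < u" "u \<le> d * (real i + 1)" shows "cell d u = i"
proof -
  have "real i < u / d" "u / d \<le> real i + 1"
    using assms by (simp_all add: pos_less_divide_eq pos_divide_le_eq mult.commute)
  then have "\<lceil>u / d\<rceil> = int i + 1" by (intro ceiling_unique) auto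
  then show ?thesis by (simp add: cell_def)
qed

lemma cell_less: "0 < d \<Longrightarrow> 0 < u \<Longrightarrow> d * cell d u < u"
proof -
  assume d: "0 < d" "0 < u"
  have "real (nat (\<lceil>u / d\<rceil> - 1)) < u / d" using d divide_pos_pos[of u d] by linarith
  then show ?thesis using d by (simp add: cell_def pos_less_divide_eq mult.commute)
qed

lemma cell_mono: "0 < d \<Longrightarrow> u \<le> v \<Longrightarrow> cell d u \<le> cell d v"
  unfolding cell_def by (intro nat_mono diff_mono ceiling_mono divide_right_mono) auto

lemma cell_interval:
  assumes "0 < d"
  shows "{u. 0 \<le> u \<and> cell d u = i} = (if i = 0 then {0..d} else {d * real i<..d * (real i + 1)})"
proof (intro set_eqI iffI)
  fix u assume u: "u \<in> {u. 0 \<le> u \<and> cell d u = i}"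
  then show "u \<in> (if i = 0 then {0..d} else {d * real i<..d * (real i + 1)})"
    using le_cell[OF assms, of u] cell_less[OF assms, of u] cell_le[OF assms, of u] assms
    by (cases "u = 0") (auto simp: cell_def)
next
  fix u assume u: "u \<in> (if i = 0 then {0..d} else {d * real i<..d * (real i + 1)})"
  show "u \<in> {u. 0 \<le> u \<and> cell d u = i}"
  proof (cases "i = 0")
    case True
    then have "0 \<le> u" "u \<le> d" using u by auto
    then show ?thesis using True cell_eqI[OF assms, of 0 u] by (cases "u = 0") (auto simp: cell_def)
  next
    case False
    then have *: "d * real i < u" "u \<le> d * (real i + 1)" using u by auto
    moreover have "0 \<le> d * real i" using assms by simp
    ultimately show ?thesis using cell_eqI[OF assms *] by (auto intro: less_imp_le order_le_less_trans)
  qed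
qed

lemma emeasure_cell:
  assumes "0 < d"
  shows "{u. 0 \<le> u \<and> cell d u = i} \<in> sets borel" "emeasure lborel {u. 0 \<le> u \<and> cell d u = i} = ennreal d"
  unfolding cell_interval[OF assms] using assms by (auto simp: algebra_simps)

lemma emeasure_cells:
  assumes "0 < d" "finite F"
  shows "{u. 0 \<le> u \<and> cell d u \<in> F} \<in> sets borel" "emeasure lborel {u. 0 \<le> u \<and> cell d u \<in> F} = ennreal (d * card F)"
proof -
  have e: "{u. 0 \<le> u \<and> cell d u \<in> F} = (\<Union>i\<in>F. {u. 0 \<le> u \<and> cell d u = i})" by auto
  show "{u. 0 \<le> u \<and> cell d u \<in> F} \<in> sets borel"
    unfolding e using emeasure_cell(1)[OF assms(1)] assms(2) by (intro sets.finite_UN) auto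
  have "emeasure lborel {u. 0 \<le> u \<and> cell d u \<in> F} = (\<Sum>i\<in>F. emeasure lborel {u. 0 \<le> u \<and> cell d u = i})"
    unfolding e by (rule sum_emeasure[symmetric])
      (use emeasure_cell(1)[OF assms(1)] assms(2) in \<open>auto simp: disjoint_family_on_def\<close>)
  also have "\<dots> = ennreal (d * card F)"
    using assms by (simp add: emeasure_cell sum_constant mult.commute ennreal_of_nat_eq_real_of_nat ennreal_mult[symmetric])
  finally show "emeasure lborel {u. 0 \<le> u \<and> cell d u \<in> F} = ennreal (d * card F)" .
qed

lemma cells_le_emeasure:
  assumes d: "0 < d" and sub: "{u. 0 \<le> u \<and> cell d u \<in> S} \<subseteq> T" and T: "T \<in> sets borel" and n: "enat n \<le> ecard S"
  shows "ennreal (d * n) \<le> emeasure lebesgue T"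
proof -
  have "\<exists>F\<subseteq>S. finite F \<and> card F = n"
  proof (cases "finite S")
    case True
    then show ?thesis using n obtain_subset_with_card_n[of n S] by (auto simp: ecard_def)
  next
    case False
    then show ?thesis using infinite_arbitrarily_large by (metis (no_types, lifting))
  qed
  then obtain F where F: "F \<subseteq> S" "finite F" "card F = n" by blast
  have "emeasure lborel {u. 0 \<le> u \<and> cell d u \<in> F} \<le> emeasure lborel T"
    by (rule emeasure_mono) (use sub F T in auto)
  then show ?thesis using emeasure_cells(2)[OF d F(2)] F(3) T by simp
qed

text \<open>\<open>T\<close> may be nonmeasurable, in which case its \<open>emeasure\<close> is 0;
  hence Euclidean iterates can be bounded by cells whatever the initial set.\<close>

lemma emeasure_le_cells:
  assumes d: "0 < d" and sub: "T \<subseteq> {u. 0 \<le> u \<and> cell d u \<in> F}" and F: "finite F"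
  shows "emeasure lebesgue T \<le> ennreal (d * card F)"
proof -
  have "emeasure lebesgue T \<le> emeasure lebesgue {u. 0 \<le> u \<and> cell d u \<in> F}"
    by (rule emeasure_mono[OF sub]) (use emeasure_cells(1)[OF d F] in auto)
  then show ?thesis using emeasure_cells[OF d F] by simp
qed

lemma emeasure_rectangle:
  fixes S T :: "real set"
  assumes "S \<in> sets borel" "T \<in> sets borel"
  shows "emeasure lborel (S \<times> T) = emeasure lborel S * emeasure lborel T"
  using lborel.emeasure_pair_measure_Times[of S lborel T] assms by (simp add: lborel_prod)

lemma card_boxes_le_emeasure:
  assumes d: "0 < d" and D: "finite D" and U: "U \<in> sets borel"
    and sub: "\<And>i j. (i, j) \<in> D \<Longrightarrow> {d * real i<..<d * (real i + 1)} \<times> {d * real j<..<d * (real j + 1)} \<subseteq> U"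
  shows "ennreal (d\<^sup>2 * card D) \<le> emeasure lborel U"
proof -
  define B where "B = (\<lambda>(i::nat, j::nat). {d * real i<..<d * (real i + 1)} \<times> {d * real j<..<d * (real j + 1)})"
  have cB: "cell d u = i \<and> cell d v = j" if "(u, v) \<in> B (i, j)" for u v i j
    using that d by (auto simp: B_def intro!: cell_eqI)
  have sB: "B p \<in> sets borel" for p :: "nat \<times> nat" by (cases p) (simp add: B_def borel_Times)
  have "emeasure lborel (B p) = ennreal (d\<^sup>2)" for p :: "nat \<times> nat"
    using d by (cases p) (simp add: B_def emeasure_rectangle algebra_simps power2_eq_square ennreal_mult)
  then have "ennreal (d\<^sup>2 * card D) = (\<Sum>p\<in>D. emeasure lborel (B p))"
    by (simp add: mult.commute ennreal_of_nat_eq_real_of_nat ennreal_mult[symmetric])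
  also have "\<dots> = emeasure lborel (\<Union>p\<in>D. B p)"
  proof (rule sum_emeasure)
    show "disjoint_family_on B D"
      unfolding disjoint_family_on_def
    proof (intro ballI impI)
      fix p q :: "nat \<times> nat" assume "p \<noteq> q"
      show "B p \<inter> B q = {}"
      proof (rule equals0I)
        fix z assume z: "z \<in> B p \<inter> B q"
        then have "p = q" using cB[of "fst z" "snd z" "fst p" "snd p"] cB[of "fst z" "snd z" "fst q" "snd q"]
          by (simp add: prod_eq_iff)
        then show False using \<open>p \<noteq> q\<close> by simp
      qed
    qed
  qed (use sB D in auto)
  also have "\<dots> \<le> emeasure lborel U"
    by (rule emeasure_mono) (use sub U in \<open>auto simp: B_def\<close>)
  finally show ?thesis .
qed

lemma emeasure_le_card_boxes:
  assumes d: "0 < d" and D: "finite D" and U: "U \<in> sets borel"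
    and sub: "U \<subseteq> (\<Union>(i, j)\<in>D. {d * real i..d * (real i + 1)} \<times> {d * real j..d * (real j + 1)})"
  shows "emeasure lborel U \<le> ennreal (d\<^sup>2 * card D)"
proof -
  define B where "B = (\<lambda>(i::nat, j::nat). {d * real i..d * (real i + 1)} \<times> {d * real j..d * (real j + 1)})"
  have sB: "B p \<in> sets borel" for p :: "nat \<times> nat" by (cases p) (simp add: B_def borel_Times)
  have "emeasure lborel U \<le> emeasure lborel (\<Union>p\<in>D. B p)"
    by (rule emeasure_mono) (use sub sB D in \<open>auto simp: B_def\<close>)
  also have "\<dots> \<le> (\<Sum>p\<in>D. emeasure lborel (B p))"
    by (rule emeasure_subadditive_finite) (use sB D in auto)
  also have "\<dots> = ennreal (d\<^sup>2 * card D)"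
  proof -
    have "emeasure lborel (B p) = ennreal (d\<^sup>2)" for p :: "nat \<times> nat"
      using d by (cases p) (simp add: B_def emeasure_rectangle algebra_simps power2_eq_square ennreal_mult)
    then show ?thesis by (simp add: mult.commute ennreal_of_nat_eq_real_of_nat ennreal_mult[symmetric])
  qed
  finally show ?thesis .
qed

subsection \<open>Measurability of the Euclidean dynamics\<close>

text \<open>\<open>admissible_fun\<close> gives monotonicity for nonnegative arguments only, so
  \<open>f\<close> is continued to the left by its value at 0.\<close>

lemma borel_measurable_admissible:
  assumes "admissible_fun f" shows "(\<lambda>v. f (max v 0)) \<in> borel_measurable borel"
proof -
  have "mono (\<lambda>v. - f (max v 0))"
  proof (rule monoI)
    fix v w :: real assume "v \<le> w"
    then have "f (max w 0) \<le> f (max v 0)" using assms unfolding admissible_fun_def by (meson max.cobounded2 max.mono order_refl)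
    then show "- f (max v 0) \<le> - f (max w 0)" by simp
  qed
  from borel_measurable_uminus[OF borel_measurable_mono[OF this]] show ?thesis by simp
qed

lemma section_borel:
  fixes A :: "(real \<times> real) set"
  assumes "A \<in> sets borel"
  shows "{s. (s, v) \<in> A} \<in> sets borel" "{t. (u, t) \<in> A} \<in> sets borel"
proof -
  have "(\<lambda>s. (s, v)) -` A \<inter> space borel \<in> sets borel" by (rule measurable_sets[OF _ assms]) measurable
  then show "{s. (s, v) \<in> A} \<in> sets borel" by (simp add: vimage_def)
  have "(\<lambda>s. (u, s)) -` A \<inter> space borel \<in> sets borel" by (rule measurable_sets[OF _ assms]) measurable
  then show "{t. (u, t) \<in> A} \<in> sets borel" by (simp add: vimage_def)
qed

lemma borel_measurable_ecol:
  assumes "A \<in> sets borel" shows "(\<lambda>u. emeasure lborel {t. (u, t) \<in> A}) \<in> borel_measurable (borel :: real measure)"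
proof -
  have "A \<in> sets (borel \<Otimes>\<^sub>M lborel)"
    using assms by (metis borel_prod sets_lborel sets_pair_measure_cong)
  from lborel.measurable_emeasure_Pair[OF this] show ?thesis by (simp add: vimage_def)
qed

lemma borel_measurable_erow:
  assumes "A \<in> sets borel" shows "(\<lambda>v. emeasure lborel {s. (s, v) \<in> A}) \<in> borel_measurable (borel :: real measure)"
proof -
  have "prod.swap -` A \<inter> space borel \<in> sets borel"
    by (rule measurable_sets[OF _ assms]) (auto intro!: borel_measurable_continuous_onI continuous_intros)
  then have "{(a, b). (b, a) \<in> A} \<in> sets borel" by (simp add: vimage_def prod.swap_def case_prod_unfold)
  from borel_measurable_ecol[OF this] show ?thesis by simp
qed

text \<open>A form suited to measurability and limits, since \<open>enn2real\<close> is measurable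
  and continuous at finite values. The quadrant matters because \<open>ennreal\<close> sends
  negative numbers to 0.\<close>

lemma notin_Z_iff:
  assumes "W \<subseteq> quadrant"
  shows "notin_Z W r c \<longleftrightarrow> \<not> (r < \<infinity> \<and> c < \<infinity> \<and> (enn2real r, enn2real c) \<in> W)"
proof -
  have "(\<exists>(a, b)\<in>W. r = ennreal a \<and> c = ennreal b) \<longleftrightarrow> r < \<infinity> \<and> c < \<infinity> \<and> (enn2real r, enn2real c) \<in> W"
  proof
    assume "\<exists>(a, b)\<in>W. r = ennreal a \<and> c = ennreal b"
    then obtain a b where ab: "(a, b) \<in> W" "r = ennreal a" "c = ennreal b" by blast
    then have "0 \<le> a" "0 \<le> b" using assms by (auto simp: quadrant_def)
    then show "r < \<infinity> \<and> c < \<infinity> \<and> (enn2real r, enn2real c) \<in> W" using ab by simp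
  next
    assume "r < \<infinity> \<and> c < \<infinity> \<and> (enn2real r, enn2real c) \<in> W"
    then show "\<exists>(a, b)\<in>W. r = ennreal a \<and> c = ennreal b"
      by (intro bexI[of _ "(enn2real r, enn2real c)"]) auto
  qed
  then show ?thesis unfolding notin_Z_def by simp
qed

lemma quadrant_borel: "quadrant \<in> sets borel"
proof -
  have e: "quadrant = {0..} \<times> {0..}" by (auto simp: quadrant_def)
  have "closed quadrant" unfolding e by (intro closed_Times closed_atLeast)
  then show ?thesis by simp
qed

text \<open>Measurability of the iterates is what makes continuity from below available for their
  rows and columns.\<close>

lemma ETstep_borel:
  assumes W: "closed W" "W \<subseteq> quadrant" and fg: "admissible_fun f" "admissible_fun g" and A: "A \<in> sets borel"
  shows "ETstep W f g A \<in> sets borel"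
proof -
  define r where "r v = emeasure lborel {s. (s, v) \<in> A} + ennreal (f (max v 0))" for v
  define c where "c u = emeasure lborel {t. (u, t) \<in> A} + ennreal (g (max u 0))" for u
  have [measurable]: "r \<in> borel_measurable borel" "c \<in> borel_measurable borel"
    unfolding r_def[abs_def] c_def[abs_def]
    by (intro borel_measurable_add borel_measurable_erow borel_measurable_ecol A
        measurable_compose[OF borel_measurable_admissible measurable_ennreal] fg)+
  have fs: "(fst :: real \<times> real \<Rightarrow> real) \<in> borel_measurable borel" "(snd :: real \<times> real \<Rightarrow> real) \<in> borel_measurable borel"
    by (auto intro!: borel_measurable_continuous_onI continuous_intros)
  define R where "R p = r (snd p)" for p :: "real \<times> real"
  define C where "C p = c (fst p)" for p :: "real \<times> real"
  have rc: "r \<in> borel_measurable borel" "c \<in> borel_measurable borel" by measurable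
  have [measurable]: "R \<in> borel_measurable borel" "C \<in> borel_measurable borel"
    unfolding R_def[abs_def] C_def[abs_def]
    by (rule measurable_compose[OF fs(2) rc(1)], rule measurable_compose[OF fs(1) rc(2)])
  define h where "h p = (enn2real (R p), enn2real (C p))" for p
  have [measurable]: "h \<in> borel_measurable borel"
    unfolding h_def[abs_def] by (rule borel_measurable_Pair) measurable
  have [measurable]: "W \<in> sets borel" using W(1) by simp
  define N where "N = {p. \<not> (R p < \<infinity> \<and> C p < \<infinity> \<and> h p \<in> W)}"
  have "{p \<in> space borel. \<not> (R p < \<infinity> \<and> C p < \<infinity> \<and> h p \<in> W)} \<in> sets borel"
    by measurable
  then have N: "N \<in> sets borel" by (simp add: N_def)
  have "erow (u, v) A = emeasure lborel {s. (s, v) \<in> A}" "ecol (u, v) A = emeasure lborel {t. (u, t) \<in> A}" for u v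
    using section_borel[OF A] by (simp_all add: erow_def ecol_def)
  then have "ETstep W f g A = A \<union> (quadrant \<inter> N)"
    unfolding ETstep_def N_def h_def R_def C_def r_def c_def notin_Z_iff[OF W(2)] quadrant_def by (auto simp: max_def)
  then show ?thesis using A N quadrant_borel by auto
qed

lemma ETstep_pow_borel:
  assumes "closed W" "W \<subseteq> quadrant" "admissible_fun f" "admissible_fun g" "A \<in> sets borel"
  shows "(ETstep W f g ^^ n) A \<in> sets borel"
  by (induction n) (use assms ETstep_borel in auto)

text \<open>Counterpart of \<open>stable_Union_Tstep\<close>. The line measures of the iterates
  increase to those of the union; if the site never grew, all these pairs of measures would lie in
  \<open>W\<close>, which is bounded and closed, and so would their limit.\<close>

lemma ETstep_Union_closed:
  assumes W: "low_set W" and fg: "admissible_fun f" "admissible_fun g" and A: "A \<in> sets borel"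
    and uv: "0 \<le> u" "0 \<le> v"
    and o: "notin_Z W (erow (u, v) (\<Union>n. (ETstep W f g ^^ n) A) + ennreal (f v)) (ecol (u, v) (\<Union>n. (ETstep W f g ^^ n) A) + ennreal (g u))"
  shows "(u, v) \<in> (\<Union>n. (ETstep W f g ^^ n) A)"
proof (rule ccontr)
  assume n: "(u, v) \<notin> (\<Union>n. (ETstep W f g ^^ n) A)"
  have Wc: "closed W" "bounded W" "W \<subseteq> quadrant" using W by (auto simp: low_set_def)
  define G where "G n = (ETstep W f g ^^ n) A" for n
  have Gb: "G n \<in> sets borel" for n unfolding G_def by (rule ETstep_pow_borel[OF Wc(1,3) fg A])
  have Gi: "incseq G" by (rule incseq_SucI) (auto simp: G_def ETstep_def)
  have r: "(\<lambda>n. erow (u, v) (G n) + ennreal (f v)) \<longlonglongrightarrow> erow (u, v) (\<Union>n. G n) + ennreal (f v)"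
  proof -
    have "(\<lambda>n. emeasure lborel {s. (s, v) \<in> G n}) \<longlonglongrightarrow> emeasure lborel (\<Union>n. {s. (s, v) \<in> G n})"
      by (rule Lim_emeasure_incseq) (use section_borel(1)[OF Gb] Gi[THEN incseqD] in \<open>auto simp: incseq_def subset_iff\<close>)
    moreover have "(\<Union>n. {s. (s, v) \<in> G n}) = {s. (s, v) \<in> (\<Union>n. G n)}" by auto
    moreover have "(\<Union>n. G n) \<in> sets borel" using Gb by auto
    ultimately have "(\<lambda>n. erow (u, v) (G n)) \<longlonglongrightarrow> erow (u, v) (\<Union>n. G n)"
      unfolding erow_def using section_borel(1)[OF Gb] section_borel(1)[of "\<Union>n. G n"] by simp
    then show ?thesis by (intro tendsto_add tendsto_const) auto
  qed
  have c: "(\<lambda>n. ecol (u, v) (G n) + ennreal (g u)) \<longlonglongrightarrow> ecol (u, v) (\<Union>n. G n) + ennreal (g u)"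
  proof -
    have "(\<lambda>n. emeasure lborel {s. (u, s) \<in> G n}) \<longlonglongrightarrow> emeasure lborel (\<Union>n. {s. (u, s) \<in> G n})"
      by (rule Lim_emeasure_incseq) (use section_borel(2)[OF Gb] Gi[THEN incseqD] in \<open>auto simp: incseq_def subset_iff\<close>)
    moreover have "(\<Union>n. {s. (u, s) \<in> G n}) = {s. (u, s) \<in> (\<Union>n. G n)}" by auto
    moreover have "(\<Union>n. G n) \<in> sets borel" using Gb by auto
    ultimately have "(\<lambda>n. ecol (u, v) (G n)) \<longlonglongrightarrow> ecol (u, v) (\<Union>n. G n)"
      unfolding ecol_def using section_borel(2)[OF Gb] section_borel(2)[of "\<Union>n. G n"] by simp
    then show ?thesis by (intro tendsto_add tendsto_const) auto
  qed
  define R where "R n = erow (u, v) (G n) + ennreal (f v)" for n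
  define C where "C n = ecol (u, v) (G n) + ennreal (g u)" for n
  have RC: "R n < \<infinity> \<and> C n < \<infinity> \<and> (enn2real (R n), enn2real (C n)) \<in> W" for n
  proof -
    have "(u, v) \<notin> G (Suc n)" unfolding G_def using n by blast
    then have "\<not> notin_Z W (R n) (C n)" using uv by (auto simp: G_def R_def C_def ETstep_def)
    then show ?thesis using notin_Z_iff[OF Wc(3)] by blast
  qed
  obtain K where K: "0 < K" "W \<subseteq> {0..K} \<times> {0..K}" by (rule low_set_bound[OF W])
  have le: "R n \<le> ennreal K" "C n \<le> ennreal K" for n
  proof -
    have "enn2real (R n) \<le> K" "enn2real (C n) \<le> K" using RC[of n] K by auto
    then have "ennreal (enn2real (R n)) \<le> ennreal K" "ennreal (enn2real (C n)) \<le> ennreal K" by (auto intro: ennreal_leI)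
    then show "R n \<le> ennreal K" "C n \<le> ennreal K" using RC[of n] by auto
  qed
  define R' where "R' = erow (u, v) (\<Union>n. G n) + ennreal (f v)"
  define C' where "C' = ecol (u, v) (\<Union>n. G n) + ennreal (g u)"
  have lim: "R \<longlonglongrightarrow> R'" "C \<longlonglongrightarrow> C'" using r c by (auto simp: R_def[abs_def] C_def[abs_def] R'_def C'_def)
  have "R' \<le> ennreal K" "C' \<le> ennreal K"
    using LIMSEQ_le_const2[OF lim(1)] LIMSEQ_le_const2[OF lim(2)] le by blast+
  then have fin: "R' < \<infinity>" "C' < \<infinity>" using ennreal_less_top le_less_trans by (metis infinity_ennreal_def)+
  have "(\<lambda>n. enn2real (R n)) \<longlonglongrightarrow> enn2real R'" "(\<lambda>n. enn2real (C n)) \<longlonglongrightarrow> enn2real C'"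
    using lim fin by (auto intro!: tendsto_enn2real)
  then have "(\<lambda>n. (enn2real (R n), enn2real (C n))) \<longlonglongrightarrow> (enn2real R', enn2real C')" by (rule tendsto_Pair)
  then have "(enn2real R', enn2real C') \<in> W"
    by (rule closed_sequentially[OF Wc(1), rotated]) (use RC in blast)
  then have "\<not> notin_Z W R' C'" using fin notin_Z_iff[OF Wc(3)] by blast
  then show False using o by (simp add: R'_def C'_def G_def)
qed

subsection \<open>From discrete to Euclidean configurations\<close>

lemma finite_support_bound:
  fixes f :: "nat \<Rightarrow> nat"
  assumes "finite {y. f y \<noteq> 0}"
  obtains m where "\<And>y. f y \<noteq> 0 \<Longrightarrow> y < m"
proof -
  obtain m where "\<forall>y\<in>{y. f y \<noteq> 0}. y < m" using assms unfolding finite_nat_set_iff_bounded by blast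
  then have "f y \<noteq> 0 \<Longrightarrow> y < m" for y by blast
  then show ?thesis by (rule that)
qed

lemma admissible_step:
  assumes f: "profile f" and d: "0 < d"
  shows "admissible_fun (\<lambda>v. d * real (f (cell d v)))"
  unfolding admissible_fun_def
proof (intro conjI allI impI)
  fix x :: real assume "0 \<le> x"
  then show "0 \<le> d * real (f (cell d x))" using d by simp
next
  fix x y :: real assume "0 \<le> x" "x \<le> y"
  then show "d * real (f (cell d y)) \<le> d * real (f (cell d x))"
    using cell_mono[OF d, of x y] f d by (auto simp: profile_def monotone_def)
next
  fix x :: real assume x: "0 < x"
  have "eventually (\<lambda>y. y \<in> {d * real (cell d x)<..<x}) (at_left x)"
    by (rule eventually_at_left_real[OF cell_less[OF d x]])
  then have "eventually (\<lambda>y. d * real (f (cell d y)) = d * real (f (cell d x))) (at_left x)"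
  proof eventually_elim
    case (elim y)
    then have "cell d y = cell d x" using le_cell[OF d, of x] by (intro cell_eqI[OF d]) auto
    then show ?case by simp
  qed
  then show "((\<lambda>v. d * real (f (cell d v))) \<longlongrightarrow> d * real (f (cell d x))) (at_left x)"
    by (rule tendsto_eventually)
next
  have "finite {y. f y \<noteq> 0}" using f by (simp add: profile_def)
  then obtain m where m: "\<And>y. f y \<noteq> 0 \<Longrightarrow> y < m" using finite_support_bound by blast
  have "d * real (f (cell d x)) = 0" if "d * (real m + 1) \<le> x" for x
  proof -
    have "d * (real m + 1) \<le> d * (real (cell d x) + 1)" using le_cell[OF d, of x] that by linarith
    then have "m \<le> cell d x" using d by simp
    then have "f (cell d x) = 0" using m[of "cell d x"] by auto
    then show ?thesis by simp
  qed
  then show "\<exists>K. \<forall>x\<ge>K. d * real (f (cell d x)) = 0" by blast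
qed

lemma integral_step:
  assumes f: "finite {y. f y \<noteq> 0}" and d: "0 < d"
  shows "integral {0..} (\<lambda>v. d * real (f (cell d v))) = d\<^sup>2 * real (total f)"
proof -
  obtain m where m: "\<And>y. f y \<noteq> 0 \<Longrightarrow> y < m" using finite_support_bound[OF f] by blast
  define J where "J j = {u. 0 \<le> u \<and> cell d u = j}" for j
  have "((\<lambda>u. if u \<in> J j then 1 else 0) has_integral d) {0..}" for j
  proof -
    have "((\<lambda>u. 1) has_integral measure lborel (J j)) (J j)"
      by (rule has_integral_measure_lborel) (use emeasure_cell[OF d, of j] in \<open>simp_all add: J_def\<close>)
    moreover have "measure lborel (J j) = d" using emeasure_cell(2)[OF d, of j] d by (simp add: measure_def J_def)
    moreover have "J j \<subseteq> {0..}" by (auto simp: J_def)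
    ultimately show ?thesis using has_integral_restrict[of "J j" "{0..}" "\<lambda>_. 1::real" d] by simp
  qed
  then have "((\<lambda>u. \<Sum>j<m. d * real (f j) * (if u \<in> J j then 1 else 0)) has_integral (\<Sum>j<m. d * real (f j) * d)) {0..}"
    by (intro has_integral_sum has_integral_mult_right) auto
  moreover have "(\<Sum>j<m. d * real (f j) * (if u \<in> J j then 1 else 0)) = d * real (f (cell d u))" if "u \<in> {0..}" for u
  proof -
    have "(\<Sum>j<m. d * real (f j) * (if u \<in> J j then 1 else 0)) = (\<Sum>j<m. if cell d u = j then d * real (f j) else 0)"
      by (rule sum.cong) (use that in \<open>auto simp: J_def\<close>)
    also have "\<dots> = (if cell d u \<in> {..<m} then d * real (f (cell d u)) else 0)" by (rule sum.delta'[simplified]) simp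
    also have "\<dots> = d * real (f (cell d u))" using m[of "cell d u"] by auto
    finally show ?thesis .
  qed
  ultimately have "((\<lambda>u. d * real (f (cell d u))) has_integral (\<Sum>j<m. d * real (f j) * d)) {0..}"
    using has_integral_cong[of "{0..}"] by (smt (verit, best))
  then have "integral {0..} (\<lambda>u. d * real (f (cell d u))) = (\<Sum>j<m. d * real (f j) * d)"
    by (rule integral_unique)
  also have "\<dots> = d\<^sup>2 * real (total f)"
    using total_eq[of "{..<m}" f] m by (simp add: sum_distrib_left power2_eq_square mult_ac)
  finally show ?thesis .
qed

definition cells :: "real \<Rightarrow> (nat \<times> nat) set \<Rightarrow> (real \<times> real) set" where
  "cells d S = {(u, v). 0 \<le> u \<and> 0 \<le> v \<and> (cell d u, cell d v) \<in> S}"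

definition boxes :: "real \<Rightarrow> (nat \<times> nat) set \<Rightarrow> (real \<times> real) set" where
  "boxes d S = (\<Union>(i, j)\<in>S. {d * real i..d * (real i + 1)} \<times> {d * real j..d * (real j + 1)})"

lemma cells_subset_boxes: "0 < d \<Longrightarrow> cells d S \<subseteq> boxes d S"
  using cell_le le_cell unfolding cells_def boxes_def by fastforce

lemma compact_boxes: "finite S \<Longrightarrow> compact (boxes d S)"
  unfolding boxes_def by (intro compact_UN) (auto intro!: compact_Times)

lemma boxes_subset_quadrant: "0 < d \<Longrightarrow> boxes d S \<subseteq> quadrant"
proof clarify
  fix a b assume d: "0 < d" and "(a, b) \<in> boxes d S"
  then obtain i j :: nat where "d * real i \<le> a" "d * real j \<le> b" by (auto simp: boxes_def)
  moreover have "0 \<le> d * real i" "0 \<le> d * real j" using d by auto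
  ultimately show "(a, b) \<in> quadrant" by (simp add: quadrant_def)
qed

lemma measure_boxes_le:
  assumes "0 < d" "finite S" shows "measure lborel (boxes d S) \<le> d\<^sup>2 * card S"
proof -
  have "emeasure lborel (boxes d S) \<le> ennreal (d\<^sup>2 * card S)"
    by (rule emeasure_le_card_boxes[OF assms]) (use compact_boxes[OF assms(2)] in \<open>auto simp: boxes_def compact_imp_closed\<close>)
  then show ?thesis using assms by (simp add: measure_def enn2real_leI)
qed

lemma discrete_count_le:
  assumes d: "0 < d" and sub: "{s. 0 \<le> s \<and> cell d s \<in> P} \<subseteq> T" and T: "T \<in> sets borel"
    and e: "emeasure lebesgue T + ennreal (d * real k) = ennreal a" "0 \<le> a"
  shows "\<exists>n. ecard P = enat n \<and> d * (real n + real k) \<le> a"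
proof -
  have *: "d * (real n + real k) \<le> a" if "enat n \<le> ecard P" for n
  proof -
    have "ennreal (d * real n) + ennreal (d * real k) \<le> ennreal a"
      unfolding e(1)[symmetric] by (intro add_right_mono cells_le_emeasure[OF d sub T that])
    then have "ennreal (d * (real n + real k)) \<le> ennreal a"
      using d by (simp add: distrib_left)
    then show ?thesis using e(2) by simp
  qed
  have "ecard P \<noteq> \<infinity>"
  proof
    assume "ecard P = \<infinity>"
    then have b: "d * (real n + real k) \<le> a" for n using * by simp
    obtain n where "a / d < real n" using reals_Archimedean2 by blast
    then have "a < d * real n" using d by (simp add: pos_divide_less_eq mult.commute)
    also have "\<dots> \<le> d * (real n + real k)" using d by simp
    finally show False using b[of n] by simp
  qed
  then obtain n where "ecard P = enat n" by auto
  then show ?thesis using * by auto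
qed

text \<open>The cells lying entirely in the Euclidean closure \<open>U\<close> form a stable set
  containing \<open>A\<close>: the measure of a line of \<open>U\<close> is at least
  \<open>d\<close> times the number of its cells in \<open>S\<close>, and boosts correspond
  exactly.\<close>

lemma Espans_of_fspans:
  assumes W: "low_set W" and d: "0 < d" and A: "finite A" and fg: "profile f" "profile g"
    and sp: "fspans (Zd d W) f g A"
  shows "Espans W (\<lambda>v. d * real (f (cell d v))) (\<lambda>v. d * real (g (cell d v))) (boxes d A)"
proof -
  let ?f = "\<lambda>v. d * real (f (cell d v))" and ?g = "\<lambda>v. d * real (g (cell d v))"
  have adm: "admissible_fun ?f" "admissible_fun ?g" using admissible_step fg d by auto
  have Wq: "closed W" "W \<subseteq> quadrant" using W by (auto simp: low_set_def)
  have Ab: "boxes d A \<in> sets borel" by (intro borel_closed compact_imp_closed compact_boxes A)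
  define U where "U = (\<Union>n. (ETstep W ?f ?g ^^ n) (boxes d A))"
  have Ub: "U \<in> sets borel" unfolding U_def using ETstep_pow_borel[OF Wq adm Ab] by auto
  have "(ETstep W ?f ?g ^^ 0) (boxes d A) \<subseteq> U" unfolding U_def by (rule UN_upper) simp
  then have AU: "boxes d A \<subseteq> U" by simp
  define S where "S = {(i, j). \<forall>u v. 0 \<le> u \<longrightarrow> 0 \<le> v \<longrightarrow> cell d u = i \<longrightarrow> cell d v = j \<longrightarrow> (u, v) \<in> U}"
  have "A \<subseteq> S"
  proof (clarsimp simp: S_def)
    fix u v :: real assume "(cell d u, cell d v) \<in> A" "0 \<le> u" "0 \<le> v"
    then have "(u, v) \<in> cells d A" by (simp add: cells_def)
    then show "(u, v) \<in> U" using cells_subset_boxes[OF d] AU by blast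
  qed
  moreover have "stable (Zd d W) f g S"
    unfolding stable_def
  proof (intro allI impI)
    fix i j assume o: "outside (Zd d W) (row (i, j) S + enat (f j)) (col (i, j) S + enat (g i))"
    have "(u, v) \<in> U" if uv: "0 \<le> u" "0 \<le> v" "cell d u = i" "cell d v = j" for u v
      unfolding U_def
    proof (rule ETstep_Union_closed[OF W adm Ab uv(1,2)], fold U_def, rule ccontr)
      assume "\<not> notin_Z W (erow (u, v) U + ennreal (?f v)) (ecol (u, v) U + ennreal (?g u))"
      then obtain a b where ab: "(a, b) \<in> W" "erow (u, v) U + ennreal (?f v) = ennreal a" "ecol (u, v) U + ennreal (?g u) = ennreal b"
        unfolding notin_Z_def by blast
      have ab0: "0 \<le> a" "0 \<le> b" using ab(1) Wq(2) by (auto simp: quadrant_def)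
      have "\<exists>n. ecard {i'. (i', j) \<in> S} = enat n \<and> d * (real n + real (f j)) \<le> a"
        by (rule discrete_count_le[OF d _ section_borel(1)[OF Ub, of v] _ ab0(1)])
          (use ab(2) uv in \<open>auto simp: erow_def S_def\<close>)
      then obtain n where n: "row (i, j) S = enat n" "d * (real n + real (f j)) \<le> a" by (auto simp: row_eq)
      have "\<exists>n. ecard {j'. (i, j') \<in> S} = enat n \<and> d * (real n + real (g i)) \<le> b"
        by (rule discrete_count_le[OF d _ section_borel(2)[OF Ub, of u] _ ab0(2)])
          (use ab(3) uv in \<open>auto simp: ecol_def S_def\<close>)
      then obtain n' where n': "col (i, j) S = enat n'" "d * (real n' + real (g i)) \<le> b" by (auto simp: col_eq)
      have "(d * real (n + f j), d * real (n' + g i)) \<in> W"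
        by (rule low_setD[OF W ab(1)]) (use n(2) n'(2) d in auto)
      then have "(n + f j, n' + g i) \<in> Zd d W" by (simp add: Zd_def)
      then show False using o n(1) n'(1) by (simp add: outside_enat)
    qed
    then show "(i, j) \<in> S" by (simp add: S_def)
  qed
  ultimately have "S = UNIV" using sp unfolding fspans_def by blast
  then have "(cell d u, cell d v) \<in> S" for u v by simp
  then have "quadrant \<subseteq> U" by (auto simp: quadrant_def S_def)
  then show ?thesis unfolding Espans_def U_def .
qed

subsection \<open>From Euclidean to discrete configurations\<close>

text \<open>For nonincreasing \<open>f\<close> the value at the left end bounds \<open>f\<close> on
  the whole cell, and rounding up preserves this (\<open>disc_fun_ge\<close>).\<close>

definition disc_fun :: "real \<Rightarrow> (real \<Rightarrow> real) \<Rightarrow> nat \<Rightarrow> nat" where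
  "disc_fun d f j = nat \<lceil>f (d * real j) / d\<rceil>"

lemma profile_disc_fun:
  assumes f: "admissible_fun f" and d: "0 < d"
  shows "profile (disc_fun d f)"
proof -
  have "antimono (disc_fun d f)"
  proof (rule antimonoI)
    fix j j' :: nat assume "j \<le> j'"
    then have "f (d * real j') \<le> f (d * real j)" using f d unfolding admissible_fun_def by simp
    then show "disc_fun d f j' \<le> disc_fun d f j"
      unfolding disc_fun_def using d by (intro nat_mono ceiling_mono divide_right_mono) auto
  qed
  moreover
  obtain K where "\<forall>x\<ge>K. f x = 0" using f unfolding admissible_fun_def by blast
  then have K: "f x = 0" if "K \<le> x" for x using that by blast
  obtain m where "K / d < real m" using reals_Archimedean2 by blast
  then have m: "K < d * real m" using d by (simp add: pos_divide_less_eq mult.commute)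
  have "disc_fun d f j = 0" if "m \<le> j" for j
  proof -
    have "d * real m \<le> d * real j" using that d by simp
    then have "f (d * real j) = 0" using K m by simp
    then show ?thesis by (simp add: disc_fun_def)
  qed
  then have "y < m" if "disc_fun d f y \<noteq> 0" for y using that by (cases "m \<le> y") auto
  then have "{y. disc_fun d f y \<noteq> 0} \<subseteq> {..<m}" by auto
  then have "finite {y. disc_fun d f y \<noteq> 0}" by (rule finite_subset) simp
  ultimately show ?thesis unfolding profile_def by blast
qed

lemma disc_fun_ge:
  assumes f: "admissible_fun f" and d: "0 < d" and v: "0 \<le> v"
  shows "f v \<le> d * real (disc_fun d f (cell d v))"
proof -
  have "f v \<le> f (d * real (cell d v))"
    using f cell_le[OF d v] d unfolding admissible_fun_def by simp
  moreover have "f (d * real (cell d v)) / d \<le> real (disc_fun d f (cell d v))"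
    unfolding disc_fun_def by linarith
  ultimately show ?thesis using d by (simp add: pos_divide_le_eq mult.commute)
qed

text \<open>If \<open>S\<close> is stable and contains all cells met by \<open>A\<close>, the
  Euclidean dynamics never leaves the union of the cells of \<open>S\<close>; as it covers the
  quadrant, \<open>S\<close> is everything.\<close>

lemma fspans_of_Espans:
  assumes W: "low_set W" and d: "0 < d" and A: "A \<subseteq> quadrant" and fg: "admissible_fun f" "admissible_fun g"
    and sp: "Espans W f g A"
  shows "fspans (Zd d W) (disc_fun d f) (disc_fun d g) (map_prod (cell d) (cell d) ` A)"
  unfolding fspans_def
proof (intro allI impI)
  fix S assume S: "map_prod (cell d) (cell d) ` A \<subseteq> S" "stable (Zd d W) (disc_fun d f) (disc_fun d g) S"
  have f0: "0 \<le> f v" "0 \<le> g v" if "0 \<le> v" for v using fg that unfolding admissible_fun_def by auto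
  have sub: "(ETstep W f g ^^ n) A \<subseteq> cells d S" for n
  proof (induction n)
    case 0
    then show ?case using A S(1) by (force simp: cells_def quadrant_def)
  next
    case (Suc n)
    let ?E = "(ETstep W f g ^^ n) A"
    have step: "(u, v) \<in> cells d S" if uv: "0 \<le> u" "0 \<le> v" and o: "notin_Z W (erow (u, v) ?E + ennreal (f v)) (ecol (u, v) ?E + ennreal (g u))" for u v
    proof (rule ccontr)
      let ?i = "cell d u" and ?j = "cell d v"
      assume "(u, v) \<notin> cells d S"
      then have "(?i, ?j) \<notin> S" using uv by (simp add: cells_def)
      then have "\<not> outside (Zd d W) (row (?i, ?j) S + enat (disc_fun d f ?j)) (col (?i, ?j) S + enat (disc_fun d g ?i))"
        using stableD[OF S(2)] by blast
      then obtain r c where rc: "(r, c) \<in> Zd d W" "row (?i, ?j) S + enat (disc_fun d f ?j) = enat r"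
        "col (?i, ?j) S + enat (disc_fun d g ?i) = enat c" unfolding outside_def by blast
      have fin: "finite {i. (i, ?j) \<in> S}" "finite {j. (?i, j) \<in> S}"
        using rc(2,3) by (auto simp: row_eq col_eq ecard_def split: if_splits)
      have r: "r = card {i. (i, ?j) \<in> S} + disc_fun d f ?j" "c = card {j. (?i, j) \<in> S} + disc_fun d g ?i"
        using rc(2,3) fin by (simp_all add: row_eq col_eq ecard_finite)
      have "erow (u, v) ?E \<le> ennreal (d * card {i. (i, ?j) \<in> S})"
        unfolding erow_def by (rule emeasure_le_cells[OF d _ fin(1)]) (use Suc in \<open>auto simp: cells_def\<close>)
      then have "erow (u, v) ?E + ennreal (f v) \<le> ennreal (d * card {i. (i, ?j) \<in> S}) + ennreal (d * disc_fun d f ?j)"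
        by (intro add_mono ennreal_leI disc_fun_ge fg d uv)
      also have "\<dots> = ennreal (d * real r)" using d by (simp add: r distrib_left)
      finally have 1: "erow (u, v) ?E + ennreal (f v) \<le> ennreal (d * real r)" .
      have "ecol (u, v) ?E \<le> ennreal (d * card {j. (?i, j) \<in> S})"
        unfolding ecol_def by (rule emeasure_le_cells[OF d _ fin(2)]) (use Suc in \<open>auto simp: cells_def\<close>)
      then have "ecol (u, v) ?E + ennreal (g u) \<le> ennreal (d * card {j. (?i, j) \<in> S}) + ennreal (d * disc_fun d g ?i)"
        by (intro add_mono ennreal_leI disc_fun_ge fg d uv)
      also have "\<dots> = ennreal (d * real c)" using d by (simp add: r distrib_left)
      finally have 2: "ecol (u, v) ?E + ennreal (g u) \<le> ennreal (d * real c)" .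
      let ?r = "erow (u, v) ?E + ennreal (f v)" and ?c = "ecol (u, v) ?E + ennreal (g u)"
      have fin: "?r < \<infinity>" "?c < \<infinity>"
        using le_less_trans[OF 1 ennreal_less_top] le_less_trans[OF 2 ennreal_less_top] by simp_all
      have le: "enn2real ?r \<le> d * real r" "enn2real ?c \<le> d * real c"
        by (rule enn2real_leI[OF _ 1], use d in simp, rule enn2real_leI[OF _ 2], use d in simp)
      have "(d * real r, d * real c) \<in> W" using rc(1) by (simp add: Zd_def)
      then have "(enn2real ?r, enn2real ?c) \<in> W"
        by (rule low_setD[OF W _ enn2real_nonneg le(1) enn2real_nonneg le(2)])
      then show False using o fin notin_Z_iff[of W] W by (auto simp: low_set_def)
    qed
    have "ETstep W f g ?E \<subseteq> cells d S"
      unfolding ETstep_def[of W f g ?E] using Suc step by blast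
    then show ?case by simp
  qed
  have full: "quadrant \<subseteq> cells d S"
    by (rule order_trans[OF sp[unfolded Espans_def] UN_least[OF sub]])
  have "(i, j) \<in> S" for i j
  proof -
    have "(d * (real i + 1), d * (real j + 1)) \<in> quadrant" using d by (simp add: quadrant_def)
    then have "(d * (real i + 1), d * (real j + 1)) \<in> cells d S" using full by blast
    moreover have "cell d (d * (real i + 1)) = i" "cell d (d * (real j + 1)) = j"
      using d by (auto intro!: cell_eqI)
    ultimately show ?thesis by (simp add: cells_def)
  qed
  then show "S = UNIV" by auto
qed

text \<open>A left-end Riemann sum of a nonincreasing function exceeds the integral by at most
  \<open>d * f 0\<close>, and rounding up costs at most \<open>d^2\<close> on each of about
  \<open>K / d\<close> cells.\<close>

lemma total_disc_fun_le:
  assumes f: "admissible_fun f" and K: "0 \<le> K" "\<And>x. K \<le> x \<Longrightarrow> f x = 0" and d: "0 < d"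
  shows "d\<^sup>2 * real (total (disc_fun d f)) \<le> integral {0..} f + d * (f 0 + K + d)"
proof -
  define n where "n = nat \<lceil>K / d\<rceil>"
  have "K / d \<le> real n" "real n \<le> K / d + 1" using K(1) d unfolding n_def by (auto simp: of_nat_nat)
  then have n: "K \<le> d * real n" "d * real n \<le> K + d"
    using d by (simp_all add: pos_divide_le_eq mult.commute field_simps)
  have anti: "f y \<le> f x" if "0 \<le> x" "x \<le> y" for x y using f that unfolding admissible_fun_def by auto
  have f0: "0 \<le> f x" if "0 \<le> x" for x using f that unfolding admissible_fun_def by auto
  have int: "f integrable_on {a..b}" if "0 \<le> a" for a b
  proof -
    have "(\<lambda>x. - f x) integrable_on {a..b}"
      by (rule integrable_on_mono_on) (use anti that in \<open>auto simp: mono_on_def\<close>)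
    then show ?thesis by (simp add: integrable_neg_iff)
  qed
  have "total (disc_fun d f) = sum (disc_fun d f) {..<n}"
  proof (rule total_eq)
    fix y assume "disc_fun d f y \<noteq> 0"
    then have "f (d * real y) \<noteq> 0" by (auto simp: disc_fun_def)
    then have "d * real y < K" using K(2) not_le by blast
    then have "d * real y < d * real n" using n by linarith
    then show "y \<in> {..<n}" using d by simp
  qed simp
  then have "d\<^sup>2 * real (total (disc_fun d f)) = (\<Sum>j<n. d\<^sup>2 * real (disc_fun d f j))"
    by (simp add: sum_distrib_left)
  also have "\<dots> \<le> (\<Sum>j<n. d * f (d * real j) + d\<^sup>2)"
  proof (rule sum_mono)
    fix j
    have "0 \<le> f (d * real j) / d" using f0[of "d * real j"] d by simp
    then have "real (disc_fun d f j) \<le> f (d * real j) / d + 1" unfolding disc_fun_def by linarith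
    then have "d\<^sup>2 * real (disc_fun d f j) \<le> d\<^sup>2 * (f (d * real j) / d + 1)" by (intro mult_left_mono) auto
    also have "\<dots> = d * f (d * real j) + d\<^sup>2" using d by (simp add: field_simps power2_eq_square)
    finally show "d\<^sup>2 * real (disc_fun d f j) \<le> d * f (d * real j) + d\<^sup>2" .
  qed
  also have "\<dots> = (\<Sum>j<n. d * f (d * real j)) + d * (d * real n)" by (simp add: sum.distrib power2_eq_square)
  also have "\<dots> \<le> (\<Sum>j<n. d * f (d * real j)) + d * (K + d)" using n(2) d by simp
  also have "(\<Sum>j<n. d * f (d * real j)) \<le> (\<Sum>j<Suc n. d * f (d * real j))"
    using f0[of "d * real n"] d by simp
  also have "\<dots> \<le> d * f 0 + integral {0..d * real n} f"
  proof (induction n)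
    case (Suc n)
    have "integral {0..d * real (Suc n)} f = integral {0..d * real n} f + integral {d * real n..d * real (Suc n)} f"
      by (rule Henstock_Kurzweil_Integration.integral_combine[symmetric]) (use d int in auto)
    moreover have "integral {d * real n..d * real (Suc n)} (\<lambda>_. f (d * real (Suc n))) \<le> integral {d * real n..d * real (Suc n)} f"
    proof (rule integral_le)
      show "f integrable_on {d * real n..d * real (Suc n)}" by (rule int) (use d in simp)
      fix x assume x: "x \<in> {d * real n..d * real (Suc n)}"
      have "0 \<le> d * real n" using d by simp
      then show "f (d * real (Suc n)) \<le> f x" using x by (intro anti) auto
    qed auto
    then have "d * f (d * real (Suc n)) \<le> integral {d * real n..d * real (Suc n)} f"
      using d by (simp add: algebra_simps)
    ultimately show ?case using Suc by simp
  qed simp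
  also have "integral {0..d * real n} f = integral {0..} f"
  proof -
    have "integral {0..} f = integral {0..} (\<lambda>x. if x \<in> {0..d * real n} then f x else 0)"
      by (rule integral_cong) (use K(2) n(1) in auto)
    also have "\<dots> = integral {0..d * real n} f"
      by (rule integral_unique, subst has_integral_restrict) (use int[of 0 "d * real n"] in auto)
    finally show ?thesis ..
  qed
  finally show ?thesis using d by (simp add: algebra_simps)
qed

subsection \<open>The Euclidean cost as a limit of discrete costs\<close>

definition costsE :: "bool \<Rightarrow> real \<Rightarrow> real \<Rightarrow> (real \<times> real) set \<Rightarrow> real set" where
  "costsE \<tau> \<alpha> \<beta> W = {measure lborel A + (1 - \<alpha>) * integral {0..} f + (1 - \<beta>) * integral {0..} g | A f g.
     compact A \<and> A \<subseteq> quadrant \<and> admissible_fun f \<and> admissible_fun g \<and> (\<tau> \<longrightarrow> A = {}) \<and> Espans W f g A}"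

text \<open>Real-valued form of \<open>It_bdd\<close> for \<open>\<tau> = False\<close> and, at
  \<alpha> = \<beta> = 0, of \<open>gt_thin_bdd\<close> for \<open>\<tau> = True\<close>.\<close>

definition ItR :: "bool \<Rightarrow> real \<Rightarrow> real \<Rightarrow> (real \<times> real) set \<Rightarrow> real" where
  "ItR \<tau> \<alpha> \<beta> W = Inf (costsE \<tau> \<alpha> \<beta> W)"

lemma integral_admissible_nonneg:
  assumes "admissible_fun f" shows "0 \<le> integral {0..} f"
proof (cases "f integrable_on {0..}")
  case True
  then show ?thesis using assms by (intro integral_nonneg) (auto simp: admissible_fun_def)
qed (simp add: not_integrable_integral)

lemma costsE_nonneg: "\<alpha> \<le> 1 \<Longrightarrow> \<beta> \<le> 1 \<Longrightarrow> x \<in> costsE \<tau> \<alpha> \<beta> W \<Longrightarrow> 0 \<le> x"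
  by (auto simp: costsE_def intro!: add_nonneg_nonneg mult_nonneg_nonneg integral_admissible_nonneg)

lemma bdd_below_costsE: "\<alpha> \<le> 1 \<Longrightarrow> \<beta> \<le> 1 \<Longrightarrow> bdd_below (costsE \<tau> \<alpha> \<beta> W)"
  using costsE_nonneg by (meson bdd_belowI)

lemma costsE_le_of_fspans:
  assumes W: "low_set W" and d: "0 < d" and ab: "\<alpha> \<le> 1" "\<beta> \<le> 1"
    and *: "finite A" "profile f" "profile g" "\<tau> \<Longrightarrow> A = {}" "fspans (Zd d W) f g A"
  shows "\<exists>x\<in>costsE \<tau> \<alpha> \<beta> W. x \<le> d\<^sup>2 * (real (card A) + (1 - \<alpha>) * real (total f) + (1 - \<beta>) * real (total g))"
proof -
  let ?f = "\<lambda>v. d * real (f (cell d v))" and ?g = "\<lambda>v. d * real (g (cell d v))"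
  let ?x = "measure lborel (boxes d A) + (1 - \<alpha>) * integral {0..} ?f + (1 - \<beta>) * integral {0..} ?g"
  have "?x \<in> costsE \<tau> \<alpha> \<beta> W"
    unfolding costsE_def mem_Collect_eq
  proof (intro exI conjI impI)
    show "compact (boxes d A)" by (rule compact_boxes[OF *(1)])
    show "boxes d A \<subseteq> quadrant" by (rule boxes_subset_quadrant[OF d])
    show "boxes d A = {}" if \<tau> using *(4)[OF that] by (simp add: boxes_def)
    show "Espans W ?f ?g (boxes d A)" by (rule Espans_of_fspans[OF W d *(1,2,3,5)])
  qed (use admissible_step * d in auto)
  moreover have "integral {0..} ?f = d\<^sup>2 * total f" "integral {0..} ?g = d\<^sup>2 * total g"
    by (rule integral_step[OF _ d]; use * in \<open>simp add: profile_def\<close>)+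
  then have "?x \<le> d\<^sup>2 * (real (card A) + (1 - \<alpha>) * real (total f) + (1 - \<beta>) * real (total g))"
    using measure_boxes_le[OF d *(1)] by (simp add: algebra_simps)
  ultimately show ?thesis by blast
qed

lemma costsE_nonempty:
  assumes W: "low_set W" and ab: "\<alpha> \<le> 1" "\<beta> \<le> 1"
  shows "costsE \<tau> \<alpha> \<beta> W \<noteq> {}"
proof -
  have Z: "down_closed (Zd 1 W)" "finite (Zd 1 W)" using down_closed_Zd finite_Zd W by auto
  show ?thesis
    using costsE_le_of_fspans[OF W _ ab _ profile_width[OF Z] profile_0 _ fspans_width[OF Z], of \<tau>] by auto
qed

text \<open>Cell configurations are genuine Euclidean ones, so there is no error term: the
  inequality holds at every mesh and not only in the limit.\<close>

lemma ItR_le_Enh: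
  assumes W: "low_set W" and d: "0 < d" and ab: "\<alpha> \<le> 1" "\<beta> \<le> 1"
  shows "ItR \<tau> \<alpha> \<beta> W \<le> d\<^sup>2 * Enh \<tau> \<alpha> \<beta> (Zd d W)"
proof -
  have "ItR \<tau> \<alpha> \<beta> W / d\<^sup>2 \<le> Enh \<tau> \<alpha> \<beta> (Zd d W)"
  proof (rule Enh_greatest[OF down_closed_Zd[OF W d] finite_Zd[OF W d]])
    fix A f g assume *: "finite A" "profile f" "profile g" "\<tau> \<Longrightarrow> A = {}" "fspans (Zd d W) f g A"
    then obtain x where x: "x \<in> costsE \<tau> \<alpha> \<beta> W" "x \<le> d\<^sup>2 * (real (card A) + (1 - \<alpha>) * real (total f) + (1 - \<beta>) * real (total g))"
      using costsE_le_of_fspans[OF W d ab] by blast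
    have "ItR \<tau> \<alpha> \<beta> W \<le> x" unfolding ItR_def by (rule cInf_lower[OF x(1) bdd_below_costsE[OF ab]])
    then show "ItR \<tau> \<alpha> \<beta> W / d\<^sup>2 \<le> real (card A) + (1 - \<alpha>) * real (total f) + (1 - \<beta>) * real (total g)"
      using x(2) d by (simp add: pos_divide_le_eq mult.commute)
  qed
  then show ?thesis using d by (simp add: pos_divide_le_eq mult.commute)
qed

lemma eventually_at_right_0_less: "0 < r \<Longrightarrow> eventually (\<lambda>d::real. 0 < d \<and> d < r) (at_right 0)"
  using eventually_at_right_real[of 0 r] by (auto elim: eventually_mono)

text \<open>Outer regularity gives an open \<open>U\<close> around \<open>A\<close> of almost the
  same area, and compactness an \<open>r\<close>-neighbourhood of \<open>A\<close> inside
  \<open>U\<close>; cells of side below \<open>r / 2\<close> that meet \<open>A\<close> have their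
  interior in \<open>U\<close>.\<close>

lemma eventually_card_cells_less:
  assumes A: "compact A" "A \<subseteq> quadrant" and e: "0 < e"
  shows "eventually (\<lambda>d. 0 < d \<and> finite (map_prod (cell d) (cell d) ` A) \<and>
     d\<^sup>2 * real (card (map_prod (cell d) (cell d) ` A)) \<le> measure lborel A + e) (at_right 0)"
proof -
  have Ab: "A \<in> sets borel" by (rule borel_closed[OF compact_imp_closed[OF A(1)]])
  have Af: "emeasure lborel A < \<infinity>" using A emeasure_compact_finite by auto
  obtain U where U: "open U" "A \<subseteq> U" "emeasure lebesgue (U - A) < ennreal e"
    using sets_lebesgue_outer_open[of A e] Ab e by (metis lborelD sets_completionI_sets sets_lborel)
  have Ub: "U \<in> sets borel" using U(1) by simp
  have "emeasure lborel U = emeasure lborel (A \<union> (U - A))" using U(2) by (simp add: Un_absorb1)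
  also have "\<dots> \<le> emeasure lborel A + emeasure lborel (U - A)"
    by (rule emeasure_subadditive) (use Ab Ub in auto)
  also have "\<dots> \<le> ennreal (measure lborel A) + ennreal e"
    using U(3) Ab Ub Af by (intro add_mono) (auto simp: emeasure_eq_ennreal_measure less_top[symmetric])
  finally have mU: "emeasure lborel U \<le> ennreal (measure lborel A + e)" using e by simp
  obtain r where r: "0 < r" "(\<Union>x\<in>A. ball x r) \<subseteq> U"
    using compact_subset_open_imp_ball_epsilon_subset[OF A(1) U(1,2)] by blast
  obtain K where K: "\<And>x. x \<in> A \<Longrightarrow> norm x \<le> K" using compact_imp_bounded[OF A(1)] bounded_iff by metis
  have "eventually (\<lambda>d. 0 < d \<and> d < r / 2) (at_right 0)" using r by (intro eventually_at_right_0_less) simp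
  then show ?thesis
  proof eventually_elim
    case (elim d)
    then have d: "0 < d" by simp
    let ?D = "map_prod (cell d) (cell d) ` A"
    have "?D \<subseteq> {..cell d K} \<times> {..cell d K}"
    proof clarsimp
      fix a b assume "(a, b) \<in> A"
      then have "a \<le> K" "b \<le> K" using K[of "(a, b)"] norm_fst_le[of a b] norm_snd_le[of b a] by fastforce+
      then show "cell d a \<le> cell d K \<and> cell d b \<le> cell d K" using cell_mono[OF d] by blast
    qed
    then have fin: "finite ?D" by (rule finite_subset) simp
    have "ennreal (d\<^sup>2 * card ?D) \<le> emeasure lborel U"
    proof (rule card_boxes_le_emeasure[OF d fin Ub])
      fix i j assume "(i, j) \<in> ?D"
      then obtain u v where uv: "(u, v) \<in> A" "i = cell d u" "j = cell d v" by auto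
      have uv0: "0 \<le> u" "0 \<le> v" using uv A(2) by (auto simp: quadrant_def)
      show "{d * real i<..<d * (real i + 1)} \<times> {d * real j<..<d * (real j + 1)} \<subseteq> U"
      proof clarify
        fix a b assume ab: "a \<in> {d * real i<..<d * (real i + 1)}" "b \<in> {d * real j<..<d * (real j + 1)}"
        have "\<bar>u - a\<bar> \<le> d" "\<bar>v - b\<bar> \<le> d"
          using ab cell_le[OF d uv0(1)] le_cell[OF d, of u] cell_le[OF d uv0(2)] le_cell[OF d, of v] uv
          by (auto simp: algebra_simps)
        moreover have "dist (u, v) (a, b) \<le> \<bar>u - a\<bar> + \<bar>v - b\<bar>"
          unfolding dist_Pair_Pair dist_real_def using sqrt_sum_squares_le_sum_abs by simp
        ultimately have "(a, b) \<in> ball (u, v) r" using elim by simp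
        then show "(a, b) \<in> U" using r(2) uv(1) by blast
      qed
    qed
    then have "ennreal (d\<^sup>2 * card ?D) \<le> ennreal (measure lborel A + e)" using mU by (rule order_trans)
    then have "d\<^sup>2 * card ?D \<le> measure lborel A + e"
      using e by (subst (asm) ennreal_le_iff) (auto intro: add_nonneg_nonneg)
    then show ?case using d fin by simp
  qed
qed

lemma eventually_total_disc_fun_le:
  assumes f: "admissible_fun f" and e: "0 < e"
  shows "eventually (\<lambda>d. d\<^sup>2 * real (total (disc_fun d f)) \<le> integral {0..} f + e) (at_right 0)"
proof -
  obtain K0 where K0: "\<forall>x\<ge>K0. f x = 0" using f unfolding admissible_fun_def by blast
  define K where "K = max K0 0"
  have K: "0 \<le> K" "\<And>x. K \<le> x \<Longrightarrow> f x = 0" using K0 by (auto simp: K_def)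
  have "((\<lambda>d. d * (f 0 + K + d)) \<longlongrightarrow> 0 * (f 0 + K + 0)) (at_right 0)" by (intro tendsto_intros)
  then have "eventually (\<lambda>d. d * (f 0 + K + d) < e) (at_right 0)" using e by (intro order_tendstoD(2)) auto
  then show ?thesis using eventually_at_right_0_less[OF zero_less_one]
  proof eventually_elim
    case (elim d)
    then show ?case using total_disc_fun_le[OF f K, of d] by linarith
  qed
qed

lemma eventually_Enh_less:
  assumes W: "low_set W" and ab: "\<alpha> \<in> {0..1}" "\<beta> \<in> {0..1}" and e: "0 < e"
  shows "eventually (\<lambda>d. d\<^sup>2 * Enh \<tau> \<alpha> \<beta> (Zd d W) < ItR \<tau> \<alpha> \<beta> W + e) (at_right 0)"
proof -
  have ab1: "\<alpha> \<le> 1" "\<beta> \<le> 1" using ab by auto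
  obtain x where x: "x \<in> costsE \<tau> \<alpha> \<beta> W" "x < ItR \<tau> \<alpha> \<beta> W + e / 4"
    using cInf_lessD[OF costsE_nonempty[OF W ab1, of \<tau>], of "ItR \<tau> \<alpha> \<beta> W + e / 4"] e by (auto simp: ItR_def)
  then obtain A f g where *: "compact A" "A \<subseteq> quadrant" "admissible_fun f" "admissible_fun g" "\<tau> \<Longrightarrow> A = {}" "Espans W f g A"
    and x': "x = measure lborel A + (1 - \<alpha>) * integral {0..} f + (1 - \<beta>) * integral {0..} g"
    by (auto simp: costsE_def)
  have e4: "0 < e / 4" using e by simp
  show ?thesis
    using eventually_card_cells_less[OF *(1,2) e4] eventually_total_disc_fun_le[OF *(3) e4] eventually_total_disc_fun_le[OF *(4) e4]
  proof eventually_elim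
    case (elim d)
    then have d: "0 < d" by simp
    let ?D = "map_prod (cell d) (cell d) ` A"
    have "Enh \<tau> \<alpha> \<beta> (Zd d W) \<le> real (card ?D) + (1 - \<alpha>) * real (total (disc_fun d f)) + (1 - \<beta>) * real (total (disc_fun d g))"
    proof (rule Enh_le[OF ab1])
      show "fspans (Zd d W) (disc_fun d f) (disc_fun d g) ?D" by (rule fspans_of_Espans[OF W d *(2,3,4,6)])
    qed (use elim * d profile_disc_fun in auto)
    then have "d\<^sup>2 * Enh \<tau> \<alpha> \<beta> (Zd d W) \<le> d\<^sup>2 * (real (card ?D) + (1 - \<alpha>) * real (total (disc_fun d f)) + (1 - \<beta>) * real (total (disc_fun d g)))"
      by (intro mult_left_mono) auto
    also have "\<dots> = d\<^sup>2 * real (card ?D) + (1 - \<alpha>) * (d\<^sup>2 * real (total (disc_fun d f))) + (1 - \<beta>) * (d\<^sup>2 * real (total (disc_fun d g)))"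
      by (simp add: algebra_simps)
    also have "\<dots> \<le> (measure lborel A + e / 4) + (1 - \<alpha>) * (integral {0..} f + e / 4) + (1 - \<beta>) * (integral {0..} g + e / 4)"
      using elim ab by (intro add_mono mult_left_mono) auto
    also have "\<dots> = x + (e / 4 + (1 - \<alpha>) * (e / 4) + (1 - \<beta>) * (e / 4))" by (simp add: x' algebra_simps)
    also have "\<dots> \<le> x + (e / 4 + 1 * (e / 4) + 1 * (e / 4))"
      using ab e by (intro add_mono mult_right_mono order_refl) auto
    finally show ?case using x(2) by simp
  qed
qed

lemma Enh_tendsto_ItR:
  assumes W: "low_set W" and ab: "\<alpha> \<in> {0..1}" "\<beta> \<in> {0..1}"
  shows "((\<lambda>d. d\<^sup>2 * Enh \<tau> \<alpha> \<beta> (Zd d W)) \<longlongrightarrow> ItR \<tau> \<alpha> \<beta> W) (at_right 0)"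
proof (rule order_tendstoI)
  fix a assume "a < ItR \<tau> \<alpha> \<beta> W"
  show "eventually (\<lambda>d. a < d\<^sup>2 * Enh \<tau> \<alpha> \<beta> (Zd d W)) (at_right 0)"
    using eventually_at_right_0_less[OF zero_less_one]
  proof eventually_elim
    case (elim d)
    then show ?case using ItR_le_Enh[OF W, of d \<alpha> \<beta> \<tau>] ab \<open>a < ItR \<tau> \<alpha> \<beta> W\<close> by auto
  qed
next
  fix a assume "ItR \<tau> \<alpha> \<beta> W < a"
  then show "eventually (\<lambda>d. d\<^sup>2 * Enh \<tau> \<alpha> \<beta> (Zd d W) < a) (at_right 0)"
    using eventually_Enh_less[OF W ab, of "a - ItR \<tau> \<alpha> \<beta> W" \<tau>] by simp
qed

lemma measure_le_card_Zd:
  assumes W: "low_set W" and d: "0 < d"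
  shows "measure lborel W \<le> d\<^sup>2 * card (Zd d W)"
proof -
  have "W \<subseteq> cells d (Zd d W)"
  proof clarify
    fix u v assume uv: "(u, v) \<in> W"
    then have uv0: "0 \<le> u" "0 \<le> v" using W by (auto simp: low_set_def quadrant_def)
    have "(d * cell d u, d * cell d v) \<in> W"
      by (rule low_setD[OF W uv]) (use d cell_le[OF d] uv0 in auto)
    then show "(u, v) \<in> cells d (Zd d W)" using uv0 by (simp add: cells_def Zd_def)
  qed
  also have "\<dots> \<subseteq> boxes d (Zd d W)" by (rule cells_subset_boxes[OF d])
  finally have "emeasure lborel W \<le> emeasure lborel (boxes d (Zd d W))"
    by (rule emeasure_mono) (use compact_boxes[OF finite_Zd[OF W d], of d] in \<open>auto simp: compact_imp_closed\<close>)
  moreover have "emeasure lborel (boxes d (Zd d W)) < \<infinity>"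
    using emeasure_compact_finite[OF compact_boxes[OF finite_Zd[OF W d]]] by auto
  ultimately have "measure lborel W \<le> measure lborel (boxes d (Zd d W))"
    by (simp add: measure_def enn2real_mono)
  then show ?thesis using measure_boxes_le[OF d finite_Zd[OF W d]] by linarith
qed

text \<open>Lattice points off the axes are upper right corners of cells whose interior lies in
  \<open>W\<close>; only the at most \<open>2 * n\<close> points on the axes are not accounted for
  by area.\<close>

lemma card_Zd_le:
  assumes W: "low_set W" and K: "W \<subseteq> {0..K} \<times> {0..K}" "0 < K" and d: "0 < d"
  shows "d\<^sup>2 * card (Zd d W) \<le> measure lborel W + 2 * d * (K + d)"
proof -
  let ?Z = "Zd d W"
  define n where "n = nat \<lfloor>K / d\<rfloor> + 1"
  have n: "d * real n \<le> K + d" "K < d * real n"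
  proof -
    have "real n \<le> K / d + 1" "K / d < real n" using K(2) d unfolding n_def by (auto simp: of_nat_nat) linarith
    then show "d * real n \<le> K + d" "K < d * real n" using d by (simp_all add: field_simps)
  qed
  have ZR: "?Z \<subseteq> Rect n n" by (rule Zd_subset_Rect[OF K(1) d n(2)])
  define D where "D = {(i, j). (Suc i, Suc j) \<in> ?Z}"
  have fD: "finite D" using ZR by (intro finite_subset[OF _ finite_Rect[of n n]]) (auto simp: D_def Rect_def)
  have "?Z \<subseteq> map_prod Suc Suc ` D \<union> ({0} \<times> {..<n} \<union> {..<n} \<times> {0})"
  proof
    fix p assume p: "p \<in> ?Z"
    obtain i j where ij: "p = (i, j)" by (cases p)
    have "i < n" "j < n" using ZR p ij by (auto simp: Rect_def)
    then show "p \<in> map_prod Suc Suc ` D \<union> ({0} \<times> {..<n} \<union> {..<n} \<times> {0})"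
      using p by (cases i; cases j) (force simp: D_def ij)+
  qed
  then have "card ?Z \<le> card (map_prod Suc Suc ` D \<union> ({0} \<times> {..<n} \<union> {..<n} \<times> {0}))"
    by (rule card_mono[rotated]) (use fD in auto)
  also have "\<dots> \<le> card (map_prod Suc Suc ` D) + (card ({0::nat} \<times> {..<n}) + card ({..<n} \<times> {0::nat}))"
    by (rule order_trans[OF card_Un_le add_left_mono[OF card_Un_le]])
  also have "\<dots> \<le> card D + 2 * n" using card_image_le[OF fD, of "map_prod Suc Suc"] by simp
  finally have c: "real (card ?Z) \<le> real (card D) + 2 * real n" by linarith
  have "ennreal (d\<^sup>2 * card D) \<le> emeasure lborel W"
  proof (rule card_boxes_le_emeasure[OF d fD])
    show "W \<in> sets borel" using W by (auto simp: low_set_def)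
    fix i j assume "(i, j) \<in> D"
    then have ij: "(d * real (Suc i), d * real (Suc j)) \<in> W" by (simp add: D_def Zd_def)
    show "{d * real i<..<d * (real i + 1)} \<times> {d * real j<..<d * (real j + 1)} \<subseteq> W"
    proof clarify
      fix a b assume ab: "a \<in> {d * real i<..<d * (real i + 1)}" "b \<in> {d * real j<..<d * (real j + 1)}"
      have "0 \<le> d * real i" "0 \<le> d * real j" using d by auto
      then have "0 \<le> a" "0 \<le> b" using ab by (meson greaterThanLessThan_iff less_imp_le order_trans)+
      then show "(a, b) \<in> W" using ab by (intro low_setD[OF W ij]) (auto simp: algebra_simps)
    qed
  qed
  moreover have "emeasure lborel W < \<infinity>"
    using W emeasure_bounded_finite[of W] by (auto simp: low_set_def)
  ultimately have "d\<^sup>2 * card D \<le> measure lborel W"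
    by (simp add: emeasure_eq_ennreal_measure less_top[symmetric])
  moreover have "d\<^sup>2 * card ?Z \<le> d\<^sup>2 * (real (card D) + 2 * real n)" using c by (intro mult_left_mono) auto
  moreover have "d\<^sup>2 * (2 * real n) \<le> 2 * d * (K + d)"
    using mult_left_mono[OF n(1), of "2 * d"] d by (simp add: power2_eq_square algebra_simps)
  ultimately show ?thesis by (simp add: algebra_simps)
qed

lemma card_Zd_tendsto:
  assumes W: "low_set W"
  shows "((\<lambda>d. d\<^sup>2 * real (card (Zd d W))) \<longlongrightarrow> measure lborel W) (at_right 0)"
proof -
  obtain K where K: "0 < K" "W \<subseteq> {0..K} \<times> {0..K}" by (rule low_set_bound[OF W])
  have "((\<lambda>d. measure lborel W + 2 * d * (K + d)) \<longlongrightarrow> measure lborel W + 2 * 0 * (K + 0)) (at_right 0)"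
    by (intro tendsto_intros)
  then have "((\<lambda>d. measure lborel W + 2 * d * (K + d)) \<longlongrightarrow> measure lborel W) (at_right 0)" by simp
  then show ?thesis
  proof (rule tendsto_sandwich[OF _ _ tendsto_const, rotated 2])
    show "\<forall>\<^sub>F d in at_right 0. measure lborel W \<le> d\<^sup>2 * real (card (Zd d W))"
      using eventually_at_right_0_less[OF zero_less_one] measure_le_card_Zd[OF W] by (auto elim: eventually_mono)
    show "\<forall>\<^sub>F d in at_right 0. d\<^sup>2 * real (card (Zd d W)) \<le> measure lborel W + 2 * d * (K + d)"
      using eventually_at_right_0_less[OF zero_less_one] card_Zd_le[OF W K(2,1)] by (auto elim: eventually_mono)
  qed
qed

subsection \<open>Properties of the Euclidean cost\<close>

lemma filterlim_scale_at_right_0: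
  assumes "0 < (s::real)" shows "filterlim (\<lambda>d. d / s) (at_right 0) (at_right 0)"
proof -
  have "((\<lambda>d. d / s) \<longlongrightarrow> 0 / s) (at_right 0)" by (intro tendsto_intros) (use assms in simp)
  moreover have "eventually (\<lambda>d. d / s \<in> {0<..}) (at_right 0)"
    using eventually_at_right_0_less[OF zero_less_one] by eventually_elim (use assms in simp)
  ultimately show ?thesis unfolding filterlim_at by (auto elim: eventually_mono)
qed

text \<open>Scaling a set amounts to changing the mesh of its discretization, so both claims follow
  from an inclusion of lattice sets as the mesh tends to 0.\<close>

lemma ItR_le_scale:
  assumes W: "low_set W1" "low_set W2" and ab: "\<alpha> \<in> {0..1}" "\<beta> \<in> {0..1}" and s: "0 < s"
    and sub: "\<And>x y. (x, y) \<in> W1 \<Longrightarrow> (x / s, y / s) \<in> W2"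
  shows "ItR \<tau> \<alpha> \<beta> W1 \<le> s\<^sup>2 * ItR \<tau> \<alpha> \<beta> W2" "measure lborel W1 \<le> s\<^sup>2 * measure lborel W2"
proof -
  have Zsub: "Zd d W1 \<subseteq> Zd (d / s) W2" for d using sub by (fastforce simp: Zd_def)
  have Z: "down_closed (Zd (d / s) W2)" "finite (Zd (d / s) W2)" if "0 < d" for d
    using down_closed_Zd finite_Zd W s that by auto
  have t: "((\<lambda>d. s\<^sup>2 * ((d / s)\<^sup>2 * Enh \<tau> \<alpha> \<beta> (Zd (d / s) W2))) \<longlongrightarrow> s\<^sup>2 * ItR \<tau> \<alpha> \<beta> W2) (at_right 0)"
    by (intro tendsto_mult_left filterlim_compose[OF Enh_tendsto_ItR[OF W(2) ab] filterlim_scale_at_right_0[OF s]])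
  show "ItR \<tau> \<alpha> \<beta> W1 \<le> s\<^sup>2 * ItR \<tau> \<alpha> \<beta> W2"
  proof (rule tendsto_le[OF _ t Enh_tendsto_ItR[OF W(1) ab]])
    show "\<forall>\<^sub>F d in at_right 0. d\<^sup>2 * Enh \<tau> \<alpha> \<beta> (Zd d W1) \<le> s\<^sup>2 * ((d / s)\<^sup>2 * Enh \<tau> \<alpha> \<beta> (Zd (d / s) W2))"
      using eventually_at_right_0_less[OF zero_less_one]
    proof eventually_elim
      case (elim d)
      then have "d\<^sup>2 * Enh \<tau> \<alpha> \<beta> (Zd d W1) \<le> d\<^sup>2 * Enh \<tau> \<alpha> \<beta> (Zd (d / s) W2)"
        using Z[of d] ab by (intro mult_left_mono Enh_mono Zsub) auto
      then show ?case using s by (simp add: power_divide)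
    qed
  qed simp
  have t: "((\<lambda>d. s\<^sup>2 * ((d / s)\<^sup>2 * real (card (Zd (d / s) W2)))) \<longlongrightarrow> s\<^sup>2 * measure lborel W2) (at_right 0)"
    by (intro tendsto_mult_left filterlim_compose[OF card_Zd_tendsto[OF W(2)] filterlim_scale_at_right_0[OF s]])
  show "measure lborel W1 \<le> s\<^sup>2 * measure lborel W2"
  proof (rule tendsto_le[OF _ t card_Zd_tendsto[OF W(1)]])
    show "\<forall>\<^sub>F d in at_right 0. d\<^sup>2 * real (card (Zd d W1)) \<le> s\<^sup>2 * ((d / s)\<^sup>2 * real (card (Zd (d / s) W2)))"
      using eventually_at_right_0_less[OF zero_less_one]
    proof eventually_elim
      case (elim d)
      then have "d\<^sup>2 * real (card (Zd d W1)) \<le> d\<^sup>2 * real (card (Zd (d / s) W2))"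
        using card_mono[OF Z(2) Zsub] by (intro mult_left_mono) auto
      then show ?case using s by (simp add: power_divide)
    qed
  qed simp
qed

lemma ItR_mono:
  assumes "low_set W1" "low_set W2" "W1 \<subseteq> W2" "\<alpha> \<in> {0..1}" "\<beta> \<in> {0..1}"
  shows "ItR \<tau> \<alpha> \<beta> W1 \<le> ItR \<tau> \<alpha> \<beta> W2"
  using ItR_le_scale(1)[OF assms(1,2,4,5), of 1 \<tau>] assms(3) by auto

lemma ItR_nonneg:
  assumes "low_set W" "\<alpha> \<le> 1" "\<beta> \<le> 1" shows "0 \<le> ItR \<tau> \<alpha> \<beta> W"
  unfolding ItR_def by (rule cInf_greatest[OF costsE_nonempty[OF assms]]) (rule costsE_nonneg[OF assms(2,3)])

text \<open>In the limit of small mesh, \<open>Enh\<close> and \<open>card\<close> turn into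
  \<open>ItR\<close> and area, so linear inequalities between the former are inherited.\<close>

lemma ItR_transfer:
  fixes a a' b b' :: real
  assumes W: "low_set W" and ab: "\<alpha> \<in> {0..1}" "\<beta> \<in> {0..1}" "\<alpha>' \<in> {0..1}" "\<beta>' \<in> {0..1}"
    and le: "\<And>Z. down_closed Z \<Longrightarrow> finite Z \<Longrightarrow> a * Enh \<tau> \<alpha> \<beta> Z + a' * card Z \<le> b * Enh \<tau> \<alpha>' \<beta>' Z + b' * card Z"
  shows "a * ItR \<tau> \<alpha> \<beta> W + a' * measure lborel W \<le> b * ItR \<tau> \<alpha>' \<beta>' W + b' * measure lborel W"
proof (rule tendsto_le)
  let ?E = "\<lambda>\<alpha> \<beta> d. d\<^sup>2 * Enh \<tau> \<alpha> \<beta> (Zd d W)" and ?C = "\<lambda>d. d\<^sup>2 * real (card (Zd d W))"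
  show "((\<lambda>d. a * ?E \<alpha> \<beta> d + a' * ?C d) \<longlongrightarrow> a * ItR \<tau> \<alpha> \<beta> W + a' * measure lborel W) (at_right 0)"
    by (intro tendsto_intros Enh_tendsto_ItR card_Zd_tendsto W ab)
  show "((\<lambda>d. b * ?E \<alpha>' \<beta>' d + b' * ?C d) \<longlongrightarrow> b * ItR \<tau> \<alpha>' \<beta>' W + b' * measure lborel W) (at_right 0)"
    by (intro tendsto_intros Enh_tendsto_ItR card_Zd_tendsto W ab)
  show "\<forall>\<^sub>F d in at_right 0. a * ?E \<alpha> \<beta> d + a' * ?C d \<le> b * ?E \<alpha>' \<beta>' d + b' * ?C d"
    using eventually_at_right_0_less[OF zero_less_one]
  proof eventually_elim
    case (elim d)
    have "d\<^sup>2 * (a * Enh \<tau> \<alpha> \<beta> (Zd d W) + a' * card (Zd d W)) \<le> d\<^sup>2 * (b * Enh \<tau> \<alpha>' \<beta>' (Zd d W) + b' * card (Zd d W))"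
      using elim by (intro mult_left_mono le down_closed_Zd finite_Zd W) auto
    then show ?case by (simp add: algebra_simps)
  qed
qed simp

lemma ItR_antimono:
  assumes "low_set W" "\<alpha> \<in> {0..1}" "\<beta> \<in> {0..1}" "\<alpha>' \<in> {0..1}" "\<beta>' \<in> {0..1}" "\<alpha> \<le> \<alpha>'" "\<beta> \<le> \<beta>'"
  shows "ItR \<tau> \<alpha>' \<beta>' W \<le> ItR \<tau> \<alpha> \<beta> W"
  using ItR_transfer[OF assms(1,4,5,2,3), of 1 \<tau> 0 1 0] Enh_antimono assms by auto

lemma ItR_ratio:
  assumes "low_set W" "\<alpha> \<in> {0..1}" "\<beta> \<in> {0..1}" "\<alpha>' \<in> {0..1}" "\<beta>' \<in> {0..1}"
    "0 \<le> r" "r \<le> 1" "r * (1 - \<alpha>) \<le> 1 - \<alpha>'" "r * (1 - \<beta>) \<le> 1 - \<beta>'"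
  shows "r * ItR \<tau> \<alpha> \<beta> W \<le> ItR \<tau> \<alpha>' \<beta>' W"
  using ItR_transfer[OF assms(1-5), of r \<tau> 0 1 0] Enh_ratio[of _ r \<alpha> \<alpha>' \<beta> \<beta>'] assms by auto

lemma ItR_le_measure:
  assumes "low_set W" "\<alpha> \<in> {0..1}" "\<beta> \<in> {0..1}"
  shows "ItR \<tau> \<alpha> \<beta> W \<le> (1 - \<alpha>) * measure lborel W" "ItR \<tau> \<alpha> \<beta> W \<le> (1 - \<beta>) * measure lborel W"
  using ItR_transfer[OF assms(1-3) assms(2,3), of 1 \<tau> 0 0 "1 - \<alpha>"] Enh_le_card(1)[of _ \<alpha> \<beta> \<tau>]
    ItR_transfer[OF assms(1-3) assms(2,3), of 1 \<tau> 0 0 "1 - \<beta>"] Enh_le_card(2)[of _ \<alpha> \<beta> \<tau>] assms by auto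

lemma ItR_lower:
  fixes c :: real
  assumes "low_set W" "\<alpha> \<in> {0..1}" "\<beta> \<in> {0..1}" "0 \<le> c" "c \<le> 1 - \<alpha>" "c \<le> 1 - \<beta>"
  shows "c * measure lborel W \<le> 8 * ItR \<tau> \<alpha> \<beta> W"
  using ItR_transfer[OF assms(1-3) assms(2,3), of 0 \<tau> c 8 0] Enh_lower[of _ c \<alpha> \<beta> \<tau>] assms by auto

lemma ItR_concave:
  assumes W: "low_set W" and ab: "\<alpha> \<in> {0..1}" "\<beta> \<in> {0..1}" "\<alpha>' \<in> {0..1}" "\<beta>' \<in> {0..1}"
    and st: "0 \<le> s" "0 \<le> t" "s + t = 1"
  shows "s * ItR \<tau> \<alpha> \<beta> W + t * ItR \<tau> \<alpha>' \<beta>' W \<le> ItR \<tau> (s * \<alpha> + t * \<alpha>') (s * \<beta> + t * \<beta>') W"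
proof -
  have mem: "s * x + t * y \<in> {0..1}" if "x \<in> {0..1}" "y \<in> {0..1}" for x y :: real
    using convexD[of "{0..1::real}" x y s t] that st by auto
  show ?thesis
  proof (rule tendsto_le)
    show "((\<lambda>d. s * (d\<^sup>2 * Enh \<tau> \<alpha> \<beta> (Zd d W)) + t * (d\<^sup>2 * Enh \<tau> \<alpha>' \<beta>' (Zd d W))) \<longlongrightarrow>
        s * ItR \<tau> \<alpha> \<beta> W + t * ItR \<tau> \<alpha>' \<beta>' W) (at_right 0)"
      by (intro tendsto_intros Enh_tendsto_ItR W ab)
    show "((\<lambda>d. d\<^sup>2 * Enh \<tau> (s * \<alpha> + t * \<alpha>') (s * \<beta> + t * \<beta>') (Zd d W)) \<longlongrightarrow>
        ItR \<tau> (s * \<alpha> + t * \<alpha>') (s * \<beta> + t * \<beta>') W) (at_right 0)"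
      by (intro Enh_tendsto_ItR W mem ab)
    show "\<forall>\<^sub>F d in at_right 0. s * (d\<^sup>2 * Enh \<tau> \<alpha> \<beta> (Zd d W)) + t * (d\<^sup>2 * Enh \<tau> \<alpha>' \<beta>' (Zd d W))
        \<le> d\<^sup>2 * Enh \<tau> (s * \<alpha> + t * \<alpha>') (s * \<beta> + t * \<beta>') (Zd d W)"
      using eventually_at_right_0_less[OF zero_less_one]
    proof eventually_elim
      case (elim d)
      have "d\<^sup>2 * (s * Enh \<tau> \<alpha> \<beta> (Zd d W) + t * Enh \<tau> \<alpha>' \<beta>' (Zd d W)) \<le> d\<^sup>2 * Enh \<tau> (s * \<alpha> + t * \<alpha>') (s * \<beta> + t * \<beta>') (Zd d W)"
        using elim ab st by (intro mult_left_mono Enh_concave down_closed_Zd finite_Zd W) auto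
      then show ?case by (simp add: algebra_simps)
    qed
  qed simp
qed

lemma low_set_Int_square:
  assumes "low_set W" shows "low_set (W \<inter> {0..R} \<times> {0..R})"
  unfolding low_set_def
proof (intro conjI)
  show "closed (W \<inter> {0..R} \<times> {0..R})" using assms by (intro closed_Int closed_Times) (auto simp: low_set_def)
  show "bounded (W \<inter> {0..R} \<times> {0..R})" using assms by (intro bounded_Int) (auto simp: low_set_def)
  show "W \<inter> {0..R} \<times> {0..R} \<subseteq> quadrant" using assms by (auto simp: low_set_def)
  show "\<forall>(a, b)\<in>W \<inter> {0..R} \<times> {0..R}. {0..a} \<times> {0..b} \<subseteq> W \<inter> {0..R} \<times> {0..R}"
    using low_setD[OF assms] by auto
qed

lemma ItR_tail:
  assumes W: "low_set W" and ab: "\<alpha> \<in> {0..1}" "\<beta> \<in> {0..1}" and R: "0 < R"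
  shows "ItR \<tau> \<alpha> \<beta> W \<le> ItR \<tau> \<alpha> \<beta> (W \<inter> {0..R} \<times> {0..R})
     + 6 * (measure lborel W - measure lborel (W \<inter> {0..R / 4} \<times> {0..R / 4}))"
proof (rule tendsto_le)
  let ?W1 = "W \<inter> {0..R} \<times> {0..R}" and ?W2 = "W \<inter> {0..R / 4} \<times> {0..R / 4}"
  have L: "low_set ?W1" "low_set ?W2" using low_set_Int_square[OF W] by auto
  show "((\<lambda>d. d\<^sup>2 * Enh \<tau> \<alpha> \<beta> (Zd d W)) \<longlongrightarrow> ItR \<tau> \<alpha> \<beta> W) (at_right 0)"
    by (rule Enh_tendsto_ItR[OF W ab])
  show "((\<lambda>d. d\<^sup>2 * Enh \<tau> \<alpha> \<beta> (Zd d ?W1) + 6 * (d\<^sup>2 * real (card (Zd d W)) - d\<^sup>2 * real (card (Zd d ?W2)))) \<longlongrightarrow>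
     ItR \<tau> \<alpha> \<beta> ?W1 + 6 * (measure lborel W - measure lborel ?W2)) (at_right 0)"
    by (intro tendsto_intros Enh_tendsto_ItR card_Zd_tendsto L W ab)
  have R4: "0 < R / 4" using R by simp
  show "\<forall>\<^sub>F d in at_right 0. d\<^sup>2 * Enh \<tau> \<alpha> \<beta> (Zd d W) \<le>
      d\<^sup>2 * Enh \<tau> \<alpha> \<beta> (Zd d ?W1) + 6 * (d\<^sup>2 * real (card (Zd d W)) - d\<^sup>2 * real (card (Zd d ?W2)))"
    using eventually_at_right_0_less[OF R4]
  proof eventually_elim
    case (elim d)
    then have d: "0 < d" "d < R / 4" by auto
    \<comment> \<open>Then \<open>2 * (d * q)\<close> is at most \<open>R\<close>, while
      \<open>d < R / 4\<close> makes \<open>d * q\<close> exceed \<open>R / 4\<close>; this is the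
      origin of the 4.\<close>
    define q where "q = nat \<lfloor>R / (2 * d)\<rfloor>"
    have qR: "real q \<le> R / (2 * d)" "R / (2 * d) < real q + 1" using R d unfolding q_def by (auto simp: of_nat_nat)
    have q: "2 * (d * q) \<le> R" "R < 2 * (d * q) + 2 * d" using qR d by (simp_all add: field_simps)
    have Z: "down_closed (Zd d W)" "finite (Zd d W)" using down_closed_Zd finite_Zd W d by auto
    have Z1: "down_closed (Zd d ?W1)" "finite (Zd d ?W1)" using down_closed_Zd finite_Zd L d by auto
    have "Zd d W \<inter> Rect (2 * q) (2 * q) \<subseteq> Zd d ?W1"
    proof clarify
      fix i j assume ij: "(i, j) \<in> Zd d W" "(i, j) \<in> Rect (2 * q) (2 * q)"
      then have "real i \<le> 2 * real q" "real j \<le> 2 * real q" by (auto simp: Rect_def)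
      then have "d * real i \<le> d * (2 * real q)" "d * real j \<le> d * (2 * real q)" using d by (auto intro: mult_left_mono)
      moreover have "d * (2 * real q) = 2 * (d * real q)" by simp
      ultimately have "d * real i \<le> R" "d * real j \<le> R" using q(1) by linarith+
      then show "(i, j) \<in> Zd d ?W1" using ij(1) d by (simp add: Zd_def)
    qed
    then have "Enh \<tau> \<alpha> \<beta> (Zd d W \<inter> Rect (2 * q) (2 * q)) \<le> Enh \<tau> \<alpha> \<beta> (Zd d ?W1)"
      using ab by (intro Enh_mono Z1) auto
    moreover have "Enh \<tau> \<alpha> \<beta> (Zd d W) \<le> Enh \<tau> \<alpha> \<beta> (Zd d W \<inter> Rect (2 * q) (2 * q)) + 6 * real (card (Zd d W - Rect q q))"
      using ab Enh_tail[OF Z, of \<alpha> \<beta> \<tau> q] by simp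
    moreover have "real (card (Zd d W - Rect q q)) \<le> real (card (Zd d W)) - real (card (Zd d ?W2))"
    proof -
      have sub: "Zd d ?W2 \<subseteq> Rect q q"
      proof (rule Zd_subset_Rect[of _ "R / 4"])
        show "R / 4 < d * real q" using q d by linarith
      qed (use d in auto)
      have sub': "Zd d ?W2 \<subseteq> Zd d W" by (auto simp: Zd_def)
      have "card (Zd d W - Rect q q) \<le> card (Zd d W - Zd d ?W2)"
        by (rule card_mono) (use Z sub in auto)
      also have "\<dots> = card (Zd d W) - card (Zd d ?W2)"
        by (rule card_Diff_subset) (use sub' Z finite_subset in auto)
      finally show ?thesis using card_mono[OF Z(2) sub'] by linarith
    qed
    ultimately have "Enh \<tau> \<alpha> \<beta> (Zd d W) \<le> Enh \<tau> \<alpha> \<beta> (Zd d ?W1) + 6 * (real (card (Zd d W)) - real (card (Zd d ?W2)))"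
      using order_trans add_mono mult_left_mono[of "real (card (Zd d W - Rect q q))" _ "6::real"]
      by (smt (verit))
    then have "d\<^sup>2 * Enh \<tau> \<alpha> \<beta> (Zd d W) \<le> d\<^sup>2 * (Enh \<tau> \<alpha> \<beta> (Zd d ?W1) + 6 * (real (card (Zd d W)) - real (card (Zd d ?W2))))"
      by (intro mult_left_mono) auto
    then show ?case by (simp add: algebra_simps)
  qed
qed simp

section \<open>Convergence of zero-sets\<close>

abbreviation sq :: "real \<Rightarrow> (real \<times> real) set" where "sq R \<equiv> {0..R} \<times> {0..R}"

lemma low_set_eucl:
  assumes "eucl_zero_set Z" shows "low_set (Z \<inter> sq R)"
  unfolding low_set_def
proof (intro conjI)
  show "closed (Z \<inter> sq R)" using assms by (intro closed_Int closed_Times) (auto simp: eucl_zero_set_def)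
  show "bounded (Z \<inter> sq R)"
    by (rule bounded_subset[OF bounded_Times[OF bounded_closed_interval bounded_closed_interval]]) auto
  show "Z \<inter> sq R \<subseteq> quadrant" using assms by (auto simp: eucl_zero_set_def)
  have *: "{0..a} \<times> {0..b} \<subseteq> Z" if "(a, b) \<in> Z" for a b using assms that unfolding eucl_zero_set_def by blast
  show "\<forall>(a, b)\<in>Z \<inter> sq R. {0..a} \<times> {0..b} \<subseteq> Z \<inter> sq R" using * by fastforce
qed

lemma It_bdd_eq_ItR:
  assumes "low_set W" "\<alpha> \<le> 1" "\<beta> \<le> 1"
  shows "It_bdd \<alpha> \<beta> W = ereal (ItR False \<alpha> \<beta> W)"
proof -
  have "ereal (Inf (costsE False \<alpha> \<beta> W)) = (INF x\<in>costsE False \<alpha> \<beta> W. ereal x)"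
    by (rule ereal_Inf'[OF bdd_below_costsE[OF assms(2,3)] costsE_nonempty[OF assms]])
  moreover have "ereal ` costsE False \<alpha> \<beta> W = {ereal (measure lborel A + (1 - \<alpha>) * integral {0..} f + (1 - \<beta>) * integral {0..} g)
       | A f g. compact A \<and> A \<subseteq> quadrant \<and> admissible_fun f \<and> admissible_fun g \<and> Espans W f g A}"
    unfolding costsE_def by auto
  ultimately show ?thesis by (simp add: It_bdd_def ItR_def)
qed

lemma gt_thin_bdd_eq_ItR:
  assumes "low_set W" shows "gt_thin_bdd W = ereal (ItR True 0 0 W)"
proof -
  have "ereal (Inf (costsE True 0 0 W)) = (INF x\<in>costsE True 0 0 W. ereal x)"
    using assms by (intro ereal_Inf' bdd_below_costsE costsE_nonempty) auto
  moreover have "ereal ` costsE True 0 0 W = {ereal (integral {0..} f + integral {0..} g)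
       | f g. admissible_fun f \<and> admissible_fun g \<and> Espans W f g {}}"
    unfolding costsE_def by (auto simp: image_iff)
  ultimately show ?thesis by (simp add: gt_thin_bdd_def ItR_def)
qed

text \<open>By monotonicity in \<open>R\<close> the supremum is the limit defining \<open>It\<close>
  and \<open>gt_thin\<close> for unbounded sets, and for bounded sets it is the value itself; both
  branches are thus treated at once.\<close>

definition ItS :: "bool \<Rightarrow> real \<Rightarrow> real \<Rightarrow> (real \<times> real) set \<Rightarrow> ereal" where
  "ItS \<tau> \<alpha> \<beta> Z = (SUP R. ereal (ItR \<tau> \<alpha> \<beta> (Z \<inter> sq R)))"

lemma ItR_sq_mono:
  assumes "eucl_zero_set Z" "\<alpha> \<in> {0..1}" "\<beta> \<in> {0..1}" "R \<le> R'"
  shows "ItR \<tau> \<alpha> \<beta> (Z \<inter> sq R) \<le> ItR \<tau> \<alpha> \<beta> (Z \<inter> sq R')"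
  by (rule ItR_mono) (use assms low_set_eucl in auto)

lemma tendsto_SUP_at_top:
  fixes h :: "real \<Rightarrow> ereal"
  assumes "mono h" shows "(h \<longlongrightarrow> (SUP R. h R)) at_top"
proof (rule order_tendstoI)
  fix a assume "a < (SUP R. h R)"
  then obtain R where R: "a < h R" by (auto simp: less_SUP_iff)
  show "eventually (\<lambda>x. a < h x) at_top"
    using eventually_ge_at_top[of R]
  proof eventually_elim
    case (elim x)
    show ?case using R monoD[OF assms elim] by (rule less_le_trans)
  qed
next
  fix a assume "(SUP R. h R) < a"
  then have "h x < a" for x using SUP_upper[of x UNIV h] by (meson UNIV_I le_less_trans)
  then show "eventually (\<lambda>x. h x < a) at_top" by simp
qed

lemma ItS_tendsto:
  assumes "eucl_zero_set Z" "\<alpha> \<in> {0..1}" "\<beta> \<in> {0..1}"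
  shows "((\<lambda>R. ereal (ItR \<tau> \<alpha> \<beta> (Z \<inter> sq R))) \<longlongrightarrow> ItS \<tau> \<alpha> \<beta> Z) at_top"
  unfolding ItS_def by (rule tendsto_SUP_at_top) (use ItR_sq_mono[OF assms] in \<open>auto intro!: monoI\<close>)

lemma bounded_subset_sq:
  assumes "eucl_zero_set Z" "bounded Z" obtains R where "Z \<inter> sq R = Z"
proof -
  have "low_set Z" using assms by (auto simp: low_set_def eucl_zero_set_def)
  then obtain K where "0 < K" "Z \<subseteq> sq K" by (rule low_set_bound)
  then have "Z \<inter> sq K = Z" by blast
  then show ?thesis by (rule that)
qed

lemma ItS_bounded:
  assumes Z: "eucl_zero_set Z" "bounded Z" and ab: "\<alpha> \<in> {0..1}" "\<beta> \<in> {0..1}"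
  shows "ItS \<tau> \<alpha> \<beta> Z = ereal (ItR \<tau> \<alpha> \<beta> Z)" "low_set Z"
proof -
  obtain R where R: "Z \<inter> sq R = Z" by (rule bounded_subset_sq[OF Z])
  have L: "low_set (Z \<inter> sq R')" for R' by (rule low_set_eucl[OF Z(1)])
  then show "low_set Z" using R by metis
  show "ItS \<tau> \<alpha> \<beta> Z = ereal (ItR \<tau> \<alpha> \<beta> Z)"
    unfolding ItS_def
  proof (rule antisym)
    show "(SUP R. ereal (ItR \<tau> \<alpha> \<beta> (Z \<inter> sq R))) \<le> ereal (ItR \<tau> \<alpha> \<beta> Z)"
      by (rule SUP_least) (use L \<open>low_set Z\<close> ab in \<open>auto intro: ItR_mono\<close>)
    have "ereal (ItR \<tau> \<alpha> \<beta> (Z \<inter> sq R)) \<le> (SUP R. ereal (ItR \<tau> \<alpha> \<beta> (Z \<inter> sq R)))" by (rule SUP_upper) simp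
    then show "ereal (ItR \<tau> \<alpha> \<beta> Z) \<le> (SUP R. ereal (ItR \<tau> \<alpha> \<beta> (Z \<inter> sq R)))" by (simp only: R)
  qed
qed

lemma It_eq_ItS:
  assumes Z: "eucl_zero_set Z" and ab: "\<alpha> \<in> {0..1}" "\<beta> \<in> {0..1}"
  shows "It \<alpha> \<beta> Z = ItS False \<alpha> \<beta> Z"
proof (cases "bounded Z")
  case True
  then show ?thesis using ItS_bounded(1)[OF Z True ab, of False] ItS_bounded(2)[OF Z True ab] It_bdd_eq_ItR[of Z \<alpha> \<beta>] ab by (simp add: It_def)
next
  case False
  have "It_bdd \<alpha> \<beta> (Z \<inter> sq R) = ereal (ItR False \<alpha> \<beta> (Z \<inter> sq R))" for R
    using It_bdd_eq_ItR[OF low_set_eucl[OF Z]] ab by simp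
  then show ?thesis using False ItS_tendsto[OF Z ab, of False] by (simp add: It_def tendsto_Lim)
qed

lemma gt_thin_eq_ItS:
  assumes Z: "eucl_zero_set Z" shows "gt_thin Z = ItS True 0 0 Z"
proof (cases "bounded Z")
  case True
  then show ?thesis using ItS_bounded(1)[OF Z True, of 0 0 True] ItS_bounded(2)[OF Z True, of 0 0] gt_thin_bdd_eq_ItR[of Z] by (simp add: gt_thin_def)
next
  case False
  have "gt_thin_bdd (Z \<inter> sq R) = ereal (ItR True 0 0 (Z \<inter> sq R))" for R
    using gt_thin_bdd_eq_ItR[OF low_set_eucl[OF Z]] by simp
  then show ?thesis using False ItS_tendsto[OF Z, of 0 0 True] by (simp add: gt_thin_def tendsto_Lim)
qed

subsection \<open>Area of truncated zero-sets\<close>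

lemma eucl_borel: "eucl_zero_set Z \<Longrightarrow> Z \<in> sets borel"
  by (auto simp: eucl_zero_set_def)

lemma emeasure_sq:
  assumes "eucl_zero_set Z" shows "emeasure lborel (Z \<inter> sq R) = ennreal (measure lborel (Z \<inter> sq R))"
proof -
  have "emeasure lborel (Z \<inter> sq R) < \<infinity>"
    using low_set_eucl[OF assms, of R] emeasure_bounded_finite by (auto simp: low_set_def)
  then show ?thesis by (simp add: emeasure_eq_ennreal_measure less_top[symmetric])
qed

lemma area_tendsto:
  assumes "eucl_zero_set Z"
  shows "(\<lambda>k::nat. emeasure lborel (Z \<inter> sq (real k))) \<longlonglongrightarrow> area Z"
proof -
  have e: "Z = (\<Union>k::nat. Z \<inter> sq (real k))"
  proof
    show "Z \<subseteq> (\<Union>k::nat. Z \<inter> sq (real k))"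
    proof clarify
      fix a b assume ab: "(a, b) \<in> Z"
      then have "0 \<le> a" "0 \<le> b" using assms by (auto simp: eucl_zero_set_def quadrant_def)
      moreover obtain k :: nat where "max a b \<le> real k" using real_arch_simple by blast
      ultimately show "(a, b) \<in> (\<Union>k::nat. Z \<inter> sq (real k))" using ab by auto
    qed
  qed auto
  have "(\<lambda>k::nat. emeasure lborel (Z \<inter> sq (real k))) \<longlonglongrightarrow> emeasure lborel (\<Union>k::nat. Z \<inter> sq (real k))"
    by (rule Lim_emeasure_incseq) (use eucl_borel[OF assms] in \<open>auto simp: incseq_def borel_Times\<close>)
  then show ?thesis unfolding area_def e[symmetric] .
qed

lemma measure_sq_le_area:
  assumes "eucl_zero_set Z" "area Z < \<infinity>" shows "measure lborel (Z \<inter> sq R) \<le> measure lborel Z"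
  unfolding measure_def
  by (rule enn2real_mono) (use assms eucl_borel in \<open>auto simp: area_def intro!: emeasure_mono\<close>)

lemma measure_sq_approx:
  assumes Z: "eucl_zero_set Z" "area Z < \<infinity>" and e: "0 < e"
  shows "\<exists>R>0. measure lborel Z - measure lborel (Z \<inter> sq R) < e"
proof -
  have "area Z = ennreal (measure lborel Z)"
    using Z(2) by (simp add: area_def emeasure_eq_ennreal_measure less_top[symmetric])
  then have "(\<lambda>k::nat. measure lborel (Z \<inter> sq (real k))) \<longlonglongrightarrow> measure lborel Z"
    using area_tendsto[OF Z(1)] unfolding emeasure_sq[OF Z(1)] by simp
  then have "eventually (\<lambda>k::nat. measure lborel Z - e < measure lborel (Z \<inter> sq (real k))) sequentially"
    using e by (intro order_tendstoD(1)) auto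
  then have "eventually (\<lambda>k::nat. measure lborel Z - e < measure lborel (Z \<inter> sq (real k)) \<and> 0 < k) sequentially"
    using eventually_gt_at_top[of "0::nat"] by eventually_elim simp
  then obtain k :: nat where "measure lborel Z - e < measure lborel (Z \<inter> sq (real k))" "0 < k"
    by (auto simp: eventually_at_top_linorder)
  then show ?thesis by (intro exI[of _ "real k"]) auto
qed

text \<open>A finite value would bound the areas of all truncations by \<open>ItR_lower\<close>,
  whose constant \<open>c\<close> is positive because both parameters are below 1.\<close>

lemma ItS_infinite:
  assumes Z: "eucl_zero_set Z" "area Z = \<infinity>" and ab: "\<alpha> \<in> {0..<1}" "\<beta> \<in> {0..<1}"
  shows "ItS \<tau> \<alpha> \<beta> Z = \<infinity>"
proof (rule ccontr)
  assume n: "ItS \<tau> \<alpha> \<beta> Z \<noteq> \<infinity>"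
  define c where "c = min (1 - \<alpha>) (1 - \<beta>)"
  have c: "0 < c" "c \<le> 1 - \<alpha>" "c \<le> 1 - \<beta>" using ab by (auto simp: c_def)
  have le: "ereal (ItR \<tau> \<alpha> \<beta> (Z \<inter> sq R)) \<le> ItS \<tau> \<alpha> \<beta> Z" for R unfolding ItS_def by (rule SUP_upper) simp
  then have "ItS \<tau> \<alpha> \<beta> Z \<noteq> -\<infinity>" by (metis ereal_infty_less_eq(2) PInfty_neq_ereal(1) MInfty_neq_ereal(1))
  then obtain T where T: "ItS \<tau> \<alpha> \<beta> Z = ereal T" using n by (cases "ItS \<tau> \<alpha> \<beta> Z") auto
  have "measure lborel (Z \<inter> sq R) \<le> 8 * T / c" for R
  proof -
    have "c * measure lborel (Z \<inter> sq R) \<le> 8 * ItR \<tau> \<alpha> \<beta> (Z \<inter> sq R)"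
      using ab c by (intro ItR_lower low_set_eucl Z) auto
    also have "\<dots> \<le> 8 * T" using le[of R] T by simp
    finally show ?thesis using c by (simp add: pos_le_divide_eq mult.commute)
  qed
  then have "emeasure lborel (Z \<inter> sq R) \<le> ennreal (8 * T / c)" for R
    unfolding emeasure_sq[OF Z(1)] by (rule ennreal_leI)
  then have "area Z \<le> ennreal (8 * T / c)"
    using LIMSEQ_le_const2[OF area_tendsto[OF Z(1)]] by blast
  then show False using Z(2) by (simp add: top_unique)
qed

lemma ItR_sq_le_ItS: "ereal (ItR \<tau> \<alpha> \<beta> (Z \<inter> sq R)) \<le> ItS \<tau> \<alpha> \<beta> Z"
  unfolding ItS_def by (rule SUP_upper) simp

lemma ItS_nonneg:
  assumes "eucl_zero_set Z" "\<alpha> \<in> {0..1}" "\<beta> \<in> {0..1}" shows "0 \<le> ItS \<tau> \<alpha> \<beta> Z"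
proof -
  have "0 \<le> ItR \<tau> \<alpha> \<beta> (Z \<inter> sq 0)" using assms by (intro ItR_nonneg low_set_eucl) auto
  then show ?thesis using ItR_sq_le_ItS[of \<tau> \<alpha> \<beta> Z 0] by (metis ereal_less_eq(5) order_trans)
qed

lemma ItS_le_measure:
  assumes Z: "eucl_zero_set Z" "area Z < \<infinity>" and ab: "\<alpha> \<in> {0..1}" "\<beta> \<in> {0..1}"
  shows "ItS \<tau> \<alpha> \<beta> Z \<le> ereal ((1 - \<alpha>) * measure lborel Z)" "ItS \<tau> \<alpha> \<beta> Z \<le> ereal ((1 - \<beta>) * measure lborel Z)"
proof -
  have *: "ItR \<tau> \<alpha> \<beta> (Z \<inter> sq R) \<le> (1 - \<alpha>) * measure lborel Z \<and> ItR \<tau> \<alpha> \<beta> (Z \<inter> sq R) \<le> (1 - \<beta>) * measure lborel Z" for R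
    using ItR_le_measure[OF low_set_eucl[OF Z(1)] ab, of \<tau> R] ab
      mult_left_mono[OF measure_sq_le_area[OF Z, of R], of "1 - \<alpha>"] mult_left_mono[OF measure_sq_le_area[OF Z, of R], of "1 - \<beta>"]
    by auto
  show "ItS \<tau> \<alpha> \<beta> Z \<le> ereal ((1 - \<alpha>) * measure lborel Z)" "ItS \<tau> \<alpha> \<beta> Z \<le> ereal ((1 - \<beta>) * measure lborel Z)"
    unfolding ItS_def by (rule SUP_least; use * in simp)+
qed

lemma ItS_tail:
  assumes Z: "eucl_zero_set Z" "area Z < \<infinity>" and ab: "\<alpha> \<in> {0..1}" "\<beta> \<in> {0..1}" and R: "0 < R"
  shows "ItS \<tau> \<alpha> \<beta> Z \<le> ereal (ItR \<tau> \<alpha> \<beta> (Z \<inter> sq R) + 6 * (measure lborel Z - measure lborel (Z \<inter> sq (R / 4))))"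
  unfolding ItS_def
proof (rule SUP_least)
  fix R'
  define M where "M = max R R'"
  have e: "Z \<inter> sq M \<inter> sq R = Z \<inter> sq R" "Z \<inter> sq M \<inter> sq (R / 4) = Z \<inter> sq (R / 4)"
    using R by (auto simp: M_def)
  have "ItR \<tau> \<alpha> \<beta> (Z \<inter> sq R') \<le> ItR \<tau> \<alpha> \<beta> (Z \<inter> sq M)" by (rule ItR_sq_mono[OF Z(1) ab]) (simp add: M_def)
  also have "\<dots> \<le> ItR \<tau> \<alpha> \<beta> (Z \<inter> sq R) + 6 * (measure lborel (Z \<inter> sq M) - measure lborel (Z \<inter> sq (R / 4)))"
    using ItR_tail[OF low_set_eucl[OF Z(1), of M] ab R, of \<tau>] unfolding e .
  also have "\<dots> \<le> ItR \<tau> \<alpha> \<beta> (Z \<inter> sq R) + 6 * (measure lborel Z - measure lborel (Z \<inter> sq (R / 4)))"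
    using measure_sq_le_area[OF Z, of M] by simp
  finally show "ereal (ItR \<tau> \<alpha> \<beta> (Z \<inter> sq R')) \<le> ereal (ItR \<tau> \<alpha> \<beta> (Z \<inter> sq R) + 6 * (measure lborel Z - measure lborel (Z \<inter> sq (R / 4))))"
    by simp
qed

subsection \<open>Hausdorff convergence absorbs into scaling\<close>

text \<open>This is where the closure condition on Euclidean zero-sets enters: it excludes segments on the
  axes that stick out of the interior.\<close>

lemma shrink_shift:
  assumes Z: "eucl_zero_set Z" and R: "0 < R" and s: "1 < s"
  shows "\<exists>\<eta>>0. \<forall>x y. (x, y) \<in> Z \<inter> sq R \<longrightarrow> (x / s + \<eta>, y / s + \<eta>) \<in> Z \<inter> sq R"
proof -
  let ?W = "Z \<inter> sq R"
  have L: "low_set ?W" by (rule low_set_eucl[OF Z])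
  have cW: "compact ?W" using L by (simp add: low_set_def compact_eq_bounded_closed)
  \<comment> \<open>An open cover of the compact truncation: \<open>V (p, q, \<eta>)\<close>
    contains the points that, after shrinking and shifting by \<eta>, stay below the point
    \<open>(p, q)\<close> of the set. A finite subcover yields a single \<eta>.\<close>
  define C where "C = {(p, q, \<eta>). (p, q) \<in> ?W \<and> (0::real) < \<eta>}"
  define V where "V = (\<lambda>(p, q, \<eta>). {z :: real \<times> real. fst z / s + \<eta> < p \<and> snd z / s + \<eta> < q})"
  have pt: "\<exists>p q. (p, q) \<in> ?W \<and> x / s < p \<and> y / s < q" if xy: "(x, y) \<in> ?W" for x y
  proof -
    have xy0: "0 \<le> x" "x \<le> R" "0 \<le> y" "y \<le> R" using xy by auto
    \<comment> \<open>For positive \<open>x\<close>, closeness within \<open>x - x / s\<close> keeps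
      \<open>p\<close> above \<open>x / s\<close>. For \<open>x = 0\<close> positivity of
      \<open>p\<close> is enough, which the approximating point has, so any tolerance will
      do.\<close>
    define ex where "ex = (if 0 < x then x - x / s else 1)"
    define ey where "ey = (if 0 < y then y - y / s else 1)"
    have "x / s < x" if "0 < x" for x using s that by (simp add: pos_divide_less_eq)
    then have e: "0 < ex" "0 < ey" by (auto simp: ex_def ey_def)
    have "(x, y) \<in> closure (Z \<inter> {(a, b). 0 < a \<and> 0 < b})" using xy Z unfolding eucl_zero_set_def by auto
    then obtain z where z: "z \<in> Z \<inter> {(a, b). 0 < a \<and> 0 < b}" "dist z (x, y) < min ex ey"
      unfolding closure_approachable using e by (meson min_less_iff_conj)
    obtain p q where pq: "z = (p, q)" by (cases z)
    have "dist p x < ex" "dist q y < ey"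
      using z(2) dist_fst_le[of z "(x, y)"] dist_snd_le[of z "(x, y)"] by (auto simp: pq)
    then have "x / s < p" "y / s < q" using z(1) xy0 by (auto simp: pq dist_real_def ex_def ey_def split: if_splits)
    moreover have "x / s < R" "y / s < R"
      using xy0 R s by (cases "x = 0"; cases "y = 0"; simp add: pos_divide_less_eq; smt (verit) mult_less_cancel_left1)+
    moreover have "(min p R, min q R) \<in> ?W"
    proof -
      have "{0..p} \<times> {0..q} \<subseteq> Z" using z(1) Z unfolding pq eucl_zero_set_def by blast
      then show ?thesis using z(1) R by (auto simp: pq subset_iff min_def)
    qed
    ultimately show ?thesis by (intro exI[of _ "min p R"] exI[of _ "min q R"]) simp
  qed
  have "?W \<subseteq> (\<Union>c\<in>C. V c)"
  proof clarify
    fix x y assume xy: "(x, y) \<in> Z" "x \<in> {0..R}" "y \<in> {0..R}"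
    then obtain p q where pq: "(p, q) \<in> ?W" "x / s < p" "y / s < q" using pt[of x y] by auto
    define \<eta> where "\<eta> = min (p - x / s) (q - y / s) / 2"
    have "0 < \<eta>" "\<eta> \<le> (p - x / s) / 2" "\<eta> \<le> (q - y / s) / 2" using pq unfolding \<eta>_def by auto
    moreover have "X + h < P" if "h \<le> (P - X) / 2" "X < P" for X h P :: real using that by simp
    ultimately have "0 < \<eta>" "x / s + \<eta> < p" "y / s + \<eta> < q" using pq by blast+
    then have "(p, q, \<eta>) \<in> C" "(x, y) \<in> V (p, q, \<eta>)" using pq(1) by (auto simp: C_def V_def)
    then show "(x, y) \<in> (\<Union>c\<in>C. V c)" by blast
  qed
  moreover have "open (V c)" for c
    unfolding V_def using s by (cases c) (auto intro!: open_Collect_conj open_Collect_less continuous_intros)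
  ultimately obtain D where D: "D \<subseteq> C" "finite D" "?W \<subseteq> (\<Union>c\<in>D. V c)"
    using compactE_image[OF cW, of C V] by metis
  define \<eta> where "\<eta> = Min (insert 1 ((\<lambda>c. snd (snd c)) ` D))"
  have "0 < \<eta>" unfolding \<eta>_def using D(1,2) by (subst Min_gr_iff) (auto simp: C_def)
  moreover have "(x / s + \<eta>, y / s + \<eta>) \<in> ?W" if xy: "(x, y) \<in> ?W" for x y
  proof -
    obtain c where c: "c \<in> D" "(x, y) \<in> V c" using D(3) xy by blast
    obtain p q h where pqh: "c = (p, q, h)" by (cases c)
    have "\<eta> \<le> h" unfolding \<eta>_def using D(2) c(1) by (intro Min_le) (force simp: pqh)+
    then have "x / s + \<eta> \<le> p" "y / s + \<eta> \<le> q" using c(2) by (auto simp: V_def pqh)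
    moreover have "(p, q) \<in> ?W" using c(1) D(1) by (auto simp: C_def pqh)
    moreover have "0 \<le> x / s + \<eta>" "0 \<le> y / s + \<eta>" using xy s \<open>0 < \<eta>\<close> by auto
    ultimately show ?thesis using low_setD[OF L] by blast
  qed
  ultimately show ?thesis by blast
qed

text \<open>Shrinking by \<open>s\<close> makes room for a shift inside the limit set, and a
  Hausdorff distance below half of this shift is absorbed. In the second inclusion the other half
  survives as a margin, which will cover boxes of positive side.\<close>

lemma haus_sandwich:
  assumes Z: "eucl_zero_set Z" and R: "0 < R" and s: "1 < s"
    and h: "haus_conv (\<lambda>n. Sn n \<inter> sq R) (Z \<inter> sq R)"
  shows "\<exists>\<eta>>0. eventually (\<lambda>n. (\<forall>x y. (x, y) \<in> Sn n \<inter> sq R \<longrightarrow> (x / s, y / s) \<in> Z \<inter> sq R) \<and>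
     (\<forall>x y. (x, y) \<in> Z \<inter> sq R \<longrightarrow> (\<exists>a b. (a, b) \<in> Sn n \<inter> sq R \<and> x / s + \<eta> \<le> a \<and> y / s + \<eta> \<le> b))) sequentially"
proof -
  let ?W = "Z \<inter> sq R"
  have L: "low_set ?W" by (rule low_set_eucl[OF Z])
  obtain \<eta> where eta: "0 < \<eta>" "\<And>x y. (x, y) \<in> ?W \<Longrightarrow> (x / s + \<eta>, y / s + \<eta>) \<in> ?W"
    using shrink_shift[OF Z R s] by blast
  have "0 < \<eta> / 2" using eta by simp
  then have "eventually (\<lambda>n. (\<forall>x\<in>Sn n \<inter> sq R. \<exists>y\<in>?W. dist x y < \<eta> / 2) \<and> (\<forall>y\<in>?W. \<exists>x\<in>Sn n \<inter> sq R. dist x y < \<eta> / 2)) sequentially"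
    using h unfolding haus_conv_def by blast
  then have "eventually (\<lambda>n. (\<forall>x y. (x, y) \<in> Sn n \<inter> sq R \<longrightarrow> (x / s, y / s) \<in> Z \<inter> sq R) \<and>
     (\<forall>x y. (x, y) \<in> Z \<inter> sq R \<longrightarrow> (\<exists>a b. (a, b) \<in> Sn n \<inter> sq R \<and> x / s + \<eta> / 2 \<le> a \<and> y / s + \<eta> / 2 \<le> b))) sequentially"
  proof eventually_elim
    case (elim n)
    show ?case
    proof (intro conjI allI impI)
      fix x y assume xy: "(x, y) \<in> Sn n \<inter> sq R"
      then obtain z where z: "z \<in> ?W" "dist (x, y) z < \<eta> / 2" using elim by blast
      obtain a b where ab: "z = (a, b)" by (cases z)
      have "dist x a < \<eta> / 2" "dist y b < \<eta> / 2"
        using z(2) dist_fst_le[of "(x, y)" z] dist_snd_le[of "(x, y)" z] by (auto simp: ab)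
      then have "x \<le> a + \<eta> / 2" "y \<le> b + \<eta> / 2" unfolding dist_real_def by linarith+
      then have "x / s \<le> (a + \<eta> / 2) / s" "y / s \<le> (b + \<eta> / 2) / s" using s by (intro divide_right_mono; simp)+
      moreover have "\<eta> / 2 / s \<le> \<eta>" using s eta(1) by (simp add: pos_divide_le_eq)
      ultimately have "x / s \<le> a / s + \<eta>" "y / s \<le> b / s + \<eta>" by (auto simp: add_divide_distrib)
      moreover have "(a / s + \<eta>, b / s + \<eta>) \<in> ?W" using eta(2)[of a b] z(1) ab by blast
      moreover have "0 \<le> x / s" "0 \<le> y / s" using xy s by auto
      ultimately show "(x / s, y / s) \<in> ?W" using low_setD[OF L] by blast
    next
      fix x y assume "(x, y) \<in> ?W"
      then have "(x / s + \<eta>, y / s + \<eta>) \<in> ?W" by (rule eta(2))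
      then obtain z where z: "z \<in> Sn n \<inter> sq R" "dist z (x / s + \<eta>, y / s + \<eta>) < \<eta> / 2" using elim by blast
      obtain a b where ab: "z = (a, b)" by (cases z)
      have "dist a (x / s + \<eta>) < \<eta> / 2" "dist b (y / s + \<eta>) < \<eta> / 2"
        using z(2) dist_fst_le[of z "(x / s + \<eta>, y / s + \<eta>)"] dist_snd_le[of z "(x / s + \<eta>, y / s + \<eta>)"] by (auto simp: ab)
      then have "x / s + \<eta> / 2 \<le> a" "y / s + \<eta> / 2 \<le> b" unfolding dist_real_def by linarith+
      then show "\<exists>a b. (a, b) \<in> Sn n \<inter> sq R \<and> x / s + \<eta> / 2 \<le> a \<and> y / s + \<eta> / 2 \<le> b"
        using z(1) ab by blast
    qed
  qed
  then show ?thesis using \<open>0 < \<eta> / 2\<close> by blast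
qed

subsection \<open>A squeeze criterion\<close>

text \<open>Common core of the discrete and the Euclidean convergence. The lower bound sees only a
  truncation; the upper bound pays for the rest by the area outside \<open>R / 4\<close> and is
  therefore demanded only for finite \<open>L\<close>. First \<open>R\<close> is chosen, then
  \<open>s\<close> close to 1.\<close>

lemma squeeze_scaling:
  fixes X :: "nat \<Rightarrow> ereal" and w m :: "real \<Rightarrow> real"
  assumes L: "L = (SUP R. ereal (w R))" and mono: "mono w"
    and lo: "\<And>R s e. 0 < R \<Longrightarrow> 1 < s \<Longrightarrow> 0 < e \<Longrightarrow> eventually (\<lambda>n. ereal (w R) \<le> ereal (s\<^sup>2) * X n + ereal e) sequentially"
    and up: "\<And>R s e. L < \<infinity> \<Longrightarrow> 0 < R \<Longrightarrow> 1 < s \<Longrightarrow> 0 < e \<Longrightarrow>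
        eventually (\<lambda>n. X n \<le> ereal (s\<^sup>2 * w R + 6 * (a - m (R / 4) / s\<^sup>2) + e)) sequentially"
    and m: "\<And>e. L < \<infinity> \<Longrightarrow> 0 < e \<Longrightarrow> \<exists>R>0. a - m (R / 4) < e"
  shows "X \<longlonglongrightarrow> L"
proof (rule order_tendstoI)
  fix c assume "c < L"
  then obtain R0 where "c < ereal (w R0)" unfolding L by (auto simp: less_SUP_iff)
  moreover define R where "R = max R0 1"
  have "w R0 \<le> w R" using mono by (auto simp: R_def monoD)
  ultimately have "c < ereal (w R)" by (metis ereal_less_eq(3) less_le_trans)
  then obtain b where b: "c < ereal b" "b < w R" using ereal_dense2 by (metis less_ereal.simps(1))
  \<comment> \<open>The additive error is taken to be \<open>s - 1\<close>, so that the single limit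
    at \<open>s = 1\<close> removes both errors.\<close>
  have "((\<lambda>s::real. s\<^sup>2 * b + (s - 1)) \<longlongrightarrow> 1\<^sup>2 * b + (1 - 1)) (at_right 1)" by (intro tendsto_intros)
  then have "eventually (\<lambda>s::real. s\<^sup>2 * b + (s - 1) < w R) (at_right 1)" using b(2) by (intro order_tendstoD(2)) auto
  moreover have "eventually (\<lambda>s::real. 1 < s) (at_right 1)" by (simp add: eventually_at_right_less)
  ultimately have "eventually (\<lambda>s::real. s\<^sup>2 * b + (s - 1) < w R \<and> 1 < s) (at_right 1)" by eventually_elim simp
  then obtain s where s: "s\<^sup>2 * b + (s - 1) < w R" "1 < s" using eventually_happens'[of "at_right (1::real)"] by auto
  have "0 < R" by (simp add: R_def)
  then have "eventually (\<lambda>n. ereal (w R) \<le> ereal (s\<^sup>2) * X n + ereal (s - 1)) sequentially" using lo s by simp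
  then show "eventually (\<lambda>n. c < X n) sequentially"
  proof eventually_elim
    case (elim n)
    have "ereal b < X n"
    proof (rule ccontr)
      assume "\<not> ereal b < X n"
      then have "ereal (s\<^sup>2) * X n \<le> ereal (s\<^sup>2) * ereal b" by (intro ereal_mult_left_mono) auto
      then have "ereal (s\<^sup>2) * X n + ereal (s - 1) \<le> ereal (s\<^sup>2) * ereal b + ereal (s - 1)" by (rule add_right_mono)
      from order_trans[OF elim this] have "ereal (w R) \<le> ereal (s\<^sup>2 * b + (s - 1))" by simp
      then show False using s(1) by simp
    qed
    then show ?case using b(1) by (rule less_trans[rotated])
  qed
next
  fix c assume "L < c"
  then have Lf: "L < \<infinity>" by (metis ereal_infty_less(1) less_trans not_less_iff_gr_or_eq)
  have "ereal (w 0) \<le> L" unfolding L by (rule SUP_upper) simp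
  then obtain T where T: "L = ereal T" using Lf by (cases L) auto
  obtain b where b: "T < b" "ereal b \<le> c" using \<open>L < c\<close> T ereal_dense2 by (metis less_ereal.simps(1) less_imp_le)
  have wT: "w R \<le> T" for R using T L SUP_upper[of R UNIV "\<lambda>R. ereal (w R)"] by simp
  \<comment> \<open>With its factor 6 the tail then uses less than half of the gap between
    \<open>T\<close> and \<open>b\<close>.\<close>
  have "0 < (b - T) / 12" using b by simp
  then obtain R where R: "0 < R" "a - m (R / 4) < (b - T) / 12" using m[OF Lf] by blast
  let ?h = "\<lambda>s::real. s\<^sup>2 * T + 6 * (a - m (R / 4) / s\<^sup>2) + (s - 1)"
  have "(?h \<longlongrightarrow> 1\<^sup>2 * T + 6 * (a - m (R / 4) / 1\<^sup>2) + (1 - 1)) (at_right 1)" by (intro tendsto_intros) auto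
  moreover have "1\<^sup>2 * T + 6 * (a - m (R / 4) / 1\<^sup>2) + (1 - 1) < b" using R(2) b(1) by simp
  ultimately have "eventually (\<lambda>s. ?h s < b) (at_right 1)" by (rule order_tendstoD(2))
  moreover have "eventually (\<lambda>s::real. 1 < s) (at_right 1)" by (simp add: eventually_at_right_less)
  ultimately have "eventually (\<lambda>s::real. ?h s < b \<and> 1 < s) (at_right 1)" by eventually_elim simp
  then obtain s where s: "?h s < b" "1 < s" using eventually_happens'[of "at_right (1::real)"] by auto
  have "eventually (\<lambda>n. X n \<le> ereal (s\<^sup>2 * w R + 6 * (a - m (R / 4) / s\<^sup>2) + (s - 1))) sequentially"
    using up[OF Lf R(1) s(2)] s(2) by simp
  then show "eventually (\<lambda>n. X n < c) sequentially"
  proof eventually_elim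
    case (elim n)
    have "s\<^sup>2 * w R \<le> s\<^sup>2 * T" using wT by (intro mult_left_mono) auto
    then have "ereal (s\<^sup>2 * w R + 6 * (a - m (R / 4) / s\<^sup>2) + (s - 1)) < ereal b" using s(1) by simp
    then show ?case using elim b(2) by (meson le_less_trans less_le_trans)
  qed
qed

section \<open>Discrete zero-sets with a Euclidean limit\<close>

lemma scale_set_square:
  assumes "0 < d" shows "scale_set d (square Z) = boxes d Z"
proof
  show "scale_set d (square Z) \<subseteq> boxes d Z"
    using assms by (force simp: scale_set_def square_def boxes_def distrib_left)
  show "boxes d Z \<subseteq> scale_set d (square Z)"
  proof
    fix p assume "p \<in> boxes d Z"
    then obtain i j where ij: "(i, j) \<in> Z" "p \<in> {d * real i..d * (real i + 1)} \<times> {d * real j..d * (real j + 1)}"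
      by (auto simp: boxes_def)
    define a where "a = fst p / d - real i"
    define b where "b = snd p / d - real j"
    have "a \<in> {0..1}" "b \<in> {0..1}" using ij(2) assms by (auto simp: a_def b_def field_simps)
    moreover have "p = d *\<^sub>R (real i + a, real j + b)" using assms by (simp add: a_def b_def prod_eq_iff)
    ultimately show "p \<in> scale_set d (square Z)" using ij(1) unfolding scale_set_def square_def by blast
  qed
qed

lemma boxes_borel: "boxes d Z \<in> sets borel"
  unfolding boxes_def by (intro sets.countable_UN'') (auto simp: borel_Times)

lemma card_le_area_boxes:
  assumes d: "0 < d" and c: "emeasure lborel (boxes d Z) \<le> ennreal c" "0 \<le> c"
  shows "finite Z" "d\<^sup>2 * real (card Z) \<le> c"
proof -
  have *: "d\<^sup>2 * real (card D) \<le> c" if "finite D" "D \<subseteq> Z" for D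
  proof -
    have "ennreal (d\<^sup>2 * card D) \<le> emeasure lborel (boxes d Z)"
      by (rule card_boxes_le_emeasure[OF d that(1) boxes_borel]) (use that(2) in \<open>force simp: boxes_def\<close>)
    also have "\<dots> \<le> ennreal c" by (rule c(1))
    finally show ?thesis using c(2) by simp
  qed
  show "finite Z"
  proof (rule ccontr)
    assume "infinite Z"
    obtain k :: nat where k: "c / d\<^sup>2 < real k" using reals_Archimedean2 by blast
    obtain D where "finite D" "card D = k" "D \<subseteq> Z" using infinite_arbitrarily_large[OF \<open>infinite Z\<close>] by metis
    then have "d\<^sup>2 * real k \<le> c" using * by blast
    then show False using k d by (simp add: pos_divide_less_eq mult.commute)
  qed
  then show "d\<^sup>2 * real (card Z) \<le> c" using * by blast
qed

locale disc_approx =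
  fixes Zs :: "nat \<Rightarrow> (nat \<times> nat) set" and \<delta> :: "nat \<Rightarrow> real" and Zt :: "(real \<times> real) set"
  assumes zs: "\<And>n. down_closed (Zs n)"
    and dpos: "\<And>n. 0 < \<delta> n"
    and dlim: "\<delta> \<longlonglongrightarrow> 0"
    and zt: "eucl_zero_set Zt"
    and conv: "E_conv (\<lambda>n. boxes (\<delta> n) (Zs n)) Zt"
begin

lemma small: "0 < r \<Longrightarrow> eventually (\<lambda>n. \<delta> n < r) sequentially"
  using order_tendstoD(2)[OF dlim] by blast

text \<open>\<open>boxes\<close> reaches one cell beyond the lattice points of \<open>Zs n\<close>.
  Once \<open>\<delta> n\<close> is below the margin from \<open>haus_sandwich\<close>, this excess
  is covered, which also gives the \<open>+ 1\<close> in the bounds by \<open>R\<close>.\<close>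

lemma sandwich:
  assumes R: "0 < R" and s: "1 < s"
  shows "eventually (\<lambda>n. (\<forall>i j. (i, j) \<in> Zs n \<longrightarrow> \<delta> n * real i \<le> R \<longrightarrow> \<delta> n * real j \<le> R \<longrightarrow> (i, j) \<in> Zd (\<delta> n / s) (Zt \<inter> sq R)) \<and>
    (\<forall>i j. (i, j) \<in> Zd (\<delta> n * s) (Zt \<inter> sq R) \<longrightarrow> (i, j) \<in> Zs n \<and> \<delta> n * (real i + 1) \<le> R \<and> \<delta> n * (real j + 1) \<le> R)) sequentially"
proof -
  have "haus_conv (\<lambda>n. boxes (\<delta> n) (Zs n) \<inter> sq R) (Zt \<inter> sq R)" using conv R by (simp add: E_conv_def)
  from haus_sandwich[OF zt R s this]
  obtain \<eta> where eta: "0 < \<eta>" and ev: "eventually (\<lambda>n. (\<forall>x y. (x, y) \<in> boxes (\<delta> n) (Zs n) \<inter> sq R \<longrightarrow> (x / s, y / s) \<in> Zt \<inter> sq R) \<and>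
     (\<forall>x y. (x, y) \<in> Zt \<inter> sq R \<longrightarrow> (\<exists>a b. (a, b) \<in> boxes (\<delta> n) (Zs n) \<inter> sq R \<and> x / s + \<eta> \<le> a \<and> y / s + \<eta> \<le> b))) sequentially"
    by blast
  show ?thesis using ev small[OF eta]
  proof eventually_elim
    case (elim n)
    have d: "0 < \<delta> n" by (rule dpos)
    show ?case
    proof (intro conjI allI impI)
      fix i j assume ij: "(i, j) \<in> Zs n" "\<delta> n * real i \<le> R" "\<delta> n * real j \<le> R"
      have "(\<delta> n * real i, \<delta> n * real j) \<in> boxes (\<delta> n) (Zs n)"
        using ij(1) d by (auto simp: boxes_def intro!: bexI[of _ "(i, j)"])
      then have "(\<delta> n * real i, \<delta> n * real j) \<in> boxes (\<delta> n) (Zs n) \<inter> sq R" using ij(2,3) d by auto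
      then have "(\<delta> n * real i / s, \<delta> n * real j / s) \<in> Zt \<inter> sq R" using elim by blast
      then show "(i, j) \<in> Zd (\<delta> n / s) (Zt \<inter> sq R)" by (simp add: Zd_def)
    next
      fix i j assume "(i, j) \<in> Zd (\<delta> n * s) (Zt \<inter> sq R)"
      then have "(\<delta> n * s * real i, \<delta> n * s * real j) \<in> Zt \<inter> sq R" by (simp add: Zd_def)
      then obtain a b where ab: "(a, b) \<in> boxes (\<delta> n) (Zs n) \<inter> sq R" "\<delta> n * s * real i / s + \<eta> \<le> a" "\<delta> n * s * real j / s + \<eta> \<le> b"
        using elim by blast
      then have ab': "\<delta> n * real i + \<eta> \<le> a" "\<delta> n * real j + \<eta> \<le> b" using s by auto
      then have l: "\<delta> n * (real i + 1) < a" "\<delta> n * (real j + 1) < b" using elim by (auto simp: distrib_left)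
      obtain i' j' where ij': "(i', j') \<in> Zs n" "a \<le> \<delta> n * (real i' + 1)" "b \<le> \<delta> n * (real j' + 1)"
        using ab(1) by (auto simp: boxes_def)
      have "\<delta> n * (real i + 1) < \<delta> n * (real i' + 1)" "\<delta> n * (real j + 1) < \<delta> n * (real j' + 1)" using l ij' by linarith+
      then have "i \<le> i'" "j \<le> j'" using d by auto
      then show "(i, j) \<in> Zs n" using down_closedD[OF zs ij'(1)] by blast
      show "\<delta> n * (real i + 1) \<le> R" "\<delta> n * (real j + 1) \<le> R" using l ab(1) by auto
    qed
  qed
qed

text \<open>Each box contributes its full area, so convergence of the areas makes
  \<open>Zs n\<close> finite from some index on; Hausdorff convergence on squares could not detect
  this.\<close>

lemma area_bound:
  assumes fin: "area Zt < \<infinity>" and e: "0 < e"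
  shows "eventually (\<lambda>n. finite (Zs n) \<and> (\<delta> n)\<^sup>2 * real (card (Zs n)) \<le> measure lborel Zt + e) sequentially"
proof -
  have a: "area Zt = ennreal (measure lborel Zt)"
    using fin by (simp add: area_def emeasure_eq_ennreal_measure less_top[symmetric])
  have "ennreal (measure lborel Zt) < ennreal (measure lborel Zt + e)" using e by (simp add: ennreal_less_iff)
  moreover have "(\<lambda>n. area (boxes (\<delta> n) (Zs n))) \<longlonglongrightarrow> area Zt" using conv by (simp add: E_conv_def)
  ultimately have "eventually (\<lambda>n. area (boxes (\<delta> n) (Zs n)) < ennreal (measure lborel Zt + e)) sequentially"
    using a order_tendstoD(2) by metis
  then show ?thesis
  proof eventually_elim
    case (elim n)
    then have "emeasure lborel (boxes (\<delta> n) (Zs n)) \<le> ennreal (measure lborel Zt + e)" by (simp add: area_def)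
    from card_le_area_boxes[OF dpos this] show ?case using e by (simp add: add_nonneg_nonneg)
  qed
qed

text \<open>\<open>J\<close> stands for \<open>I_disc\<close>, \<open>gamma\<close> or
  \<open>gamma_thin\<close>. Its argument may be infinite, so \<open>J_lo\<close> refers to
  truncations; the error \<open>e * m^2\<close> is harmless because \<open>m\<close> is taken of
  order \<open>R / \<delta> n\<close>.\<close>

lemma convergence:
  fixes J :: "(nat \<times> nat) set \<Rightarrow> ereal"
  assumes ab: "\<alpha> \<in> {0..1}" "\<beta> \<in> {0..1}"
    and J_up: "\<And>Z. down_closed Z \<Longrightarrow> finite Z \<Longrightarrow> J Z \<le> ereal (Enh \<tau> \<alpha> \<beta> Z)"
    and J_lo: "\<And>e. 0 < e \<Longrightarrow> \<exists>m0. \<forall>m\<ge>m0. \<forall>Z. down_closed Z \<longrightarrow> ereal (Enh \<tau> \<alpha> \<beta> (Z \<inter> Rect m m)) \<le> J Z + ereal (e * real m ^ 2)"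
    and J0: "\<And>Z. down_closed Z \<Longrightarrow> 0 \<le> J Z"
    and inf: "area Zt = \<infinity> \<Longrightarrow> ItS \<tau> \<alpha> \<beta> Zt = \<infinity>"
  shows "(\<lambda>n. ereal ((\<delta> n)\<^sup>2) * J (Zs n)) \<longlonglongrightarrow> ItS \<tau> \<alpha> \<beta> Zt"
proof (rule squeeze_scaling[where w = "\<lambda>R. ItR \<tau> \<alpha> \<beta> (Zt \<inter> sq R)" and m = "\<lambda>R. measure lborel (Zt \<inter> sq R)" and a = "measure lborel Zt", OF ItS_def])
  show "mono (\<lambda>R. ItR \<tau> \<alpha> \<beta> (Zt \<inter> sq R))" by (rule monoI) (rule ItR_sq_mono[OF zt ab])
next
  fix R s e :: real assume R: "0 < R" and s: "1 < s" and e: "0 < e"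
  \<comment> \<open>Since \<open>\<delta> n * m\<close> will be at most \<open>R + 1\<close>, the
    error of \<open>J_lo\<close> becomes at most \<open>e\<close> after scaling.\<close>
  define e' where "e' = e / (s\<^sup>2 * (R + 1)\<^sup>2)"
  have e': "0 < e'" using e s R by (simp add: e'_def)
  obtain m0 where m0: "\<And>m Z. m0 \<le> m \<Longrightarrow> down_closed Z \<Longrightarrow> ereal (Enh \<tau> \<alpha> \<beta> (Z \<inter> Rect m m)) \<le> J Z + ereal (e' * real m ^ 2)"
    using J_lo[OF e'] by blast
  have "0 < R / (real m0 + 1)" using R by simp
  from sandwich[OF R s] small[OF zero_less_one] small[OF this]
  show "eventually (\<lambda>n. ereal (ItR \<tau> \<alpha> \<beta> (Zt \<inter> sq R)) \<le> ereal (s\<^sup>2) * (ereal ((\<delta> n)\<^sup>2) * J (Zs n)) + ereal e) sequentially"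
  proof eventually_elim
    case (elim n)
    have d: "0 < \<delta> n" by (rule dpos)
    define m where "m = nat \<lceil>R / \<delta> n\<rceil>"
    have "0 \<le> R / \<delta> n" using R d by simp
    then have m: "R / \<delta> n \<le> real m" "real m \<le> R / \<delta> n + 1" unfolding m_def by linarith+
    have "\<delta> n * (real m0 + 1) < R" using elim(3) by (simp add: pos_less_divide_eq)
    then have "real m0 + 1 < R / \<delta> n" using d by (simp add: pos_less_divide_eq mult.commute)
    then have mm0: "m0 \<le> m" using m(1) by linarith
    have dm: "\<delta> n * real m \<le> R + 1"
    proof -
      have "\<delta> n * real m \<le> \<delta> n * (R / \<delta> n + 1)" using m(2) d by (intro mult_left_mono) auto
      also have "\<dots> = R + \<delta> n" using d by (simp add: distrib_left)
      finally show ?thesis using elim(2) by linarith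
    qed
    let ?Z = "Zs n \<inter> Rect m m"
    have Z: "down_closed ?Z" "finite ?Z" using down_closed_Int[OF zs down_closed_Rect] by auto
    have sub: "Zd (\<delta> n * s) (Zt \<inter> sq R) \<subseteq> ?Z"
    proof clarify
      fix i j assume "(i, j) \<in> Zd (\<delta> n * s) (Zt \<inter> sq R)"
      then have ij: "(i, j) \<in> Zs n" "\<delta> n * (real i + 1) \<le> R" "\<delta> n * (real j + 1) \<le> R" using elim(1) by blast+
      then have "real i + 1 \<le> R / \<delta> n" "real j + 1 \<le> R / \<delta> n" using d by (simp_all add: pos_le_divide_eq mult.commute)
      then have "i < m" "j < m" using m(1) by linarith+
      then show "(i, j) \<in> ?Z" using ij(1) by (simp add: Rect_def)
    qed
    have "0 < \<delta> n * s" using d s by simp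
    then have "ItR \<tau> \<alpha> \<beta> (Zt \<inter> sq R) \<le> (\<delta> n * s)\<^sup>2 * Enh \<tau> \<alpha> \<beta> (Zd (\<delta> n * s) (Zt \<inter> sq R))"
      using ab by (intro ItR_le_Enh low_set_eucl zt) auto
    also have "\<dots> \<le> (\<delta> n * s)\<^sup>2 * Enh \<tau> \<alpha> \<beta> ?Z"
      using ab by (intro mult_left_mono Enh_mono Z sub) auto
    finally have w: "ItR \<tau> \<alpha> \<beta> (Zt \<inter> sq R) \<le> (\<delta> n * s)\<^sup>2 * Enh \<tau> \<alpha> \<beta> ?Z" .
    have J: "ereal (Enh \<tau> \<alpha> \<beta> ?Z) \<le> J (Zs n) + ereal (e' * real m ^ 2)" by (rule m0[OF mm0 zs])
    show ?case
    proof (cases "J (Zs n)")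
      case (real j)
      have "(\<delta> n * s)\<^sup>2 * Enh \<tau> \<alpha> \<beta> ?Z \<le> (\<delta> n * s)\<^sup>2 * (j + e' * real m ^ 2)"
        using J real by (intro mult_left_mono) auto
      also have "\<dots> = s\<^sup>2 * ((\<delta> n)\<^sup>2 * j) + s\<^sup>2 * e' * (\<delta> n * real m)\<^sup>2" by (simp add: algebra_simps power_mult_distrib)
      also have "s\<^sup>2 * e' * (\<delta> n * real m)\<^sup>2 \<le> s\<^sup>2 * e' * (R + 1)\<^sup>2"
        using dm d e' by (intro mult_left_mono power_mono) auto
      also have "\<dots> = e" using s R by (simp add: e'_def)
      finally show ?thesis using w real by simp
    next
      case PInf
      then show ?thesis using d s by simp
    next
      case MInf
      then show ?thesis using J0[OF zs, of n] by simp
    qed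
  qed
next
  assume Lf: "ItS \<tau> \<alpha> \<beta> Zt < \<infinity>"
  then have fin: "area Zt < \<infinity>" using inf by (metis infinity_ennreal_def less_irrefl less_top)
  {
    fix R s e :: real assume R: "0 < R" and s: "1 < s" and e: "0 < e"
    let ?W = "Zt \<inter> sq R" and ?W' = "Zt \<inter> sq (R / 4)"
    have R4: "0 < R / 4" using R by simp
    have s0: "0 < s" using s by simp
    \<comment> \<open>This error occurs once with factor \<open>s\<^sup>2\<close>, from the cost,
      and once with factor 6, from the area.\<close>
    define e' where "e' = e / (s\<^sup>2 + 6)"
    have e': "0 < e'" using e s by (simp add: e'_def add_pos_pos)
    have "filterlim \<delta> (at_right 0) sequentially"
    proof -
      have "\<delta> n \<noteq> 0" for n using dpos[of n] by simp
      then show ?thesis using dlim dpos by (simp add: filterlim_at)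
    qed
    then have "filterlim (\<lambda>n. \<delta> n / s) (at_right 0) sequentially"
      by (rule filterlim_compose[OF filterlim_scale_at_right_0[OF s0]])
    from filterlim_compose[OF Enh_tendsto_ItR[OF low_set_eucl[OF zt] ab] this]
    have "(\<lambda>n. (\<delta> n / s)\<^sup>2 * Enh \<tau> \<alpha> \<beta> (Zd (\<delta> n / s) ?W)) \<longlonglongrightarrow> ItR \<tau> \<alpha> \<beta> ?W" .
    then have "eventually (\<lambda>n. (\<delta> n / s)\<^sup>2 * Enh \<tau> \<alpha> \<beta> (Zd (\<delta> n / s) ?W) < ItR \<tau> \<alpha> \<beta> ?W + e') sequentially"
      using e' by (intro order_tendstoD(2)) auto
    from this sandwich[OF R s] sandwich[OF R4 s] area_bound[OF fin e'] small[OF R4]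
    show "eventually (\<lambda>n. ereal ((\<delta> n)\<^sup>2) * J (Zs n) \<le> ereal (s\<^sup>2 * ItR \<tau> \<alpha> \<beta> ?W + 6 * (measure lborel Zt - measure lborel ?W' / s\<^sup>2) + e)) sequentially"
    proof eventually_elim
      case (elim n)
      have d: "0 < \<delta> n" by (rule dpos)
      define q where "q = nat \<lfloor>R / (2 * \<delta> n)\<rfloor>"
      have "0 \<le> R / (2 * \<delta> n)" using R d by simp
      then have "real q \<le> R / (2 * \<delta> n)" "R / (2 * \<delta> n) < real q + 1" unfolding q_def by linarith+
      then have q: "2 * (\<delta> n * q) \<le> R" "R < 2 * (\<delta> n * q) + 2 * \<delta> n" using d by (simp_all add: field_simps)
      have fZ: "finite (Zs n)" using elim(4) by blast
      have Zo: "down_closed (Zd (\<delta> n / s) ?W)" "finite (Zd (\<delta> n / s) ?W)"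
        using down_closed_Zd finite_Zd low_set_eucl[OF zt] d s0 by auto
      have sub1: "Zs n \<inter> Rect (2 * q) (2 * q) \<subseteq> Zd (\<delta> n / s) ?W"
      proof clarify
        fix i j assume ij: "(i, j) \<in> Zs n" "(i, j) \<in> Rect (2 * q) (2 * q)"
        then have "real i \<le> 2 * real q" "real j \<le> 2 * real q" by (auto simp: Rect_def)
        then have "\<delta> n * real i \<le> \<delta> n * (2 * real q)" "\<delta> n * real j \<le> \<delta> n * (2 * real q)" using d by (auto intro: mult_left_mono)
        moreover have "\<delta> n * (2 * real q) = 2 * (\<delta> n * real q)" by simp
        ultimately have "\<delta> n * real i \<le> R" "\<delta> n * real j \<le> R" using q(1) by linarith+
        then show "(i, j) \<in> Zd (\<delta> n / s) ?W" using elim(2) ij(1) by blast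
      qed
      have sub2: "Zd (\<delta> n * s) ?W' \<subseteq> Zs n \<inter> Rect q q"
      proof clarify
        fix i j assume "(i, j) \<in> Zd (\<delta> n * s) ?W'"
        then have ij: "(i, j) \<in> Zs n" "\<delta> n * (real i + 1) \<le> R / 4" "\<delta> n * (real j + 1) \<le> R / 4" using elim(3) by blast+
        have "R / 4 < \<delta> n * real q" using q(2) elim(5) by linarith
        then have "\<delta> n * (real i + 1) < \<delta> n * real q" "\<delta> n * (real j + 1) < \<delta> n * real q" using ij by linarith+
        then have "real i + 1 < real q" "real j + 1 < real q" using d by auto
        then show "(i, j) \<in> Zs n \<inter> Rect q q" using ij(1) by (auto simp: Rect_def)
      qed
      have t: "Enh \<tau> \<alpha> \<beta> (Zs n) \<le> Enh \<tau> \<alpha> \<beta> (Zs n \<inter> Rect (2 * q) (2 * q)) + 6 * real (card (Zs n - Rect q q))"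
        using Enh_tail[OF zs fZ, of \<alpha> \<beta> \<tau> q] ab by simp
      have t1: "Enh \<tau> \<alpha> \<beta> (Zs n \<inter> Rect (2 * q) (2 * q)) \<le> Enh \<tau> \<alpha> \<beta> (Zd (\<delta> n / s) ?W)"
        using ab by (intro Enh_mono Zo sub1) auto
      have c: "real (card (Zs n - Rect q q)) \<le> real (card (Zs n)) - real (card (Zd (\<delta> n * s) ?W'))"
      proof -
        have "card (Zs n - Rect q q) \<le> card (Zs n - Zd (\<delta> n * s) ?W')"
          by (rule card_mono) (use fZ sub2 in auto)
        also have "\<dots> = card (Zs n) - card (Zd (\<delta> n * s) ?W')"
          by (rule card_Diff_subset) (use sub2 fZ finite_subset in auto)
        finally show ?thesis using card_mono[OF fZ, of "Zd (\<delta> n * s) ?W'"] sub2 by auto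
      qed
      have m: "measure lborel ?W' \<le> (\<delta> n * s)\<^sup>2 * card (Zd (\<delta> n * s) ?W')"
        by (rule measure_le_card_Zd[OF low_set_eucl[OF zt]]) (use d s in simp)
      define A B C D where "A = (\<delta> n)\<^sup>2 * Enh \<tau> \<alpha> \<beta> (Zs n)" and "B = (\<delta> n)\<^sup>2 * Enh \<tau> \<alpha> \<beta> (Zd (\<delta> n / s) ?W)"
        and "C = (\<delta> n)\<^sup>2 * real (card (Zs n))" and "D = (\<delta> n)\<^sup>2 * real (card (Zd (\<delta> n * s) ?W'))"
      have "Enh \<tau> \<alpha> \<beta> (Zs n) \<le> Enh \<tau> \<alpha> \<beta> (Zd (\<delta> n / s) ?W) + 6 * (real (card (Zs n)) - real (card (Zd (\<delta> n * s) ?W')))"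
        using t t1 c by (smt (verit))
      then have "A \<le> (\<delta> n)\<^sup>2 * (Enh \<tau> \<alpha> \<beta> (Zd (\<delta> n / s) ?W) + 6 * (real (card (Zs n)) - real (card (Zd (\<delta> n * s) ?W'))))"
        unfolding A_def by (intro mult_left_mono) auto
      then have A: "A \<le> B + 6 * (C - D)" by (simp add: B_def C_def D_def algebra_simps)
      have "B = s\<^sup>2 * ((\<delta> n / s)\<^sup>2 * Enh \<tau> \<alpha> \<beta> (Zd (\<delta> n / s) ?W))" using s by (simp add: B_def power_divide)
      also have "\<dots> \<le> s\<^sup>2 * (ItR \<tau> \<alpha> \<beta> ?W + e')" using elim(1) by (intro mult_left_mono) auto
      finally have B: "B \<le> s\<^sup>2 * ItR \<tau> \<alpha> \<beta> ?W + s\<^sup>2 * e'" by (simp add: algebra_simps)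
      have C: "C \<le> measure lborel Zt + e'" using elim(4) by (simp add: C_def)
      have "measure lborel ?W' \<le> s\<^sup>2 * D" using m by (simp add: D_def power_mult_distrib mult_ac)
      then have D: "measure lborel ?W' / s\<^sup>2 \<le> D" using s by (simp add: pos_divide_le_eq mult.commute)
      have "0 < s\<^sup>2 + 6" by (simp add: add_nonneg_pos)
      then have "(s\<^sup>2 + 6) * e' = e" by (simp add: e'_def)
      then have "s\<^sup>2 * e' + 6 * e' = e" by (simp add: distrib_right)
      then have "A \<le> s\<^sup>2 * ItR \<tau> \<alpha> \<beta> ?W + 6 * (measure lborel Zt - measure lborel ?W' / s\<^sup>2) + e"
        using A B C D by (smt (verit))
      moreover have "ereal ((\<delta> n)\<^sup>2) * J (Zs n) \<le> ereal ((\<delta> n)\<^sup>2) * ereal (Enh \<tau> \<alpha> \<beta> (Zs n))"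
        by (intro ereal_mult_left_mono J_up zs fZ) simp
      ultimately show ?case by (simp add: A_def order_trans[of "ereal ((\<delta> n)\<^sup>2) * J (Zs n)" "ereal A"])
    qed
  }
  fix e :: real assume e: "0 < e"
  obtain R where "0 < R" "measure lborel Zt - measure lborel (Zt \<inter> sq R) < e" using measure_sq_approx[OF zt fin e] by blast
  then show "\<exists>R>0. measure lborel Zt - measure lborel (Zt \<inter> sq (R / 4)) < e" by (intro exI[of _ "4 * R"]) auto
qed

end

text \<open>\<open>ItR_le_scale\<close> takes over the role of the lattice sandwich, for costs as
  well as for areas; the part of \<open>Zn n\<close> far out is controlled by the convergence of
  areas through \<open>ItS_tail\<close>.\<close>

lemma eucl_convergence:
  assumes zn: "\<And>n. eucl_zero_set (Zn n)" and zt: "eucl_zero_set Zt" and conv: "E_conv Zn Zt"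
    and fin: "area Zt < \<infinity>" and ab: "\<alpha> \<in> {0..1}" "\<beta> \<in> {0..1}"
  shows "(\<lambda>n. ItS \<tau> \<alpha> \<beta> (Zn n)) \<longlonglongrightarrow> ItS \<tau> \<alpha> \<beta> Zt"
proof (rule squeeze_scaling[where w = "\<lambda>R. ItR \<tau> \<alpha> \<beta> (Zt \<inter> sq R)" and m = "\<lambda>R. measure lborel (Zt \<inter> sq R)" and a = "measure lborel Zt", OF ItS_def])
  have sw: "eventually (\<lambda>n. (\<forall>x y. (x, y) \<in> Zn n \<inter> sq R \<longrightarrow> (x / s, y / s) \<in> Zt \<inter> sq R) \<and>
      (\<forall>x y. (x, y) \<in> Zt \<inter> sq R \<longrightarrow> (x / s, y / s) \<in> Zn n \<inter> sq R)) sequentially" if R: "0 < R" and s: "1 < s" for R s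
  proof -
    have "haus_conv (\<lambda>n. Zn n \<inter> sq R) (Zt \<inter> sq R)" using conv R by (simp add: E_conv_def)
    from haus_sandwich[OF zt R s this]
    obtain \<eta> where eta: "0 < \<eta>" and ev: "eventually (\<lambda>n. (\<forall>x y. (x, y) \<in> Zn n \<inter> sq R \<longrightarrow> (x / s, y / s) \<in> Zt \<inter> sq R) \<and>
     (\<forall>x y. (x, y) \<in> Zt \<inter> sq R \<longrightarrow> (\<exists>a b. (a, b) \<in> Zn n \<inter> sq R \<and> x / s + \<eta> \<le> a \<and> y / s + \<eta> \<le> b))) sequentially"
      by blast
    show ?thesis using ev
    proof eventually_elim
      case (elim n)
      have "(x / s, y / s) \<in> Zn n \<inter> sq R" if xy: "(x, y) \<in> Zt \<inter> sq R" for x y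
      proof -
        obtain a b where ab: "(a, b) \<in> Zn n \<inter> sq R" "x / s + \<eta> \<le> a" "y / s + \<eta> \<le> b" using elim xy by blast
        show ?thesis by (rule low_setD[OF low_set_eucl[OF zn] ab(1)]) (use xy s ab eta in auto)
      qed
      then show ?case using elim by blast
    qed
  qed
  show "mono (\<lambda>R. ItR \<tau> \<alpha> \<beta> (Zt \<inter> sq R))" by (rule monoI) (rule ItR_sq_mono[OF zt ab])
  {
    fix R s e :: real assume R: "0 < R" and s: "1 < s" and e: "0 < e"
    show "eventually (\<lambda>n. ereal (ItR \<tau> \<alpha> \<beta> (Zt \<inter> sq R)) \<le> ereal (s\<^sup>2) * ItS \<tau> \<alpha> \<beta> (Zn n) + ereal e) sequentially"
      using sw[OF R s]
    proof eventually_elim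
      case (elim n)
      have "ItR \<tau> \<alpha> \<beta> (Zt \<inter> sq R) \<le> s\<^sup>2 * ItR \<tau> \<alpha> \<beta> (Zn n \<inter> sq R)"
        by (rule ItR_le_scale(1)[OF low_set_eucl[OF zt] low_set_eucl[OF zn] ab]) (use s elim in auto)
      then have "ereal (ItR \<tau> \<alpha> \<beta> (Zt \<inter> sq R)) \<le> ereal (s\<^sup>2) * ereal (ItR \<tau> \<alpha> \<beta> (Zn n \<inter> sq R))" by simp
      also have "\<dots> \<le> ereal (s\<^sup>2) * ItS \<tau> \<alpha> \<beta> (Zn n)" by (intro ereal_mult_left_mono ItR_sq_le_ItS) simp
      also have "\<dots> \<le> ereal (s\<^sup>2) * ItS \<tau> \<alpha> \<beta> (Zn n) + ereal e" using e by (intro ereal_le_add_self) simp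
      finally show ?case .
    qed
  next
    fix R s e :: real assume R: "0 < R" and s: "1 < s" and e: "0 < e"
    let ?W = "Zt \<inter> sq R" and ?W' = "Zt \<inter> sq (R / 4)"
    have R4: "0 < R / 4" using R by simp
    have a: "area Zt = ennreal (measure lborel Zt)"
      using fin by (simp add: area_def emeasure_eq_ennreal_measure less_top[symmetric])
    have "ennreal (measure lborel Zt) < ennreal (measure lborel Zt + e / 6)" using e by (simp add: ennreal_less_iff)
    moreover have "(\<lambda>n. area (Zn n)) \<longlonglongrightarrow> area Zt" using conv by (simp add: E_conv_def)
    ultimately have "eventually (\<lambda>n. area (Zn n) < ennreal (measure lborel Zt + e / 6)) sequentially"
      using a order_tendstoD(2) by metis
    from this sw[OF R s] sw[OF R4 s]
    show "eventually (\<lambda>n. ItS \<tau> \<alpha> \<beta> (Zn n) \<le> ereal (s\<^sup>2 * ItR \<tau> \<alpha> \<beta> ?W + 6 * (measure lborel Zt - measure lborel ?W' / s\<^sup>2) + e)) sequentially"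
    proof eventually_elim
      case (elim n)
      have fn: "area (Zn n) < \<infinity>" using elim(1) by (metis ennreal_less_top infinity_ennreal_def less_trans)
      then have "area (Zn n) = ennreal (measure lborel (Zn n))"
        by (simp add: area_def emeasure_eq_ennreal_measure less_top[symmetric])
      from less_imp_le[OF elim(1)[unfolded this]]
      have C: "measure lborel (Zn n) \<le> measure lborel Zt + e / 6"
        using e by (subst (asm) ennreal_le_iff) (auto intro: add_nonneg_nonneg)
      have B: "ItR \<tau> \<alpha> \<beta> (Zn n \<inter> sq R) \<le> s\<^sup>2 * ItR \<tau> \<alpha> \<beta> ?W"
        by (rule ItR_le_scale(1)[OF low_set_eucl[OF zn] low_set_eucl[OF zt] ab]) (use s elim in auto)
      have "measure lborel ?W' \<le> s\<^sup>2 * measure lborel (Zn n \<inter> sq (R / 4))"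
        by (rule ItR_le_scale(2)[OF low_set_eucl[OF zt] low_set_eucl[OF zn] ab]) (use s elim in auto)
      then have D: "measure lborel ?W' / s\<^sup>2 \<le> measure lborel (Zn n \<inter> sq (R / 4))" using s by (simp add: pos_divide_le_eq mult.commute)
      have "ItR \<tau> \<alpha> \<beta> (Zn n \<inter> sq R) + 6 * (measure lborel (Zn n) - measure lborel (Zn n \<inter> sq (R / 4)))
          \<le> s\<^sup>2 * ItR \<tau> \<alpha> \<beta> ?W + 6 * (measure lborel Zt - measure lborel ?W' / s\<^sup>2) + e"
      proof -
        have "a + 6 * (c - y) \<le> b + 6 * (d - x) + e" if "a \<le> b" "c \<le> d + e / 6" "x \<le> y" for a b c d x y :: real
          using that by simp
        from this[OF B C D] show ?thesis .
      qed
      then show ?case using ItS_tail[OF zn fn ab R, of \<tau>] by (meson ereal_less_eq(3) order_trans)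
    qed
  }
  fix e :: real assume e: "0 < e"
  obtain R where "0 < R" "measure lborel Zt - measure lborel (Zt \<inter> sq R) < e" using measure_sq_approx[OF zt fin e] by blast
  then show "\<exists>R>0. measure lborel Zt - measure lborel (Zt \<inter> sq (R / 4)) < e" by (intro exI[of _ "4 * R"]) auto
qed

section \<open>Uniformity and the main theorem\<close>

text \<open>Polya's argument: pointwise convergence of monotone functions to a continuous one on a
  compact square is uniform, because it suffices to control a finite grid.\<close>

lemma antimono_uniform_convergence:
  fixes X :: "nat \<Rightarrow> real \<Rightarrow> real \<Rightarrow> ereal" and T :: "real \<Rightarrow> real \<Rightarrow> real"
  assumes cont: "continuous_on ({0..1} \<times> {0..1}) (\<lambda>(\<alpha>, \<beta>). T \<alpha> \<beta>)"
    and anti: "\<And>n \<alpha> \<beta> \<alpha>' \<beta>'. \<alpha> \<in> {0..1} \<Longrightarrow> \<beta> \<in> {0..1} \<Longrightarrow> \<alpha>' \<in> {0..1} \<Longrightarrow> \<beta>' \<in> {0..1} \<Longrightarrow>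
       \<alpha> \<le> \<alpha>' \<Longrightarrow> \<beta> \<le> \<beta>' \<Longrightarrow> X n \<alpha>' \<beta>' \<le> X n \<alpha> \<beta>"
    and lim: "\<And>\<alpha> \<beta>. \<alpha> \<in> {0..1} \<Longrightarrow> \<beta> \<in> {0..1} \<Longrightarrow> (\<lambda>n. X n \<alpha> \<beta>) \<longlonglongrightarrow> ereal (T \<alpha> \<beta>)"
    and e: "0 < e"
  shows "eventually (\<lambda>n. \<forall>\<alpha>\<in>{0..1}. \<forall>\<beta>\<in>{0..1}. \<bar>X n \<alpha> \<beta> - ereal (T \<alpha> \<beta>)\<bar> < ereal e) sequentially"
proof -
  have "uniformly_continuous_on ({0..1} \<times> {0..1}) (\<lambda>(\<alpha>, \<beta>). T \<alpha> \<beta>)"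
    by (intro compact_uniformly_continuous cont compact_Times) auto
  then obtain d where d: "0 < d" and uc: "\<And>x y. x \<in> {0..1} \<times> {0..1} \<Longrightarrow> y \<in> {0..1} \<times> {0..1} \<Longrightarrow> dist y x < d \<Longrightarrow>
      dist ((\<lambda>(\<alpha>, \<beta>). T \<alpha> \<beta>) y) ((\<lambda>(\<alpha>, \<beta>). T \<alpha> \<beta>) x) < e / 2"
    unfolding uniformly_continuous_on_def using e by (metis half_gt_zero)
  have ucT: "\<bar>T a b - T \<alpha> \<beta>\<bar> < e / 2"
    if "\<alpha> \<in> {0..1}" "\<beta> \<in> {0..1}" "a \<in> {0..1}" "b \<in> {0..1}" "\<bar>a - \<alpha>\<bar> < d / 2" "\<bar>b - \<beta>\<bar> < d / 2" for \<alpha> \<beta> a b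
  proof -
    have "dist (a, b) (\<alpha>, \<beta>) \<le> \<bar>a - \<alpha>\<bar> + \<bar>b - \<beta>\<bar>"
      unfolding dist_Pair_Pair dist_real_def using sqrt_sum_squares_le_sum_abs by simp
    then have "dist (a, b) (\<alpha>, \<beta>) < d" using that by linarith
    then show ?thesis using uc[of "(\<alpha>, \<beta>)" "(a, b)"] that by (simp add: dist_real_def)
  qed
  obtain m :: nat where m: "2 / d < real m" using reals_Archimedean2 by blast
  have m0: "0 < real m" using m d by (meson divide_pos_pos less_trans zero_less_numeral)
  then have m': "1 / real m < d / 2" using m d by (simp add: field_simps)
  define G where "G = (\<lambda>i::nat. real i / real m) ` {..m}"
  have G: "finite G" "G \<subseteq> {0..1}" using m0 by (auto simp: G_def)
  have "eventually (\<lambda>n. \<forall>a\<in>G. \<forall>b\<in>G. ereal (T a b - e / 2) < X n a b \<and> X n a b < ereal (T a b + e / 2)) sequentially"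
  proof (intro eventually_ball_finite G ballI eventually_conj)
    fix a b assume "a \<in> G" "b \<in> G"
    then have l: "(\<lambda>n. X n a b) \<longlonglongrightarrow> ereal (T a b)" using G lim by blast
    show "eventually (\<lambda>n. ereal (T a b - e / 2) < X n a b) sequentially" by (rule order_tendstoD(1)[OF l]) (use e in simp)
    show "eventually (\<lambda>n. X n a b < ereal (T a b + e / 2)) sequentially" by (rule order_tendstoD(2)[OF l]) (use e in simp)
  qed
  then show ?thesis
  proof eventually_elim
    case (elim n)
    have near: "\<exists>lo\<in>G. \<exists>hi\<in>G. lo \<le> \<alpha> \<and> \<alpha> \<le> hi \<and> \<bar>lo - \<alpha>\<bar> < d / 2 \<and> \<bar>hi - \<alpha>\<bar> < d / 2" if a: "\<alpha> \<in> {0..1}" for \<alpha>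
    proof -
      define i where "i = nat \<lfloor>\<alpha> * real m\<rfloor>"
      define j where "j = nat \<lceil>\<alpha> * real m\<rceil>"
      have am: "0 \<le> \<alpha> * real m" "\<alpha> * real m \<le> real m" using a m0 by (auto simp: mult_left_le_one_le)
      have i: "real i \<le> \<alpha> * real m" "\<alpha> * real m < real i + 1" using am unfolding i_def by linarith+
      have j: "\<alpha> * real m \<le> real j" "real j < \<alpha> * real m + 1" using am unfolding j_def by linarith+
      have "i \<le> m" using i(1) am(2) by linarith
      moreover have "j \<le> m" using am unfolding j_def by linarith
      ultimately have "real i / real m \<in> G" "real j / real m \<in> G" by (auto simp: G_def)
      moreover have "real i / real m \<le> \<alpha>" "\<alpha> \<le> real j / real m" "\<alpha> < real i / real m + 1 / real m" "real j / real m < \<alpha> + 1 / real m"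
        using i j m0 by (simp_all add: field_simps)
      moreover have "\<bar>x - \<alpha>\<bar> < d / 2" if "x \<le> \<alpha>" "\<alpha> < x + t" "t < d / 2" for x t :: real using that by simp
      moreover have "\<bar>x - \<alpha>\<bar> < d / 2" if "\<alpha> \<le> x" "x < \<alpha> + t" "t < d / 2" for x t :: real using that by simp
      ultimately show ?thesis using m' by blast
    qed
    show ?case
    proof (intro ballI)
      fix \<alpha> \<beta> :: real assume ab: "\<alpha> \<in> {0..1}" "\<beta> \<in> {0..1}"
      obtain a1 a2 where a: "a1 \<in> G" "a2 \<in> G" "a1 \<le> \<alpha>" "\<alpha> \<le> a2" "\<bar>a1 - \<alpha>\<bar> < d / 2" "\<bar>a2 - \<alpha>\<bar> < d / 2" using near[OF ab(1)] by blast
      obtain b1 b2 where b: "b1 \<in> G" "b2 \<in> G" "b1 \<le> \<beta>" "\<beta> \<le> b2" "\<bar>b1 - \<beta>\<bar> < d / 2" "\<bar>b2 - \<beta>\<bar> < d / 2" using near[OF ab(2)] by blast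
      have mem: "a1 \<in> {0..1}" "a2 \<in> {0..1}" "b1 \<in> {0..1}" "b2 \<in> {0..1}" using a b G by blast+
      have "X n \<alpha> \<beta> \<le> X n a1 b1" using anti mem ab a b by blast
      also have "\<dots> < ereal (T a1 b1 + e / 2)" using elim a b by blast
      also have "ereal (T a1 b1 + e / 2) < ereal (T \<alpha> \<beta> + e)"
      proof -
        have "T a1 b1 + e / 2 < T \<alpha> \<beta> + e" using ucT[OF ab mem(1,3) a(5) b(5)] by linarith
        then show ?thesis by simp
      qed
      finally have u: "X n \<alpha> \<beta> < ereal (T \<alpha> \<beta> + e)" .
      have "T \<alpha> \<beta> - e < T a2 b2 - e / 2" using ucT[OF ab mem(2,4) a(6) b(6)] by linarith
      then have "ereal (T \<alpha> \<beta> - e) < ereal (T a2 b2 - e / 2)" by simp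
      also have "\<dots> < X n a2 b2" using elim a b by blast
      also have "\<dots> \<le> X n \<alpha> \<beta>" using anti mem ab a b by blast
      finally have l: "ereal (T \<alpha> \<beta> - e) < X n \<alpha> \<beta>" .
      show "\<bar>X n \<alpha> \<beta> - ereal (T \<alpha> \<beta>)\<bar> < ereal e"
        using u l by (cases "X n \<alpha> \<beta>") (auto simp: abs_less_iff)
    qed
  qed
qed

subsection \<open>Finite area: regularity of the limit\<close>

context
  fixes Zt :: "(real \<times> real) set"
  assumes zt: "eucl_zero_set Zt" and fin: "area Zt < \<infinity>"
begin

definition TS :: "bool \<Rightarrow> real \<Rightarrow> real \<Rightarrow> real" where "TS \<tau> \<alpha> \<beta> = real_of_ereal (ItS \<tau> \<alpha> \<beta> Zt)"

lemma ItS_eq_TS: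
  assumes "\<alpha> \<in> {0..1}" "\<beta> \<in> {0..1}" shows "ItS \<tau> \<alpha> \<beta> Zt = ereal (TS \<tau> \<alpha> \<beta>)"
  using ItS_nonneg[OF zt assms, of \<tau>] ItS_le_measure(1)[OF zt fin assms, of \<tau>] unfolding TS_def
  by (cases "ItS \<tau> \<alpha> \<beta> Zt") auto

lemma TS_tendsto:
  assumes "\<alpha> \<in> {0..1}" "\<beta> \<in> {0..1}"
  shows "((\<lambda>R. ItR \<tau> \<alpha> \<beta> (Zt \<inter> sq R)) \<longlongrightarrow> TS \<tau> \<alpha> \<beta>) at_top"
  using ItS_tendsto[OF zt assms, of \<tau>] unfolding ItS_eq_TS[OF assms] by simp

lemma TS_bounds:
  assumes "\<alpha> \<in> {0..1}" "\<beta> \<in> {0..1}"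
  shows "0 \<le> TS \<tau> \<alpha> \<beta>" "TS \<tau> \<alpha> \<beta> \<le> (1 - \<alpha>) * measure lborel Zt" "TS \<tau> \<alpha> \<beta> \<le> (1 - \<beta>) * measure lborel Zt"
  using ItS_nonneg[OF zt assms, of \<tau>] ItS_le_measure[OF zt fin assms, of \<tau>] unfolding ItS_eq_TS[OF assms] by auto

lemma TS_ratio:
  assumes "\<alpha> \<in> {0..1}" "\<beta> \<in> {0..1}" "\<alpha>' \<in> {0..1}" "\<beta>' \<in> {0..1}"
    "0 \<le> r" "r \<le> 1" "r * (1 - \<alpha>) \<le> 1 - \<alpha>'" "r * (1 - \<beta>) \<le> 1 - \<beta>'"
  shows "r * TS \<tau> \<alpha> \<beta> \<le> TS \<tau> \<alpha>' \<beta>'"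
  by (rule tendsto_le[OF _ TS_tendsto[OF assms(3,4)] tendsto_mult_left[OF TS_tendsto[OF assms(1,2)]]])
    (use ItR_ratio[OF low_set_eucl[OF zt] assms] in auto)

lemma TS_concave: "concave_on ({0..1} \<times> {0..1}) (\<lambda>(\<alpha>, \<beta>). TS \<tau> \<alpha> \<beta>)"
  unfolding concave_on_iff
proof (intro conjI ballI allI impI)
  show "convex ({0..1::real} \<times> {0..1::real})" by (intro convex_Times) auto
  fix x y :: "real \<times> real" and s t :: real
  assume xy: "x \<in> {0..1} \<times> {0..1}" "y \<in> {0..1} \<times> {0..1}" and st: "0 \<le> s" "0 \<le> t" "s + t = 1"
  obtain a b where x: "x = (a, b)" by (cases x)
  obtain a' b' where y: "y = (a', b')" by (cases y)
  have mem: "a \<in> {0..1}" "b \<in> {0..1}" "a' \<in> {0..1}" "b' \<in> {0..1}" using xy x y by auto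
  have m: "s * u + t * v \<in> {0..1}" if "u \<in> {0..1}" "v \<in> {0..1}" for u v :: real
    using convexD[of "{0..1::real}" u v s t] that st by auto
  have "s * TS \<tau> a b + t * TS \<tau> a' b' \<le> TS \<tau> (s * a + t * a') (s * b + t * b')"
    by (rule tendsto_le[OF _ TS_tendsto[OF m m] tendsto_add[OF tendsto_mult_left[OF TS_tendsto] tendsto_mult_left[OF TS_tendsto]]])
      (use ItR_concave[OF low_set_eucl[OF zt]] mem st in auto)
  then show "s * (case x of (\<alpha>, \<beta>) \<Rightarrow> TS \<tau> \<alpha> \<beta>) + t * (case y of (\<alpha>, \<beta>) \<Rightarrow> TS \<tau> \<alpha> \<beta>) \<le> (case s *\<^sub>R x + t *\<^sub>R y of (\<alpha>, \<beta>) \<Rightarrow> TS \<tau> \<alpha> \<beta>)"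
    by (simp add: x y)
qed

text \<open>On the sides \<alpha> = 1 and \<beta> = 1 the bounds of \<open>TS_bounds\<close> squeeze
  nearby values to 0. Elsewhere \<open>TS_ratio\<close>, used in both directions, encloses them
  between multiples of the central value with factors tending to 1.\<close>

lemma TS_continuous: "continuous_on ({0..1} \<times> {0..1}) (\<lambda>(\<alpha>, \<beta>). TS \<tau> \<alpha> \<beta>)"
  unfolding continuous_on_def
proof
  let ?S = "{0..1::real} \<times> {0..1::real}"
  fix z assume z: "z \<in> ?S"
  obtain a b where ab: "z = (a, b)" by (cases z)
  have mem: "a \<in> {0..1}" "b \<in> {0..1}" using z ab by auto
  have ft: "(fst \<longlongrightarrow> a) (at z within ?S)" "(snd \<longlongrightarrow> b) (at z within ?S)"
    using tendsto_fst[OF tendsto_ident_at, of z ?S] tendsto_snd[OF tendsto_ident_at, of z ?S] by (auto simp: ab)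
  have inS: "eventually (\<lambda>x. x \<in> ?S) (at z within ?S)" by (simp add: eventually_at_filter)
  let ?T = "\<lambda>x. TS \<tau> (fst x) (snd x)" and ?M = "measure lborel Zt"
  have "(?T \<longlongrightarrow> TS \<tau> a b) (at z within ?S)"
  proof (cases "a = 1 \<or> b = 1")
    case True
    then have T0: "TS \<tau> a b = 0" using TS_bounds[OF mem, of \<tau>] by auto
    have "((\<lambda>x. min ((1 - fst x) * ?M) ((1 - snd x) * ?M)) \<longlongrightarrow> min ((1 - a) * ?M) ((1 - b) * ?M)) (at z within ?S)"
      by (intro tendsto_intros ft)
    moreover have "0 \<le> (1 - a) * ?M" "0 \<le> (1 - b) * ?M" using mem by simp_all
    then have "min ((1 - a) * ?M) ((1 - b) * ?M) = 0" using True by (auto simp: min_def)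
    ultimately have up: "((\<lambda>x. min ((1 - fst x) * ?M) ((1 - snd x) * ?M)) \<longlongrightarrow> 0) (at z within ?S)" by simp
    have "(?T \<longlongrightarrow> 0) (at z within ?S)"
      by (rule tendsto_sandwich[OF _ _ tendsto_const up]; use inS in eventually_elim; use TS_bounds in auto)
    then show ?thesis using T0 by simp
  next
    case False
    then have lt: "a < 1" "b < 1" using mem by auto
    \<comment> \<open>The largest factor that \<open>TS_ratio\<close> admits from the central point
      to \<open>x\<close>; \<open>r'\<close> is the one for the opposite direction.\<close>
    define r where "r x = min 1 (min ((1 - fst x) / (1 - a)) ((1 - snd x) / (1 - b)))" for x
    define r' where "r' x = min 1 (min ((1 - a) / (1 - fst x)) ((1 - b) / (1 - snd x)))" for x
    have "(r \<longlongrightarrow> min 1 (min ((1 - a) / (1 - a)) ((1 - b) / (1 - b)))) (at z within ?S)"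
      unfolding r_def[abs_def] by (intro tendsto_intros ft) (use lt in auto)
    then have r: "(r \<longlongrightarrow> 1) (at z within ?S)" using lt by simp
    have "(r' \<longlongrightarrow> min 1 (min ((1 - a) / (1 - a)) ((1 - b) / (1 - b)))) (at z within ?S)"
      unfolding r'_def[abs_def] by (intro tendsto_intros ft) (use lt in auto)
    then have r': "(r' \<longlongrightarrow> 1) (at z within ?S)" using lt by simp
    have lo: "((\<lambda>x. r x * TS \<tau> a b) \<longlongrightarrow> TS \<tau> a b) (at z within ?S)"
      using tendsto_mult[OF r tendsto_const, of "TS \<tau> a b"] by simp
    have hi: "((\<lambda>x. TS \<tau> a b / r' x) \<longlongrightarrow> TS \<tau> a b) (at z within ?S)"
      using tendsto_divide[OF tendsto_const r', of "TS \<tau> a b"] by simp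
    have ev: "eventually (\<lambda>x. fst x < 1) (at z within ?S)" "eventually (\<lambda>x. snd x < 1) (at z within ?S)"
      using order_tendstoD(2)[OF ft(1)] order_tendstoD(2)[OF ft(2)] lt by blast+
    show ?thesis
    proof (rule tendsto_sandwich[OF _ _ lo hi])
      show "eventually (\<lambda>x. r x * TS \<tau> a b \<le> ?T x) (at z within ?S)"
        using inS ev
      proof eventually_elim
        case (elim x)
        have "r x \<le> (1 - fst x) / (1 - a)" "r x \<le> (1 - snd x) / (1 - b)" by (auto simp: r_def)
        then have "r x * (1 - a) \<le> 1 - fst x" "r x * (1 - b) \<le> 1 - snd x" using lt by (simp_all add: pos_le_divide_eq)
        moreover have "0 \<le> r x" "r x \<le> 1" using elim lt by (auto simp: r_def)
        ultimately show ?case using elim mem by (intro TS_ratio) auto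
      qed
      show "eventually (\<lambda>x. ?T x \<le> TS \<tau> a b / r' x) (at z within ?S)"
        using inS ev
      proof eventually_elim
        case (elim x)
        have "r' x \<le> (1 - a) / (1 - fst x)" "r' x \<le> (1 - b) / (1 - snd x)" by (auto simp: r'_def)
        then have "r' x * (1 - fst x) \<le> 1 - a" "r' x * (1 - snd x) \<le> 1 - b" using elim by (simp_all add: pos_le_divide_eq)
        moreover have r0: "0 < r' x" "r' x \<le> 1" using elim lt by (auto simp: r'_def)
        ultimately have "r' x * ?T x \<le> TS \<tau> a b" using elim mem by (intro TS_ratio) auto
        then show ?case using r0 by (simp add: pos_le_divide_eq mult.commute)
      qed
    qed
  qed
  then show "((\<lambda>(\<alpha>, \<beta>). TS \<tau> \<alpha> \<beta>) \<longlongrightarrow> (case z of (\<alpha>, \<beta>) \<Rightarrow> TS \<tau> \<alpha> \<beta>)) (at z within ?S)"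
    by (simp add: ab case_prod_unfold)
qed

end

lemma ItS_antimono:
  assumes "eucl_zero_set Z" "\<alpha> \<in> {0..1}" "\<beta> \<in> {0..1}" "\<alpha>' \<in> {0..1}" "\<beta>' \<in> {0..1}" "\<alpha> \<le> \<alpha>'" "\<beta> \<le> \<beta>'"
  shows "ItS \<tau> \<alpha>' \<beta>' Z \<le> ItS \<tau> \<alpha> \<beta> Z"
  unfolding ItS_def
  by (rule SUP_mono') (use ItR_antimono[OF low_set_eucl[OF assms(1)] assms(2-7)] in simp)

subsection \<open>The discrete rate of infinite zero-sets\<close>

text \<open>One formula for both branches of \<open>I_disc\<close>: the truncations have increasing
  exponents, which are eventually constant if \<open>Z\<close> is finite.\<close>

lemma I_disc_eq_SUP:
  assumes Z: "down_closed Z" and ab: "\<alpha> \<in> {0..1}" "\<beta> \<in> {0..1}"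
  shows "I_disc \<alpha> \<beta> Z = (SUP m. ereal (Irate \<alpha> \<beta> (Z \<inter> Rect m m)))"
proof -
  have ZR: "down_closed (Z \<inter> Rect m m)" "finite (Z \<inter> Rect m m)" for m
    using down_closed_Int[OF Z down_closed_Rect] by auto
  have I: "I_fin \<alpha> \<beta> (Z \<inter> Rect m m) = ereal (Irate \<alpha> \<beta> (Z \<inter> Rect m m))" for m
    using ab by (intro I_fin_eq_Irate ZR) auto
  have mono: "Irate \<alpha> \<beta> (Z \<inter> Rect m m) \<le> Irate \<alpha> \<beta> (Z \<inter> Rect k k)" if "m \<le> k" for m k
    using Rect_mono[OF that that] by (intro Irate_mono ZR) auto
  show ?thesis
  proof (cases "finite Z")
    case True
    obtain k where k: "Z \<subseteq> Rect k k" using finite_subset_Rect[OF True] by blast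
    then have e: "Z \<inter> Rect k k = Z" by blast
    have "ereal (Irate \<alpha> \<beta> (Z \<inter> Rect m m)) \<le> ereal (Irate \<alpha> \<beta> Z)" for m
      using Irate_mono[OF ZR(1) Z True, of m] by simp
    moreover have "ereal (Irate \<alpha> \<beta> (Z \<inter> Rect k k)) \<le> (SUP m. ereal (Irate \<alpha> \<beta> (Z \<inter> Rect m m)))"
      by (rule SUP_upper) simp
    ultimately have "(SUP m. ereal (Irate \<alpha> \<beta> (Z \<inter> Rect m m))) = ereal (Irate \<alpha> \<beta> Z)"
      unfolding e by (intro antisym SUP_least) auto
    moreover have "I_disc \<alpha> \<beta> Z = ereal (Irate \<alpha> \<beta> Z)" using True I_fin_eq_Irate[OF Z True] ab by (simp add: I_disc_def)
    ultimately show ?thesis by simp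
  next
    case False
    have "(\<lambda>m. ereal (Irate \<alpha> \<beta> (Z \<inter> Rect m m))) \<longlonglongrightarrow> (SUP m. ereal (Irate \<alpha> \<beta> (Z \<inter> Rect m m)))"
      by (rule LIMSEQ_SUP) (use mono in \<open>auto simp: incseq_def\<close>)
    then show ?thesis using False by (simp add: I_disc_def I limI)
  qed
qed

lemma I_disc_antimono:
  assumes Z: "down_closed Z" and ab: "\<alpha> \<in> {0..1}" "\<beta> \<in> {0..1}" "\<alpha>' \<in> {0..1}" "\<beta>' \<in> {0..1}" "\<alpha> \<le> \<alpha>'" "\<beta> \<le> \<beta>'"
  shows "I_disc \<alpha>' \<beta>' Z \<le> I_disc \<alpha> \<beta> Z"
  unfolding I_disc_eq_SUP[OF Z ab(1,2)] I_disc_eq_SUP[OF Z ab(3,4)]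
  by (rule SUP_mono') (use Irate_antimono[OF down_closed_Int[OF Z down_closed_Rect]] ab in simp)

lemma I_disc_nonneg:
  assumes Z: "down_closed Z" and ab: "\<alpha> \<in> {0..1}" "\<beta> \<in> {0..1}" shows "0 \<le> I_disc \<alpha> \<beta> Z"
  unfolding I_disc_eq_SUP[OF assms]
  by (rule SUP_upper2[of 0]) (use Irate_nonneg[OF down_closed_Int[OF Z down_closed_Rect]] in auto)

lemma Irate_le_I_disc:
  assumes "down_closed Z" "\<alpha> \<in> {0..1}" "\<beta> \<in> {0..1}"
  shows "ereal (Irate \<alpha> \<beta> (Z \<inter> Rect m m)) \<le> I_disc \<alpha> \<beta> Z"
  unfolding I_disc_eq_SUP[OF assms] by (rule SUP_upper) simp

text \<open>Treated apart because \<open>Enh_le_Irate\<close> requires both parameters below 1; on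
  these two sides the discrete and, by \<open>ItS_boundary\<close>, the Euclidean values
  vanish.\<close>

lemma I_disc_boundary:
  assumes Z: "down_closed Z" and ab: "\<alpha> \<in> {0..1}" "\<beta> \<in> {0..1}" "\<alpha> = 1 \<or> \<beta> = 1"
  shows "I_disc \<alpha> \<beta> Z = 0"
proof -
  have "Irate \<alpha> \<beta> (Z \<inter> Rect m m) = 0" for m
  proof -
    have ZR: "down_closed (Z \<inter> Rect m m)" "finite (Z \<inter> Rect m m)"
      using down_closed_Int[OF Z down_closed_Rect] by auto
    have "Irate \<alpha> \<beta> (Z \<inter> Rect m m) \<le> Enh False \<alpha> \<beta> (Z \<inter> Rect m m)" by (rule Irate_le_Enh[OF ZR ab(1,2)])
    then show ?thesis using Enh_le_card[OF ZR, of \<alpha> \<beta> False] Irate_nonneg[OF ZR, of \<alpha> \<beta>] ab by auto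
  qed
  then show ?thesis unfolding I_disc_eq_SUP[OF Z ab(1,2)] by (simp add: zero_ereal_def)
qed

lemma ItS_boundary:
  assumes Z: "eucl_zero_set Z" and ab: "\<alpha> \<in> {0..1}" "\<beta> \<in> {0..1}" "\<alpha> = 1 \<or> \<beta> = 1"
  shows "ItS \<tau> \<alpha> \<beta> Z = 0"
proof -
  have "ItR \<tau> \<alpha> \<beta> (Z \<inter> sq R) = 0" for R
    using ItR_le_measure[OF low_set_eucl[OF Z] ab(1,2), of \<tau> R] ItR_nonneg[OF low_set_eucl[OF Z], of \<alpha> \<beta> \<tau> R] ab by auto
  then show ?thesis unfolding ItS_def by (simp add: zero_ereal_def)
qed

context disc_approx
begin

lemma I_disc_convergence:
  assumes ab: "\<alpha> \<in> {0..1}" "\<beta> \<in> {0..1}"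
  shows "(\<lambda>n. ereal ((\<delta> n)\<^sup>2) * I_disc \<alpha> \<beta> (Zs n)) \<longlonglongrightarrow> ItS False \<alpha> \<beta> Zt"
proof (cases "\<alpha> = 1 \<or> \<beta> = 1")
  case True
  then show ?thesis using I_disc_boundary[OF zs ab True] ItS_boundary[OF zt ab True] by simp
next
  case False
  then have ab1: "\<alpha> \<in> {0..<1}" "\<beta> \<in> {0..<1}" using ab by auto
  show ?thesis
  proof (rule convergence[OF ab])
    fix Z assume "down_closed Z" "finite Z"
    then show "I_disc \<alpha> \<beta> Z \<le> ereal (Enh False \<alpha> \<beta> Z)"
      using I_fin_eq_Irate[of Z \<alpha> \<beta>] Irate_le_Enh[of Z \<alpha> \<beta> False] ab by (simp add: I_disc_def)
  next
    fix e :: real assume "0 < e"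
    then obtain m0 where m0: "\<And>m Z. m0 \<le> m \<Longrightarrow> down_closed Z \<Longrightarrow> Z \<subseteq> Rect m m \<Longrightarrow> Enh False \<alpha> \<beta> Z \<le> Irate \<alpha> \<beta> Z + e * real m ^ 2"
      using Enh_le_Irate[OF ab1] by blast
    have "ereal (Enh False \<alpha> \<beta> (Z \<inter> Rect m m)) \<le> I_disc \<alpha> \<beta> Z + ereal (e * real m ^ 2)" if "m0 \<le> m" "down_closed Z" for m Z
    proof -
      have "ereal (Enh False \<alpha> \<beta> (Z \<inter> Rect m m)) \<le> ereal (Irate \<alpha> \<beta> (Z \<inter> Rect m m)) + ereal (e * real m ^ 2)"
        using m0[OF that(1) down_closed_Int[OF that(2) down_closed_Rect]] by simp
      also have "\<dots> \<le> I_disc \<alpha> \<beta> Z + ereal (e * real m ^ 2)"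
        by (rule add_right_mono[OF Irate_le_I_disc[OF that(2) ab]])
      finally show ?thesis .
    qed
    then show "\<exists>m0. \<forall>m\<ge>m0. \<forall>Z. down_closed Z \<longrightarrow> ereal (Enh False \<alpha> \<beta> (Z \<inter> Rect m m)) \<le> I_disc \<alpha> \<beta> Z + ereal (e * real m ^ 2)"
      by blast
  qed (use I_disc_nonneg ab ItS_infinite[OF zt _ ab1] in auto)
qed

lemma gamma_convergence: "(\<lambda>n. ereal ((\<delta> n)\<^sup>2) * gamma (Zs n)) \<longlonglongrightarrow> ItS False 0 0 Zt"
proof (rule convergence)
  fix Z assume "down_closed Z" "finite Z"
  then show "gamma Z \<le> ereal (Enh False 0 0 Z)" using gamma_eq_Irate Irate_le_Enh[of Z 0 0 False] by simp
next
  fix e :: real assume "0 < e"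
  then obtain m0 where m0: "\<And>m Z. m0 \<le> m \<Longrightarrow> down_closed Z \<Longrightarrow> Z \<subseteq> Rect m m \<Longrightarrow> Enh False 0 0 Z \<le> Irate 0 0 Z + e * real m ^ 2"
    using Enh_le_Irate[of 0 0 e] by auto
  have "ereal (Enh False 0 0 (Z \<inter> Rect m m)) \<le> gamma Z + ereal (e * real m ^ 2)" if "m0 \<le> m" "down_closed Z" for m Z
  proof -
    have ZR: "down_closed (Z \<inter> Rect m m)" "finite (Z \<inter> Rect m m)"
      using down_closed_Int[OF that(2) down_closed_Rect] by auto
    have "ereal (Enh False 0 0 (Z \<inter> Rect m m)) \<le> gamma (Z \<inter> Rect m m) + ereal (e * real m ^ 2)"
      unfolding gamma_eq_Irate[OF ZR] using m0[OF that(1) ZR(1)] by simp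
    also have "\<dots> \<le> gamma Z + ereal (e * real m ^ 2)" by (intro add_right_mono gamma_mono ZR) auto
    finally show ?thesis .
  qed
  then show "\<exists>m0. \<forall>m\<ge>m0. \<forall>Z. down_closed Z \<longrightarrow> ereal (Enh False 0 0 (Z \<inter> Rect m m)) \<le> gamma Z + ereal (e * real m ^ 2)"
    by blast
next
  show "0 \<le> gamma Z" for Z unfolding gamma_def by (rule Inf_greatest) auto
  show "ItS False 0 0 Zt = \<infinity>" if "area Zt = \<infinity>" using ItS_infinite[OF zt that] by simp
qed auto

lemma gamma_thin_convergence: "(\<lambda>n. ereal ((\<delta> n)\<^sup>2) * gamma_thin (Zs n)) \<longlonglongrightarrow> ItS True 0 0 Zt"
proof (rule convergence)
  fix Z assume "down_closed Z" "finite Z"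
  then show "gamma_thin Z \<le> ereal (Enh True 0 0 Z)" by (rule gamma_thin_le_Enh)
next
  fix e :: real assume e: "0 < e"
  \<comment> \<open>From \<open>4 / e\<close> on, the linear error \<open>4 * m\<close> is at most
    \<open>e * m^2\<close>.\<close>
  obtain m0 :: nat where m0: "4 / e < real m0" using reals_Archimedean2 by blast
  have "ereal (Enh True 0 0 (Z \<inter> Rect m m)) \<le> gamma_thin Z + ereal (e * real m ^ 2)" if "m0 \<le> m" "down_closed Z" for m Z
  proof -
    have ZR: "down_closed (Z \<inter> Rect m m)" using down_closed_Int[OF that(2) down_closed_Rect] .
    have "4 / e \<le> real m" using m0 that(1) by linarith
    then have "4 \<le> e * real m" using e by (simp add: pos_divide_le_eq mult.commute)
    then have "4 * real m \<le> e * real m * real m" by (rule mult_right_mono) simp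
    then have "ereal (real (4 * m)) \<le> ereal (e * real m ^ 2)" by (simp add: power2_eq_square mult.assoc)
    moreover have "ereal (Enh True 0 0 (Z \<inter> Rect m m)) \<le> gamma_thin (Z \<inter> Rect m m) + ereal (real (4 * m))"
      by (rule Enh_le_gamma_thin[OF ZR]) auto
    moreover have "gamma_thin (Z \<inter> Rect m m) \<le> gamma_thin Z" by (rule gamma_thin_mono[OF _ ZR]) auto
    ultimately show ?thesis by (meson add_mono order_trans)
  qed
  then show "\<exists>m0. \<forall>m\<ge>m0. \<forall>Z. down_closed Z \<longrightarrow> ereal (Enh True 0 0 (Z \<inter> Rect m m)) \<le> gamma_thin Z + ereal (e * real m ^ 2)"
    by blast
next
  show "0 \<le> gamma_thin Z" for Z unfolding gamma_thin_def by (rule Inf_greatest) auto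
  show "ItS True 0 0 Zt = \<infinity>" if "area Zt = \<infinity>" using ItS_infinite[OF zt that] by simp
qed auto

end

theorem mainTheorem4:
  fixes Zs :: "nat \<Rightarrow> (nat \<times> nat) set" and \<delta> :: "nat \<Rightarrow> real" and Zt :: "(real \<times> real) set"
  assumes zs: "\<And>n. disc_zero_set (Zs n)"
    and dpos: "\<And>n. \<delta> n > 0"
    and dlim: "\<delta> \<longlonglongrightarrow> 0"
    and zt: "eucl_zero_set Zt"
    and conv: "E_conv (\<lambda>n. scale_set (\<delta> n) (square (Zs n))) Zt"
  shows
    "(\<forall>\<alpha>\<in>{0..1}. \<forall>\<beta>\<in>{0..1}.
        (\<lambda>n. ereal ((\<delta> n)\<^sup>2) * I_disc \<alpha> \<beta> (Zs n)) \<longlonglongrightarrow> It \<alpha> \<beta> Zt)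
   \<and> (\<lambda>n. ereal ((\<delta> n)\<^sup>2) * gamma (Zs n)) \<longlonglongrightarrow> gt Zt
   \<and> (\<lambda>n. ereal ((\<delta> n)\<^sup>2) * gamma_thin (Zs n)) \<longlonglongrightarrow> gt_thin Zt
   \<and> (area Zt = \<infinity> \<longrightarrow>
        (\<forall>\<alpha>\<in>{0..<1}. \<forall>\<beta>\<in>{0..<1}. It \<alpha> \<beta> Zt = \<infinity>) \<and> gt_thin Zt = \<infinity>)
   \<and> (area Zt < \<infinity> \<longrightarrow>
        (\<forall>\<alpha>\<in>{0..1}. \<forall>\<beta>\<in>{0..1}. \<bar>It \<alpha> \<beta> Zt\<bar> \<noteq> \<infinity>)
      \<and> concave_on ({0..1} \<times> {0..1}) (\<lambda>(\<alpha>, \<beta>). real_of_ereal (It \<alpha> \<beta> Zt))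
      \<and> continuous_on ({0..1} \<times> {0..1}) (\<lambda>(\<alpha>, \<beta>). real_of_ereal (It \<alpha> \<beta> Zt))
      \<and> gt_thin Zt < \<infinity>
      \<and> (\<forall>e>0. eventually (\<lambda>n. \<forall>\<alpha>\<in>{0..1}. \<forall>\<beta>\<in>{0..1}.
             \<bar>ereal ((\<delta> n)\<^sup>2) * I_disc \<alpha> \<beta> (Zs n) - It \<alpha> \<beta> Zt\<bar> < ereal e) sequentially)
      \<and> (\<forall>Zn :: nat \<Rightarrow> (real \<times> real) set.
           (\<forall>n. eucl_zero_set (Zn n)) \<and> E_conv Zn Zt \<longrightarrow>
           (\<forall>e>0. eventually (\<lambda>n. \<forall>\<alpha>\<in>{0..1}. \<forall>\<beta>\<in>{0..1}.
              \<bar>It \<alpha> \<beta> (Zn n) - It \<alpha> \<beta> Zt\<bar> < ereal e) sequentially)))"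
proof -
  have dz: "down_closed (Zs n)" for n by (rule disc_zero_set_down_closed[OF zs])
  interpret disc_approx Zs \<delta> Zt
    by unfold_locales (use dz dpos dlim zt conv in \<open>simp_all add: scale_set_square\<close>)
  have It: "It \<alpha> \<beta> Z = ItS False \<alpha> \<beta> Z" if "eucl_zero_set Z" "\<alpha> \<in> {0..1}" "\<beta> \<in> {0..1}" for \<alpha> \<beta> Z
    by (rule It_eq_ItS[OF that])
  have A1: "\<forall>\<alpha>\<in>{0..1}. \<forall>\<beta>\<in>{0..1}. (\<lambda>n. ereal ((\<delta> n)\<^sup>2) * I_disc \<alpha> \<beta> (Zs n)) \<longlonglongrightarrow> It \<alpha> \<beta> Zt"
    using I_disc_convergence It[OF zt] by simp
  have A2: "(\<lambda>n. ereal ((\<delta> n)\<^sup>2) * gamma (Zs n)) \<longlonglongrightarrow> gt Zt"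
    using gamma_convergence It[OF zt, of 0 0] by (simp add: gt_def)
  have A3: "(\<lambda>n. ereal ((\<delta> n)\<^sup>2) * gamma_thin (Zs n)) \<longlonglongrightarrow> gt_thin Zt"
    using gamma_thin_convergence gt_thin_eq_ItS[OF zt] by simp
  have A4: "(\<forall>\<alpha>\<in>{0..<1}. \<forall>\<beta>\<in>{0..<1}. It \<alpha> \<beta> Zt = \<infinity>) \<and> gt_thin Zt = \<infinity>" if "area Zt = \<infinity>"
    using ItS_infinite[OF zt that] It[OF zt] gt_thin_eq_ItS[OF zt] by simp
  have A5: "(\<forall>\<alpha>\<in>{0..1}. \<forall>\<beta>\<in>{0..1}. \<bar>It \<alpha> \<beta> Zt\<bar> \<noteq> \<infinity>)
      \<and> concave_on ({0..1} \<times> {0..1}) (\<lambda>(\<alpha>, \<beta>). real_of_ereal (It \<alpha> \<beta> Zt))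
      \<and> continuous_on ({0..1} \<times> {0..1}) (\<lambda>(\<alpha>, \<beta>). real_of_ereal (It \<alpha> \<beta> Zt))
      \<and> gt_thin Zt < \<infinity>
      \<and> (\<forall>e>0. eventually (\<lambda>n. \<forall>\<alpha>\<in>{0..1}. \<forall>\<beta>\<in>{0..1}.
             \<bar>ereal ((\<delta> n)\<^sup>2) * I_disc \<alpha> \<beta> (Zs n) - It \<alpha> \<beta> Zt\<bar> < ereal e) sequentially)
      \<and> (\<forall>Zn :: nat \<Rightarrow> (real \<times> real) set.
           (\<forall>n. eucl_zero_set (Zn n)) \<and> E_conv Zn Zt \<longrightarrow>
           (\<forall>e>0. eventually (\<lambda>n. \<forall>\<alpha>\<in>{0..1}. \<forall>\<beta>\<in>{0..1}.
              \<bar>It \<alpha> \<beta> (Zn n) - It \<alpha> \<beta> Zt\<bar> < ereal e) sequentially))" if fin: "area Zt < \<infinity>"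
  proof -
    let ?T = "TS Zt False"
    have T: "It \<alpha> \<beta> Zt = ereal (?T \<alpha> \<beta>)" if "\<alpha> \<in> {0..1}" "\<beta> \<in> {0..1}" for \<alpha> \<beta>
      using It[OF zt that] ItS_eq_TS[OF zt fin that] by simp
    have eqT: "(case x of (\<alpha>, \<beta>) \<Rightarrow> real_of_ereal (It \<alpha> \<beta> Zt)) = (case x of (\<alpha>, \<beta>) \<Rightarrow> ?T \<alpha> \<beta>)"
      if "x \<in> {0..1} \<times> {0..1}" for x
      using that T by auto
    have C: "concave_on ({0..1} \<times> {0..1}) (\<lambda>(\<alpha>, \<beta>). real_of_ereal (It \<alpha> \<beta> Zt))"
      unfolding concave_on_iff
    proof (intro conjI ballI allI impI)
      show cv: "convex ({0..1::real} \<times> {0..1::real})" by (intro convex_Times) auto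
      fix x y :: "real \<times> real" and s t :: real
      assume h: "x \<in> {0..1} \<times> {0..1}" "y \<in> {0..1} \<times> {0..1}" "0 \<le> s" "0 \<le> t" "s + t = 1"
      have m: "s *\<^sub>R x + t *\<^sub>R y \<in> {0..1} \<times> {0..1}" by (rule convexD[OF cv h])
      show "s * (case x of (\<alpha>, \<beta>) \<Rightarrow> real_of_ereal (It \<alpha> \<beta> Zt)) + t * (case y of (\<alpha>, \<beta>) \<Rightarrow> real_of_ereal (It \<alpha> \<beta> Zt))
          \<le> (case s *\<^sub>R x + t *\<^sub>R y of (\<alpha>, \<beta>) \<Rightarrow> real_of_ereal (It \<alpha> \<beta> Zt))"
        unfolding eqT[OF h(1)] eqT[OF h(2)] eqT[OF m]
        using TS_concave[OF zt fin, of False] h unfolding concave_on_iff by blast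
    qed
    have cont: "continuous_on ({0..1} \<times> {0..1}) (\<lambda>(\<alpha>, \<beta>). ?T \<alpha> \<beta>)" by (rule TS_continuous[OF zt fin])
    have D: "continuous_on ({0..1} \<times> {0..1}) (\<lambda>(\<alpha>, \<beta>). real_of_ereal (It \<alpha> \<beta> Zt))"
      by (rule continuous_on_eq[OF cont]) (simp add: eqT)
    have E: "gt_thin Zt < \<infinity>" using ItS_eq_TS[OF zt fin, of 0 0 True] gt_thin_eq_ItS[OF zt] by simp
    have F: "eventually (\<lambda>n. \<forall>\<alpha>\<in>{0..1}. \<forall>\<beta>\<in>{0..1}. \<bar>ereal ((\<delta> n)\<^sup>2) * I_disc \<alpha> \<beta> (Zs n) - It \<alpha> \<beta> Zt\<bar> < ereal e) sequentially"
      if e: "0 < e" for e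
    proof -
      \<comment> \<open>The rates are nonincreasing in \<alpha> and in \<beta> and the limit is
        continuous, so pointwise convergence is already uniform.\<close>
      have "eventually (\<lambda>n. \<forall>\<alpha>\<in>{0..1}. \<forall>\<beta>\<in>{0..1}. \<bar>ereal ((\<delta> n)\<^sup>2) * I_disc \<alpha> \<beta> (Zs n) - ereal (?T \<alpha> \<beta>)\<bar> < ereal e) sequentially"
      proof (rule antimono_uniform_convergence[OF cont _ _ e])
        fix n and \<alpha> \<beta> \<alpha>' \<beta>' :: real
        assume "\<alpha> \<in> {0..1}" "\<beta> \<in> {0..1}" "\<alpha>' \<in> {0..1}" "\<beta>' \<in> {0..1}" "\<alpha> \<le> \<alpha>'" "\<beta> \<le> \<beta>'"
        then show "ereal ((\<delta> n)\<^sup>2) * I_disc \<alpha>' \<beta>' (Zs n) \<le> ereal ((\<delta> n)\<^sup>2) * I_disc \<alpha> \<beta> (Zs n)"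
          by (intro ereal_mult_left_mono I_disc_antimono dz) auto
      qed (use A1 T in auto)
      then show ?thesis by eventually_elim (use T in auto)
    qed
    have H: "eventually (\<lambda>n. \<forall>\<alpha>\<in>{0..1}. \<forall>\<beta>\<in>{0..1}. \<bar>It \<alpha> \<beta> (Zn n) - It \<alpha> \<beta> Zt\<bar> < ereal e) sequentially"
      if Zn: "\<And>n. eucl_zero_set (Zn n)" and cv: "E_conv Zn Zt" and e: "0 < e" for Zn e
    proof -
      have "eventually (\<lambda>n. \<forall>\<alpha>\<in>{0..1}. \<forall>\<beta>\<in>{0..1}. \<bar>ItS False \<alpha> \<beta> (Zn n) - ereal (?T \<alpha> \<beta>)\<bar> < ereal e) sequentially"
      proof (rule antimono_uniform_convergence[OF cont _ _ e])
        fix \<alpha> \<beta> :: real assume ab: "\<alpha> \<in> {0..1}" "\<beta> \<in> {0..1}"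
        show "(\<lambda>n. ItS False \<alpha> \<beta> (Zn n)) \<longlonglongrightarrow> ereal (?T \<alpha> \<beta>)"
          using eucl_convergence[OF Zn zt cv fin ab, of False] ItS_eq_TS[OF zt fin ab] by simp
      qed (rule ItS_antimono[OF Zn])
      then show ?thesis by eventually_elim (use T It[OF Zn] in auto)
    qed
    show ?thesis using T C D E F H by auto
  qed
  show ?thesis using A1 A2 A3 A4 A5 by blast
qed

end
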